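(* Let $G$ be a 2-connected loopless finite graph of genus $g$. Then (1) $G$ has a $\mathbb{Z}$-emm of type $A_g$ if and only if $G$ is planar; (2) if $g\ge4$, $G$ has a $\mathbb{Z}$-emm of type $D_g$ if and only if $G$ is projective planar (embeds in $\mathbb{RP}^2$). Moreover, the implications "planar $\Rightarrow$ has a $\mathbb{Z}$-emm of type $A_g$" and (for $g\ge4$) "projective planar $\Rightarrow$ has a $\mathbb{Z}$-emm of type $D_g$" hold for any finite graph $G$ of genus $g$.
   Context: For a finite graph $G$ (loops and multiple edges allowed) with oriented edges $e_i$, $H_1(G,\mathbb{Z})$ is its cycle group, $H^1(G,\mathbb{Z})$ its dual (cokernel of the coboundary $C^0\to\bigoplus\mathbb{Z}e_i^*$), the image of $e_i^*$ in $H^1$ is the coedge $e_i^*$, and the genus is $\mathrm{rank}\,H_1(G,\mathbb{Z})$. A $\mathbb{Z}$-emm is $q\in\mathrm{Sym}^2H_1(G,\mathbb{Z})$ (an integral quadratic form on $H^1(G,\mathbb{Z})$) that is positive definite, has $q(e_i^* )=1$ for every non-bridge edge $e_i$, and $q(v)\ge1$ for all nonzero $v\in H^1(G,\mathbb{Z})$. It is of type $A_g$ (resp. $D_g$) if the lattice $H^1(G,\mathbb{Z})$ with the even bilinear form $b(v,v)=2q(v)$ is isometric to the root lattice $A_g$ (resp. $D_g$). 2-connected means connected without cut vertices. *)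

theory Defs
  imports "HOL-Analysis.Analysis"
begin

text \<open>A finite graph is given by a finite vertex set V, a finite edge set E and
  endpoint maps s (source) and t (target) which also fix the orientation of the edges.
  Loops (s e = t e) and multiple edges are allowed.\<close>

definition adj :: "'e set \<Rightarrow> ('e \<Rightarrow> 'v) \<Rightarrow> ('e \<Rightarrow> 'v) \<Rightarrow> 'v \<Rightarrow> 'v \<Rightarrow> bool" where
  "adj E s t u w \<longleftrightarrow> (\<exists>e\<in>E. (s e = u \<and> t e = w) \<or> (s e = w \<and> t e = u))"

definition reach :: "'e set \<Rightarrow> ('e \<Rightarrow> 'v) \<Rightarrow> ('e \<Rightarrow> 'v) \<Rightarrow> 'v \<Rightarrow> 'v \<Rightarrow> bool" where
  "reach E s t = (adj E s t)\<^sup>*\<^sup>*"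

definition components :: "'v set \<Rightarrow> 'e set \<Rightarrow> ('e \<Rightarrow> 'v) \<Rightarrow> ('e \<Rightarrow> 'v) \<Rightarrow> 'v set set" where
  "components V E s t = V // {(u, w). u \<in> V \<and> w \<in> V \<and> reach E s t u w}"

definition connected_graph :: "'v set \<Rightarrow> 'e set \<Rightarrow> ('e \<Rightarrow> 'v) \<Rightarrow> ('e \<Rightarrow> 'v) \<Rightarrow> bool" where
  "connected_graph V E s t \<longleftrightarrow> V \<noteq> {} \<and> (\<forall>u\<in>V. \<forall>w\<in>V. reach E s t u w)"

definition del_edges :: "'e set \<Rightarrow> ('e \<Rightarrow> 'v) \<Rightarrow> ('e \<Rightarrow> 'v) \<Rightarrow> 'v \<Rightarrow> 'e set" where
  "del_edges E s t v = {e \<in> E. s e \<noteq> v \<and> t e \<noteq> v}"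

definition cut_vertex :: "'v set \<Rightarrow> 'e set \<Rightarrow> ('e \<Rightarrow> 'v) \<Rightarrow> ('e \<Rightarrow> 'v) \<Rightarrow> 'v \<Rightarrow> bool" where
  "cut_vertex V E s t v \<longleftrightarrow> v \<in> V \<and>
     card (components (V - {v}) (del_edges E s t v) s t) > card (components V E s t)"

definition two_connected :: "'v set \<Rightarrow> 'e set \<Rightarrow> ('e \<Rightarrow> 'v) \<Rightarrow> ('e \<Rightarrow> 'v) \<Rightarrow> bool" where
  "two_connected V E s t \<longleftrightarrow> connected_graph V E s t \<and> (\<forall>v\<in>V. \<not> cut_vertex V E s t v)"

definition loopless :: "'e set \<Rightarrow> ('e \<Rightarrow> 'v) \<Rightarrow> ('e \<Rightarrow> 'v) \<Rightarrow> bool" where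
  "loopless E s t \<longleftrightarrow> (\<forall>e\<in>E. s e \<noteq> t e)"

definition bridge :: "'e set \<Rightarrow> ('e \<Rightarrow> 'v) \<Rightarrow> ('e \<Rightarrow> 'v) \<Rightarrow> 'e \<Rightarrow> bool" where
  "bridge E s t e \<longleftrightarrow> e \<in> E \<and> \<not> reach (E - {e}) s t (s e) (t e)"

text \<open>Genus = rank of H_1(G,Z) = |E| - |V| + (number of connected components).\<close>
definition genus :: "'v set \<Rightarrow> 'e set \<Rightarrow> ('e \<Rightarrow> 'v) \<Rightarrow> ('e \<Rightarrow> 'v) \<Rightarrow> nat" where
  "genus V E s t = card E + card (components V E s t) - card V"

text \<open>C^1(G,Z): integer functions on the edges (supported on E). The coedges e^* are
  indicator functions. H^1 = C^1 / image of the coboundary; we work with C^1 and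
  require everything to be compatible with the quotient.\<close>

definition C1 :: "'e set \<Rightarrow> ('e \<Rightarrow> int) set" where
  "C1 E = {x. \<forall>e. e \<notin> E \<longrightarrow> x e = 0}"

definition coedge :: "'e \<Rightarrow> 'e \<Rightarrow> int" where
  "coedge e = (\<lambda>e'. if e' = e then 1 else 0)"

definition coboundary :: "'e set \<Rightarrow> ('e \<Rightarrow> 'v) \<Rightarrow> ('e \<Rightarrow> 'v) \<Rightarrow> ('v \<Rightarrow> int) \<Rightarrow> 'e \<Rightarrow> int" where
  "coboundary E s t f = (\<lambda>e. if e \<in> E then f (t e) - f (s e) else 0)"

definition coboundaries :: "'v set \<Rightarrow> 'e set \<Rightarrow> ('e \<Rightarrow> 'v) \<Rightarrow> ('e \<Rightarrow> 'v) \<Rightarrow> ('e \<Rightarrow> int) set" where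
  "coboundaries V E s t = {coboundary E s t f | f. \<forall>v. v \<notin> V \<longrightarrow> f v = 0}"

text \<open>An integral quadratic form on C^1 (integer valued, homogeneous of degree 2,
  with biadditive polarisation) which descends to H^1, i.e. an element of Sym^2 H_1.\<close>
definition int_quadratic_form_H1 :: "'v set \<Rightarrow> 'e set \<Rightarrow> ('e \<Rightarrow> 'v) \<Rightarrow> ('e \<Rightarrow> 'v) \<Rightarrow> (('e \<Rightarrow> int) \<Rightarrow> int) \<Rightarrow> bool" where
  "int_quadratic_form_H1 V E s t q \<longleftrightarrow>
     (\<forall>x\<in>C1 E. \<forall>n::int. q (\<lambda>e. n * x e) = n^2 * q x) \<and>
     (\<forall>x\<in>C1 E. \<forall>y\<in>C1 E. \<forall>z\<in>C1 E.
        q (\<lambda>e. x e + y e + z e) - q (\<lambda>e. x e + y e) - q z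
        = (q (\<lambda>e. x e + z e) - q x - q z) + (q (\<lambda>e. y e + z e) - q y - q z)) \<and>
     (\<forall>x\<in>C1 E. \<forall>b\<in>coboundaries V E s t. q (\<lambda>e. x e + b e) = q x)"

definition Z_emm :: "'v set \<Rightarrow> 'e set \<Rightarrow> ('e \<Rightarrow> 'v) \<Rightarrow> ('e \<Rightarrow> 'v) \<Rightarrow> (('e \<Rightarrow> int) \<Rightarrow> int) \<Rightarrow> bool" where
  "Z_emm V E s t q \<longleftrightarrow>
     int_quadratic_form_H1 V E s t q \<and>
     (\<forall>x\<in>C1 E. x \<notin> coboundaries V E s t \<longrightarrow> q x > 0) \<and>
     (\<forall>e\<in>E. \<not> bridge E s t e \<longrightarrow> q (coedge e) = 1) \<and>
     (\<forall>x\<in>C1 E. x \<notin> coboundaries V E s t \<longrightarrow> q x \<ge> 1)"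

definition A_lattice :: "nat \<Rightarrow> (nat \<Rightarrow> int) set" where
  "A_lattice g = {y. (\<forall>i>g. y i = 0) \<and> (\<Sum>i\<le>g. y i) = 0}"

definition D_lattice :: "nat \<Rightarrow> (nat \<Rightarrow> int) set" where
  "D_lattice g = {y. (\<forall>i\<ge>g. y i = 0) \<and> even (\<Sum>i<g. y i)}"

definition sqnorm :: "(nat \<Rightarrow> int) \<Rightarrow> nat \<Rightarrow> int" where
  "sqnorm y n = (\<Sum>i<n. (y i)^2)"

text \<open>The lattice H^1(G,Z) with b(v,v) = 2 q(v) is isometric to the lattice L
  (with squared norm computed on coordinates < n): there is a group isomorphism
  H^1 -> L, presented as an additive map on C^1 with kernel the coboundaries.\<close>
definition H1_isometric :: "'v set \<Rightarrow> 'e set \<Rightarrow> ('e \<Rightarrow> 'v) \<Rightarrow> ('e \<Rightarrow> 'v) \<Rightarrow> (('e \<Rightarrow> int) \<Rightarrow> int)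
    \<Rightarrow> (nat \<Rightarrow> int) set \<Rightarrow> nat \<Rightarrow> bool" where
  "H1_isometric V E s t q L n \<longleftrightarrow> (\<exists>\<phi> :: ('e \<Rightarrow> int) \<Rightarrow> (nat \<Rightarrow> int).
     (\<forall>x\<in>C1 E. \<forall>y\<in>C1 E. \<phi> (\<lambda>e. x e + y e) = (\<lambda>i. \<phi> x i + \<phi> y i)) \<and>
     \<phi> ` C1 E = L \<and>
     (\<forall>x\<in>C1 E. \<phi> x = (\<lambda>i. 0) \<longleftrightarrow> x \<in> coboundaries V E s t) \<and>
     (\<forall>x\<in>C1 E. sqnorm (\<phi> x) n = 2 * q x))"

definition has_emm_A :: "'v set \<Rightarrow> 'e set \<Rightarrow> ('e \<Rightarrow> 'v) \<Rightarrow> ('e \<Rightarrow> 'v) \<Rightarrow> nat \<Rightarrow> bool" where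
  "has_emm_A V E s t g \<longleftrightarrow> (\<exists>q. Z_emm V E s t q \<and> H1_isometric V E s t q (A_lattice g) (g + 1))"

definition has_emm_D :: "'v set \<Rightarrow> 'e set \<Rightarrow> ('e \<Rightarrow> 'v) \<Rightarrow> ('e \<Rightarrow> 'v) \<Rightarrow> nat \<Rightarrow> bool" where
  "has_emm_D V E s t g \<longleftrightarrow> (\<exists>q. Z_emm V E s t q \<and> H1_isometric V E s t q (D_lattice g) g)"

definition graph_embeds :: "'p topology \<Rightarrow> 'v set \<Rightarrow> 'e set \<Rightarrow> ('e \<Rightarrow> 'v) \<Rightarrow> ('e \<Rightarrow> 'v) \<Rightarrow> bool" where
  "graph_embeds X V E s t \<longleftrightarrow> (\<exists>(p :: 'v \<Rightarrow> 'p) (\<gamma> :: 'e \<Rightarrow> real \<Rightarrow> 'p).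
     inj_on p V \<and> p ` V \<subseteq> topspace X \<and>
     (\<forall>e\<in>E. pathin X (\<gamma> e) \<and> \<gamma> e 0 = p (s e) \<and> \<gamma> e 1 = p (t e) \<and>
        (if s e = t e then inj_on (\<gamma> e) {0..<1} else inj_on (\<gamma> e) {0..1}) \<and>
        \<gamma> e ` {0<..<1} \<inter> p ` V = {}) \<and>
     (\<forall>e\<in>E. \<forall>e'\<in>E. e \<noteq> e' \<longrightarrow> \<gamma> e ` {0<..<1} \<inter> \<gamma> e' ` {0..1} = {}))"

definition planar :: "'v set \<Rightarrow> 'e set \<Rightarrow> ('e \<Rightarrow> 'v) \<Rightarrow> ('e \<Rightarrow> 'v) \<Rightarrow> bool" where
  "planar V E s t \<longleftrightarrow> graph_embeds (euclidean :: (real \<times> real) topology) V E s t"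

text \<open>RP^2 as the quotient of the unit sphere S^2 in R^3 by the antipodal map; its points
  are the pairs {x, -x}. The topology on RP^2 is the quotient topology, which is
  uniquely determined by the requirement that x |-> {x,-x} be a quotient map.\<close>
definition projective_planar :: "'v set \<Rightarrow> 'e set \<Rightarrow> ('e \<Rightarrow> 'v) \<Rightarrow> ('e \<Rightarrow> 'v) \<Rightarrow> bool" where
  "projective_planar V E s t \<longleftrightarrow>
     (\<exists>Y :: (real^3) set topology.
        quotient_map (top_of_set (sphere (0::real^3) 1)) Y (\<lambda>x. {x, -x}) \<and>
        graph_embeds Y V E s t)"

end

theory Submission
  imports Defs "HOL-Complex_Analysis.Complex_Analysis"
begin

text \<open>
  A form of type A or D is the same as a map from chains to the root lattice whose kernel consists of the
  coboundaries and which sends every non-bridge edge to a root. The coordinates of the roots make up a matrix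
  with one row per coordinate and one column per edge, each column having two entries 1 or -1.

  Given an embedding in the plane, take the faces as coordinates and send an edge to the difference of the two faces
  beside it; winding numbers of cycles show that this is the dual of the cycle lattice. An embedding in the projective plane
  lifts to an antipodally symmetric embedding of a double cover in the sphere. If no edge can be removed to make the
  cover trivial, its faces come in antipodal pairs, and identifying the antipode of a face with minus this face
  gives type D; otherwise the graph is planar. From type A one gets to type D by identifying a unit
  vector with minus another one, for two coordinates that share no edge; these exist for g at least 4.

  Conversely, in a two-connected graph each row of the matrix is a cycle that does not decompose (for type D, unless
  the lattice can be unfolded to type A), so it can be traversed as a closed walk. Joining these walks along a
  spanning tree of the dual graph gives one closed word in which every edge occurs twice. The word is placed
  on a parabola: the edges outside the tree become chords, the region above is subdivided into one convex
  region per vertex, and the edges of the tree are drawn below the parabola, through the crosscap if they are twisted.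
\<close>

section \<open>Chains, cycles and coboundaries of a finite graph\<close>

text \<open>Deleting edges one at a time bounds the number of faces only from above, by genus + 1.
  Linear algebra supplies the rest: every integer function on the faces has a nonzero multiple that
  is, up to a constant, the height of a cycle, and a cochain with a nonzero multiple that is a cycle
  is itself a cycle. In the projective case the danger is a face of the double cover containing an
  antipodal pair; a lifted path followed by its antipode is a closed curve whose winding number
  excludes this by parity. In the converse direction the heart of two-connectedness is that the
  cycle space does not split along a partition of the edges, whereas a decomposable row would
  produce such a splitting. For type D this argument can break only if, after switching signs, all
  edges avoiding one row are coherent, and that is when type D unfolds to type A. The parabola turns
  the gluing of discs into explicit coordinates: which chords cross, and on which side of a chord a
  vertex lies, is read off from the order of integer positions. The bound g at least 4 is the range
  beyond the roots of (g - 2) (g - 3), the polynomial of a degree count.\<close>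

definition bdry :: "'e set \<Rightarrow> ('e \<Rightarrow> 'v) \<Rightarrow> ('e \<Rightarrow> 'v) \<Rightarrow> ('e \<Rightarrow> int) \<Rightarrow> 'v \<Rightarrow> int" where
  "bdry E s t z v = (\<Sum>e\<in>E. z e * (of_bool (t e = v) - of_bool (s e = v)))"

text \<open>The condition ranges over the whole vertex type, so \<open>V\<close> need not be
  mentioned; a vertex that is no end of an edge satisfies it trivially.\<close>

definition is_cycle :: "'e set \<Rightarrow> ('e \<Rightarrow> 'v) \<Rightarrow> ('e \<Rightarrow> 'v) \<Rightarrow> ('e \<Rightarrow> int) \<Rightarrow> bool" where
  "is_cycle E s t z \<longleftrightarrow> (\<forall>v. bdry E s t z v = 0)"

lemma bdry_add: "bdry E s t (\<lambda>e. x e + y e) v = bdry E s t x v + bdry E s t y v"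
  by (simp add: bdry_def distrib_right sum.distrib)

lemma bdry_diff: "bdry E s t (\<lambda>e. x e - y e) v = bdry E s t x v - bdry E s t y v"
  by (simp add: bdry_def algebra_simps sum_subtractf sum.distrib)

lemma bdry_mult: "bdry E s t (\<lambda>e. n * x e) v = n * bdry E s t x v"
  by (simp add: bdry_def sum_distrib_left mult.assoc)

lemma bdry_sum: "bdry E s t (\<lambda>e. \<Sum>i\<in>I. x i e) v = (\<Sum>i\<in>I. bdry E s t (x i) v)"
  unfolding bdry_def by (simp add: sum_distrib_right) (rule sum.swap)

lemma bdry_coedge:
  assumes "finite E" "e \<in> E"
  shows "bdry E s t (coedge e) v = of_bool (t e = v) - of_bool (s e = v)"
proof -
  have "bdry E s t (coedge e) v = (\<Sum>e'\<in>E. if e' = e then of_bool (t e' = v) - of_bool (s e' = v) else 0)"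
    unfolding bdry_def coedge_def by (intro sum.cong) auto
  then show ?thesis using assms by simp
qed

lemma bdry_cong: "(\<And>e. e \<in> E \<Longrightarrow> x e = y e) \<Longrightarrow> bdry E s t x v = bdry E s t y v"
  unfolding bdry_def by (intro sum.cong) auto

lemma bdry_mono_neutral:
  assumes "finite E" "F \<subseteq> E" "\<And>e. e \<in> E - F \<Longrightarrow> x e = 0"
  shows "bdry F s t x v = bdry E s t x v"
  unfolding bdry_def using assms by (intro sum.mono_neutral_left) auto

lemma is_cycle_cong: "(\<And>e. e \<in> E \<Longrightarrow> x e = y e) \<Longrightarrow> is_cycle E s t x \<longleftrightarrow> is_cycle E s t y"
  unfolding is_cycle_def by (simp cong: bdry_cong)

lemma is_cycle_sum: "(\<And>i. i \<in> I \<Longrightarrow> is_cycle E s t (x i)) \<Longrightarrow> is_cycle E s t (\<lambda>e. \<Sum>i\<in>I. c i * x i e)"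
  unfolding is_cycle_def by (simp add: bdry_sum bdry_mult)

lemma is_cycle_mult_iff: "n \<noteq> 0 \<Longrightarrow> is_cycle E s t (\<lambda>e. n * x e) \<longleftrightarrow> is_cycle E s t x"
  unfolding is_cycle_def by (simp add: bdry_mult)

lemma sum_mult_coedge: "finite E \<Longrightarrow> e \<in> E \<Longrightarrow> (\<Sum>e'\<in>E. x e' * coedge e e') = x e"
  "finite E \<Longrightarrow> e \<in> E \<Longrightarrow> (\<Sum>e'\<in>E. coedge e e' * x e') = x e"
proof -
  assume *: "finite E" "e \<in> E"
  have "(\<Sum>e'\<in>E. x e' * coedge e e') = (\<Sum>e'\<in>E. if e' = e then x e' else 0)"
    by (intro sum.cong) (auto simp: coedge_def)
  then show "(\<Sum>e'\<in>E. x e' * coedge e e') = x e" using * by simp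
  then show "(\<Sum>e'\<in>E. coedge e e' * x e') = x e" by (simp add: mult.commute)
qed

lemma coedge_C1: "e \<in> E \<Longrightarrow> coedge e \<in> C1 E"
  by (auto simp: coedge_def C1_def)

lemma C1_expand: "finite E \<Longrightarrow> x \<in> C1 E \<Longrightarrow> x = (\<lambda>e'. \<Sum>e\<in>E. x e * coedge e e')"
  by (rule ext) (auto simp: coedge_def C1_def if_distrib[where f="\<lambda>u. _ * u"] cong: if_cong)

lemma C1_coboundary: "coboundary E s t f \<in> C1 E"
  by (auto simp: coboundary_def C1_def)

lemma coboundaries_C1: "x \<in> coboundaries V E s t \<Longrightarrow> x \<in> C1 E"
  by (auto simp: coboundaries_def C1_coboundary)

lemma reach_refl: "reach E s t u u"
  by (simp add: reach_def)

lemma reach_trans: "reach E s t u v \<Longrightarrow> reach E s t v w \<Longrightarrow> reach E s t u w"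
  by (auto simp: reach_def)

lemma adj_sym: "adj E s t u w \<Longrightarrow> adj E s t w u"
  by (auto simp: adj_def)

lemma reach_sym: "reach E s t u w \<Longrightarrow> reach E s t w u"
  unfolding reach_def
  by (induction rule: rtranclp_induct) (auto intro: converse_rtranclp_into_rtranclp dest: adj_sym)

lemma reach_edge: "e \<in> E \<Longrightarrow> reach E s t (s e) (t e)" "e \<in> E \<Longrightarrow> reach E s t (t e) (s e)"
  unfolding reach_def by (auto simp: adj_def intro!: r_into_rtranclp)

lemma reach_mono: "E \<subseteq> F \<Longrightarrow> reach E s t u w \<Longrightarrow> reach F s t u w"
  unfolding reach_def by (erule rtranclp_mono[THEN predicate2D, rotated]) (unfold adj_def, blast)

lemma reach_invariant:
  assumes "reach E s t u w" "\<And>e. e \<in> E \<Longrightarrow> f (s e) = f (t e)"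
  shows "f u = f w"
  using assms(1) unfolding reach_def by (induction rule: rtranclp_induct) (auto simp: adj_def assms(2))

lemma reach_chain:
  assumes "finite E" "reach E s t u w"
  shows "\<exists>c\<in>C1 E. \<forall>v. bdry E s t c v = of_bool (v = w) - of_bool (v = u)"
  using assms(2) unfolding reach_def
proof (induction rule: rtranclp_induct)
  case base
  have "(\<lambda>e. 0) \<in> C1 E" "\<forall>v. bdry E s t (\<lambda>e. 0) v = 0" by (auto simp: bdry_def C1_def)
  then show ?case by force
next
  case (step y z)
  then obtain c where c: "c \<in> C1 E" "\<forall>v. bdry E s t c v = of_bool (v = y) - of_bool (v = u)" by blast
  from step obtain e where e: "e \<in> E" "(s e = y \<and> t e = z) \<or> (s e = z \<and> t e = y)" by (auto simp: adj_def)
  define n :: int where "n = (if s e = y \<and> t e = z then 1 else -1)"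
  have "(\<lambda>e'. c e' + n * coedge e e') \<in> C1 E" using c(1) e(1) by (auto simp: C1_def coedge_def)
  moreover have "\<forall>v. bdry E s t (\<lambda>e'. c e' + n * coedge e e') v = of_bool (v = z) - of_bool (v = u)"
    using e assms(1) c(2) by (auto simp: bdry_add bdry_mult bdry_coedge n_def)
  ultimately show ?case by blast
qed

section \<open>Orthogonality of cycles and coboundaries, and bridges\<close>

locale fgraph =
  fixes V :: "'v set" and E :: "'e set" and s t :: "'e \<Rightarrow> 'v"
  assumes finite_V: "finite V" and finite_E: "finite E"
    and ends_in_V: "\<And>e. e \<in> E \<Longrightarrow> s e \<in> V" "\<And>e. e \<in> E \<Longrightarrow> t e \<in> V"
begin

lemma fgraph_subset: "F \<subseteq> E \<Longrightarrow> fgraph V F s t"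
  using finite_V finite_E ends_in_V by (unfold_locales) (auto intro: finite_subset)

text \<open>Summation by parts: coboundary and boundary are adjoint. The potential may take values
  in any commutative ring because winding numbers will need complex logarithms as
  potentials.\<close>

lemma coboundary_pairing_of_int:
  fixes f :: "'v \<Rightarrow> 'a::comm_ring_1"
  shows "(\<Sum>e\<in>E. (f (t e) - f (s e)) * of_int (z e)) = (\<Sum>v\<in>V. f v * of_int (bdry E s t z v))"
proof -
  have "(\<Sum>v\<in>V. f v * of_int (bdry E s t z v))
      = (\<Sum>e\<in>E. \<Sum>v\<in>V. f v * (of_int (z e) * (of_bool (t e = v) - of_bool (s e = v))))"
    unfolding bdry_def of_int_sum sum_distrib_left by (subst sum.swap) simp
  also have "\<dots> = (\<Sum>e\<in>E. (f (t e) - f (s e)) * of_int (z e))"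
  proof (rule sum.cong[OF refl])
    fix e assume "e \<in> E"
    then have "(\<Sum>v\<in>V. f v * of_bool (t e = v)) = f (t e)" "(\<Sum>v\<in>V. f v * of_bool (s e = v)) = f (s e)"
      using finite_V ends_in_V by (simp_all add: of_bool_def if_distrib cong: if_cong)
    moreover have "(\<Sum>v\<in>V. f v * (of_int (z e) * (of_bool (t e = v) - of_bool (s e = v))))
        = of_int (z e) * ((\<Sum>v\<in>V. f v * of_bool (t e = v)) - (\<Sum>v\<in>V. f v * of_bool (s e = v)))"
      unfolding sum_subtractf[symmetric] sum_distrib_left by (intro sum.cong) (auto simp: algebra_simps)
    ultimately show "(\<Sum>v\<in>V. f v * (of_int (z e) * (of_bool (t e = v) - of_bool (s e = v)))) = (f (t e) - f (s e)) * of_int (z e)"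
      by simp
  qed
  finally show ?thesis ..
qed

lemma coboundary_pairing:
  "(\<Sum>e\<in>E. (f (t e) - f (s e)) * z e) = (\<Sum>v\<in>V. f v * bdry E s t z v)"
  using coboundary_pairing_of_int[of f z] by simp

lemma coboundaries_orthogonal:
  assumes "x \<in> coboundaries V E s t" "is_cycle E s t z"
  shows "(\<Sum>e\<in>E. x e * z e) = 0"
proof -
  obtain f where "x = coboundary E s t f" using assms(1) by (auto simp: coboundaries_def)
  then have "(\<Sum>e\<in>E. x e * z e) = (\<Sum>e\<in>E. (f (t e) - f (s e)) * z e)"
    by (intro sum.cong) (auto simp: coboundary_def)
  then show ?thesis using assms(2) by (simp add: coboundary_pairing is_cycle_def)
qed

lemma coboundary_in_coboundaries:
  "coboundary E s t f \<in> coboundaries V E s t"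
proof -
  have "coboundary E s t f = coboundary E s t (\<lambda>v. if v \<in> V then f v else 0)"
    using ends_in_V by (auto simp: coboundary_def)
  then show ?thesis unfolding coboundaries_def by force
qed

lemma coboundariesI:
  assumes "x \<in> C1 E" "\<And>e. e \<in> E \<Longrightarrow> x e = f (t e) - f (s e)"
  shows "x \<in> coboundaries V E s t"
proof -
  have "x = coboundary E s t f" using assms by (auto simp: C1_def coboundary_def)
  then show ?thesis by (simp add: coboundary_in_coboundaries)
qed

text \<open>The potential of a vertex is the pairing of \<open>x\<close> with a chain from a root of
  its component. An edge together with the chains of its ends is a cycle, so orthogonality yields
  the right difference, and the potential is integral by construction.\<close>

lemma orthogonal_imp_coboundary:
  assumes x: "x \<in> C1 E" and orth: "\<And>z. is_cycle E s t z \<Longrightarrow> (\<Sum>e\<in>E. x e * z e) = 0"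
  shows "x \<in> coboundaries V E s t"
proof -
  define root where "root v = (SOME u. reach E s t v u)" for v
  have root: "reach E s t v (root v)" for v
    unfolding root_def by (rule someI[of _ v]) (rule reach_refl)
  have root_eq: "root u = root v" if "reach E s t u v" for u v
  proof -
    \<comment> \<open>Equality as predicates makes the choice operator return the same root for both
      vertices.\<close>
    have "reach E s t u = reach E s t v" using that by (auto intro: reach_trans reach_sym)
    then show ?thesis by (simp add: root_def)
  qed
  have "\<forall>v. \<exists>c\<in>C1 E. \<forall>w. bdry E s t c w = of_bool (w = v) - of_bool (w = root v)"
    using reach_chain[OF finite_E reach_sym[OF root]] by blast
  then obtain c where c: "\<And>v w. bdry E s t (c v) w = of_bool (w = v) - of_bool (w = root v)" by metis
  define f where "f v = (\<Sum>e\<in>E. x e * c v e)" for v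
  show ?thesis
  proof (rule coboundariesI[OF x, where f=f])
    fix e assume e: "e \<in> E"
    have "root (s e) = root (t e)" using e by (intro root_eq reach_edge)
    then have "is_cycle E s t (\<lambda>e'. c (s e) e' + coedge e e' - c (t e) e')"
      using e finite_E by (auto simp: is_cycle_def bdry_add bdry_diff bdry_coedge c)
    from orth[OF this] show "x e = f (t e) - f (s e)"
      using sum_mult_coedge(1)[OF finite_E e, of x] by (simp add: f_def algebra_simps sum.distrib sum_subtractf)
  qed
qed

text \<open>Pair the cycle with the coboundary of the indicator of the part that contains
  \<open>s e\<close> after deleting \<open>e\<close>: only \<open>e\<close> contributes.\<close>

lemma bridge_cycle_zero:
  assumes "bridge E s t e" "is_cycle E s t z"
  shows "z e = 0"
proof -
  have e: "e \<in> E" "\<not> reach (E - {e}) s t (s e) (t e)" using assms(1) by (auto simp: bridge_def)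
  define f :: "'v \<Rightarrow> int" where "f v = of_bool (reach (E - {e}) s t (s e) v)" for v
  have "f (s e') = f (t e')" if "e' \<in> E - {e}" for e'
  proof -
    have "reach (E - {e}) s t (s e) (s e') \<longleftrightarrow> reach (E - {e}) s t (s e) (t e')"
      using reach_edge[of e' "E - {e}" s t] that by (blast intro: reach_trans)
    then show ?thesis by (simp add: f_def)
  qed
  then have "(f (t e') - f (s e')) * z e' = - (z e' * coedge e e')" if "e' \<in> E" for e'
    using that e(2) by (auto simp: coedge_def f_def reach_refl)
  then have "(\<Sum>e'\<in>E. (f (t e') - f (s e')) * z e') = - z e"
    using sum_mult_coedge(1)[OF finite_E e(1), of z] by (simp add: sum_negf)
  then show ?thesis using assms(2) by (simp add: coboundary_pairing is_cycle_def)
qed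

lemma nonbridge_cycle:
  assumes "e \<in> E" "\<not> bridge E s t e"
  shows "\<exists>z. is_cycle E s t z \<and> z e = 1"
proof -
  have "reach (E - {e}) s t (t e) (s e)" using assms by (auto simp: bridge_def intro: reach_sym)
  from reach_chain[OF _ this] finite_E obtain c where c: "c \<in> C1 (E - {e})"
    "\<forall>v. bdry (E - {e}) s t c v = of_bool (v = s e) - of_bool (v = t e)" by auto
  have "bdry E s t c v = bdry (E - {e}) s t c v" for v
    using c(1) finite_E by (intro bdry_mono_neutral[symmetric]) (auto simp: C1_def)
  then have "is_cycle E s t (\<lambda>e'. c e' + coedge e e')"
    using assms c(2) finite_E by (auto simp: is_cycle_def bdry_add bdry_coedge)
  moreover have "c e + coedge e e = 1" using c(1) by (auto simp: C1_def coedge_def)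
  ultimately show ?thesis by fast
qed

lemma bridge_iff_coboundary:
  assumes "e \<in> E"
  shows "bridge E s t e \<longleftrightarrow> coedge e \<in> coboundaries V E s t"
proof
  assume "bridge E s t e"
  then show "coedge e \<in> coboundaries V E s t"
    using sum_mult_coedge(2)[OF finite_E assms]
    by (intro orthogonal_imp_coboundary coedge_C1 assms) (simp add: bridge_cycle_zero)
next
  assume c: "coedge e \<in> coboundaries V E s t"
  show "bridge E s t e"
  proof (rule ccontr)
    assume "\<not> bridge E s t e"
    from nonbridge_cycle[OF assms this] obtain z where z: "is_cycle E s t z" "z e = 1" by blast
    from coboundaries_orthogonal[OF c z(1)] show False
      using sum_mult_coedge(2)[OF finite_E assms, of z] z(2) by simp
  qed
qed

end

subsection \<open>Spanning forests\<close>

lemma reach_insert: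
  "reach (insert e E) s t u w \<longleftrightarrow> reach E s t u w \<or> (reach E s t u (s e) \<and> reach E s t (t e) w)
     \<or> (reach E s t u (t e) \<and> reach E s t (s e) w)" (is "?l \<longleftrightarrow> ?r u w")
proof
  assume ?l
  then show "?r u w" unfolding reach_def[of "insert e E"]
  proof (induction rule: rtranclp_induct)
    case base
    then show ?case by (simp add: reach_refl)
  next
    case (step y z)
    from step(2) consider "adj E s t y z" | "y = s e" "z = t e" | "y = t e" "z = s e"
      by (auto simp: adj_def)
    then show ?case
    proof cases
      case 1
      then have "reach E s t y z" by (simp add: reach_def)
      with step(3) show ?thesis by (meson reach_trans)
    next
      case 2
      with step(3) show ?thesis by (meson reach_refl reach_trans)
    next
      case 3
      with step(3) show ?thesis by (meson reach_refl reach_trans)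
    qed
  qed
next
  have *: "reach (insert e E) s t (s e) (t e)" "reach (insert e E) s t (t e) (s e)"
    by (simp_all add: reach_edge)
  have **: "reach E s t a b \<Longrightarrow> reach (insert e E) s t a b" for a b by (rule reach_mono[of E]) auto
  assume "?r u w"
  then show ?l by (elim disjE conjE) (blast intro: * ** reach_trans)+
qed

lemma components_equiv: "equiv V {(u, w). u \<in> V \<and> w \<in> V \<and> reach E s t u w}"
  by (intro equivI) (auto simp: refl_on_def sym_def trans_def reach_refl intro: reach_sym reach_trans)

lemma finite_components: "finite V \<Longrightarrow> finite (components V E s t)"
  unfolding components_def by (rule finite_quotient) auto

text \<open>Two classes merge exactly when the ends were not yet joined. The correction term stands
  on the left so that no subtraction of natural numbers occurs.\<close>

lemma card_components_insert:
  assumes "finite V" "s e \<in> V" "t e \<in> V"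
  shows "card (components V (insert e E) s t) + of_bool (\<not> reach E s t (s e) (t e)) = card (components V E s t)"
proof (cases "reach E s t (s e) (t e)")
  case True
  then have "reach (insert e E) s t u w = reach E s t u w" for u w
    unfolding reach_insert by (meson reach_sym reach_trans)
  then show ?thesis using True by (simp add: components_def)
next
  case False
  define r where "r = {(u, w). u \<in> V \<and> w \<in> V \<and> reach E s t u w}"
  define r' where "r' = {(u, w). u \<in> V \<and> w \<in> V \<and> reach (insert e E) s t u w}"
  define A where "A = r `` {s e}"
  define B where "B = r `` {t e}"
  have rV: "r `` {v} = {w\<in>V. reach E s t v w}" if "v \<in> V" for v using that by (auto simp: r_def)
  have r'V: "r' `` {v} = {w\<in>V. reach (insert e E) s t v w}" if "v \<in> V" for v using that by (auto simp: r'_def)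
  have AB: "A \<in> V // r" "B \<in> V // r"
    using assms(2,3) unfolding A_def B_def by (simp_all add: quotientI)
  have "t e \<in> B" "t e \<notin> A" using assms(2,3) False by (simp_all add: A_def B_def rV reach_refl)
  then have AB: "A \<in> V // r" "B \<in> V // r" "A \<noteq> B" using AB by blast+
  have cl: "r' `` {v} = (if v \<in> A \<union> B then A \<union> B else r `` {v})" if v: "v \<in> V" for v
  proof (cases "v \<in> A \<union> B")
    case True
    then have "reach E s t (s e) v \<or> reach E s t (t e) v" using assms by (auto simp: A_def B_def rV)
    then have "{w\<in>V. reach (insert e E) s t v w} = {w\<in>V. reach E s t (s e) w} \<union> {w\<in>V. reach E s t (t e) w}"
      by (auto simp: reach_insert) (meson reach_sym reach_trans)+
    then show ?thesis using True v assms by (simp add: r'V A_def B_def rV)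
  next
    case F: False
    then have "\<not> reach E s t v (s e)" "\<not> reach E s t v (t e)" using assms v
      by (auto simp: A_def B_def rV dest: reach_sym)
    then have "{w\<in>V. reach (insert e E) s t v w} = {w\<in>V. reach E s t v w}"
      by (auto simp: reach_insert)
    then show ?thesis using F v assms by (simp add: r'V rV)
  qed
  have AV: "A \<subseteq> V" "B \<subseteq> V" by (auto simp: A_def B_def r_def)
  have inA: "v \<in> A \<Longrightarrow> r `` {v} = A" "v \<in> B \<Longrightarrow> r `` {v} = B" for v
    using components_equiv[of V E s t] unfolding A_def B_def r_def[symmetric]
    by (metis Image_singleton_iff equiv_class_eq)+
  have "V // r' = (V // r - {A, B}) \<union> {A \<union> B}"
  proof (intro equalityI subsetI)
    fix X assume "X \<in> V // r'"
    then obtain v where v: "v \<in> V" "X = r' `` {v}" by (auto elim: quotientE)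
    show "X \<in> (V // r - {A, B}) \<union> {A \<union> B}"
    proof (cases "v \<in> A \<union> B")
      case False
      then have "r `` {v} \<noteq> A" "r `` {v} \<noteq> B" using v(1) rV reach_refl[of E s t v] by auto
      then show ?thesis using False v cl by (auto intro: quotientI)
    qed (use v cl in auto)
  next
    fix X assume "X \<in> (V // r - {A, B}) \<union> {A \<union> B}"
    then consider "X = A \<union> B" | "X \<in> V // r" "X \<noteq> A" "X \<noteq> B" by auto
    then show "X \<in> V // r'"
    proof cases
      case 1
      have "s e \<in> A" using assms by (auto simp: A_def rV reach_refl)
      then have "r' `` {s e} = A \<union> B" using cl[of "s e"] assms by auto
      then show ?thesis using 1 assms by (metis quotientI)
    next
      case 2
      then obtain v where v: "v \<in> V" "X = r `` {v}" by (auto elim: quotientE)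
      then have "v \<notin> A \<union> B" using 2 inA by auto
      then show ?thesis using v cl by (metis quotientI)
    qed
  qed
  moreover have "A \<union> B \<notin> V // r - {A, B}"
  proof
    assume X: "A \<union> B \<in> V // r - {A, B}"
    then have "A \<union> B \<in> V // r" by simp
    then obtain v where v: "v \<in> V" "A \<union> B = r `` {v}" by (rule quotientE)
    have "s e \<in> r `` {v}" using assms v(2)[symmetric] by (auto simp: A_def rV reach_refl)
    then have "(v, s e) \<in> r" by simp
    then have "r `` {v} = r `` {s e}"
      using components_equiv[of V E s t, folded r_def] by (rule equiv_class_eq[rotated])
    then have "A \<union> B = A" using v(2) by (simp add: A_def)
    then show False using X by auto
  qed
  moreover have fin: "finite (V // r)" using assms(1) by (rule finite_quotient) (auto simp: r_def)
  ultimately have "card (V // r') = Suc (card (V // r - {A, B}))" by simp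
  also have "\<dots> = card (V // r) - 1"
    using AB fin card_Diff_subset[of "{A,B}" "V // r"] card_mono[of "V // r" "{A, B}"] by auto
  finally show ?thesis using False AB fin unfolding components_def r_def[symmetric] r'_def[symmetric]
    by (metis Suc_eq_plus1 Suc_pred' card_gt_0_iff empty_iff of_bool_eq(2))
qed

lemma card_components_empty:
  assumes "finite V" shows "card (components V {} s t) = card V"
proof -
  have "reach {} s t u w \<longleftrightarrow> u = w" for u w
    by (metis reach_invariant[where f=id] reach_refl empty_iff id_apply)
  then have "components V {} s t = (\<lambda>v. {v}) ` V"
    by (auto simp: components_def quotient_def)
  then show ?thesis by (simp add: card_image)
qed

context fgraph begin

text \<open>Edges are added one at a time, and a new edge joins the forest exactly when its ends are
  not yet connected. The counting identity is free of subtraction and shows afterwards that the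
  truncated difference in \<open>genus\<close> is a true one.\<close>

lemma spanning_forest_exists:
  "\<exists>T\<subseteq>E. (\<forall>u w. reach T s t u w = reach E s t u w) \<and> (\<forall>e\<in>T. bridge T s t e) \<and>
     card (E - T) + card V = card E + card (components V E s t)"
  using finite_E ends_in_V
proof (induction E rule: finite_induct)
  case empty
  then show ?case by (simp add: card_components_empty finite_V)
next
  case (insert e E)
  then obtain T where T: "T \<subseteq> E" "\<forall>u w. reach T s t u w = reach E s t u w" "\<forall>e\<in>T. bridge T s t e"
     "card (E - T) + card V = card E + card (components V E s t)" by auto
  have c: "card (components V (insert e E) s t) + of_bool (\<not> reach E s t (s e) (t e)) = card (components V E s t)"
    using insert finite_V by (intro card_components_insert) auto
  show ?case
  proof (cases "reach E s t (s e) (t e)")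
    case True
    have "reach T s t u w = reach (insert e E) s t u w" for u w
      using True T(2) by (auto simp: reach_insert) (meson reach_sym reach_trans)+
    moreover have "card (insert e E - T) = Suc (card (E - T))"
      using insert T(1) by (metis Diff_iff card_insert_disjoint finite_Diff insert_Diff_if subsetD)
    ultimately show ?thesis using T c insert True by (intro exI[of _ T]) auto
  next
    case False
    have "reach (insert e T) s t u w = reach (insert e E) s t u w" for u w
      using T(2) by (simp add: reach_insert)
    moreover have "insert e E - insert e T = E - T" using insert by auto
    moreover have "bridge (insert e T) s t f" if f: "f \<in> insert e T" for f
    proof (cases "f = e")
      case True
      then have "insert e T - {f} = T" using T(1) insert by auto
      then show ?thesis using True False T(2) by (auto simp: bridge_def)
    next
      case fe: False
      then have fT: "f \<in> T" "bridge T s t f" using f T by auto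
      have eq: "insert e T - {f} = insert e (T - {f})" using fe by auto
      have "\<not> reach (T - {f}) s t (s f) (t f)" using fT by (auto simp: bridge_def)
      moreover have "reach T s t (s f) (t f)" using fT by (simp add: reach_edge)
      moreover have "reach (T - {f}) s t a b \<Longrightarrow> reach T s t a b" for a b by (rule reach_mono[of "T - {f}"]) auto
      moreover have "\<not> reach T s t (s e) (t e)" using False T(2) by simp
      ultimately have "\<not> reach (insert e (T - {f})) s t (s f) (t f)"
        unfolding reach_insert by (metis reach_sym reach_trans)
      then show ?thesis using f eq by (simp add: bridge_def)
    qed
    ultimately show ?thesis using T c insert False by (intro exI[of _ "insert e T"]) auto
  qed
qed

lemma genus_eq: "genus V E s t + card V = card E + card (components V E s t)"
  using spanning_forest_exists by (auto simp: genus_def)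

lemma spanning_forest:
  obtains T where "T \<subseteq> E" "\<And>u w. reach T s t u w = reach E s t u w" "\<And>e. e \<in> T \<Longrightarrow> bridge T s t e"
     "card (E - T) = genus V E s t"
  using spanning_forest_exists genus_eq by (metis add_right_cancel)

lemma genus_remove:
  assumes "e \<in> E"
  shows "genus V E s t = genus V (E - {e}) s t + of_bool (\<not> bridge E s t e)"
proof -
  interpret F: fgraph V "E - {e}" s t by (rule fgraph_subset) auto
  have "insert e (E - {e}) = E" using assms by auto
  moreover have "card E = Suc (card (E - {e}))" using assms finite_E by (metis card.remove)
  ultimately show ?thesis
    using card_components_insert[OF finite_V, of s e t "E - {e}"] genus_eq F.genus_eq ends_in_V assms
    by (auto simp: bridge_def of_bool_def split: if_splits)
qed

text \<open>Each edge outside a spanning forest closes up through the forest to a cycle. These edges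
  form \<open>B\<close>, and the cycles restrict to unit vectors on \<open>B\<close>.\<close>

lemma fundamental_cycles:
  obtains B and z :: "'e \<Rightarrow> 'e \<Rightarrow> int" where "B \<subseteq> E" "card B = genus V E s t"
    "\<And>b. b \<in> B \<Longrightarrow> is_cycle E s t (z b)" "\<And>b b'. b \<in> B \<Longrightarrow> b' \<in> B \<Longrightarrow> z b b' = of_bool (b = b')"
proof -
  obtain T where T: "T \<subseteq> E" "\<And>u w. reach T s t u w = reach E s t u w" "\<And>e. e \<in> T \<Longrightarrow> bridge T s t e"
     "card (E - T) = genus V E s t" using spanning_forest by blast
  have "\<exists>z. is_cycle E s t z \<and> (\<forall>b'\<in>E - T. z b' = of_bool (b = b'))" if b: "b \<in> E - T" for b
  proof -
    have "reach T s t (t b) (s b)" using T(2) b by (simp add: reach_edge)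
    from reach_chain[OF _ this] T(1) finite_E obtain c where c: "c \<in> C1 T"
      "\<forall>v. bdry T s t c v = of_bool (v = s b) - of_bool (v = t b)" by (meson finite_subset)
    have "bdry E s t c v = bdry T s t c v" for v
      using c(1) finite_E T(1) by (intro bdry_mono_neutral[symmetric]) (auto simp: C1_def)
    then have "is_cycle E s t (\<lambda>e. c e + coedge b e)"
      using b c(2) finite_E by (auto simp: is_cycle_def bdry_add bdry_coedge)
    moreover have "\<forall>b'\<in>E - T. c b' + coedge b b' = of_bool (b = b')"
      using c(1) by (auto simp: C1_def coedge_def)
    ultimately show ?thesis by blast
  qed
  then obtain z where "\<And>b. b \<in> E - T \<Longrightarrow> is_cycle E s t (z b) \<and> (\<forall>b'\<in>E - T. z b b' = of_bool (b = b'))"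
    by metis
  then show ?thesis using T(4) by (intro that[of "E - T" z]) auto
qed

text \<open>On a forest every cycle vanishes, so every cochain is orthogonal to all cycles and hence
  a coboundary. Later this is applied to dual trees, to produce heights and signs of
  coordinates.\<close>

lemma forest_potential:
  assumes T: "T \<subseteq> E" "\<And>e. e \<in> T \<Longrightarrow> bridge T s t e"
  obtains f :: "'v \<Rightarrow> int" where "\<And>e. e \<in> T \<Longrightarrow> f (t e) - f (s e) = x e"
proof -
  interpret T: fgraph V T s t using T(1) by (rule fgraph_subset)
  define y where "y e = (if e \<in> T then x e else 0)" for e
  have "y \<in> coboundaries V T s t"
    by (rule T.orthogonal_imp_coboundary) (auto simp: y_def C1_def T.bridge_cycle_zero[OF T(2)])
  then obtain f where "y = coboundary T s t f" by (auto simp: coboundaries_def)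
  then show ?thesis by (intro that[of f]) (auto simp: y_def coboundary_def fun_eq_iff split: if_splits)
qed

end

subsection \<open>Ranks\<close>

text \<open>Gaussian elimination over the integers: a pivot removes one column, and
  cross-multiplication replaces division.\<close>

lemma int_dependent:
  fixes a :: "'i \<Rightarrow> 'j \<Rightarrow> int"
  assumes "finite J" "finite I" "card J < card I"
  shows "\<exists>c. (\<exists>i\<in>I. c i \<noteq> 0) \<and> (\<forall>j\<in>J. (\<Sum>i\<in>I. c i * a i j) = 0)"
  using assms
proof (induction J arbitrary: I a rule: finite_induct)
  case empty
  then have "I \<noteq> {}" by auto
  then show ?case by (intro exI[of _ "\<lambda>_. 1"]) auto
next
  case (insert j J)
  show ?case
  proof (cases "\<forall>i\<in>I. a i j = 0")
    case True
    have "card J < card I" using insert by simp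
    from insert.IH[OF insert.prems(1) this, of a] obtain c where "\<exists>i\<in>I. c i \<noteq> 0" "\<forall>j\<in>J. (\<Sum>i\<in>I. c i * a i j) = 0" by blast
    then show ?thesis using True by (intro exI[of _ c]) auto
  next
    case False
    then obtain k where k: "k \<in> I" "a k j \<noteq> 0" by blast
    define b where "b i l = a k j * a i l - a i j * a k l" for i l
    have "finite (I - {k})" "card J < card (I - {k})" using insert k by simp_all
    from insert.IH[OF this, of b] obtain c where
      c: "\<exists>i\<in>I - {k}. c i \<noteq> 0" "\<forall>l\<in>J. (\<Sum>i\<in>I - {k}. c i * b i l) = 0" by blast
    \<comment> \<open>The coefficient of the pivot is forced by column \<open>j\<close>; scaling all
      others by \<open>a k j\<close> keeps it integral.\<close>
    define d where "d i = (if i = k then - (\<Sum>i\<in>I - {k}. c i * a i j) else c i * a k j)" for i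
    have S: "(\<Sum>i\<in>I. d i * a i l) = (\<Sum>i\<in>I - {k}. c i * b i l)" for l
    proof -
      have "(\<Sum>i\<in>I. d i * a i l) = d k * a k l + (\<Sum>i\<in>I - {k}. d i * a i l)"
        using k insert by (simp add: sum.remove)
      also have "(\<Sum>i\<in>I - {k}. d i * a i l) = (\<Sum>i\<in>I - {k}. c i * a k j * a i l)"
        by (intro sum.cong) (auto simp: d_def)
      also have "d k * a k l = - (\<Sum>i\<in>I - {k}. c i * a i j * a k l)"
        by (simp add: d_def sum_distrib_right)
      finally show ?thesis by (simp add: b_def algebra_simps sum_subtractf)
    qed
    have "(\<Sum>i\<in>I. d i * a i j) = 0" unfolding S by (simp add: b_def algebra_simps)
    moreover have "\<exists>i\<in>I. d i \<noteq> 0" using c(1) k(2) by (auto simp: d_def)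
    ultimately show ?thesis using S c(2) by (intro exI[of _ d]) auto
  qed
qed

text \<open>A map on the quotient by the coboundaries, presented on cochains as in
  \<open>H1_isometric\<close>; the kernel condition expresses injectivity on the quotient.\<close>

locale H1_map = fgraph V E s t for V :: "'v set" and E :: "'e set" and s t +
  fixes \<phi> :: "('e \<Rightarrow> int) \<Rightarrow> nat \<Rightarrow> int"
  assumes \<phi>_add: "\<And>x y. x \<in> C1 E \<Longrightarrow> y \<in> C1 E \<Longrightarrow> \<phi> (\<lambda>e. x e + y e) = (\<lambda>i. \<phi> x i + \<phi> y i)"
    and \<phi>_kernel: "\<And>x. x \<in> C1 E \<Longrightarrow> \<phi> x = (\<lambda>i. 0) \<longleftrightarrow> x \<in> coboundaries V E s t"
begin

lemma \<phi>_zero: "\<phi> (\<lambda>e. 0) = (\<lambda>i. 0)"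
  using coboundary_in_coboundaries[of "\<lambda>_. 0"] \<phi>_kernel[of "\<lambda>e. 0"]
  by (simp add: C1_def coboundary_def cong: if_cong)

lemma \<phi>_minus: assumes "x \<in> C1 E" shows "\<phi> (\<lambda>e. - x e) = (\<lambda>i. - \<phi> x i)"
proof -
  have "(\<lambda>e. - x e) \<in> C1 E" using assms by (auto simp: C1_def)
  from \<phi>_add[OF assms this] show ?thesis by (simp add: \<phi>_zero fun_eq_iff) (metis add.commute add_eq_0_iff)
qed

lemma \<phi>_diff: assumes "x \<in> C1 E" "y \<in> C1 E" shows "\<phi> (\<lambda>e. x e - y e) = (\<lambda>i. \<phi> x i - \<phi> y i)"
proof -
  have "(\<lambda>e. - y e) \<in> C1 E" using assms by (auto simp: C1_def)
  from \<phi>_add[OF assms(1) this] show ?thesis by (simp add: \<phi>_minus assms)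
qed

lemma \<phi>_scale: assumes "x \<in> C1 E" shows "\<phi> (\<lambda>e. n * x e) = (\<lambda>i. n * \<phi> x i)"
proof -
  have nat: "\<phi> (\<lambda>e. int k * x e) = (\<lambda>i. int k * \<phi> x i)" for k
  proof (induction k)
    case (Suc k)
    have "(\<lambda>e. int k * x e) \<in> C1 E" using assms by (auto simp: C1_def)
    from \<phi>_add[OF this assms] show ?case using Suc by (simp add: algebra_simps)
  qed (simp add: \<phi>_zero)
  show ?thesis
  proof (cases "n \<ge> 0")
    case True
    then show ?thesis using nat[of "nat n"] by simp
  next
    case False
    have "(\<lambda>e. int (nat (-n)) * x e) \<in> C1 E" using assms by (auto simp: C1_def)
    from \<phi>_minus[OF this] show ?thesis using nat[of "nat (-n)"] False by simp
  qed
qed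

lemma \<phi>_sum: assumes "finite I" "\<And>i. i \<in> I \<Longrightarrow> x i \<in> C1 E"
  shows "\<phi> (\<lambda>e. \<Sum>i\<in>I. c i * x i e) = (\<lambda>j. \<Sum>i\<in>I. c i * \<phi> (x i) j)"
  using assms
proof (induction I rule: finite_induct)
  case (insert k I)
  have "(\<lambda>e. c k * x k e) \<in> C1 E" "(\<lambda>e. \<Sum>i\<in>I. c i * x i e) \<in> C1 E"
    using insert by (auto simp: C1_def)
  from \<phi>_add[OF this] show ?case using insert \<phi>_scale[of "x k" "c k"] by simp
qed (simp add: \<phi>_zero)

lemma \<phi>_expand: assumes "x \<in> C1 E" shows "\<phi> x = (\<lambda>j. \<Sum>e\<in>E. x e * \<phi> (coedge e) j)"
  using \<phi>_sum[OF finite_E, of coedge x] C1_expand[OF finite_E assms] by (simp add: coedge_C1)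

text \<open>The first \<open>m\<close> coordinates are faithful and rationally surjective, so
  \<open>m\<close> is the rank of the quotient. The edges outside a spanning forest serve as a
  basis, and \<open>int_dependent\<close> gives both inequalities.\<close>

lemma rank_eq_genus:
  assumes coords: "\<And>x. x \<in> C1 E \<Longrightarrow> (\<And>i. i < m \<Longrightarrow> \<phi> x i = 0) \<Longrightarrow> \<phi> x = (\<lambda>i. 0)"
    and units: "\<And>i. i < m \<Longrightarrow> \<exists>x\<in>C1 E. \<phi> x i \<noteq> 0 \<and> (\<forall>j<m. j \<noteq> i \<longrightarrow> \<phi> x j = 0)"
  shows "m = genus V E s t"
proof -
  obtain T where T: "T \<subseteq> E" "\<And>u w. reach T s t u w = reach E s t u w" "\<And>e. e \<in> T \<Longrightarrow> bridge T s t e"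
     "card (E - T) = genus V E s t" using spanning_forest by blast
  define B where "B = E - T"
  have B: "finite B" "B \<subseteq> E" using finite_E by (auto simp: B_def)
  have "card B \<le> m"
  proof (rule ccontr)
    assume "\<not> card B \<le> m"
    with int_dependent[of "{..<m}" B "\<lambda>e. \<phi> (coedge e)"] B obtain c where
      c: "\<exists>i\<in>B. c i \<noteq> 0" "\<forall>j<m. (\<Sum>i\<in>B. c i * \<phi> (coedge i) j) = 0" by auto
    define x where "x e = (\<Sum>i\<in>B. c i * coedge i e)" for e
    have x: "x \<in> C1 E" "\<And>e. e \<in> B \<Longrightarrow> x e = c e" "\<And>e. e \<notin> B \<Longrightarrow> x e = 0"
      using B by (auto simp: x_def C1_def coedge_def if_distrib[where f="\<lambda>u. _ * u"] cong: if_cong)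
    have "\<phi> x = (\<lambda>j. \<Sum>i\<in>B. c i * \<phi> (coedge i) j)"
      unfolding x_def using B by (intro \<phi>_sum) (auto intro: coedge_C1)
    then have "\<phi> x = (\<lambda>i. 0)" using c(2) x(1) by (intro coords) auto
    then obtain f where f: "x = coboundary E s t f" using \<phi>_kernel x(1) by (auto simp: coboundaries_def)
    \<comment> \<open>A coboundary that vanishes on a spanning forest has a potential that is
      constant on components, so it is zero.\<close>
    have "f (s e) = f (t e)" if "e \<in> T" for e
    proof -
      have "x e = 0" using that x(3) by (auto simp: B_def)
      then show ?thesis using that T(1) by (auto simp: f coboundary_def)
    qed
    then have "reach E s t u w \<Longrightarrow> f u = f w" for u w
      using reach_invariant[of T s t u w f] T(2) by metis
    then have "x e = 0" for e by (auto simp: f coboundary_def reach_edge)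
    then show False using c(1) x(2) by metis
  qed
  moreover have "m \<le> card B"
  proof (rule ccontr)
    assume "\<not> m \<le> card B"
    obtain X where X: "\<And>i. i < m \<Longrightarrow> X i \<in> C1 E \<and> \<phi> (X i) i \<noteq> 0 \<and> (\<forall>j<m. j \<noteq> i \<longrightarrow> \<phi> (X i) j = 0)"
      using units by metis
    \<comment> \<open>Subtracting a coboundary moves a class to the edges outside the forest without
      changing its image.\<close>
    have "\<exists>y\<in>C1 E. (\<forall>e\<in>T. y e = 0) \<and> \<phi> y = \<phi> (X i)" if i: "i < m" for i
    proof -
      obtain f where f: "\<And>e. e \<in> T \<Longrightarrow> f (t e) - f (s e) = X i e"
        using forest_potential[OF T(1) T(3)] by blast
      define y where "y e = X i e - coboundary E s t f e" for e
      have XC: "X i \<in> C1 E" using X i by blast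
      have "\<phi> y = \<phi> (X i)" unfolding y_def using XC \<phi>_kernel[OF C1_coboundary[of E s t f]]
        by (subst \<phi>_diff) (auto simp: C1_coboundary coboundary_in_coboundaries)
      moreover have "y \<in> C1 E" using XC by (auto simp: y_def C1_def coboundary_def)
      moreover have "\<forall>e\<in>T. y e = 0" using f T(1) by (auto simp: y_def coboundary_def)
      ultimately show ?thesis by blast
    qed
    then obtain Y where Y: "\<And>i. i < m \<Longrightarrow> Y i \<in> C1 E \<and> (\<forall>e\<in>T. Y i e = 0) \<and> \<phi> (Y i) = \<phi> (X i)" by metis
    from int_dependent[of B "{..<m}" Y] B \<open>\<not> m \<le> card B\<close> obtain c where
      c: "\<exists>i<m. c i \<noteq> 0" "\<forall>e\<in>B. (\<Sum>i<m. c i * Y i e) = 0" by auto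
    have "(\<Sum>i<m. c i * Y i e) = 0" for e
    proof (cases "e \<in> B")
      case False
      then have "i < m \<Longrightarrow> Y i e = 0" for i using Y[of i] by (auto simp: B_def C1_def)
      then show ?thesis by simp
    qed (use c in auto)
    then have "(\<lambda>j. \<Sum>i<m. c i * \<phi> (Y i) j) = (\<lambda>i. 0)"
      using \<phi>_sum[of "{..<m}" Y c] Y \<phi>_zero by simp
    then have "(\<Sum>i<m. c i * \<phi> (Y i) j) = 0" for j by (rule fun_cong)
    moreover have "(\<Sum>i<m. c i * \<phi> (Y i) j) = c j * \<phi> (X j) j" if "j < m" for j
      using X Y that sum.remove[of "{..<m}" j "\<lambda>i. c i * \<phi> (Y i) j"] by auto
    ultimately show False using c(1) X by (metis mult_eq_0_iff)
  qed
  ultimately show ?thesis using T(4) by (simp add: B_def)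
qed

end

section \<open>Graphs embedded in the plane\<close>

lemma path_image_ends:
  "path_image g = {pathstart g, pathfinish g} \<union> g ` {0<..<1::real}"
proof -
  have "{0..1::real} = {0, 1} \<union> {0<..<1}" by auto
  then show ?thesis by (auto simp: path_image_def pathstart_def pathfinish_def)
qed

lemma continuous_Ints_constant:
  fixes f :: "'a::topological_space \<Rightarrow> complex"
  assumes "connected S" "continuous_on S f" "\<And>x. x \<in> S \<Longrightarrow> f x \<in> \<int>" "a \<in> S" "b \<in> S"
  shows "f a = f b"
proof -
  have "f constant_on S"
  proof (rule continuous_discrete_range_constant[OF assms(1,2)])
    fix x assume x: "x \<in> S"
    have "1 \<le> norm (f y - f x)" if y: "y \<in> S" "f y \<noteq> f x" for y
    proof -
      obtain m where m: "f y = of_int m" using assms(3)[OF y(1)] by (rule Ints_cases)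
      obtain n where n: "f x = of_int n" using assms(3)[OF x] by (rule Ints_cases)
      have "norm (f y - f x) = real_of_int \<bar>m - n\<bar>"
        unfolding m n of_int_diff[symmetric] norm_of_int by simp
      moreover have "1 \<le> \<bar>m - n\<bar>" using y m n by auto
      ultimately show ?thesis by linarith
    qed
    then show "\<exists>e>0. \<forall>y. y \<in> S \<and> f y \<noteq> f x \<longrightarrow> e \<le> norm (f y - f x)" by (intro exI[of _ 1]) auto
  qed
  then show ?thesis using assms(4,5) by (auto simp: constant_on_def)
qed

text \<open>The plane is the complex plane so that winding numbers apply; \<open>simple_path\<close>
  instead of \<open>arc\<close> admits loops.\<close>

locale plane_graph = fgraph V E s t for V :: "'v set" and E :: "'e set" and s t +
  fixes p :: "'v \<Rightarrow> complex" and \<gamma> :: "'e \<Rightarrow> real \<Rightarrow> complex"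
  assumes p_inj: "inj_on p V"
    and \<gamma>_simple: "\<And>e. e \<in> E \<Longrightarrow> simple_path (\<gamma> e)"
    and \<gamma>_start: "\<And>e. e \<in> E \<Longrightarrow> pathstart (\<gamma> e) = p (s e)"
    and \<gamma>_finish: "\<And>e. e \<in> E \<Longrightarrow> pathfinish (\<gamma> e) = p (t e)"
    and \<gamma>_V: "\<And>e. e \<in> E \<Longrightarrow> \<gamma> e ` {0<..<1} \<inter> p ` V = {}"
    and \<gamma>_disj: "\<And>e e'. e \<in> E \<Longrightarrow> e' \<in> E \<Longrightarrow> e \<noteq> e' \<Longrightarrow> \<gamma> e ` {0<..<1} \<inter> path_image (\<gamma> e') = {}"
begin

definition K :: "'e set \<Rightarrow> complex set" where
  "K F = p ` V \<union> (\<Union>e\<in>F. path_image (\<gamma> e))"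

definition face :: "complex \<Rightarrow> complex set" where
  "face x = connected_component_set (- K E) x"

definition faces :: "complex set set" where
  "faces = face ` (- K E)"

text \<open>Single edges are open paths with complex winding numbers; the weighted sum becomes
  integral only for cycles.\<close>

definition wind :: "('e \<Rightarrow> int) \<Rightarrow> complex \<Rightarrow> complex" where
  "wind z x = (\<Sum>e\<in>E. of_int (z e) * winding_number (\<gamma> e) x)"

lemma plane_graph_subset: "F \<subseteq> E \<Longrightarrow> plane_graph V F s t p \<gamma>"
  using p_inj \<gamma>_simple \<gamma>_start \<gamma>_finish \<gamma>_V \<gamma>_disj
  by (intro plane_graph.intro fgraph_subset plane_graph_axioms.intro) (auto simp: subset_iff)

lemma \<gamma>_path: "e \<in> E \<Longrightarrow> path (\<gamma> e)"
  by (simp add: \<gamma>_simple simple_path_imp_path)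

lemma \<gamma>_arc: "e \<in> E \<Longrightarrow> s e \<noteq> t e \<Longrightarrow> arc (\<gamma> e)"
  using \<gamma>_simple \<gamma>_start \<gamma>_finish p_inj ends_in_V by (metis arc_simple_path inj_onD)

lemma compact_K: "F \<subseteq> E \<Longrightarrow> compact (K F)"
  unfolding K_def using finite_V finite_E \<gamma>_path
  by (intro compact_Un compact_UN) (auto intro: finite_imp_compact finite_subset compact_path_image)

lemma closed_K: "F \<subseteq> E \<Longrightarrow> closed (K F)"
  by (simp add: compact_K compact_imp_closed)

lemma K_mono: "F \<subseteq> F' \<Longrightarrow> K F \<subseteq> K F'"
  by (auto simp: K_def)

lemma K_remove: "e \<in> E \<Longrightarrow> K E = K (E - {e}) \<union> path_image (\<gamma> e)"
  by (auto simp: K_def)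

lemma p_in_K: "v \<in> V \<Longrightarrow> p v \<in> K F"
  by (auto simp: K_def)

lemma edge_in_K: "e \<in> F \<Longrightarrow> path_image (\<gamma> e) \<subseteq> K F"
  by (auto simp: K_def)

lemma interior_edge_notin_K:
  assumes "e \<in> E" shows "\<gamma> e ` {0<..<1} \<inter> K (E - {e}) = {}"
  using \<gamma>_V[OF assms] \<gamma>_disj[OF assms] unfolding K_def by fast

lemma edge_image: "e \<in> E \<Longrightarrow> path_image (\<gamma> e) = {p (s e), p (t e)} \<union> \<gamma> e ` {0<..<1}"
  using path_image_ends[of "\<gamma> e"] by (simp add: \<gamma>_start \<gamma>_finish)

lemma reach_path_component:
  assumes "reach F s t u w" "F \<subseteq> E" "u \<in> V"
  shows "path_component (K F) (p u) (p w)"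
  using assms(1) unfolding reach_def
proof (induction rule: rtranclp_induct)
  case base
  then show ?case using assms(3) by (simp add: path_component_refl_eq p_in_K)
next
  case (step y z)
  from step(2) obtain e where e: "e \<in> F" "(s e = y \<and> t e = z) \<or> (s e = z \<and> t e = y)" by (auto simp: adj_def)
  have "path_component (K F) (p (s e)) (p (t e))"
    unfolding path_component_def using e assms(2) edge_in_K[of e F] \<gamma>_path \<gamma>_start \<gamma>_finish
    by (intro exI[of _ "\<gamma> e"]) auto
  then show ?case using e(2) step(3) by (metis path_component_sym path_component_trans)
qed

text \<open>Each \<open>\<omega> e\<close> differs by an integer from a difference of fixed
  logarithms at the ends, and those differences cancel on a cycle. Only the exponential relation is
  assumed, so an edge can be exchanged for another curve with the same ends.\<close>

lemma wind_Ints_aux: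
  assumes z: "is_cycle E s t z" and x: "x \<notin> p ` V"
    and \<omega>: "\<And>e. e \<in> E \<Longrightarrow> p (t e) - x = exp (2 * pi * \<i> * \<omega> e) * (p (s e) - x)"
  shows "(\<Sum>e\<in>E. of_int (z e) * \<omega> e) \<in> \<int>"
proof -
  define l where "l v = Ln (p v - x) / (2 * pi * \<i>)" for v
  have l: "exp (2 * pi * \<i> * l v) = p v - x" if "v \<in> V" for v
  proof -
    have "p v - x \<noteq> 0" using that x by auto
    then show ?thesis by (simp add: l_def)
  qed
  have "\<omega> e - (l (t e) - l (s e)) \<in> \<int>" if e: "e \<in> E" for e
  proof -
    have "exp (2 * pi * \<i> * (\<omega> e - (l (t e) - l (s e)))) = exp (2 * pi * \<i> * \<omega> e) * (p (s e) - x) / (p (t e) - x)"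
      unfolding l[OF ends_in_V(1)[OF e], symmetric] l[OF ends_in_V(2)[OF e], symmetric]
      by (simp add: exp_diff[symmetric] exp_add[symmetric]) (simp add: algebra_simps)
    also have "\<dots> = 1"
    proof -
      have "p (t e) - x \<noteq> 0" using x ends_in_V(2)[OF e] by auto
      then show ?thesis using \<omega>[OF e] by simp
    qed
    finally have "exp (2 * pi * \<i> * (\<omega> e - (l (t e) - l (s e)))) = 1" .
    then obtain n where "Re (2 * pi * \<i> * (\<omega> e - (l (t e) - l (s e)))) = 0" 
      "Im (2 * pi * \<i> * (\<omega> e - (l (t e) - l (s e)))) = of_int (2 * n) * pi"
      by (auto simp: exp_eq_1)
    then have "\<omega> e - (l (t e) - l (s e)) = of_int n" by (auto simp: complex_eq_iff)
    then show ?thesis by simp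
  qed
  then have "(\<Sum>e\<in>E. of_int (z e) * (\<omega> e - (l (t e) - l (s e)))) \<in> \<int>"
    by (intro Ints_sum Ints_mult) auto
  moreover have "(\<Sum>e\<in>E. of_int (z e) * (l (t e) - l (s e))) = 0"
    using coboundary_pairing_of_int[of l z] z by (simp add: is_cycle_def mult.commute)
  ultimately show ?thesis by (simp add: algebra_simps sum_subtractf sum.distrib)
qed

lemma wind_Ints:
  assumes "is_cycle E s t z" "x \<notin> K E"
  shows "wind z x \<in> \<int>"
  unfolding wind_def
proof (rule wind_Ints_aux[OF assms(1)])
  show "x \<notin> p ` V" using assms(2) by (auto simp: K_def)
  fix e assume e: "e \<in> E"
  then have "x \<notin> path_image (\<gamma> e)" using assms(2) by (auto simp: K_def)
  from winding_number_exp_2pi[OF \<gamma>_path[OF e] this] e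
  show "p (t e) - x = exp (2 * pi * \<i> * winding_number (\<gamma> e) x) * (p (s e) - x)"
    by (simp add: \<gamma>_start \<gamma>_finish)
qed

lemma continuous_winding: "e \<in> E \<Longrightarrow> S \<inter> path_image (\<gamma> e) = {} \<Longrightarrow> continuous_on S (winding_number (\<gamma> e))"
  using continuous_at_winding_number[OF \<gamma>_path] by (intro continuous_at_imp_continuous_on) blast

lemma wind_face:
  assumes "is_cycle E s t z" "connected_component (- K E) a b"
  shows "wind z a = wind z b"
proof -
  obtain S where S: "connected S" "S \<subseteq> - K E" "a \<in> S" "b \<in> S"
    using assms(2) by (auto simp: connected_component_def)
  show ?thesis
  proof (rule continuous_Ints_constant[OF S(1) _ _ S(3,4)])
    show "continuous_on S (wind z)" unfolding wind_def
      using S(2) by (intro continuous_intros continuous_winding) (auto simp: K_def)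
    show "wind z x \<in> \<int>" if "x \<in> S" for x using wind_Ints[OF assms(1)] S(2) that by auto
  qed
qed

text \<open>A non-bridge edge lies on a Jordan curve inside the graph; the rest of the curve contributes
  the function w to its winding number.\<close>

lemma nonbridge_curve:
  assumes e: "e \<in> E" "\<not> bridge E s t e"
  obtains C A w where "simple_path C" "pathfinish C = pathstart C"
    "path_image C = path_image (\<gamma> e) \<union> A" "A \<subseteq> K (E - {e})" "connected A" "p (s e) \<in> A" "p (t e) \<in> A"
    "continuous_on (- K (E - {e})) w"
    "\<And>x. x \<notin> path_image C \<Longrightarrow> winding_number C x = winding_number (\<gamma> e) x + w x"
    "\<And>x. x \<notin> K (E - {e}) \<Longrightarrow> p (s e) - x = exp (2 * pi * \<i> * w x) * (p (t e) - x)"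
proof (cases "s e = t e")
  case True
  \<comment> \<open>A loop is itself the Jordan curve, so nothing is left over and \<open>w\<close>
    is zero.\<close>
  show ?thesis
  proof (rule that[of "\<gamma> e" "{p (s e)}" "\<lambda>x. 0"])
    show "path_image (\<gamma> e) = path_image (\<gamma> e) \<union> {p (s e)}" using e by (auto simp: edge_image)
  qed (use True e in \<open>auto simp: \<gamma>_simple \<gamma>_start \<gamma>_finish p_in_K ends_in_V\<close>)
next
  case False
  have "reach (E - {e}) s t (t e) (s e)" using e by (auto simp: bridge_def intro: reach_sym)
  then have "path_component (K (E - {e})) (p (t e)) (p (s e))"
    by (rule reach_path_component) (use ends_in_V e in auto)
  then obtain g where g: "path g" "path_image g \<subseteq> K (E - {e})" "pathstart g = p (t e)" "pathfinish g = p (s e)"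
    by (auto simp: path_component_def)
  have "p (t e) \<noteq> p (s e)" using False e ends_in_V p_inj by (metis inj_onD)
  \<comment> \<open>The path through the rest of the drawing is thinned to an arc, so that together
    with the edge it is a simple closed curve.\<close>
  then obtain c where c: "arc c" "path_image c \<subseteq> path_image g" "pathstart c = p (t e)" "pathfinish c = p (s e)"
    using path_contains_arc[OF g(1), of "p (t e)" "p (s e)"] g by auto
  have cK: "path_image c \<subseteq> K (E - {e})" using c(2) g(2) by simp
  have int: "path_image (\<gamma> e) \<inter> path_image c \<subseteq> {p (s e), p (t e)}"
    using interior_edge_notin_K[OF e(1)] cK e by (auto simp: edge_image)
  have cC: "continuous_on (- K (E - {e})) (winding_number c)"
    using continuous_at_winding_number[OF arc_imp_path[OF c(1)]] cK
    by (intro continuous_at_imp_continuous_on) blast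
  show ?thesis
  proof (rule that[of "\<gamma> e +++ c" "path_image c" "winding_number c"])
    show "simple_path (\<gamma> e +++ c)"
      using c int e False by (intro simple_path_join_loop \<gamma>_arc) (auto simp: \<gamma>_start \<gamma>_finish)
    show "path_image (\<gamma> e +++ c) = path_image (\<gamma> e) \<union> path_image c"
      using c e by (intro path_image_join) (auto simp: \<gamma>_finish)
    then show "winding_number (\<gamma> e +++ c) x = winding_number (\<gamma> e) x + winding_number c x"
      if "x \<notin> path_image (\<gamma> e +++ c)" for x
      using that c e by (intro winding_number_join) (auto simp: \<gamma>_path \<gamma>_finish arc_imp_path)
    show "p (s e) - x = exp (2 * pi * \<i> * winding_number c x) * (p (t e) - x)" if "x \<notin> K (E - {e})" for x
      using winding_number_exp_2pi[of c x] c cK that by (auto simp: arc_imp_path)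
    show "p (s e) \<in> path_image c" "p (t e) \<in> path_image c"
      using c by (metis pathfinish_in_path_image, metis pathstart_in_path_image)
    show "connected (path_image c)" using c(1) by (simp add: connected_arc_image)
  qed (use e c cK cC in \<open>auto simp: \<gamma>_start\<close>)
qed

text \<open>The parts \<open>K1\<close> and \<open>K2\<close> on the two sides of the bridge are
  disjoint, so \<open>K1\<close>, the edge and \<open>K2\<close> are attached successively at single
  points. Janiszewski's theorem, which requires a connected intersection, is applied twice.\<close>

lemma bridge_no_separation:
  assumes e: "bridge E s t e" and ab: "a \<notin> K E" "b \<notin> K E" "connected_component (- K (E - {e})) a b"
  shows "connected_component (- K E) a b"
proof -
  have eE: "e \<in> E" and nr: "\<not> reach (E - {e}) s t (s e) (t e)" using e by (auto simp: bridge_def)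
  define V1 where "V1 = {v \<in> V. reach (E - {e}) s t (s e) v}"
  define E1 where "E1 = {f \<in> E - {e}. s f \<in> V1}"
  define K1 where "K1 = p ` V1 \<union> (\<Union>f\<in>E1. path_image (\<gamma> f))"
  define K2 where "K2 = p ` (V - V1) \<union> (\<Union>f\<in>E - {e} - E1. path_image (\<gamma> f))"
  have V1: "s f \<in> V1 \<longleftrightarrow> t f \<in> V1" if "f \<in> E - {e}" for f
    using reach_edge[of f "E - {e}" s t] that ends_in_V by (auto simp: V1_def intro: reach_trans)
  have ends: "s e \<in> V1" "t e \<in> V - V1" using nr eE ends_in_V by (auto simp: V1_def reach_refl)
  have st: "s e \<noteq> t e" using nr reach_refl by metis
  have KK: "K (E - {e}) = K1 \<union> K2" by (auto simp: K_def K1_def K2_def E1_def V1_def)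
  have cpt: "compact K1" "compact K2"
    unfolding K1_def K2_def using finite_V finite_E \<gamma>_path
    by (intro compact_Un compact_UN; auto intro!: finite_imp_compact compact_path_image simp: E1_def V1_def)+
  have disj: "path_image (\<gamma> f) \<inter> path_image (\<gamma> f') = {}" if "f \<in> E1" "f' \<in> E - {e} - E1" for f f'
  proof -
    have f: "f \<in> E" "f' \<in> E" "f \<noteq> f'" "f \<in> E - {e}" "f' \<in> E - {e}" using that by (auto simp: E1_def)
    have "s f \<in> V1" "t f \<in> V1" "s f' \<in> V - V1" "t f' \<in> V - V1"
      using that V1[OF f(4)] V1[OF f(5)] f ends_in_V by (auto simp: E1_def)
    then have "{p (s f), p (t f)} \<inter> {p (s f'), p (t f')} = {}"
      using p_inj by (auto simp: V1_def inj_on_def)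
    then show ?thesis
      using \<gamma>_disj[of f f'] \<gamma>_disj[of f' f] f by (auto simp: edge_image)
  qed
  have disjV: "p ` V1 \<inter> path_image (\<gamma> f') = {}" if "f' \<in> E - {e} - E1" for f'
  proof -
    have f: "f' \<in> E" "f' \<in> E - {e}" using that by auto
    then have "s f' \<in> V - V1" "t f' \<in> V - V1" using that V1[OF f(2)] ends_in_V by (auto simp: E1_def)
    then have "p ` V1 \<inter> {p (s f'), p (t f')} = {}" using p_inj by (auto simp: V1_def inj_on_def)
    moreover have "p ` V1 \<inter> \<gamma> f' ` {0<..<1} = {}" using \<gamma>_V[OF f(1)] by (auto simp: V1_def)
    ultimately show ?thesis using f by (auto simp: edge_image)
  qed
  have disjV2: "p ` (V - V1) \<inter> path_image (\<gamma> f) = {}" if "f \<in> E1" for f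
  proof -
    have f: "f \<in> E" "f \<in> E - {e}" using that by (auto simp: E1_def)
    then have "s f \<in> V1" "t f \<in> V1" using that V1[OF f(2)] by (auto simp: E1_def)
    then have "p ` (V - V1) \<inter> {p (s f), p (t f)} = {}" using p_inj by (auto simp: V1_def inj_on_def)
    moreover have "p ` (V - V1) \<inter> \<gamma> f ` {0<..<1} = {}" using \<gamma>_V[OF f(1)] by auto
    ultimately show ?thesis using f by (auto simp: edge_image)
  qed
  have "p ` V1 \<inter> p ` (V - V1) = {}" using p_inj by (auto simp: V1_def inj_on_def)
  moreover have "p ` V1 \<inter> (\<Union>f\<in>E - {e} - E1. path_image (\<gamma> f)) = {}" using disjV by blast
  moreover have "p ` (V - V1) \<inter> (\<Union>f\<in>E1. path_image (\<gamma> f)) = {}" using disjV2 by blast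
  moreover have "(\<Union>f\<in>E1. path_image (\<gamma> f)) \<inter> (\<Union>f\<in>E - {e} - E1. path_image (\<gamma> f)) = {}" using disj by blast
  ultimately have K12: "K1 \<inter> K2 = {}" unfolding K1_def K2_def by (simp add: Int_Un_distrib Int_Un_distrib2 Int_commute)
  have in12: "p (s e) \<in> K1" "p (t e) \<in> K2" using ends by (auto simp: K1_def K2_def)
  have int: "\<gamma> e ` {0<..<1} \<inter> (K1 \<union> K2) = {}" using interior_edge_notin_K[OF eE] KK by simp
  have i1: "K1 \<inter> path_image (\<gamma> e) = {p (s e)}" using int in12 K12 eE by (auto simp: edge_image)
  have i2: "(K1 \<union> path_image (\<gamma> e)) \<inter> K2 = {p (t e)}" using int in12 K12 eE by (auto simp: edge_image)
  have "connected_component (- (K1 \<union> path_image (\<gamma> e))) a b"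
  proof (rule Janiszewski)
    show "connected_component (- K1) a b"
      using ab(3) KK by (metis Compl_subset_Compl_iff Un_upper1 connected_component_of_subset)
    have "connected (- path_image (\<gamma> e))" using \<gamma>_arc[OF eE st] by (simp add: connected_arc_complement)
    then show "connected_component (- path_image (\<gamma> e)) a b"
      using ab K_remove[OF eE] unfolding connected_component_def by (intro exI[of _ "- path_image (\<gamma> e)"]) auto
  qed (use cpt i1 eE \<gamma>_path in \<open>auto intro: closed_path_image\<close>)
  moreover have "connected_component (- K2) a b"
    using ab(3) KK by (metis Compl_subset_Compl_iff Un_upper2 connected_component_of_subset)
  ultimately have "connected_component (- ((K1 \<union> path_image (\<gamma> e)) \<union> K2)) a b"
    using cpt i2 \<gamma>_path[OF eE] compact_path_image[of "\<gamma> e"]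
    by (intro Janiszewski[of "K1 \<union> path_image (\<gamma> e)" K2]) (simp_all add: compact_imp_closed compact_Un del: Compl_Un compl_sup)
  moreover have "(K1 \<union> path_image (\<gamma> e)) \<union> K2 = K E" using K_remove[OF eE] KK by auto
  ultimately show ?thesis by simp
qed

text \<open>Janiszewski's theorem for the rest of the drawing and the Jordan curve \<open>C\<close>:
  they intersect exactly in the connected set \<open>A\<close>, so two points on the same side of
  \<open>C\<close> are not newly separated by \<open>e\<close>.\<close>

lemma nonbridge_no_separation:
  assumes e: "e \<in> E" and C: "simple_path C" "pathfinish C = pathstart C"
    "path_image C = path_image (\<gamma> e) \<union> A" "A \<subseteq> K (E - {e})" "connected A" "p (s e) \<in> A" "p (t e) \<in> A"
    and ab: "connected_component (- K (E - {e})) a b"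
    and side: "(a \<in> inside (path_image C) \<and> b \<in> inside (path_image C)) \<or>
               (a \<in> outside (path_image C) \<and> b \<in> outside (path_image C))"
  shows "connected_component (- K E) a b"
proof -
  note J = Jordan_inside_outside[OF C(1,2)]
  have "connected_component (- path_image C) a b"
    using side J unfolding connected_component_def
    by (metis (no_types, lifting) inside_Un_outside sup_ge1 sup_ge2)
  moreover have "K (E - {e}) \<inter> path_image C = A"
    using C interior_edge_notin_K[OF e] edge_image[OF e] by auto
  ultimately have "connected_component (- (K (E - {e}) \<union> path_image C)) a b"
    using compact_K[of "E - {e}"] C(5) ab closed_simple_path_image[OF C(1)]
    by (intro Janiszewski) simp_all
  moreover have "K (E - {e}) \<union> path_image C = K E" using K_remove[OF e] C by auto
  ultimately show ?thesis by simp
qed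

lemma connected_interior_edge: "e \<in> E \<Longrightarrow> connected (\<gamma> e ` {0<..<1})"
proof -
  assume "e \<in> E"
  then have "continuous_on {0<..<1} (\<gamma> e)"
    using \<gamma>_path unfolding path_def by (meson continuous_on_subset greaterThanLessThan_subseteq_atLeastAtMost_iff order_refl)
  then show ?thesis by (intro connected_continuous_image) auto
qed

lemma interior_edge_component:
  assumes "e \<in> E" "x \<in> \<gamma> e ` {0<..<1}"
  shows "connected_component (- K (E - {e})) (\<gamma> e (1/2)) x"
  using connected_interior_edge[OF assms(1)] interior_edge_notin_K[OF assms(1)] assms(2)
  unfolding connected_component_def by (intro exI[of _ "\<gamma> e ` {0<..<1}"]) auto

text \<open>The interior of \<open>e\<close> is connected and lies in a single face of the smaller
  graph; every other face of that graph misses \<open>e\<close> altogether.\<close>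

lemma other_faces_unchanged:
  assumes e: "e \<in> E" and ab: "connected_component (- K (E - {e})) a b"
    and na: "\<not> connected_component (- K (E - {e})) (\<gamma> e (1/2)) a"
  shows "connected_component (- K E) a b"
proof -
  define S where "S = connected_component_set (- K (E - {e})) a"
  have "S \<subseteq> - K (E - {e})" unfolding S_def by (rule connected_component_subset)
  moreover have "S \<inter> \<gamma> e ` {0<..<1} = {}"
  proof (rule ccontr)
    assume "S \<inter> \<gamma> e ` {0<..<1} \<noteq> {}"
    then obtain x where x: "x \<in> \<gamma> e ` {0<..<1}" "connected_component (- K (E - {e})) a x" by (auto simp: S_def)
    from interior_edge_component[OF e x(1)] x(2) na show False
      by (meson connected_component_sym connected_component_trans)
  qed
  moreover have "K E = K (E - {e}) \<union> \<gamma> e ` {0<..<1}"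
    unfolding K_remove[OF e] edge_image[OF e] using p_in_K[OF ends_in_V(1)[OF e]] p_in_K[OF ends_in_V(2)[OF e]] by auto
  ultimately have "S \<subseteq> - K E" by auto
  moreover have "a \<in> S" using ab unfolding S_def by (metis connected_component_in connected_component_refl mem_Collect_eq)
  moreover have "b \<in> S" using ab by (simp add: S_def)
  moreover have "connected S" by (simp add: S_def)
  ultimately show ?thesis unfolding connected_component_def by blast
qed

text \<open>The midpoint of the edge is on the frontier of both sides of \<open>C\<close>, and the
  component of the complement of the rest that contains it is open, so it reaches both
  sides.\<close>

lemma edge_sides:
  assumes e: "e \<in> E" and C: "simple_path C" "pathfinish C = pathstart C"
    "path_image C = path_image (\<gamma> e) \<union> A" "A \<subseteq> K (E - {e})"
  obtains a b where "a \<in> inside (path_image C)" "b \<in> outside (path_image C)" "a \<notin> K E" "b \<notin> K E"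
    "connected_component (- K (E - {e})) (\<gamma> e (1/2)) a" "connected_component (- K (E - {e})) (\<gamma> e (1/2)) b"
proof -
  note J = Jordan_inside_outside[OF C(1,2)]
  define F where "F = connected_component_set (- K (E - {e})) (\<gamma> e (1/2))"
  have x: "\<gamma> e (1/2) \<in> \<gamma> e ` {0<..<1}" by simp
  have "\<gamma> e (1/2) \<in> path_image C" using x C(3) edge_image[OF e] by auto
  then have fr: "\<gamma> e (1/2) \<in> closure (inside (path_image C))" "\<gamma> e (1/2) \<in> closure (outside (path_image C))"
    using J by (auto simp: frontier_def)
  have "open F" unfolding F_def using closed_K[of "E - {e}"] by (intro open_connected_component) auto
  moreover have "\<gamma> e (1/2) \<in> F" unfolding F_def using interior_edge_component[OF e x] by simp
  ultimately have "F \<inter> inside (path_image C) \<noteq> {}" "F \<inter> outside (path_image C) \<noteq> {}"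
    using fr open_Int_closure_eq_empty[of F] by blast+
  then obtain a b where ab: "a \<in> F" "a \<in> inside (path_image C)" "b \<in> F" "b \<in> outside (path_image C)" by blast
  have "F \<subseteq> - K (E - {e})" unfolding F_def by (rule connected_component_subset)
  moreover have "a \<notin> path_image C" "b \<notin> path_image C" using ab by (auto simp: inside_def outside_def)
  ultimately have "a \<notin> K E" "b \<notin> K E" using ab C(3) K_remove[OF e] by auto
  then show ?thesis using ab that by (auto simp: F_def)
qed

section \<open>Upper bound for the number of faces\<close>

lemma face_eq_iff: "a \<notin> K E \<Longrightarrow> face a = face b \<longleftrightarrow> connected_component (- K E) a b"
  unfolding face_def by (auto simp: connected_component_eq_eq dest: connected_component_in)

lemma faces_nonempty: "faces \<noteq> {}"
proof -
  have "K E \<noteq> UNIV" using compact_K[of E] not_bounded_UNIV compact_imp_bounded by force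
  then show ?thesis by (auto simp: faces_def)
qed

text \<open>The natural map to the faces of the smaller graph is injective for a bridge; otherwise
  it becomes injective once the face next to \<open>e\<close> inside the Jordan curve is omitted.
  Equality in Euler's formula follows later from the rank of the lattice.\<close>

lemma faces_remove:
  assumes e: "e \<in> E" and fin: "finite (plane_graph.faces V (E - {e}) p \<gamma>)"
  shows "finite faces \<and> card faces \<le> card (plane_graph.faces V (E - {e}) p \<gamma>) + of_bool (\<not> bridge E s t e)"
proof -
  interpret F: plane_graph V "E - {e}" s t p \<gamma> by (rule plane_graph_subset) auto
  \<comment> \<open>A face is a set without a distinguished point, so the map goes through a chosen
    representative; \<open>j\<close> below shows independence of the choice.\<close>
  define j where "j X = F.face (SOME a. a \<notin> K E \<and> X = face a)" for X
  have some: "(SOME b. b \<notin> K E \<and> face a = face b) \<notin> K E \<and> face a = face (SOME b. b \<notin> K E \<and> face a = face b)" if "a \<notin> K E" for a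
    by (rule someI[of "\<lambda>b. b \<notin> K E \<and> face a = face b" a]) (use that in auto)
  have sub: "K (E - {e}) \<subseteq> K E" by (rule K_mono) auto
  have j: "j (face a) = F.face a" if "a \<notin> K E" for a
  proof -
    define b where "b = (SOME b. b \<notin> K E \<and> face a = face b)"
    have b: "b \<notin> K E" "face a = face b" using some[OF that] by (simp_all add: b_def)
    then have "connected_component (- K E) a b" using that face_eq_iff by blast
    then have "connected_component (- K (E - {e})) a b" using sub
      by (metis Compl_subset_Compl_iff connected_component_of_subset)
    moreover have "a \<notin> K (E - {e})" using sub that by auto
    ultimately have "F.face a = F.face b" using F.face_eq_iff by blast
    then show ?thesis by (simp add: j_def b_def)
  qed
  have jim: "j ` faces \<subseteq> F.faces" using j sub by (auto simp: faces_def F.faces_def)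
  have jeq: "connected_component (- K (E - {e})) a b" if "a \<notin> K E" "b \<notin> K E" "j (face a) = j (face b)" for a b
    using that j sub F.face_eq_iff[of a b] by auto
  have feq: "face a = face b" if "connected_component (- K E) a b" for a b
    using that face_eq_iff connected_component_in by (metis ComplD)
  show ?thesis
  proof (cases "bridge E s t e")
    case True
    have "inj_on j faces"
    proof (rule inj_onI)
      fix X Y assume "X \<in> faces" "Y \<in> faces" and eq: "j X = j Y"
      then obtain a b where ab: "a \<notin> K E" "X = face a" "b \<notin> K E" "Y = face b" by (auto simp: faces_def)
      then show "X = Y" using bridge_no_separation[OF True ab(1,3)] jeq[OF ab(1,3)] eq feq by simp
    qed
    then show ?thesis using True jim fin by (simp add: card_inj_on_le inj_on_finite)
  next
    case False
    obtain C A w where C: "simple_path C" "pathfinish C = pathstart C"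
      "path_image C = path_image (\<gamma> e) \<union> A" "A \<subseteq> K (E - {e})" "connected A" "p (s e) \<in> A" "p (t e) \<in> A"
      using nonbridge_curve[OF e False] by metis
    obtain a0 where a0: "a0 \<in> inside (path_image C)" "a0 \<notin> K E" "connected_component (- K (E - {e})) (\<gamma> e (1/2)) a0"
      using edge_sides[OF e C(1-4)] by metis
    have io: "x \<in> inside (path_image C) \<or> x \<in> outside (path_image C)" if "x \<notin> K E" for x
      using that C(3,4) sub K_remove[OF e] by (metis ComplI UnE Un_iff inside_Un_outside subsetD)
    have "inj_on j (faces - {face a0})"
    proof (rule inj_onI)
      fix X Y assume "X \<in> faces - {face a0}" "Y \<in> faces - {face a0}" and eq: "j X = j Y"
      then obtain a b where ab: "a \<notin> K E" "X = face a" "b \<notin> K E" "Y = face b" "X \<noteq> face a0" "Y \<noteq> face a0"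
        by (auto simp: faces_def)
      have cc: "connected_component (- K (E - {e})) a b" using jeq[OF ab(1,3)] eq ab by simp
      show "X = Y"
      proof (cases "connected_component (- K (E - {e})) (\<gamma> e (1/2)) a")
        case False
        then show ?thesis using other_faces_unchanged[OF e cc] feq ab by simp
      next
        case True
        have "x \<in> outside (path_image C)" if "x \<notin> K E" "face x \<noteq> face a0" "connected_component (- K (E - {e})) (\<gamma> e (1/2)) x" for x
        proof (rule ccontr)
          assume "x \<notin> outside (path_image C)"
          then have "x \<in> inside (path_image C)" using io[OF that(1)] by simp
          moreover have "connected_component (- K (E - {e})) x a0"
            using that(3) a0(3) by (meson connected_component_sym connected_component_trans)
          ultimately have "connected_component (- K E) x a0"
            using nonbridge_no_separation[OF e C] a0(1) by blast
          then show False using that feq by blast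
        qed
        then have "a \<in> outside (path_image C)" "b \<in> outside (path_image C)"
          using ab True cc by (metis connected_component_trans)+
        then show ?thesis using nonbridge_no_separation[OF e C cc] feq ab by simp
      qed
    qed
    then have "finite (faces - {face a0})" "card (faces - {face a0}) \<le> card F.faces"
      using jim fin inj_on_finite[of j "faces - {face a0}" F.faces] card_inj_on_le[of j "faces - {face a0}" F.faces]
      by (simp_all add: image_subset_iff)
    moreover have "face a0 \<in> faces" using a0 by (auto simp: faces_def)
    moreover from calculation have "finite faces" by (metis finite_insert insert_Diff)
    moreover from calculation have "card faces = Suc (card (faces - {face a0}))" by (intro card.remove)
    ultimately show ?thesis using False by (metis Suc_eq_plus1 Suc_le_mono of_bool_eq(2))
  qed
qed

end

lemma plane_graph_card_faces:
  assumes "plane_graph V E s t p \<gamma>"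
  shows "finite (plane_graph.faces V E p \<gamma>) \<and> card (plane_graph.faces V E p \<gamma>) \<le> genus V E s t + 1"
proof -
  have "finite E" using assms by (simp add: plane_graph_def fgraph_def)
  then show ?thesis using assms
  proof (induction E rule: finite_induct)
    case empty
    interpret plane_graph V "{}" s t p \<gamma> by fact
    have "K {} = p ` V" by (simp add: K_def)
    then have "connected (- K {})" using connected_open_delete_finite[of UNIV "p ` V"] finite_V
      by (simp add: Compl_eq_Diff_UNIV connected_UNIV)
    then have "face a = - K {}" if "a \<notin> K {}" for a
      unfolding face_def using that by (intro connected_component_eq_self) auto
    then have "faces \<subseteq> {- K {}}" by (auto simp: faces_def)
    then show ?case using finite_subset[of faces] card_mono[of "{- K {}}" faces] by simp
  next
    case (insert e E)
    interpret plane_graph V "insert e E" s t p \<gamma> by fact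
    have E: "insert e E - {e} = E" using insert by auto
    have "plane_graph V E s t p \<gamma>" by (rule plane_graph_subset) auto
    from insert.IH[OF this] faces_remove[of e] genus_remove[of e] E show ?case by auto
  qed
qed

section \<open>Jumps of winding numbers across an edge\<close>

context plane_graph begin

text \<open>The points lie near the middle of \<open>e\<close>, inside and outside the Jordan curve
  through \<open>e\<close>; the orientation of this curve decides which of them is called
  \<open>a\<close>. For a bridge both points coincide, since cycles vanish on it.\<close>

lemma edge_sides_jump:
  assumes e: "e \<in> E"
  shows "\<exists>a b. a \<notin> K E \<and> b \<notin> K E \<and> connected_component (- K (E - {e})) a b \<and>
     (\<forall>z. is_cycle E s t z \<longrightarrow> of_int (z e) = wind z a - wind z b)"
proof (cases "bridge E s t e")
  case True
  obtain a where "a \<notin> K E" using faces_nonempty by (auto simp: faces_def)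
  moreover have "K (E - {e}) \<subseteq> K E" by (rule K_mono) auto
  ultimately have "connected_component (- K (E - {e})) a a" by auto
  then show ?thesis using bridge_cycle_zero[OF True] \<open>a \<notin> K E\<close> by (intro exI[of _ a]) auto
next
  case False
  obtain C A w where C: "simple_path C" "pathfinish C = pathstart C"
    "path_image C = path_image (\<gamma> e) \<union> A" "A \<subseteq> K (E - {e})" "connected A" "p (s e) \<in> A" "p (t e) \<in> A"
    and w: "continuous_on (- K (E - {e})) w"
    "\<And>x. x \<notin> path_image C \<Longrightarrow> winding_number C x = winding_number (\<gamma> e) x + w x"
    "\<And>x. x \<notin> K (E - {e}) \<Longrightarrow> p (s e) - x = exp (2 * pi * \<i> * w x) * (p (t e) - x)"
    using nonbridge_curve[OF e False] by metis
  obtain a b where ab: "a \<in> inside (path_image C)" "b \<in> outside (path_image C)" "a \<notin> K E" "b \<notin> K E"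
    "connected_component (- K (E - {e})) (\<gamma> e (1/2)) a" "connected_component (- K (E - {e})) (\<gamma> e (1/2)) b"
    using edge_sides[OF e C(1-4)] by metis
  have cc: "connected_component (- K (E - {e})) a b"
    using ab by (meson connected_component_sym connected_component_trans)
  have nC: "a \<notin> path_image C" "b \<notin> path_image C" using ab by (auto simp: inside_def outside_def)
  have diff: "wind z a - wind z b = of_int (z e) * (winding_number C a - winding_number C b)"
    if z: "is_cycle E s t z" for z
  proof -
    \<comment> \<open>\<open>D\<close> replaces \<open>e\<close> by the rest of the Jordan curve
      traversed backwards, which joins the same ends. It is integral and continuous across
      \<open>e\<close>, so it agrees at \<open>a\<close> and \<open>b\<close>; the whole jump comes
      from the winding number of \<open>C\<close>.\<close>
    define D where "D x = (\<Sum>f\<in>E. of_int (z f) * (if f = e then - w x else winding_number (\<gamma> f) x))" for x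
    have De: "D x = (\<Sum>f\<in>E-{e}. of_int (z f) * winding_number (\<gamma> f) x) - of_int (z e) * w x" for x
      unfolding D_def using e finite_E by (simp add: sum.remove)
    obtain S where S: "connected S" "S \<subseteq> - K (E - {e})" "a \<in> S" "b \<in> S"
      using cc by (auto simp: connected_component_def)
    have "D a = D b"
    proof (rule continuous_Ints_constant[OF S(1) _ _ S(3,4)])
      show "continuous_on S D" unfolding De using S(2) w(1)
        by (intro continuous_intros continuous_winding continuous_on_subset[OF w(1)]) (auto simp: K_def)
      fix x assume "x \<in> S"
      then have x: "x \<notin> K (E - {e})" using S(2) by auto
      show "D x \<in> \<int>" unfolding D_def
      proof (rule wind_Ints_aux[OF z])
        show xV: "x \<notin> p ` V" using x by (auto simp: K_def)
        fix f assume f: "f \<in> E"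
        show "p (t f) - x = exp (2 * pi * \<i> * (if f = e then - w x else winding_number (\<gamma> f) x)) * (p (s f) - x)"
        proof (cases "f = e")
          case True
          then show ?thesis using w(3)[OF x] by (simp add: exp_minus)
        next
          case False
          then have "x \<notin> path_image (\<gamma> f)" using x f by (auto simp: K_def)
          then show ?thesis using winding_number_exp_2pi[OF \<gamma>_path[OF f], of x] f False
            by (simp add: \<gamma>_start \<gamma>_finish)
        qed
      qed
    qed
    moreover have "wind z x = D x + of_int (z e) * winding_number C x" if "x \<notin> path_image C" for x
      using w(2)[OF that] e finite_E by (simp add: De wind_def sum.remove algebra_simps)
    ultimately show ?thesis using nC by (simp add: algebra_simps)
  qed
  have 0: "winding_number C b = 0" using C(1,2) ab(2) by (intro winding_number_zero_in_outside) (auto simp: simple_path_imp_path)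
  consider "winding_number C a = 1" | "winding_number C a = -1"
    using simple_closed_path_winding_number_inside[OF C(1)] ab(1) by metis
  then show ?thesis
  proof cases
    case 1
    then show ?thesis using ab cc diff 0 by (intro exI[of _ a] exI[of _ b]) auto
  next
    case 2
    have "of_int (z e) = wind z b - wind z a" if "is_cycle E s t z" for z
      using diff[OF that] 2 0 by (simp add: algebra_simps)
    then show ?thesis using ab connected_component_sym[OF cc] by (intro exI[of _ b] exI[of _ a]) auto
  qed
qed

end

section \<open>Algebraic duality\<close>

text \<open>An abstract record of what a plane drawing provides: faces, the two faces beside each
  edge, and heights of cycles that jump by \<open>z e\<close> across \<open>e\<close>. The double
  cover of a projective drawing provides the same data, so the algebra is done once for
  both.\<close>

locale dual_data = fgraph V E s t for V :: "'v set" and E :: "'e set" and s t +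
  fixes \<Phi> :: "'f set" and L R :: "'e \<Rightarrow> 'f" and W :: "('e \<Rightarrow> int) \<Rightarrow> 'f \<Rightarrow> int"
  assumes finite_\<Phi>: "finite \<Phi>" and \<Phi>_nonempty: "\<Phi> \<noteq> {}" and card_\<Phi>: "card \<Phi> \<le> genus V E s t + 1"
    and LR_\<Phi>: "\<And>e. e \<in> E \<Longrightarrow> L e \<in> \<Phi>" "\<And>e. e \<in> E \<Longrightarrow> R e \<in> \<Phi>"
    and W_sum: "\<And>B c z F. finite (B :: 'e set) \<Longrightarrow> F \<in> \<Phi> \<Longrightarrow> (\<And>b. b \<in> B \<Longrightarrow> is_cycle E s t (z b)) \<Longrightarrow>
        W (\<lambda>e. \<Sum>b\<in>B. c b * z b e) F = (\<Sum>b\<in>B. c b * W (z b) F)"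
    and W_zero: "\<And>z F. F \<in> \<Phi> \<Longrightarrow> (\<And>e. e \<in> E \<Longrightarrow> z e = 0) \<Longrightarrow> W z F = 0"
    and W_jump: "\<And>z e. is_cycle E s t z \<Longrightarrow> e \<in> E \<Longrightarrow> z e = W z (L e) - W z (R e)"
begin

lemma fgraph_dual: "fgraph \<Phi> E R L"
  using finite_\<Phi> finite_E LR_\<Phi> by unfold_locales auto

text \<open>The heights W of cycles have finite index among all functions on the faces modulo constants:
  by the bound on the number of faces, h, the constant 1 and the heights of a cycle basis are dependent.\<close>

lemma heights_finite_index:
  obtains n c z where "n \<noteq> (0::int)" "is_cycle E s t z" "\<And>F. F \<in> \<Phi> \<Longrightarrow> n * h F = W z F + c"
proof -
  obtain B and z :: "'e \<Rightarrow> 'e \<Rightarrow> int" where B: "B \<subseteq> E" "card B = genus V E s t"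
    "\<And>b. b \<in> B \<Longrightarrow> is_cycle E s t (z b)" "\<And>b b'. b \<in> B \<Longrightarrow> b' \<in> B \<Longrightarrow> z b b' = of_bool (b = b')"
    using fundamental_cycles by metis
  have fB: "finite B" using B(1) finite_E by (rule finite_subset)
  \<comment> \<open>\<open>None\<close> indexes \<open>h\<close>, \<open>Some None\<close> the
    constant 1, and \<open>Some (Some b)\<close> the height of the basis cycle of \<open>b\<close>.
    These are genus + 2 functions, more than there are faces.\<close>
  define a where "a i F = (case i of None \<Rightarrow> h F | Some None \<Rightarrow> 1 | Some (Some b) \<Rightarrow> W (z b) F)" for i F
  define I where "I = insert None (insert (Some None) ((\<lambda>b. Some (Some b)) ` B))"
  have "card I = card B + 2"
    unfolding I_def using fB by (subst card_insert_disjoint; simp add: card_image inj_on_def image_iff)+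
  then have cI: "card \<Phi> < card I" using card_\<Phi> B(2) by simp
  have fI: "finite I" using fB by (simp add: I_def)
  from int_dependent[OF finite_\<Phi> fI cI, of a] obtain c where
    c: "\<exists>i\<in>I. c i \<noteq> 0" "\<forall>F\<in>\<Phi>. (\<Sum>i\<in>I. c i * a i F) = 0" by blast
  define d where "d b = c (Some (Some b))" for b
  have S: "c None * h F + c (Some None) + (\<Sum>b\<in>B. d b * W (z b) F) = 0" if "F \<in> \<Phi>" for F
  proof -
    have "(\<Sum>i\<in>I. c i * a i F) = c None * h F + (c (Some None) + (\<Sum>i\<in>(\<lambda>b. Some (Some b)) ` B. c i * a i F))"
      unfolding I_def using fB by (simp add: a_def image_iff)
    also have "(\<Sum>i\<in>(\<lambda>b. Some (Some b)) ` B. c i * a i F) = (\<Sum>b\<in>B. d b * W (z b) F)"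
      by (subst sum.reindex) (auto simp: a_def d_def inj_on_def)
    finally show ?thesis using c(2) that by simp
  qed
  define Z where "Z e = (\<Sum>b\<in>B. d b * z b e)" for e
  have Z: "is_cycle E s t Z" unfolding Z_def using B(3) by (rule is_cycle_sum)
  have WZ: "W Z F = (\<Sum>b\<in>B. d b * W (z b) F)" if "F \<in> \<Phi>" for F
    unfolding Z_def using fB that B(3) by (rule W_sum)
  \<comment> \<open>Without \<open>h\<close> the relation would give a cycle of constant height. Its
    jumps, and hence its coefficients on the basis edges, would vanish, and then also the
    coefficient of the constant.\<close>
  have "c None \<noteq> 0"
  proof
    assume 0: "c None = 0"
    then have WC: "W Z F = - c (Some None)" if "F \<in> \<Phi>" for F using S[OF that] WZ[OF that] by simp
    have "Z e = 0" if "e \<in> E" for e using W_jump[OF Z that] WC LR_\<Phi>[OF that] by simp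
    moreover have "Z b = d b" if "b \<in> B" for b
    proof -
      have "Z b = (\<Sum>b'\<in>B. d b' * of_bool (b' = b))" unfolding Z_def using B(4) that by (intro sum.cong) auto
      then show ?thesis using fB that by (simp add: of_bool_def if_distrib cong: if_cong)
    qed
    ultimately have db: "d b = 0" if "b \<in> B" for b using that B(1) by (metis subsetD)
    obtain F where F: "F \<in> \<Phi>" using \<Phi>_nonempty by auto
    have "c (Some None) = 0" using S[OF F] 0 db by simp
    then show False using c(1) 0 db by (auto simp: I_def d_def)
  qed
  moreover have "is_cycle E s t (\<lambda>e. - Z e)" using Z is_cycle_mult_iff[of "-1" E s t Z] by simp
  moreover have "W (\<lambda>e. - Z e) F = - W Z F" if "F \<in> \<Phi>" for F
    using W_sum[of "{undefined}" F "\<lambda>_. Z" "\<lambda>_. -1"] that Z by simp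
  moreover have "c None * h F = W (\<lambda>e. - Z e) F + - c (Some None)" if "F \<in> \<Phi>" for F
    using S[OF that] WZ[OF that] calculation(3)[OF that] by simp
  ultimately show ?thesis by (intro that[of "c None" "\<lambda>e. - Z e" "- c (Some None)"])
qed

text \<open>A multiple of \<open>h\<close> is a cycle height up to a constant, so a multiple of the
  differences is a cycle, and the factor can be cancelled. Here finite index yields an integral
  statement.\<close>

lemma height_difference_cycle: "is_cycle E s t (\<lambda>e. h (L e) - h (R e))"
proof -
  obtain n c z where n: "n \<noteq> (0::int)" "is_cycle E s t z" "\<And>F. F \<in> \<Phi> \<Longrightarrow> n * h F = W z F + c"
    using heights_finite_index[of h] by metis
  have "n * (h (L e) - h (R e)) = z e" if "e \<in> E" for e
    using n(3)[OF LR_\<Phi>(1)[OF that]] n(3)[OF LR_\<Phi>(2)[OF that]] W_jump[OF n(2) that] by (simp add: algebra_simps)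
  then have "is_cycle E s t (\<lambda>e. n * (h (L e) - h (R e)))" using n(2) is_cycle_cong by (metis (mono_tags, lifting))
  then show ?thesis using n(1) is_cycle_mult_iff[of n E s t "\<lambda>e. h (L e) - h (R e)"] by blast
qed

text \<open>The jumps of cycle heights determine the differences of every function on the faces,
  again because a nonzero factor cancels. So pairs of faces with equal jumps can be interchanged in
  all later sums without identifying the faces.\<close>

lemma sides_unique:
  fixes h :: "'f \<Rightarrow> int"
  assumes "F \<in> \<Phi>" "F' \<in> \<Phi>" "e \<in> E" "\<And>z. is_cycle E s t z \<Longrightarrow> z e = W z F - W z F'"
  shows "h (L e) - h (R e) = h F - h F'"
proof -
  obtain n c z where n: "n \<noteq> (0::int)" "is_cycle E s t z" "\<And>F. F \<in> \<Phi> \<Longrightarrow> n * h F = W z F + c"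
    using heights_finite_index[of h] by metis
  have "n * (h (L e) - h (R e)) = n * (h F - h F')"
    using n(3)[OF LR_\<Phi>(1)[OF assms(3)]] n(3)[OF LR_\<Phi>(2)[OF assms(3)]] n(3)[OF assms(1)] n(3)[OF assms(2)]
      W_jump[OF n(2) assms(3)] assms(4)[OF n(2)] by (simp add: algebra_simps)
  then show ?thesis using n(1) by simp
qed

text \<open>The indicator of a component of the dual graph has no jumps, so a multiple of it is a
  constant plus the height of the zero cycle.\<close>

lemma dual_connected:
  assumes "F \<in> \<Phi>" "F' \<in> \<Phi>" shows "reach E R L F F'"
proof -
  define h :: "'f \<Rightarrow> int" where "h X = of_bool (reach E R L F X)" for X
  obtain n c z where n: "n \<noteq> (0::int)" "is_cycle E s t z" "\<And>F. F \<in> \<Phi> \<Longrightarrow> n * h F = W z F + c"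
    using heights_finite_index[of h] by metis
  have "h (L e) = h (R e)" if "e \<in> E" for e
  proof -
    have "reach E R L F (L e) \<longleftrightarrow> reach E R L F (R e)"
      using reach_edge[OF that, of R L] by (blast intro: reach_trans)
    then show ?thesis by (simp add: h_def)
  qed
  then have "z e = 0" if "e \<in> E" for e
    using n(3)[OF LR_\<Phi>(1)[OF that]] n(3)[OF LR_\<Phi>(2)[OF that]] W_jump[OF n(2) that] that by simp
  then have "W z X = 0" if "X \<in> \<Phi>" for X using W_zero that by blast
  then have "n * h F = n * h F'" using n(3) assms by simp
  then show ?thesis using n(1) by (simp add: h_def reach_refl split: if_splits)
qed

text \<open>One direction pairs with cycle heights, the other with the cycles obtained from
  indicators of single faces. Together with \<open>bdry_dual_surj\<close> this identifies the
  quotient by the coboundaries with the functions of sum zero on the faces.\<close>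

lemma bdry_dual_zero_iff:
  assumes "x \<in> C1 E"
  shows "(\<forall>F\<in>\<Phi>. bdry E R L x F = 0) \<longleftrightarrow> x \<in> coboundaries V E s t"
proof
  interpret D: fgraph \<Phi> E R L by (rule fgraph_dual)
  assume 0: "\<forall>F\<in>\<Phi>. bdry E R L x F = 0"
  show "x \<in> coboundaries V E s t"
  proof (rule orthogonal_imp_coboundary[OF assms])
    fix z assume z: "is_cycle E s t z"
    have "(\<Sum>e\<in>E. x e * z e) = (\<Sum>e\<in>E. (W z (L e) - W z (R e)) * x e)"
      using W_jump[OF z] by (intro sum.cong) auto
    also have "\<dots> = (\<Sum>F\<in>\<Phi>. W z F * bdry E R L x F)" by (rule D.coboundary_pairing)
    finally show "(\<Sum>e\<in>E. x e * z e) = 0" using 0 by simp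
  qed
next
  assume x: "x \<in> coboundaries V E s t"
  show "\<forall>F\<in>\<Phi>. bdry E R L x F = 0"
    using coboundaries_orthogonal[OF x height_difference_cycle[of "\<lambda>X. of_bool (X = F)" for F]]
    by (simp add: bdry_def)
qed

lemma bdry_dual_surj:
  assumes "(\<Sum>F\<in>\<Phi>. y F) = 0"
  obtains x where "x \<in> C1 E" "\<And>F. F \<in> \<Phi> \<Longrightarrow> bdry E R L x F = y F"
proof -
  obtain F0 where F0: "F0 \<in> \<Phi>" using \<Phi>_nonempty by auto
  have "\<exists>c\<in>C1 E. \<forall>X. bdry E R L c X = of_bool (X = F) - of_bool (X = F0)" if "F \<in> \<Phi>" for F
    using reach_chain[OF finite_E dual_connected[OF F0 that]] .
  then obtain c where c: "\<And>F. F \<in> \<Phi> \<Longrightarrow> c F \<in> C1 E"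
    "\<And>F X. F \<in> \<Phi> \<Longrightarrow> bdry E R L (c F) X = of_bool (X = F) - of_bool (X = F0)" by metis
  define x where "x e = (\<Sum>F\<in>\<Phi>. y F * c F e)" for e
  have "x \<in> C1 E" using c(1) by (auto simp: x_def C1_def)
  moreover have "bdry E R L x X = y X" if X: "X \<in> \<Phi>" for X
  proof -
    have "bdry E R L x X = (\<Sum>F\<in>\<Phi>. y F * (of_bool (X = F) - of_bool (X = F0)))"
      unfolding x_def bdry_sum bdry_mult using c(2) by (intro sum.cong) auto
    also have "\<dots> = (\<Sum>F\<in>\<Phi>. y F * of_bool (X = F)) - (\<Sum>F\<in>\<Phi>. y F) * of_bool (X = F0)"
      by (simp add: right_diff_distrib sum_subtractf sum_distrib_right)
    also have "(\<Sum>F\<in>\<Phi>. y F * of_bool (X = F)) = y X"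
      using X finite_\<Phi> by (simp add: of_bool_def if_distrib cong: if_cong)
    finally show ?thesis using assms by simp
  qed
  ultimately show ?thesis using that by blast
qed

lemma sides_eq_iff_bridge:
  assumes "e \<in> E" shows "L e = R e \<longleftrightarrow> bridge E s t e"
proof -
  have "(\<forall>F\<in>\<Phi>. bdry E R L (coedge e) F = 0) \<longleftrightarrow> L e = R e"
    using LR_\<Phi>[OF assms] bdry_coedge[OF finite_E assms, of R L] by (auto simp: of_bool_def)
  then show ?thesis using bdry_dual_zero_iff[OF coedge_C1[OF assms]] bridge_iff_coboundary[OF assms] by simp
qed

end

subsection \<open>Lattices of type A and D\<close>

lemma sqnorm_zero_iff: "sqnorm y n = 0 \<longleftrightarrow> (\<forall>i<n. y i = 0)"
  by (auto simp: sqnorm_def sum_nonneg_eq_0_iff)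

lemma sqnorm_nonneg: "sqnorm y n \<ge> 0"
  by (simp add: sqnorm_def sum_nonneg)

lemma even_sqnorm_iff: "even (sqnorm y n) \<longleftrightarrow> even (\<Sum>i<n. y i)"
proof -
  have "sqnorm y n = (\<Sum>i<n. y i) + (\<Sum>i<n. y i * (y i - 1))"
    by (simp add: sqnorm_def sum.distrib[symmetric] algebra_simps power2_eq_square)
  moreover have "even (\<Sum>i<n. y i * (y i - 1))" by (intro dvd_sum) auto
  ultimately show ?thesis by simp
qed

lemma sqnorm_add: "sqnorm (\<lambda>i. a i + b i) n = sqnorm a n + sqnorm b n + 2 * (\<Sum>i<n. a i * b i)"
  by (simp add: sqnorm_def power2_sum sum.distrib sum_distrib_left algebra_simps)

context H1_map begin

text \<open>The form is half the squared norm of the image: evenness of the lattice makes it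
  integral, and faithfulness of the first \<open>n\<close> coordinates makes it positive.\<close>

lemma emmI:
  assumes im: "\<phi> ` C1 E = Lat" and even: "\<And>y. y \<in> Lat \<Longrightarrow> even (sqnorm y n)"
    and zero: "\<And>y. y \<in> Lat \<Longrightarrow> (\<And>i. i < n \<Longrightarrow> y i = 0) \<Longrightarrow> y = (\<lambda>i. 0)"
    and roots: "\<And>e. e \<in> E \<Longrightarrow> \<not> bridge E s t e \<Longrightarrow> sqnorm (\<phi> (coedge e)) n = 2"
  shows "\<exists>q. Z_emm V E s t q \<and> H1_isometric V E s t q Lat n"
proof -
  define q where "q x = sqnorm (\<phi> x) n div 2" for x
  have q: "2 * q x = sqnorm (\<phi> x) n" if "x \<in> C1 E" for x
    using even[of "\<phi> x"] im that by (auto simp: q_def)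
  have C1_add: "(\<lambda>e. x e + y e) \<in> C1 E" if "x \<in> C1 E" "y \<in> C1 E" for x y
    using that by (auto simp: C1_def)
  have pos: "q x > 0" if "x \<in> C1 E" "x \<notin> coboundaries V E s t" for x
  proof -
    have "\<phi> x \<noteq> (\<lambda>i. 0)" using that \<phi>_kernel by simp
    then have "sqnorm (\<phi> x) n \<noteq> 0" using zero[of "\<phi> x"] im that(1) by (auto simp: sqnorm_zero_iff)
    then show ?thesis using q[OF that(1)] sqnorm_nonneg[of "\<phi> x" n] by linarith
  qed
  have hom: "q (\<lambda>e. k * x e) = k^2 * q x" if "x \<in> C1 E" for x k
  proof -
    have "(\<lambda>e. k * x e) \<in> C1 E" using that by (auto simp: C1_def)
    then have "2 * q (\<lambda>e. k * x e) = sqnorm (\<lambda>i. k * \<phi> x i) n" using q \<phi>_scale[OF that] by simp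
    also have "\<dots> = k^2 * (2 * q x)" using q[OF that] by (simp add: sqnorm_def power_mult_distrib sum_distrib_left)
    finally show ?thesis by simp
  qed
  have quad: "q (\<lambda>e. x e + y e + z e) - q (\<lambda>e. x e + y e) - q z
        = (q (\<lambda>e. x e + z e) - q x - q z) + (q (\<lambda>e. y e + z e) - q y - q z)"
    if x: "x \<in> C1 E" and y: "y \<in> C1 E" and z: "z \<in> C1 E" for x y z
  proof -
    have "2 * q (\<lambda>e. x e + y e + z e) - 2 * q (\<lambda>e. x e + y e) - 2 * q z
        = (2 * q (\<lambda>e. x e + z e) - 2 * q x - 2 * q z) + (2 * q (\<lambda>e. y e + z e) - 2 * q y - 2 * q z)"
      using q[OF C1_add[OF C1_add[OF x y] z]] q[OF C1_add[OF x y]] q[OF z] q[OF x] q[OF y]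
        q[OF C1_add[OF x z]] q[OF C1_add[OF y z]]
      by (simp add: \<phi>_add x y z C1_add sqnorm_add algebra_simps sum.distrib)
    then show ?thesis by simp
  qed
  have inv: "q (\<lambda>e. x e + b e) = q x" if "x \<in> C1 E" "b \<in> coboundaries V E s t" for x b
    using \<phi>_add[OF that(1) coboundaries_C1[OF that(2)]] \<phi>_kernel[OF coboundaries_C1[OF that(2)]] that(2)
    by (simp add: q_def)
  have "Z_emm V E s t q"
    unfolding Z_emm_def int_quadratic_form_H1_def
    using hom quad inv pos roots pos[THEN int_one_le_iff_zero_less[THEN iffD2]] by (auto simp: q_def)
  moreover have "H1_isometric V E s t q Lat n"
    unfolding H1_isometric_def using \<phi>_add \<phi>_kernel im q by (intro exI[of _ \<phi>]) auto
  ultimately show ?thesis by blast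
qed

lemma has_emm_AI:
  assumes "\<phi> ` C1 E = A_lattice g" "\<And>e. e \<in> E \<Longrightarrow> \<not> bridge E s t e \<Longrightarrow> sqnorm (\<phi> (coedge e)) (g + 1) = 2"
  shows "has_emm_A V E s t g"
  unfolding has_emm_A_def
proof (rule emmI[OF assms(1) _ _ assms(2)])
  show "even (sqnorm y (g + 1))" if "y \<in> A_lattice g" for y
    using that by (simp add: even_sqnorm_iff A_lattice_def lessThan_Suc_atMost)
  show "y = (\<lambda>i. 0)" if "y \<in> A_lattice g" "\<And>i. i < g + 1 \<Longrightarrow> y i = 0" for y
    using that by (auto simp: A_lattice_def fun_eq_iff) (metis not_less_eq)
qed

lemma has_emm_DI:
  assumes "\<phi> ` C1 E = D_lattice g" "\<And>e. e \<in> E \<Longrightarrow> \<not> bridge E s t e \<Longrightarrow> sqnorm (\<phi> (coedge e)) g = 2"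
  shows "has_emm_D V E s t g"
  unfolding has_emm_D_def
proof (rule emmI[OF assms(1) _ _ assms(2)])
  show "even (sqnorm y g)" if "y \<in> D_lattice g" for y
    using that by (simp add: even_sqnorm_iff D_lattice_def)
  show "y = (\<lambda>i. 0)" if "y \<in> D_lattice g" "\<And>i. i < g \<Longrightarrow> y i = 0" for y
    using that by (auto simp: D_lattice_def fun_eq_iff) (metis not_less)
qed

text \<open>The difference of the unit vectors at \<open>i\<close> and \<open>m\<close> is a unit
  vector on the coordinates below \<open>m\<close>; the last coordinate is determined by the
  others.\<close>

lemma rank_A:
  assumes im: "\<phi> ` C1 E = A_lattice m" shows "m = genus V E s t"
proof (rule rank_eq_genus)
  fix x assume x: "x \<in> C1 E" "\<And>i. i < m \<Longrightarrow> \<phi> x i = 0"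
  have "\<phi> x \<in> A_lattice m" using im x(1) by auto
  then have "\<phi> x m = 0" "\<forall>i>m. \<phi> x i = 0" using x(2) by (auto simp: A_lattice_def lessThan_Suc_atMost[symmetric])
  then show "\<phi> x = (\<lambda>i. 0)" using x(2) by (metis ext linorder_neqE_nat)
next
  fix i assume i: "i < m"
  define y :: "nat \<Rightarrow> int" where "y j = of_bool (j = i) - of_bool (j = m)" for j
  have "y \<in> A_lattice m" using i by (auto simp: A_lattice_def y_def sum_subtractf of_bool_def)
  then obtain x where "x \<in> C1 E" "\<phi> x = y" using im by (metis imageE)
  then show "\<exists>x\<in>C1 E. \<phi> x i \<noteq> 0 \<and> (\<forall>j<m. j \<noteq> i \<longrightarrow> \<phi> x j = 0)" using i by (intro bexI[of _ x]) (auto simp: y_def)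
qed

text \<open>Unit vectors have odd coordinate sum, but their doubles lie in the lattice, which is
  enough for \<open>rank_eq_genus\<close>.\<close>

lemma rank_D:
  assumes im: "\<phi> ` C1 E = D_lattice m" shows "m = genus V E s t"
proof (rule rank_eq_genus)
  fix x assume x: "x \<in> C1 E" "\<And>i. i < m \<Longrightarrow> \<phi> x i = 0"
  have "\<phi> x \<in> D_lattice m" using im x(1) by auto
  then show "\<phi> x = (\<lambda>i. 0)" using x(2) by (auto simp: D_lattice_def fun_eq_iff) (metis not_less)
next
  fix i assume i: "i < m"
  define y :: "nat \<Rightarrow> int" where "y j = 2 * of_bool (j = i)" for j
  have "y \<in> D_lattice m" using i by (auto simp: D_lattice_def y_def intro!: dvd_sum)
  then obtain x where "x \<in> C1 E" "\<phi> x = y" using im by (metis imageE)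
  then show "\<exists>x\<in>C1 E. \<phi> x i \<noteq> 0 \<and> (\<forall>j<m. j \<noteq> i \<longrightarrow> \<phi> x j = 0)" by (intro bexI[of _ x]) (auto simp: y_def)
qed

end

lemma sum_of_bool_single: "finite A \<Longrightarrow> (\<Sum>i\<in>A. of_bool (i = a) * f i :: int) = (if a \<in> A then f a else 0)"
  by (simp add: of_bool_def if_distrib[where f="\<lambda>u. u * _"] cong: if_cong)

lemma sqnorm_root:
  assumes "a < n" "b < n" "a \<noteq> b" "u^2 = 1" "w^2 = 1"
  shows "sqnorm (\<lambda>i. of_bool (i = a) * u + of_bool (i = b) * w) n = 2"
proof -
  have "(of_bool (i = a) * u + of_bool (i = b) * w)^2 = of_bool (i = a) * 1 + of_bool (i = b) * 1" for i
    using assms by (auto simp: of_bool_def)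
  then show ?thesis unfolding sqnorm_def using assms by (simp add: sum.distrib sum_of_bool_single del: mult_1_right)
qed

context dual_data begin

lemma dual_map_A:
  obtains \<phi> F where "H1_map V E s t \<phi>" "\<phi> ` C1 E = A_lattice (card \<Phi> - 1)" "bij_betw F {..card \<Phi> - 1} \<Phi>"
    "\<And>x i. \<phi> x i = (if i \<le> card \<Phi> - 1 then bdry E R L x (F i) else 0)"
proof -
  define m where "m = card \<Phi> - 1"
  have "card \<Phi> > 0" using finite_\<Phi> \<Phi>_nonempty by (simp add: card_gt_0_iff)
  then have "card {..m} = card \<Phi>" by (simp add: m_def)
  then obtain F where F: "bij_betw F {..m} \<Phi>" using finite_\<Phi> finite_same_card_bij by (metis finite_atMost)
  define \<phi> where "\<phi> x i = (if i \<le> m then bdry E R L x (F i) else 0)" for x i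
  have F\<Phi>: "F i \<in> \<Phi>" if "i \<le> m" for i using F that by (auto simp: bij_betw_def)
  have zero: "\<phi> x = (\<lambda>i. 0) \<longleftrightarrow> (\<forall>X\<in>\<Phi>. bdry E R L x X = 0)" for x
    using F by (auto simp: \<phi>_def fun_eq_iff bij_betw_def)
  have H: "H1_map V E s t \<phi>"
  proof
    show "\<phi> (\<lambda>e. x e + y e) = (\<lambda>i. \<phi> x i + \<phi> y i)" for x y by (auto simp: \<phi>_def bdry_add)
    show "\<phi> x = (\<lambda>i. 0) \<longleftrightarrow> x \<in> coboundaries V E s t" if "x \<in> C1 E" for x
      using zero bdry_dual_zero_iff[OF that] by simp
  qed
  have sumF: "(\<Sum>i\<le>m. f (F i)) = (\<Sum>X\<in>\<Phi>. f X)" for f :: "'f \<Rightarrow> int"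
    using sum.reindex_bij_betw[OF F, of f] .
  have "\<phi> ` C1 E = A_lattice m"
  proof (intro equalityI subsetI)
    fix y assume "y \<in> \<phi> ` C1 E"
    then obtain x where y: "y = \<phi> x" by auto
    interpret D: fgraph \<Phi> E R L by (rule fgraph_dual)
    have "(\<Sum>i\<le>m. y i) = (\<Sum>X\<in>\<Phi>. 1 * bdry E R L x X)" using sumF[of "bdry E R L x"] by (simp add: y \<phi>_def)
    also have "\<dots> = 0" using D.coboundary_pairing[of "\<lambda>_. 1" x] by simp
    finally show "y \<in> A_lattice m" by (auto simp: A_lattice_def y \<phi>_def)
  next
    fix y assume y: "y \<in> A_lattice m"
    define Y where "Y X = y (the_inv_into {..m} F X)" for X
    have YF: "Y (F i) = y i" if "i \<le> m" for i
      using F that by (simp add: Y_def the_inv_into_f_f bij_betw_def)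
    have "(\<Sum>X\<in>\<Phi>. Y X) = (\<Sum>i\<le>m. y i)" using sumF[of Y] YF by simp
    also have "\<dots> = 0" using y by (simp add: A_lattice_def)
    finally obtain x where x: "x \<in> C1 E" "\<And>X. X \<in> \<Phi> \<Longrightarrow> bdry E R L x X = Y X" using bdry_dual_surj[of Y] by blast
    have "\<phi> x = y" using y x(2)[OF F\<Phi>] YF by (auto simp: \<phi>_def A_lattice_def fun_eq_iff)
    then show "y \<in> \<phi> ` C1 E" using x(1) by blast
  qed
  then show ?thesis using that[of \<phi> F] H F by (auto simp: m_def \<phi>_def)
qed

text \<open>Comparing ranks turns the bound on the number of faces into an equality. A non-bridge
  has two different sides, so its image is a difference of two unit vectors.\<close>

lemma dual_has_emm_A: "has_emm_A V E s t (genus V E s t)"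
proof -
  obtain \<phi> F where H: "H1_map V E s t \<phi>" and im: "\<phi> ` C1 E = A_lattice (card \<Phi> - 1)"
    and F: "bij_betw F {..card \<Phi> - 1} \<Phi>"
    and \<phi>: "\<And>x i. \<phi> x i = (if i \<le> card \<Phi> - 1 then bdry E R L x (F i) else 0)"
    using dual_map_A by metis
  interpret H1_map V E s t \<phi> by (rule H)
  have g: "card \<Phi> - 1 = genus V E s t" using im by (rule rank_A)
  show ?thesis
  proof (rule has_emm_AI[OF im[unfolded g]])
    fix e assume e: "e \<in> E" "\<not> bridge E s t e"
    then have ne: "L e \<noteq> R e" using sides_eq_iff_bridge by simp
    have "L e \<in> F ` {..card \<Phi> - 1}" "R e \<in> F ` {..card \<Phi> - 1}"
      using LR_\<Phi>[OF e(1)] bij_betw_imp_surj_on[OF F] by simp_all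
    then obtain a b where ab: "a \<le> card \<Phi> - 1" "F a = L e" "b \<le> card \<Phi> - 1" "F b = R e" by auto
    have Fi: "F i = F j \<longleftrightarrow> i = j" if "i \<le> card \<Phi> - 1" "j \<le> card \<Phi> - 1" for i j
      using F that by (auto simp: bij_betw_def inj_on_def)
    have "\<phi> (coedge e) = (\<lambda>i. of_bool (i = a) * 1 + of_bool (i = b) * (-1))"
      using ab by (auto simp: \<phi> bdry_coedge[OF finite_E e(1)] fun_eq_iff Fi simp flip: ab(2,4))
    then show "sqnorm (\<phi> (coedge e)) (genus V E s t + 1) = 2"
      using ab ne g by (simp only:) (rule sqnorm_root, auto)
  qed
qed

end

subsection \<open>Planar graphs have a form of type A\<close>

context plane_graph begin

text \<open>Evaluated at a chosen point of the face; the floor of the real part merely converts an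
  integral complex number into an integer.\<close>

definition height :: "('e \<Rightarrow> int) \<Rightarrow> complex set \<Rightarrow> int" where
  "height z F = \<lfloor>Re (wind z (SOME a. a \<notin> K E \<and> F = face a))\<rfloor>"

lemma height_face:
  assumes "is_cycle E s t z" "a \<notin> K E"
  shows "of_int (height z (face a)) = wind z a"
proof -
  define b where "b = (SOME b. b \<notin> K E \<and> face a = face b)"
  have "b \<notin> K E \<and> face a = face b" unfolding b_def by (rule someI[of _ a]) (use assms in auto)
  then have "wind z b = wind z a" using wind_face[OF assms(1)] face_eq_iff[OF assms(2)] by metis
  moreover have "wind z a \<in> \<int>" using assms by (rule wind_Ints)
  ultimately show ?thesis unfolding height_def b_def[symmetric] by (auto elim!: Ints_cases)
qed

lemma wind_sum: "wind (\<lambda>e. \<Sum>b\<in>B. c b * z b e) x = (\<Sum>b\<in>B. of_int (c b) * wind (z b) x)"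
  unfolding wind_def of_int_sum sum_distrib_right sum_distrib_left
  by (subst sum.swap) (simp add: mult.assoc)

text \<open>The second conclusion says that the two sides of an edge merge when the edge is deleted.
  It serves to exclude edges of the double cover whose two sides are antipodal.\<close>

lemma plane_dual:
  obtains L R where "dual_data V E s t faces L R height"
    "\<And>e a b. e \<in> E \<Longrightarrow> a \<in> L e \<Longrightarrow> b \<in> R e \<Longrightarrow> connected_component (- K (E - {e})) a b"
proof -
  obtain a b where ab: "\<And>e. e \<in> E \<Longrightarrow> a e \<notin> K E \<and> b e \<notin> K E \<and> connected_component (- K (E - {e})) (a e) (b e) \<and>
     (\<forall>z. is_cycle E s t z \<longrightarrow> of_int (z e) = wind z (a e) - wind z (b e))"
    using edge_sides_jump by metis
  have "dual_data V E s t faces (\<lambda>e. face (a e)) (\<lambda>e. face (b e)) height"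
  proof
    show "finite faces" "card faces \<le> genus V E s t + 1"
      using plane_graph_card_faces[OF plane_graph_axioms] by auto
    show "faces \<noteq> {}" by (rule faces_nonempty)
    show "face (a e) \<in> faces" "face (b e) \<in> faces" if "e \<in> E" for e
      using ab[OF that] by (auto simp: faces_def)
    show "height (\<lambda>e. \<Sum>b\<in>B. c b * z b e) F = (\<Sum>b\<in>B. c b * height (z b) F)"
      if "finite B" and F: "F \<in> faces" and z: "\<And>b. b \<in> B \<Longrightarrow> is_cycle E s t (z b)" for B :: "'e set" and c z F
    proof -
      obtain x where x: "x \<notin> K E" "F = face x" using F by (auto simp: faces_def)
      have "(of_int (height (\<lambda>e. \<Sum>b\<in>B. c b * z b e) F) :: complex) = (\<Sum>b\<in>B. of_int (c b) * of_int (height (z b) F))"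
        unfolding x(2) using height_face[OF is_cycle_sum[OF z] x(1)] height_face[OF z x(1)]
        by (simp add: wind_sum)
      also have "\<dots> = of_int (\<Sum>b\<in>B. c b * height (z b) F)" by simp
      finally show ?thesis unfolding of_int_eq_iff .
    qed
    show "height z F = 0" if "F \<in> faces" "\<And>e. e \<in> E \<Longrightarrow> z e = 0" for z F
      using that by (simp add: height_def wind_def)
    show "z e = height z (face (a e)) - height z (face (b e))" if z: "is_cycle E s t z" and e: "e \<in> E" for z e
    proof -
      have "(of_int (z e) :: complex) = of_int (height z (face (a e))) - of_int (height z (face (b e)))"
        using ab[OF e] z height_face[OF z] by simp
      then show ?thesis by (metis of_int_diff of_int_eq_iff)
    qed
  qed
  moreover have "connected_component (- K (E - {e})) x y" if "e \<in> E" "x \<in> face (a e)" "y \<in> face (b e)" for e x y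
  proof -
    have "K (E - {e}) \<subseteq> K E" by (rule K_mono) auto
    then have "connected_component (- K (E - {e})) (a e) x" "connected_component (- K (E - {e})) (b e) y"
      using that unfolding face_def by (auto intro: connected_component_of_subset)
    then show ?thesis using ab[OF that(1)] by (meson connected_component_sym connected_component_trans)
  qed
  ultimately show ?thesis using that by blast
qed

end

lemma simple_path_loopI:
  assumes "path g" "g 0 = g 1" "inj_on g {0..<1}"
  shows "simple_path g"
  unfolding simple_path_def loop_free_def
proof (intro conjI ballI impI)
  fix x y :: real assume xy: "x \<in> {0..1}" "y \<in> {0..1}" "g x = g y"
  define r :: "real \<Rightarrow> real" where "r x = (if x = 1 then 0 else x)" for x
  have "g (r x) = g (r y)" "r x \<in> {0..<1}" "r y \<in> {0..<1}" using xy assms(2) by (auto simp: r_def)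
  then have "r x = r y" using assms(3) by (auto simp: inj_on_def)
  then show "x = y \<or> x = 0 \<and> y = 1 \<or> x = 1 \<and> y = 0" using xy by (auto simp: r_def split: if_splits)
qed (use assms in auto)

lemma pathin_euclidean: "pathin euclidean g \<longleftrightarrow> path g"
  using pathin_canon_iff[of UNIV g] by simp

lemma graph_embeds_euclidean_simple:
  assumes "pathin euclidean g" "g 0 = p a" "g 1 = p b"
    "if a = b then inj_on g {0..<1} else inj_on g {0..1}"
  shows "simple_path g"
  using assms by (auto simp: pathin_euclidean arc_def intro: simple_path_loopI arc_imp_simple_path split: if_splits)

lemma planar_imp_plane_graph:
  assumes "fgraph V E s t" "planar V E s t"
  obtains p \<gamma> where "plane_graph V E s t p \<gamma>"
proof -
  obtain p :: "'a \<Rightarrow> real \<times> real" and \<gamma> where p: "inj_on p V" and \<gamma>': "\<forall>e\<in>E. pathin euclidean (\<gamma> e) \<and> \<gamma> e 0 = p (s e) \<and> \<gamma> e 1 = p (t e) \<and>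
        (if s e = t e then inj_on (\<gamma> e) {0..<1} else inj_on (\<gamma> e) {0..1}) \<and> \<gamma> e ` {0<..<1} \<inter> p ` V = {}"
    and d': "\<forall>e\<in>E. \<forall>e'\<in>E. e \<noteq> e' \<longrightarrow> \<gamma> e ` {0<..<1} \<inter> \<gamma> e' ` {0..1} = {}"
    using assms(2) unfolding planar_def graph_embeds_def by - (elim exE conjE, rule that, assumption+)
  note \<gamma> = \<gamma>'[rule_format] and d = d'[rule_format]
  define c where "c = (\<lambda>u::real \<times> real. Complex (fst u) (snd u))"
  have inj: "inj c" by (auto simp: c_def inj_def prod_eq_iff)
  have cont: "continuous_on UNIV c" unfolding c_def Complex_eq by (intro continuous_intros)
  have "plane_graph V E s t (c \<circ> p) (\<lambda>e. c \<circ> \<gamma> e)"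
  proof (intro plane_graph.intro plane_graph_axioms.intro assms(1))
    show "inj_on (c \<circ> p) V" using p inj by (simp add: comp_inj_on inj_on_subset)
    show "simple_path (c \<circ> \<gamma> e)" if "e \<in> E" for e
      using graph_embeds_euclidean_simple[of "\<gamma> e" p "s e" "t e"] \<gamma>[OF that] inj cont
      by (intro simple_path_continuous_image) (auto intro: continuous_on_subset inj_on_subset)
    show "pathstart (c \<circ> \<gamma> e) = (c \<circ> p) (s e)" "pathfinish (c \<circ> \<gamma> e) = (c \<circ> p) (t e)" if "e \<in> E" for e
      using \<gamma>[OF that] by (simp_all add: pathstart_def pathfinish_def)
    show "(c \<circ> \<gamma> e) ` {0<..<1} \<inter> (c \<circ> p) ` V = {}" if "e \<in> E" for e
      using \<gamma>[OF that] inj unfolding image_comp[symmetric] by (simp add: image_Int[symmetric])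
    show "(c \<circ> \<gamma> e) ` {0<..<1} \<inter> path_image (c \<circ> \<gamma> e') = {}" if "e \<in> E" "e' \<in> E" "e \<noteq> e'" for e e'
      using d[OF that] inj unfolding path_image_def image_comp[symmetric] by (simp add: image_Int[symmetric])
  qed
  then show ?thesis by (rule that)
qed

theorem planar_imp_has_emm_A:
  assumes "fgraph V E s t" "planar V E s t"
  shows "has_emm_A V E s t (genus V E s t)"
proof -
  obtain p \<gamma> where "plane_graph V E s t p \<gamma>" using planar_imp_plane_graph[OF assms] .
  then interpret plane_graph V E s t p \<gamma> .
  show ?thesis using plane_dual dual_data.dual_has_emm_A by metis
qed

section \<open>The projective plane\<close>

no_notation fps_nth (infixl "$" 75)

text \<open>The Veronese map identifies the projective plane with a set of symmetric matrices, which makes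
  the library's results on covering spaces applicable.\<close>

definition veronese :: "real^3 \<Rightarrow> real^3^3" where
  "veronese x = (\<chi> i j. x $ i * x $ j)"

definition RP2 :: "(real^3^3) set" where
  "RP2 = veronese ` sphere 0 1"

lemma veronese_mult: "veronese x *v a = (x \<bullet> a) *\<^sub>R x"
  by (simp add: veronese_def matrix_vector_mult_def inner_vec_def vec_eq_iff sum_distrib_left mult_ac)

lemma veronese_minus: "veronese (- x) = veronese x"
  by (simp add: veronese_def)

lemma veronese_eq_iff:
  assumes "norm x = 1" "norm y = 1"
  shows "veronese x = veronese y \<longleftrightarrow> x = y \<or> x = - y"
proof
  assume "veronese x = veronese y"
  then have "(x \<bullet> x) *\<^sub>R x = (y \<bullet> x) *\<^sub>R y" using veronese_mult by metis
  then have x: "x = (y \<bullet> x) *\<^sub>R y" using assms by (simp add: dot_square_norm)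
  then have "1 = \<bar>y \<bullet> x\<bar>" using assms by (metis mult.right_neutral norm_scaleR)
  then show "x = y \<or> x = - y" using x by (metis abs_eq_iff' abs_if scaleR_minus1_left scaleR_one)
qed (auto simp: veronese_minus)

lemma continuous_veronese: "continuous_on S veronese"
  unfolding veronese_def by (intro continuous_intros continuous_on_vec_lambda) 

lemma veronese_quotient: "quotient_map (top_of_set (sphere 0 1)) (top_of_set RP2) veronese"
  by (rule continuous_imp_quotient_map)
     (auto simp: RP2_def continuous_veronese compact_space_subtopology Hausdorff_space_subtopology)

lemma graph_embeds_image:
  assumes emb: "graph_embeds X V E s t" and cont: "continuous_map X Y f" and inj: "inj_on f (topspace X)"
  shows "graph_embeds Y V E s t"
proof -
  obtain p \<gamma> where p: "inj_on p V" "p ` V \<subseteq> topspace X"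
    and \<gamma>': "\<forall>e\<in>E. pathin X (\<gamma> e) \<and> \<gamma> e 0 = p (s e) \<and> \<gamma> e 1 = p (t e) \<and>
        (if s e = t e then inj_on (\<gamma> e) {0..<1} else inj_on (\<gamma> e) {0..1}) \<and> \<gamma> e ` {0<..<1} \<inter> p ` V = {}"
    and d': "\<forall>e\<in>E. \<forall>e'\<in>E. e \<noteq> e' \<longrightarrow> \<gamma> e ` {0<..<1} \<inter> \<gamma> e' ` {0..1} = {}"
    using emb unfolding graph_embeds_def by - (elim exE conjE, rule that, assumption+)
  note \<gamma> = \<gamma>'[rule_format] and d = d'[rule_format]
  have img: "\<gamma> e ` {0..1} \<subseteq> topspace X" if "e \<in> E" for e
    using \<gamma>[OF that] path_image_subset_topspace by blast
  have img1: "\<gamma> e ` {0<..<1} \<subseteq> topspace X" "\<gamma> e ` {0..<1} \<subseteq> topspace X" if "e \<in> E" for e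
    using img[OF that] by fastforce+
  have disj: "f ` A \<inter> f ` B = {}" if "A \<subseteq> topspace X" "B \<subseteq> topspace X" "A \<inter> B = {}" for A B
    using that inj by (metis image_empty inj_on_image_Int)
  show ?thesis
    unfolding graph_embeds_def
  proof (intro exI[of _ "f \<circ> p"] exI[of _ "\<lambda>e. f \<circ> \<gamma> e"] conjI ballI impI)
    show "inj_on (f \<circ> p) V" using p inj by (meson comp_inj_on inj_on_subset)
    show "(f \<circ> p) ` V \<subseteq> topspace Y" using p(2) cont by (auto simp: continuous_map_def)
    fix e assume e: "e \<in> E"
    show "pathin Y (f \<circ> \<gamma> e)" using \<gamma>[OF e] cont pathin_compose by blast
    show "(f \<circ> \<gamma> e) 0 = (f \<circ> p) (s e)" "(f \<circ> \<gamma> e) 1 = (f \<circ> p) (t e)" using \<gamma>[OF e] by simp_all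
    show "if s e = t e then inj_on (f \<circ> \<gamma> e) {0..<1} else inj_on (f \<circ> \<gamma> e) {0..1}"
      using \<gamma>[OF e] inj img[OF e] img1[OF e] by (auto intro!: comp_inj_on intro: inj_on_subset split: if_splits)
    show "(f \<circ> \<gamma> e) ` {0<..<1} \<inter> (f \<circ> p) ` V = {}"
      unfolding image_comp[symmetric] using \<gamma>[OF e] img1[OF e] p(2) by (intro disj) auto
    fix e' assume "e' \<in> E" "e \<noteq> e'"
    then show "(f \<circ> \<gamma> e) ` {0<..<1} \<inter> (f \<circ> \<gamma> e') ` {0..1} = {}"
      unfolding image_comp[symmetric] using d[OF e] img1[OF e] img by (intro disj) auto
  qed
qed

text \<open>Both spaces are quotients of the sphere with the same fibres, so the universal property
  gives continuous injections in both directions, and these carry embeddings along.\<close>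

lemma projective_planar_iff:
  "projective_planar V E s t \<longleftrightarrow> graph_embeds (top_of_set RP2) V E s t"
proof
  define q :: "real^3 \<Rightarrow> (real^3) set" where "q x = {x, - x}" for x
  assume "projective_planar V E s t"
  then obtain Y where Y: "quotient_map (top_of_set (sphere 0 1)) Y q" and emb: "graph_embeds Y V E s t"
    unfolding projective_planar_def q_def by blast
  \<comment> \<open>\<open>veronese\<close> is even, so either choice from \<open>{x, -x}\<close>
    gives the same matrix.\<close>
  define f where "f S = veronese (SOME x. x \<in> S)" for S :: "(real^3) set"
  have f: "f (q x) = veronese x" for x
  proof -
    have "(SOME y. y \<in> q x) \<in> q x" by (rule someI[of _ x]) (simp add: q_def)
    then show ?thesis by (auto simp: f_def q_def veronese_minus)
  qed
  have "continuous_map Y (top_of_set RP2) f"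
  proof (rule continuous_compose_quotient_map[OF Y])
    have "f \<circ> q = veronese" using f by auto
    then show "continuous_map (top_of_set (sphere 0 1)) (top_of_set RP2) (f \<circ> q)"
      using quotient_imp_continuous_map[OF veronese_quotient] by simp
  qed
  moreover have "inj_on f (topspace Y)"
  proof -
    have "topspace Y = q ` sphere 0 1" using Y by (auto simp: quotient_map_def)
    then show ?thesis using f by (auto simp: inj_on_def veronese_eq_iff q_def)
  qed
  ultimately show "graph_embeds (top_of_set RP2) V E s t" using emb graph_embeds_image by blast
next
  define q :: "real^3 \<Rightarrow> (real^3) set" where "q x = {x, - x}" for x
  define Y where "Y = topology (\<lambda>U. U \<subseteq> q ` sphere 0 1 \<and> openin (top_of_set (sphere 0 1)) {x \<in> sphere 0 1. q x \<in> U})"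
  assume emb: "graph_embeds (top_of_set RP2) V E s t"
  have "istopology (\<lambda>U. U \<subseteq> q ` sphere 0 1 \<and> openin (top_of_set (sphere 0 1)) {x \<in> sphere 0 1. q x \<in> U})"
    unfolding istopology_def
  proof (intro conjI allI impI)
    fix S T assume "S \<subseteq> q ` sphere 0 1 \<and> openin (top_of_set (sphere 0 1)) {x \<in> sphere 0 1. q x \<in> S}"
      "T \<subseteq> q ` sphere 0 1 \<and> openin (top_of_set (sphere 0 1)) {x \<in> sphere 0 1. q x \<in> T}"
    moreover have "{x \<in> sphere 0 1. q x \<in> S \<inter> T} = {x \<in> sphere 0 1. q x \<in> S} \<inter> {x \<in> sphere 0 1. q x \<in> T}" by auto
    ultimately show "S \<inter> T \<subseteq> q ` sphere 0 1" "openin (top_of_set (sphere 0 1)) {x \<in> sphere 0 1. q x \<in> S \<inter> T}"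
      by (auto simp: openin_Int)
  next
    fix \<K> assume "\<forall>S\<in>\<K>. S \<subseteq> q ` sphere 0 1 \<and> openin (top_of_set (sphere 0 1)) {x \<in> sphere 0 1. q x \<in> S}"
    moreover have "{x \<in> sphere 0 1. q x \<in> \<Union>\<K>} = (\<Union>S\<in>\<K>. {x \<in> sphere 0 1. q x \<in> S})" by auto
    ultimately show "\<Union>\<K> \<subseteq> q ` sphere 0 1" "openin (top_of_set (sphere 0 1)) {x \<in> sphere 0 1. q x \<in> \<Union>\<K>}"
      by (auto simp only: intro!: openin_Union)
  qed
  then have op: "openin Y U \<longleftrightarrow> U \<subseteq> q ` sphere 0 1 \<and> openin (top_of_set (sphere 0 1)) {x \<in> sphere 0 1. q x \<in> U}" for U
    unfolding Y_def by (simp add: topology_inverse')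
  have top: "topspace Y = q ` sphere 0 1"
  proof -
    have "{x \<in> sphere 0 1. q x \<in> q ` sphere 0 1} = sphere 0 1" by auto
    then have "openin Y (q ` sphere 0 1)" unfolding op using openin_topspace[of "top_of_set (sphere (0::real^3) 1)"] by simp
    then show ?thesis using op openin_subset openin_topspace by blast
  qed
  have Yq: "quotient_map (top_of_set (sphere 0 1)) Y q"
    unfolding quotient_map_def using top op by auto
  define h where "h M = {x \<in> sphere 0 1. veronese x = M}" for M
  have h: "h (veronese x) = q x" if "norm x = 1" for x
    using that by (auto simp: h_def q_def veronese_eq_iff veronese_minus)
  have "continuous_map (top_of_set RP2) Y h"
  proof (rule continuous_compose_quotient_map[OF veronese_quotient])
    show "continuous_map (top_of_set (sphere 0 1)) Y (h \<circ> veronese)"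
      by (rule continuous_map_eq[OF quotient_imp_continuous_map[OF Yq]]) (simp add: h)
  qed
  moreover have "inj_on h (topspace (top_of_set RP2))"
  proof (rule inj_onI)
    fix M M' assume "M \<in> topspace (top_of_set RP2)" "M' \<in> topspace (top_of_set RP2)" and eq: "h M = h M'"
    then obtain x where "norm x = 1" "M = veronese x" by (auto simp: RP2_def)
    then have "x \<in> h M" by (simp add: h_def)
    then show "M = M'" using eq by (auto simp: h_def)
  qed
  ultimately have "graph_embeds Y V E s t" using emb graph_embeds_image by blast
  then show "projective_planar V E s t" using Yq unfolding projective_planar_def q_def by blast
qed

text \<open>Over the lines not orthogonal to \<open>a\<close> the two sheets are the open hemisphere
  around \<open>a\<close> and its negative. Since \<open>veronese y *v a\<close> is \<open>y\<close>
  scaled by its inner product with \<open>a\<close>, normalising \<open>N *v a\<close> inverts the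
  map on a sheet.\<close>

lemma veronese_covering: "covering_space (sphere 0 1) veronese RP2"
proof
  show "continuous_on (sphere 0 1) veronese" by (rule continuous_veronese)
  show "veronese ` sphere 0 1 = RP2" by (simp add: RP2_def)
  fix M assume "M \<in> RP2"
  then obtain a where a: "norm a = 1" "M = veronese a" by (auto simp: RP2_def)
  define U where "U = {y \<in> sphere 0 1. y \<bullet> a > 0}"
  define T where "T = {N \<in> RP2. N *v a \<noteq> 0}"
  have T: "veronese y \<in> T \<longleftrightarrow> y \<bullet> a \<noteq> 0" if "norm y = 1" for y
    using that by (auto simp: T_def RP2_def veronese_mult)
  have "continuous_on RP2 (\<lambda>N. N *v a)"
    unfolding matrix_vector_mult_def by (intro continuous_intros continuous_on_vec_lambda)
  then have "openin (top_of_set RP2) (RP2 \<inter> (\<lambda>N. N *v a) -` (- {0}))"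
    by (intro continuous_openin_preimage_gen) auto
  moreover have "RP2 \<inter> (\<lambda>N. N *v a) -` (- {0}) = T" by (auto simp: T_def)
  ultimately have opT: "openin (top_of_set RP2) T" by simp
  have opU: "openin (top_of_set (sphere 0 1)) U" 
  proof -
    have "openin (top_of_set (sphere 0 1)) (sphere 0 1 \<inter> (\<lambda>y. y \<bullet> a) -` {0<..})"
      by (intro continuous_openin_preimage_gen continuous_intros)
    moreover have "sphere 0 1 \<inter> (\<lambda>y. y \<bullet> a) -` {0<..} = U" by (auto simp: U_def)
    ultimately show ?thesis by simp
  qed
  have mU: "uminus ` U = {y \<in> sphere 0 1. y \<bullet> a < 0}"
    by (auto simp: U_def image_iff) (metis add.inverse_inverse inner_minus_left neg_0_less_iff_less norm_minus_cancel)
  have opU': "openin (top_of_set (sphere 0 1)) (uminus ` U)" 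
  proof -
    have "openin (top_of_set (sphere 0 1)) (sphere 0 1 \<inter> (\<lambda>y. y \<bullet> a) -` {..<0})"
      by (intro continuous_openin_preimage_gen continuous_intros)
    moreover have "sphere 0 1 \<inter> (\<lambda>y. y \<bullet> a) -` {..<0} = uminus ` U"
      unfolding mU by auto
    ultimately show ?thesis by simp
  qed
  define r where "r N = (N *v a) /\<^sub>R norm (N *v a)" for N :: "real^3^3"
  have r: "r (veronese y) = y" if "y \<in> U" for y
    using that by (auto simp: r_def U_def veronese_mult)
  have vU: "veronese ` U = T"
  proof (intro equalityI subsetI)
    fix N assume "N \<in> T"
    then obtain y where y: "norm y = 1" "N = veronese y" by (auto simp: T_def RP2_def)
    then have "y \<bullet> a \<noteq> 0" using T[of y] \<open>N \<in> T\<close> by simp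
    then have "y \<in> U \<or> - y \<in> U" using y by (auto simp: U_def)
    then show "N \<in> veronese ` U" using y veronese_minus by (metis imageI)
  qed (use T in \<open>auto simp: U_def\<close>)
  have contr: "continuous_on T r"
    unfolding r_def matrix_vector_mult_def by (intro continuous_intros continuous_on_vec_lambda) (auto simp: T_def matrix_vector_mult_def)
  have hom: "homeomorphism U T veronese r"
    using vU r contr continuous_veronese unfolding homeomorphism_def by (auto simp: image_iff)
  have hom': "homeomorphism (uminus ` U) T veronese (uminus \<circ> r)"
  proof -
    have "veronese ` (uminus ` U) = T" using vU by (simp add: image_image veronese_minus)
    moreover have "(uminus \<circ> r) ` T = uminus ` U" using hom by (metis homeomorphism_image2 image_comp)
    moreover have "veronese ((uminus \<circ> r) N) = N" if "N \<in> T" for N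
      using hom that by (simp add: veronese_minus homeomorphism_def)
    ultimately show ?thesis
      using contr continuous_veronese r
      unfolding homeomorphism_def by (auto simp: veronese_minus o_def intro: continuous_intros)
  qed
  show "\<exists>T. M \<in> T \<and> openin (top_of_set RP2) T \<and> (\<exists>v. \<Union> v = sphere 0 1 \<inter> veronese -` T \<and>
       (\<forall>u\<in>v. openin (top_of_set (sphere 0 1)) u) \<and> pairwise disjnt v \<and> (\<forall>u\<in>v. \<exists>q. homeomorphism u T veronese q))"
  proof (intro exI[of _ T] exI[of _ "{U, uminus ` U}"] conjI)
    show "M \<in> T" using a T[of a] by (simp add: dot_square_norm)
    show "\<Union> {U, uminus ` U} = sphere 0 1 \<inter> veronese -` T"
      using T unfolding mU by (auto simp: U_def)
    show "pairwise disjnt {U, uminus ` U}" by (auto simp: pairwise_def disjnt_def U_def)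
  qed (use opT opU opU' hom hom' in auto)
qed

subsection \<open>Stereographic projection\<close>

definition stereo :: "real^3 \<Rightarrow> complex" where
  "stereo y = Complex (y $ 1) (y $ 2) / of_real (1 - y $ 3)"

text \<open>The antipodal map of the sphere in stereographic coordinates. The true antipode of 0 is
  infinity, while the formula yields \<open>antip 0 = 0\<close>; hence 0 is excluded
  throughout.\<close>

definition antip :: "complex \<Rightarrow> complex" where
  "antip z = - 1 / cnj z"

lemma unit3: "norm (y::real^3) = 1 \<longleftrightarrow> (y$1)^2 + (y$2)^2 + (y$3)^2 = 1"
  by (simp add: norm_vec_def L2_set_def sum_3)

lemma north: "norm (y::real^3) = 1 \<Longrightarrow> y $ 3 = 1 \<longleftrightarrow> y = axis 3 1"
  by (auto simp: unit3 vec_eq_iff forall_3 axis_def sum_power2_eq_zero_iff)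

lemma stereo_inj: 
  assumes "norm y = 1" "norm y' = 1" "y \<noteq> axis 3 1" "y' \<noteq> axis 3 1" "stereo y = stereo y'"
  shows "y = y'"
proof -
  have 3: "y $ 3 \<noteq> 1" "y' $ 3 \<noteq> 1" using assms north by auto
  have *: "(cmod (stereo y))^2 = (1 + y $ 3) / (1 - y $ 3)" if "norm y = 1" "y $ 3 \<noteq> 1" for y
  proof -
    have "(cmod (stereo y))^2 = ((y$1)^2 + (y$2)^2) / (1 - y$3)^2"
      by (simp add: stereo_def norm_divide cmod_def power_divide add_divide_distrib)
    also have "(y$1)^2 + (y$2)^2 = (1 + y $ 3) * (1 - y $ 3)" using that(1) unfolding unit3 by (simp add: algebra_simps power2_eq_square)
    finally show ?thesis using that(2) by (simp add: power2_eq_square)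
  qed
  have "(1 + y $ 3) / (1 - y $ 3) = (1 + y' $ 3) / (1 - y' $ 3)" using * assms 3 by metis
  then have e3: "y $ 3 = y' $ 3" using 3 by (simp add: field_simps)
  then have "Complex (y $ 1) (y $ 2) = Complex (y' $ 1) (y' $ 2)" using assms(5) 3 by (simp add: stereo_def)
  then show ?thesis using e3 by (simp add: vec_eq_iff forall_3)
qed

lemma continuous_stereo: "continuous_on {y. y $ 3 \<noteq> 1} stereo"
  unfolding stereo_def Complex_eq by (intro continuous_intros) (auto simp: complex_eq_iff)

lemma stereo_eq_0: "norm y = 1 \<Longrightarrow> y \<noteq> axis 3 1 \<Longrightarrow> - y \<noteq> axis 3 1 \<Longrightarrow> stereo y \<noteq> 0"
proof
  assume y: "norm y = 1" "y \<noteq> axis 3 1" "- y \<noteq> axis 3 1" and 0: "stereo y = 0"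
  have "y $ 3 \<noteq> 1" "(- y) $ 3 \<noteq> 1" using y north[of y] north[of "- y"] by auto
  moreover from 0 this have "y $ 1 = 0" "y $ 2 = 0" by (auto simp: stereo_def complex_eq_iff)
  then have "(y $ 3)^2 = 1" using y(1) unfolding unit3 by simp
  ultimately show False by (auto simp: power2_eq_1_iff)
qed

lemma stereo_minus:
  assumes "norm y = 1" "y \<noteq> axis 3 1" "- y \<noteq> axis 3 1"
  shows "stereo (- y) = antip (stereo y)"
proof -
  have 3: "1 - y $ 3 \<noteq> 0" "1 + y $ 3 \<noteq> 0" using assms north[of y] north[of "- y"] by (auto simp: add_eq_0_iff)
  define w where "w = Complex (y $ 1) (y $ 2)"
  have "w * cnj w = of_real ((y$1)^2 + (y$2)^2)" by (simp add: w_def complex_mult_cnj complex_eq_iff power2_eq_square)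
  also have "(y$1)^2 + (y$2)^2 = (1 + y $ 3) * (1 - y $ 3)" using assms(1) unfolding unit3 by (simp add: algebra_simps power2_eq_square)
  finally have w: "w * cnj w = of_real (1 + y$3) * of_real (1 - y $ 3)" by simp
  have w0: "w \<noteq> 0" using stereo_eq_0[OF assms] by (auto simp: stereo_def w_def)
  have "stereo (- y) = - w / of_real (1 + y $ 3)" by (simp add: stereo_def w_def complex_eq_iff)
  also have "\<dots> = - (of_real (1 - y $ 3) / cnj w)"
  proof -
    have "(of_real (1 + y $ 3) :: complex) \<noteq> 0" using 3(2) by (simp only: of_real_eq_0_iff not_False_eq_True)
    then show ?thesis using w w0 by (simp add: divide_simps del: of_real_add of_real_diff)
  qed
  also have "\<dots> = antip (stereo y)" by (simp add: antip_def stereo_def w_def minus_divide_left)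
  finally show ?thesis .
qed

subsection \<open>Lifting an embedding to the sphere\<close>

text \<open>Otherwise a circle in the sphere would embed in the line.\<close>

lemma arcs_do_not_cover_sphere:
  assumes g: "arc g" and x: "x \<in> g ` {0<..<1}" "norm (x::real^3) = 1"
    and C: "compact C" "x \<notin> C" "sphere 0 1 \<subseteq> C \<union> path_image g"
  shows False
proof -
  obtain f :: "real^3 \<Rightarrow> real^3" where f: "orthogonal_transformation f" "f (axis 3 1) = x"
    using orthogonal_transformation_exists[of "axis 3 1 :: real^3" x] x(2) by auto
  have lin: "linear f" and nf: "\<And>y. norm (f y) = norm y"
    using f(1) by (auto simp: orthogonal_transformation)
  have "open (- C)" using C(1) by (simp add: compact_imp_closed open_Compl)
  then obtain r where r: "r > 0" "ball x r \<subseteq> - C" using C(2) by (meson ComplI open_contains_ball)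
  \<comment> \<open>The radius of a circle of latitude around \<open>x\<close>. Its points have
    squared distance at most \<open>2 * a^2\<close> from \<open>x\<close>, so they stay in the ball
    of radius \<open>r\<close>.\<close>
  define a where "a = min (1/2) (r/2)"
  have a: "0 < a" "a < 1" "a \<le> r/2" using r(1) by (auto simp: a_def)
  have a2: "a^2 < 1" using a by (simp add: abs_square_less_1)
  define b where "b = sqrt (1 - a^2)"
  have b: "0 < b" "b < 1" "a^2 + b^2 = 1" using a a2 by (auto simp: b_def)
  define c :: "complex \<Rightarrow> real^3" where "c z = vector [a * Re z, a * Im z, b]" for z
  have cc: "c z $ 1 = a * Re z" "c z $ 2 = a * Im z" "c z $ 3 = b" for z by (simp_all add: c_def)
  have sq: "(a * Re z)^2 + (a * Im z)^2 = a^2" if "cmod z = 1" for z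
  proof -
    have "(Re z)^2 + (Im z)^2 = 1" using that by (simp add: cmod_power2[symmetric])
    then show ?thesis by (simp add: power_mult_distrib distrib_left[symmetric])
  qed
  have norm1: "norm (c z) = 1" if "cmod z = 1" for z
    unfolding unit3 cc using b sq[OF that] by simp
  have near: "norm (c z - axis 3 1) < r" if "cmod z = 1" for z
  proof -
    have "(norm (c z - axis 3 1))^2 = (a * Re z)^2 + (a * Im z)^2 + (b - 1)^2"
      by (simp add: norm_vec_def L2_set_def sum_3 cc axis_def)
    also have "\<dots> = a^2 + (b - 1)^2" using sq[OF that] by simp
    also have "\<dots> = 2 * (1 - b)" using b(3) by (simp add: power2_eq_square algebra_simps)
    also have "1 - b \<le> a^2"
    proof -
      have "a^2 = (1 - b) * (1 + b)" using b(3) by (simp add: power2_eq_square algebra_simps)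
      then show ?thesis using b by simp
    qed
    also have "2 * a^2 \<le> 2 * (r/2)^2" using a by (simp add: power_mono)
    also have "\<dots> < r^2" using r by (simp add: power2_eq_square)
    finally show ?thesis using r(1) by (simp add: power2_less_imp_less)
  qed
  have im: "f (c z) \<in> path_image g" if "cmod z = 1" for z
  proof -
    have "f (c z) - x = f (c z - axis 3 1)" using f(2) lin by (simp add: linear_diff)
    then have "norm (f (c z) - x) < r" using near[OF that] nf[of "c z - axis 3 1"] by simp
    then have "dist x (f (c z)) < r" by (simp add: dist_norm norm_minus_commute)
    then have "f (c z) \<notin> C" using r(2) by auto
    moreover have "f (c z) \<in> sphere 0 1" using nf norm1[OF that] by simp
    ultimately show ?thesis using C(3) by auto
  qed
  obtain h where h: "homeomorphism {0..1} (path_image g) g h" using homeomorphism_arc[OF g] by blast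
  have contc: "continuous_on (sphere 0 1) c"
  proof -
    have "c = (\<lambda>z. (a * Re z) *\<^sub>R axis 1 1 + (a * Im z) *\<^sub>R axis 2 1 + b *\<^sub>R axis 3 1)"
      by (rule ext) (simp add: vec_eq_iff forall_3 cc axis_def)
    then show ?thesis by (simp only:) (intro continuous_intros)
  qed
  have "DIM(complex) \<le> DIM(real)"
  proof (rule no_embedding_sphere_lowdim[of 0 1 "h \<circ> f \<circ> c"])
    show "continuous_on (sphere 0 1) (h \<circ> f \<circ> c)"
    proof (intro continuous_on_compose contc)
      show "continuous_on (c ` sphere 0 1) f" using lin by (simp add: linear_continuous_on linear_conv_bounded_linear)
      show "continuous_on (f ` c ` sphere 0 1) h"
        using h im by (auto simp: homeomorphism_def intro: continuous_on_subset)
    qed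
    show "inj_on (h \<circ> f \<circ> c) (sphere 0 1)"
    proof (rule inj_onI)
      fix z w assume zw: "z \<in> sphere 0 1" "w \<in> sphere 0 1" "(h \<circ> f \<circ> c) z = (h \<circ> f \<circ> c) w"
      then have "h (f (c z)) = h (f (c w))" by simp
      then have "f (c z) = f (c w)" using h im zw(1,2) unfolding homeomorphism_def by (metis dist_0_norm mem_sphere)
      then have "f (c z - c w) = 0" using lin by (simp add: linear_diff)
      then have "c z = c w" using nf by (metis norm_eq_zero right_minus_eq)
      then have "c z $ 1 = c w $ 1" "c z $ 2 = c w $ 2" by simp_all
      then show "z = w" using a(1) unfolding cc by (simp add: complex_eq_iff)
    qed
  qed simp
  then show False by simp
qed

text \<open>Each edge is lifted through the covering from the chosen lift of its source. The flag
  \<open>c e\<close> records that the lift ends at the negative of the chosen lift of the target;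
  these flags are the voltages of the double cover.\<close>

lemma projective_lift_sphere:
  assumes G: "fgraph V E s t" and emb: "projective_planar V E s t"
  obtains c :: "'e \<Rightarrow> bool" and P :: "'v \<Rightarrow> real^3" and H :: "'e \<Rightarrow> real \<Rightarrow> real^3" where
    "\<And>v. v \<in> V \<Longrightarrow> norm (P v) = 1" "\<And>u v. u \<in> V \<Longrightarrow> v \<in> V \<Longrightarrow> P u = P v \<or> P u = - P v \<Longrightarrow> u = v"
    "\<And>e. e \<in> E \<Longrightarrow> path (H e)" "\<And>e x. e \<in> E \<Longrightarrow> x \<in> {0..1} \<Longrightarrow> norm (H e x) = 1"
    "\<And>e. e \<in> E \<Longrightarrow> H e 0 = P (s e)" "\<And>e. e \<in> E \<Longrightarrow> H e 1 = (if c e then - P (t e) else P (t e))"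
    "\<And>e x y. e \<in> E \<Longrightarrow> x \<in> {0<..<1} \<Longrightarrow> y \<in> {0..1} \<Longrightarrow> H e x = H e y \<or> H e x = - H e y \<Longrightarrow> x = y"
    "\<And>e v x. e \<in> E \<Longrightarrow> v \<in> V \<Longrightarrow> x \<in> {0<..<1} \<Longrightarrow> H e x \<noteq> P v \<and> H e x \<noteq> - P v"
    "\<And>e e' x y. e \<in> E \<Longrightarrow> e' \<in> E \<Longrightarrow> e \<noteq> e' \<Longrightarrow> x \<in> {0<..<1} \<Longrightarrow> y \<in> {0..1} \<Longrightarrow> H e x \<noteq> H e' y \<and> H e x \<noteq> - H e' y"
proof -
  interpret fgraph V E s t by fact
  obtain p \<gamma> where p: "inj_on p V" "p ` V \<subseteq> topspace (top_of_set RP2)"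
    and \<gamma>': "\<forall>e\<in>E. pathin (top_of_set RP2) (\<gamma> e) \<and> \<gamma> e 0 = p (s e) \<and> \<gamma> e 1 = p (t e) \<and>
        (if s e = t e then inj_on (\<gamma> e) {0..<1} else inj_on (\<gamma> e) {0..1}) \<and> \<gamma> e ` {0<..<1} \<inter> p ` V = {}"
    and d': "\<forall>e\<in>E. \<forall>e'\<in>E. e \<noteq> e' \<longrightarrow> \<gamma> e ` {0<..<1} \<inter> \<gamma> e' ` {0..1} = {}"
    using emb unfolding projective_planar_iff graph_embeds_def by - (elim exE conjE, rule that, assumption+)
  note \<gamma> = \<gamma>'[rule_format] and d = d'[rule_format]
  have "\<exists>x. norm x = 1 \<and> veronese x = p v" if "v \<in> V" for v
  proof -
    have "p v \<in> veronese ` sphere 0 1" using p(2) that by (auto simp: RP2_def)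
    then show ?thesis by auto
  qed
  then obtain P where P: "\<And>v. v \<in> V \<Longrightarrow> norm (P v) = 1 \<and> veronese (P v) = p v" by metis
  have "\<exists>h. path h \<and> path_image h \<subseteq> sphere 0 1 \<and> pathstart h = P (s e) \<and> (\<forall>x\<in>{0..1}. veronese (h x) = \<gamma> e x)"
    if e: "e \<in> E" for e
  proof -
    have "path (\<gamma> e)" "path_image (\<gamma> e) \<subseteq> RP2" "pathstart (\<gamma> e) = veronese (P (s e))"
      using \<gamma>[OF e] P[OF ends_in_V(1)[OF e]] by (auto simp: pathin_canon_iff path_image_def pathstart_def)
    moreover have "P (s e) \<in> sphere 0 1" using P[OF ends_in_V(1)[OF e]] by simp
    ultimately show ?thesis using covering_space_lift_path_strong[OF veronese_covering] by metis
  qed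
  then obtain H where H: "\<And>e. e \<in> E \<Longrightarrow> path (H e) \<and> path_image (H e) \<subseteq> sphere 0 1 \<and> pathstart (H e) = P (s e) \<and>
      (\<forall>x\<in>{0..1}. veronese (H e x) = \<gamma> e x)" by metis
  have nH: "norm (H e x) = 1" if "e \<in> E" "x \<in> {0..1}" for e x
    using H[OF that(1)] that(2) by (auto simp: path_image_def image_subset_iff)
  have vH: "veronese (H e x) = \<gamma> e x" if "e \<in> E" "x \<in> {0..1}" for e x using H[OF that(1)] that(2) by blast
  define c where "c e = (H e 1 \<noteq> P (t e))" for e
  show ?thesis
  proof (rule that[of P H c])
    show "norm (P v) = 1" if "v \<in> V" for v using P that by simp
    show "u = v" if "u \<in> V" "v \<in> V" "P u = P v \<or> P u = - P v" for u v
    proof -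
      have "p u = p v" using P[OF that(1)] P[OF that(2)] that(3) veronese_minus[of "P v"] by metis
      then show ?thesis using p(1) that by (auto simp: inj_on_def)
    qed
    show "path (H e)" "H e 0 = P (s e)" if "e \<in> E" for e using H[OF that] by (auto simp: pathstart_def)
    show "norm (H e x) = 1" if "e \<in> E" "x \<in> {0..1}" for e x using nH that .
    show "H e 1 = (if c e then - P (t e) else P (t e))" if e: "e \<in> E" for e
    proof -
      have "veronese (H e 1) = veronese (P (t e))" using vH[OF e, of 1] \<gamma>[OF e] P[OF ends_in_V(2)[OF e]] by simp
      then have "H e 1 = P (t e) \<or> H e 1 = - P (t e)"
        using nH[OF e, of 1] P[OF ends_in_V(2)[OF e]] veronese_eq_iff[of "H e 1" "P (t e)"] by simp
      then show ?thesis by (auto simp: c_def)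
    qed
    show "x = y" if e: "e \<in> E" and x: "x \<in> {0<..<1}" and y: "y \<in> {0..1}" and eq: "H e x = H e y \<or> H e x = - H e y" for e x y
    proof -
      have g: "\<gamma> e x = \<gamma> e y" using vH[OF e, of x] vH[OF e y] x eq veronese_minus[of "H e y"] by force
      have "inj_on (\<gamma> e) {0..<1}" using \<gamma>[OF e] by (auto split: if_splits intro: inj_on_subset)
      moreover have "y \<noteq> 1"
      proof
        assume "y = 1"
        then have "\<gamma> e x \<in> p ` V" using g \<gamma>[OF e] ends_in_V(2)[OF e] by simp
        then show False using \<gamma>[OF e] x by blast
      qed
      ultimately show ?thesis using g x y by (auto simp: inj_on_def)
    qed
    show "H e x \<noteq> P v \<and> H e x \<noteq> - P v" if e: "e \<in> E" and v: "v \<in> V" and x: "x \<in> {0<..<1}" for e v x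
    proof -
      have "\<gamma> e x \<noteq> p v" using \<gamma>[OF e] v x by blast
      then show ?thesis using vH[OF e, of x] P[OF v] x veronese_minus[of "P v"] by force
    qed
    show "H e x \<noteq> H e' y \<and> H e x \<noteq> - H e' y"
      if e: "e \<in> E" and e': "e' \<in> E" and ne: "e \<noteq> e'" and x: "x \<in> {0<..<1}" and y: "y \<in> {0..1}" for e e' x y
    proof -
      have "\<gamma> e x \<noteq> \<gamma> e' y" using d[OF e e' ne] x y by blast
      then show ?thesis using vH[OF e, of x] vH[OF e' y] x veronese_minus[of "H e' y"] by force
    qed
  qed
qed

definition flip :: "bool \<Rightarrow> real^3 \<Rightarrow> real^3" where
  "flip b y = (if b then - y else y)"

text \<open>An antipodal pair of points off the drawing is rotated to the poles. Then stereographic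
  projection is defined on both lifts of everything, and \<open>antip\<close> is never evaluated at
  0.\<close>

lemma projective_lift:
  assumes G: "fgraph V E s t" and emb: "projective_planar V E s t"
  obtains c :: "'e \<Rightarrow> bool" and P :: "'v \<times> bool \<Rightarrow> complex" and \<Gamma> :: "'e \<times> bool \<Rightarrow> real \<Rightarrow> complex" where
    "plane_graph (V \<times> UNIV) (E \<times> UNIV) (\<lambda>(e, b). (s e, b)) (\<lambda>(e, b). (t e, b \<noteq> c e)) P \<Gamma>"
    "\<And>v b. v \<in> V \<Longrightarrow> P (v, b) \<noteq> 0 \<and> P (v, \<not> b) = antip (P (v, b))"
    "\<And>e b x. e \<in> E \<Longrightarrow> x \<in> {0..1} \<Longrightarrow> \<Gamma> (e, b) x \<noteq> 0 \<and> \<Gamma> (e, \<not> b) x = antip (\<Gamma> (e, b) x)"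
proof -
  interpret fgraph V E s t by fact
  obtain c and P :: "'v \<Rightarrow> real^3" and H where
    P1: "\<And>v. v \<in> V \<Longrightarrow> norm (P v) = 1" and Pinj: "\<And>u v. u \<in> V \<Longrightarrow> v \<in> V \<Longrightarrow> P u = P v \<or> P u = - P v \<Longrightarrow> u = v"
    and Hp: "\<And>e. e \<in> E \<Longrightarrow> path (H e)" and H1: "\<And>e x. e \<in> E \<Longrightarrow> x \<in> {0..1} \<Longrightarrow> norm (H e x) = 1"
    and Hs: "\<And>e. e \<in> E \<Longrightarrow> H e 0 = P (s e)" and Ht: "\<And>e. e \<in> E \<Longrightarrow> H e 1 = (if c e then - P (t e) else P (t e))"
    and Hinj: "\<And>e x y. e \<in> E \<Longrightarrow> x \<in> {0<..<1} \<Longrightarrow> y \<in> {0..1} \<Longrightarrow> H e x = H e y \<or> H e x = - H e y \<Longrightarrow> x = y"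
    and HV: "\<And>e v x. e \<in> E \<Longrightarrow> v \<in> V \<Longrightarrow> x \<in> {0<..<1} \<Longrightarrow> H e x \<noteq> P v \<and> H e x \<noteq> - P v"
    and Hd: "\<And>e e' x y. e \<in> E \<Longrightarrow> e' \<in> E \<Longrightarrow> e \<noteq> e' \<Longrightarrow> x \<in> {0<..<1} \<Longrightarrow> y \<in> {0..1} \<Longrightarrow> H e x \<noteq> H e' y \<and> H e x \<noteq> - H e' y"
    by (rule projective_lift_sphere[OF assms]) (rule that, assumption+)
  have ne: "y \<noteq> - y" if "norm y = 1" for y :: "real^3"
  proof
    assume "y = - y"
    then have "y = 0" by (simp add: vec_eq_iff)
    then show False using that by simp
  qed
  define S where "S X = X \<union> uminus ` X" for X :: "(real^3) set"
  have cS: "compact (S X)" if "compact X" for X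
    unfolding S_def using that compact_negations[OF that] by (intro compact_Un) auto
  have cH: "compact (H e ` A)" if "e \<in> E" "compact A" "A \<subseteq> {0..1}" for e A
    using Hp[OF that(1)] that(2,3) unfolding path_def by (meson compact_continuous_image continuous_on_subset)
  \<comment> \<open>Finitely many edges cannot fill the sphere: a neighbourhood of a point in the
    middle of an edge would have to be covered by this edge alone.\<close>
  have "\<exists>u. norm u = 1 \<and> (\<forall>v\<in>V. u \<notin> S {P v}) \<and> (\<forall>e\<in>E. \<forall>x\<in>{0..1}. u \<notin> S {H e x})"
  proof (rule ccontr)
    assume nex: "\<not> (\<exists>u. norm u = 1 \<and> (\<forall>v\<in>V. u \<notin> S {P v}) \<and> (\<forall>e\<in>E. \<forall>x\<in>{0..1}. u \<notin> S {H e x}))"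
    then have cover: "sphere 0 1 \<subseteq> S (P ` V) \<union> (\<Union>e\<in>E. S (H e ` {0..1}))" by (force simp: S_def)
    show False
    proof (cases "E = {}")
      case True
      then have "finite (sphere (0::real^3) 1)" using cover finite_V by (auto simp: S_def intro: finite_subset)
      moreover have "connected (sphere (0::real^3) 1)" by (simp add: connected_sphere)
      ultimately obtain a where "sphere (0::real^3) 1 \<subseteq> {a}" by (metis connected_finite_iff_sing empty_subsetI order_refl)
      moreover have "axis 3 1 \<in> sphere (0::real^3) 1" "- axis 3 1 \<in> sphere (0::real^3) 1" by simp_all
      ultimately have "axis 3 1 = - (axis 3 1 :: real^3)" by (metis singletonD subsetD)
      moreover have "norm (axis 3 1 :: real^3) = 1" by simp
      ultimately show False using ne by blast
    next
      case False
      then obtain e where e: "e \<in> E" by auto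
      \<comment> \<open>The middle half of the edge is an arc even if the lift of a loop is closed,
        and it keeps the chosen point \<open>H e (1/2)\<close> away from the remaining pieces, which
        go into \<open>C\<close>.\<close>
      define g where "g x = H e (1/4 + x/2)" for x
      define C where "C = S (P ` V) \<union> (\<Union>e'\<in>E - {e}. S (H e' ` {0..1})) \<union> uminus ` (H e ` {0..1}) \<union> H e ` {0..1/4} \<union> H e ` {3/4..1}"
      show False
      proof (rule arcs_do_not_cover_sphere[of g "H e (1/2)" C])
        have cont: "continuous_on {0..1} (H e)" using Hp[OF e] by (simp add: path_def)
        have "path g" unfolding path_def g_def
          by (intro continuous_on_compose2[OF cont] continuous_intros) auto
        moreover have "inj_on g {0..1}"
        proof (rule inj_onI)
          fix x y :: real assume "x \<in> {0..1}" "y \<in> {0..1}" "g x = g y"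
          then show "x = y" using Hinj[OF e, of "1/4 + x/2" "1/4 + y/2"] by (auto simp: g_def)
        qed
        ultimately show "arc g" by (simp add: arc_def)
        show "H e (1/2) \<in> g ` {0<..<1}" by (rule image_eqI[of _ _ "1/2"]) (auto simp: g_def)
        show "norm (H e (1/2)) = 1" using H1[OF e] by simp
        show "compact C" unfolding C_def using finite_V finite_E e
          by (intro compact_Un compact_UN cS cH compact_negations) (auto intro: finite_imp_compact)
        show "H e (1/2) \<notin> C"
        proof
          assume "H e (1/2) \<in> C"
          then consider v where "v \<in> V" "H e (1/2) = P v \<or> H e (1/2) = - P v"
            | e' y where "e' \<in> E" "e \<noteq> e'" "y \<in> {0..1}" "H e (1/2) = H e' y \<or> H e (1/2) = - H e' y"
            | y where "y \<in> {0..1}" "H e (1/2) = - H e y" | y where "y \<in> {0..1/4} \<union> {3/4..1}" "H e (1/2) = H e y"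
            unfolding C_def S_def by blast
          then show False
          proof cases
            case 1
            then show ?thesis using HV[OF e, of v "1/2"] by simp
          next
            case 2
            then show ?thesis using Hd[OF e, of e' "1/2" y] by simp
          next
            case 3
            then have "1/2 = y" by (intro Hinj[OF e]) auto
            then have "H e (1/2) = - H e (1/2)" using 3(2) by metis
            moreover have "norm (H e (1/2)) = 1" by (rule H1[OF e]) auto
            ultimately show ?thesis using ne by blast
          next
            case 4
            then show ?thesis using Hinj[OF e, of "1/2" y] by auto
          qed
        qed
        have h1: "H e ` {0..1} \<subseteq> H e ` {0..1/4} \<union> H e ` {3/4..1} \<union> path_image g"
        proof
          fix w assume "w \<in> H e ` {0..1}"
          then obtain x where x: "x \<in> {0..1}" "w = H e x" by auto
          show "w \<in> H e ` {0..1/4} \<union> H e ` {3/4..1} \<union> path_image g"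
          proof (cases "x \<le> 1/4 \<or> x \<ge> 3/4")
            case False
            then have "w = g (2 * x - 1/2)" "2 * x - 1/2 \<in> {0..1}" using x by (auto simp: g_def field_simps)
            then show ?thesis by (auto simp: path_image_def)
          qed (use x in auto)
        qed
        have h2: "(\<Union>e\<in>E. S (H e ` {0..1})) = (\<Union>e'\<in>E - {e}. S (H e' ` {0..1})) \<union> S (H e ` {0..1})" using e by blast
        have h3: "uminus ` (H e ` {0..1}) \<subseteq> C" "H e ` {0..1/4} \<union> H e ` {3/4..1} \<subseteq> C"
          "S (P ` V) \<subseteq> C" "(\<Union>e'\<in>E - {e}. S (H e' ` {0..1})) \<subseteq> C" unfolding C_def by blast+
        have "S (H e ` {0..1}) \<subseteq> C \<union> path_image g" unfolding S_def
          by (rule Un_least[OF order_trans[OF h1 Un_mono[OF h3(2) order_refl]] order_trans[OF h3(1) Un_upper1]])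
        then have "(\<Union>e\<in>E. S (H e ` {0..1})) \<subseteq> C \<union> path_image g"
          unfolding h2 using h3(4) by (intro Un_least) (rule le_supI1)
        then have "S (P ` V) \<union> (\<Union>e\<in>E. S (H e ` {0..1})) \<subseteq> C \<union> path_image g"
          using h3(3) by (intro Un_least) (rule le_supI1)
        with cover show "sphere 0 1 \<subseteq> C \<union> path_image g" by (rule order_trans)
      qed
    qed
  qed
  then obtain u where u: "norm u = 1" "\<And>v. v \<in> V \<Longrightarrow> u \<notin> S {P v}" "\<And>e x. e \<in> E \<Longrightarrow> x \<in> {0..1} \<Longrightarrow> u \<notin> S {H e x}" by blast
  obtain f :: "real^3 \<Rightarrow> real^3" where f: "orthogonal_transformation f" "f u = axis 3 1"
    using orthogonal_transformation_exists[of u "axis 3 1"] u(1) by auto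
  have lin: "linear f" and nf: "\<And>y. norm (f y) = norm y"
    using f(1) by (auto simp: orthogonal_transformation)
  have finj: "f y = f w \<longleftrightarrow> y = w" for y w
  proof
    assume "f y = f w"
    then have "f (y - w) = 0" using lin by (simp add: linear_diff)
    then show "y = w" using nf by (metis norm_eq_zero right_minus_eq)
  qed simp
  have fm: "f (- y) = - f y" for y using lin by (simp add: linear_neg)
  define X where "X = {y. norm y = 1 \<and> y \<noteq> u \<and> - y \<noteq> u}"
  define h where "h y = stereo (f y)" for y
  have Xf: "norm (f y) = 1 \<and> f y \<noteq> axis 3 1 \<and> - f y \<noteq> axis 3 1" if "y \<in> X" for y
    using that nf finj fm unfolding X_def f(2)[symmetric] by (metis (mono_tags, lifting) mem_Collect_eq)
  have hinj: "h y = h w \<Longrightarrow> y = w" if "y \<in> X" "w \<in> X" for y w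
    using stereo_inj[of "f y" "f w"] Xf[OF that(1)] Xf[OF that(2)] finj by (simp add: h_def)
  have hm: "h (- y) = antip (h y)" "h y \<noteq> 0" if "y \<in> X" for y
    using Xf[OF that] stereo_minus[of "f y"] stereo_eq_0[of "f y"] by (auto simp: h_def fm)
  have hcont: "continuous_on X h"
    unfolding h_def
  proof (rule continuous_on_compose2[OF continuous_stereo])
    show "continuous_on X f" using lin by (simp add: linear_continuous_on linear_conv_bounded_linear)
    show "f ` X \<subseteq> {y. y $ 3 \<noteq> 1}" using Xf north by blast
  qed
  have PX: "flip b (P v) \<in> X" if "v \<in> V" for v b
    using P1[OF that] u(2)[OF that] by (auto simp: X_def flip_def S_def)
  have HX: "flip b (H e x) \<in> X" if "e \<in> E" "x \<in> {0..1}" for e x b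
    using H1[OF that] u(3)[OF that] by (auto simp: X_def flip_def S_def)
  have fl: "flip b y = flip b' w \<Longrightarrow> y = w \<or> y = - w" for b b' y w by (auto simp: flip_def split: if_splits)
  define Q where "Q = (\<lambda>(v, b). h (flip b (P v)))"
  define \<Gamma> where "\<Gamma> = (\<lambda>(e, b) x. h (flip b (H e x)))"

  have \<Gamma>eq: "x = y \<and> b = b'" if "e \<in> E" "x \<in> {0<..<1}" "y \<in> {0..1}" "\<Gamma> (e, b) x = \<Gamma> (e, b') y" for e x y b b'
  proof -
    have eq: "flip b (H e x) = flip b' (H e y)" using that hinj[OF HX HX] by (auto simp: \<Gamma>_def)
    then have "x = y" using Hinj[OF that(1-3)] fl by blast
    moreover have "b = b'" using eq ne[OF H1[OF that(1,3)]] \<open>x = y\<close> by (auto simp: flip_def split: if_splits)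
    ultimately show ?thesis by simp
  qed
  have "plane_graph (V \<times> UNIV) (E \<times> UNIV) (\<lambda>(e, b). (s e, b)) (\<lambda>(e, b). (t e, b \<noteq> c e)) Q \<Gamma>"
  proof (intro plane_graph.intro plane_graph_axioms.intro)
    show "fgraph (V \<times> UNIV) (E \<times> UNIV) (\<lambda>(e, b). (s e, b)) (\<lambda>(e, b). (t e, b \<noteq> c e))"
      using finite_V finite_E ends_in_V by unfold_locales auto
    show "inj_on Q (V \<times> UNIV)"
    proof (rule inj_onI, clarify)
      fix v b v' b' assume v: "v \<in> V" "v' \<in> V" "Q (v, b) = Q (v', b')"
      then have eq: "flip b (P v) = flip b' (P v')" using hinj[OF PX PX] by (auto simp: Q_def)
      then have "v = v'" using Pinj v fl by blast
      moreover have "b = b'" using eq ne[OF P1[OF v(1)]] \<open>v = v'\<close> by (auto simp: flip_def split: if_splits)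
      ultimately show "v = v' \<and> b = b'" by simp
    qed
    show "simple_path (\<Gamma> eb)" if eb: "eb \<in> E \<times> UNIV" for eb
    proof -
      obtain e b where e: "eb = (e, b)" "e \<in> E" using eb by auto
      have "continuous_on {0..1} (\<lambda>x. flip b (H e x))"
        using Hp[OF e(2)] by (cases b) (auto simp: path_def flip_def intro!: continuous_intros)
      then have "path (\<Gamma> eb)" unfolding path_def e(1) \<Gamma>_def
        using HX[OF e(2)] by (auto intro!: continuous_on_compose2[OF hcont])
      moreover have "x = y \<or> x = 0 \<and> y = 1 \<or> x = 1 \<and> y = 0" if "x \<in> {0..1}" "y \<in> {0..1}" "\<Gamma> eb x = \<Gamma> eb y" for x y
      proof (cases "x \<in> {0<..<1} \<or> y \<in> {0<..<1}")
        case True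
        then show ?thesis using \<Gamma>eq[OF e(2), of x y b b] \<Gamma>eq[OF e(2), of y x b b] that e(1) by metis
      qed (use that in auto)
      ultimately show ?thesis by (auto simp: simple_path_def loop_free_def)
    qed
    show "pathstart (\<Gamma> eb) = Q (case eb of (e, b) \<Rightarrow> (s e, b))" if "eb \<in> E \<times> UNIV" for eb
      using that Hs by (auto simp: \<Gamma>_def Q_def pathstart_def)
    show "pathfinish (\<Gamma> eb) = Q (case eb of (e, b) \<Rightarrow> (t e, b \<noteq> c e))" if "eb \<in> E \<times> UNIV" for eb
      using that Ht by (auto simp: \<Gamma>_def Q_def pathfinish_def flip_def)
    show "\<Gamma> eb ` {0<..<1} \<inter> Q ` (V \<times> UNIV) = {}" if eb: "eb \<in> E \<times> UNIV" for eb
    proof (rule ccontr)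
      obtain e b where e: "eb = (e, b)" "e \<in> E" using eb by auto
      assume "\<Gamma> eb ` {0<..<1} \<inter> Q ` (V \<times> UNIV) \<noteq> {}"
      then obtain x v b' where x: "x \<in> {0<..<1}" "v \<in> V" "\<Gamma> (e, b) x = Q (v, b')" unfolding e by blast
      then have "flip b (H e x) = flip b' (P v)" using hinj[OF HX[OF e(2)] PX[OF x(2)]] by (auto simp: \<Gamma>_def Q_def)
      then show False using fl HV[OF e(2) x(2,1)] by blast
    qed
    show "\<Gamma> eb ` {0<..<1} \<inter> path_image (\<Gamma> eb') = {}" if eb: "eb \<in> E \<times> UNIV" "eb' \<in> E \<times> UNIV" "eb \<noteq> eb'" for eb eb'
    proof (rule ccontr)
      obtain e b e' b' where e: "eb = (e, b)" "e \<in> E" "eb' = (e', b')" "e' \<in> E" using eb by auto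
      assume "\<Gamma> eb ` {0<..<1} \<inter> path_image (\<Gamma> eb') \<noteq> {}"
      then obtain x y where x: "x \<in> {0<..<1}" "y \<in> {0..1}" "\<Gamma> (e, b) x = \<Gamma> (e', b') y"
        unfolding e path_image_def by blast
      show False
      proof (cases "e = e'")
        case True
        then show ?thesis using \<Gamma>eq[OF e(2) x(1,2)] x(3) eb(3) e by blast
      next
        case False
        have "flip b (H e x) = flip b' (H e' y)" using hinj[OF HX[OF e(2)] HX[OF e(4) x(2)]] x by (auto simp: \<Gamma>_def)
        then show False using fl Hd[OF e(2,4) False x(1,2)] by blast
      qed
    qed
  qed
  moreover have nb: "flip (\<not> b) y = - flip b y" for b y by (simp add: flip_def)
  have "Q (v, b) \<noteq> 0 \<and> Q (v, \<not> b) = antip (Q (v, b))" if "v \<in> V" for v b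
    using hm[OF PX[OF that]] by (simp add: Q_def nb)
  moreover have "\<Gamma> (e, b) x \<noteq> 0 \<and> \<Gamma> (e, \<not> b) x = antip (\<Gamma> (e, b) x)" if "e \<in> E" "x \<in> {0..1}" for e b x
    using hm[OF HX[OF that]] by (simp add: \<Gamma>_def nb)
  ultimately show ?thesis using that by blast
qed

section \<open>Double covers of graphs in the projective plane\<close>

subsection \<open>Winding numbers and the antipodal map\<close>

text \<open>Two continuous logarithms of the same path differ by a constant multiple of 2 pi i, so
  each of them computes the winding number.\<close>

lemma winding_number_log:
  assumes "path p" "path q" "\<And>x. x \<in> {0..1} \<Longrightarrow> p x = \<zeta> + exp (q x)"
  shows "winding_number p \<zeta> = (q 1 - q 0) / (2 * pi * \<i>)"
proof -
  have \<zeta>: "\<zeta> \<notin> path_image p" using assms(3) by (auto simp: path_image_def)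
  obtain r where r: "path r" "pathfinish r - pathstart r = 2 * of_real pi * \<i> * winding_number p \<zeta>"
    "\<And>x. x \<in> {0..1} \<Longrightarrow> p x = \<zeta> + exp (r x)" using winding_number_as_continuous_log[OF assms(1) \<zeta>] by blast
  define d where "d x = (q x - r x) / (2 * pi * \<i>)" for x
  have "d 0 = d 1"
  proof (rule continuous_Ints_constant[of "{0..1::real}"])
    show "continuous_on {0..1} d" unfolding d_def using assms(2) r(1) by (auto simp: path_def intro!: continuous_intros)
    fix x :: real assume "x \<in> {0..1}"
    then have "exp (q x) = exp (r x)" using assms(3) r(3) by (metis add_left_cancel)
    then obtain n where n: "q x = r x + of_int (2 * n) * pi * \<i>" by (auto simp: exp_eq)
    have "d x = of_int n" unfolding d_def n by (simp add: field_simps)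
    then show "d x \<in> \<int>" by simp
  qed auto
  then have "q 1 - q 0 = r 1 - r 0" by (simp add: d_def field_simps)
  then show ?thesis using r(2) by (simp add: pathfinish_def pathstart_def)
qed

lemma antip_antip: "x \<noteq> 0 \<Longrightarrow> antip (antip x) = x"
  by (simp add: antip_def)

lemma antip_nonzero: "x \<noteq> 0 \<Longrightarrow> antip x \<noteq> 0"
  by (simp add: antip_def)

lemma continuous_antip: "0 \<notin> S \<Longrightarrow> continuous_on S antip"
  unfolding antip_def by (intro continuous_intros) auto

text \<open>By \<open>antip u - antip v = cnj ((u - v) / (u * v))\<close> a logarithm along the
  antipodal path is the conjugate of a difference of logarithms. Open paths have winding numbers
  with imaginary parts, which conjugation treats differently, so real parts are compared.\<close>

lemma winding_number_antip:
  assumes \<alpha>: "path \<alpha>" "path \<beta>" "\<And>x. x \<in> {0..1} \<Longrightarrow> \<alpha> x \<noteq> 0 \<and> \<beta> x = antip (\<alpha> x)" and \<zeta>: "\<zeta> \<noteq> 0" "\<zeta> \<notin> path_image \<alpha>"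
  shows "Re (winding_number \<beta> (antip \<zeta>)) = Re (winding_number \<alpha> 0) - Re (winding_number \<alpha> \<zeta>)"
proof -
  have 0: "0 \<notin> path_image \<alpha>" using \<alpha>(3) by (force simp: path_image_def)
  obtain l where l: "path l" "pathfinish l - pathstart l = 2 * of_real pi * \<i> * winding_number \<alpha> 0"
    "\<And>x. x \<in> {0..1} \<Longrightarrow> \<alpha> x = 0 + exp (l x)" using winding_number_as_continuous_log[OF \<alpha>(1) 0] by blast
  obtain m where m: "path m" "pathfinish m - pathstart m = 2 * of_real pi * \<i> * winding_number \<alpha> \<zeta>"
    "\<And>x. x \<in> {0..1} \<Longrightarrow> \<alpha> x = \<zeta> + exp (m x)" using winding_number_as_continuous_log[OF \<alpha>(1) \<zeta>(2)] by blast
  define q where "q x = cnj (m x - l x - Ln \<zeta>)" for x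
  have "winding_number \<beta> (antip \<zeta>) = (q 1 - q 0) / (2 * pi * \<i>)"
  proof (rule winding_number_log[OF \<alpha>(2)])
    show "path q" using l(1) m(1) unfolding q_def path_def by (intro continuous_intros)
    fix x :: real assume x: "x \<in> {0..1}"
    have e1: "exp (l x) = \<alpha> x" using l(3)[OF x] by simp
    have e2: "exp (m x) = \<alpha> x - \<zeta>" using m(3)[OF x] by simp
    have "exp (m x - l x - Ln \<zeta>) = (\<alpha> x - \<zeta>) / (\<alpha> x * \<zeta>)"
      unfolding exp_diff e1 e2 using \<zeta>(1) by (simp add: divide_divide_eq_left)
    then have "exp (q x) = cnj ((\<alpha> x - \<zeta>) / (\<alpha> x * \<zeta>))"
      unfolding q_def exp_cnj[symmetric] by simp
    also have "\<dots> = antip (\<alpha> x) - antip \<zeta>" using \<alpha>(3)[OF x] \<zeta>(1) by (simp add: antip_def field_simps)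
    finally show "\<beta> x = antip \<zeta> + exp (q x)" using \<alpha>(3)[OF x] by simp
  qed
  also have "q 1 - q 0 = cnj (2 * pi * \<i> * (winding_number \<alpha> \<zeta> - winding_number \<alpha> 0))"
    using l(2) m(2) by (simp add: q_def pathfinish_def pathstart_def algebra_simps flip: complex_cnj_diff)
  also have "\<dots> / (2 * pi * \<i>) = - cnj (winding_number \<alpha> \<zeta> - winding_number \<alpha> 0)"
    by (simp add: field_simps)
  finally show ?thesis by simp
qed

text \<open>\<open>antip a\<close> is a negative real multiple of \<open>a\<close>, so the argument
  changes by an odd multiple of pi.\<close>

lemma half_turn_winding:
  assumes \<alpha>: "path \<alpha>" "0 \<notin> path_image \<alpha>" "pathfinish \<alpha> = antip (pathstart \<alpha>)"
  obtains n :: int where "Re (winding_number \<alpha> 0) = 1/2 + of_int n"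
proof -
  define a where "a = pathstart \<alpha>"
  have a0: "a \<noteq> 0" using \<alpha>(2) by (metis a_def pathstart_in_path_image)
  define w where "w = winding_number \<alpha> 0"
  have "antip a = exp (2 * pi * \<i> * w) * a"
    using winding_number_exp_2pi[OF \<alpha>(1,2)] \<alpha>(3) by (simp add: a_def w_def)
  then have "exp (2 * pi * \<i> * w) = antip a / a" using a0 by simp
  also have "\<dots> = - of_real (1 / (cmod a)^2)"
    using a0 complex_norm_square[of a] by (simp add: antip_def field_simps)
  finally have e: "exp (2 * pi * \<i> * w) = - of_real (1 / (cmod a)^2)" .
  have "Re (exp (2 * pi * \<i> * w)) = exp (- (2 * pi * Im w)) * cos (2 * pi * Re w)"
    "Im (exp (2 * pi * \<i> * w)) = exp (- (2 * pi * Im w)) * sin (2 * pi * Re w)"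
    by (simp_all add: Re_exp Im_exp)
  then have "cos (2 * pi * Re w) < 0" "sin (2 * pi * Re w) = 0"
    using e a0 by (auto simp: mult_less_0_iff zero_less_divide_iff zero_less_mult_iff) (smt (verit, best) divide_pos_pos exp_gt_zero mult_nonneg_nonneg zero_less_norm_iff zero_less_power)+
  then obtain k :: int where k: "2 * pi * Re w = of_int k * pi" by (auto simp: sin_zero_iff_int2)
  have "odd k"
  proof
    assume "even k"
    then obtain j where "k = 2 * j" by (elim evenE)
    then have "cos (2 * pi * Re w) = 1" using k cos_int_2pin[of j] by (simp add: mult_ac)
    then show False using \<open>cos (2 * pi * Re w) < 0\<close> by simp
  qed
  then obtain j where "k = 2 * j + 1" by (elim oddE)
  moreover have "pi * (2 * Re w) = pi * of_int k" using k by (simp add: mult_ac)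
  then have "2 * Re w = of_int k" by (simp only: mult_cancel_left) simp
  ultimately have "Re w = 1/2 + of_int j" by simp
  then show ?thesis using that by (simp add: w_def)
qed

subsection \<open>Free involutions\<close>

text \<open>Coordinates for antisymmetric functions: one index for each pair of partners and a sign
  that tells the partners apart.\<close>

lemma free_involution_index:
  assumes "finite \<Phi>" "\<And>F. F \<in> \<Phi> \<Longrightarrow> \<sigma> F \<in> \<Phi> \<and> \<sigma> F \<noteq> F \<and> \<sigma> (\<sigma> F) = F"
  obtains m :: nat and idx :: "'f \<Rightarrow> nat" and sg :: "'f \<Rightarrow> int" where
    "\<And>F. F \<in> \<Phi> \<Longrightarrow> idx F < m" "\<And>F F'. F \<in> \<Phi> \<Longrightarrow> F' \<in> \<Phi> \<Longrightarrow> idx F = idx F' \<longleftrightarrow> F' = F \<or> F' = \<sigma> F"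
    "\<And>F. F \<in> \<Phi> \<Longrightarrow> sg F = 1 \<or> sg F = -1" "\<And>F. F \<in> \<Phi> \<Longrightarrow> sg (\<sigma> F) = - sg F"
    "\<And>i. i < m \<Longrightarrow> \<exists>F\<in>\<Phi>. idx F = i \<and> sg F = 1"
proof -
  define q where "q F = {F, \<sigma> F}" for F
  have q: "q F = q F' \<longleftrightarrow> F' = F \<or> F' = \<sigma> F" if "F \<in> \<Phi>" "F' \<in> \<Phi>" for F F'
    using assms(2)[OF that(1)] assms(2)[OF that(2)] by (auto simp: q_def doubleton_eq_iff)
  obtain \<iota> where \<iota>: "bij_betw \<iota> (q ` \<Phi>) {0..<card (q ` \<Phi>)}"
    using ex_bij_betw_finite_nat[of "q ` \<Phi>"] assms(1) by auto
  define r where "r X = (SOME F. F \<in> X)" for X :: "'f set"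
  have r: "r (q F) = F \<or> r (q F) = \<sigma> F" for F
    using someI[of "\<lambda>F'. F' \<in> q F" F] by (auto simp: r_def q_def)
  define sg :: "'f \<Rightarrow> int" where "sg F = (if r (q F) = F then 1 else -1)" for F
  have q\<sigma>: "q (\<sigma> F) = q F" if "F \<in> \<Phi>" for F using assms(2)[OF that] by (auto simp: q_def)
  show ?thesis
  proof (rule that[of "\<lambda>F. \<iota> (q F)" "card (q ` \<Phi>)" sg])
    show "\<iota> (q F) < card (q ` \<Phi>)" if "F \<in> \<Phi>" for F using \<iota> that by (auto simp: bij_betw_def)
    show "\<iota> (q F) = \<iota> (q F') \<longleftrightarrow> F' = F \<or> F' = \<sigma> F" if "F \<in> \<Phi>" "F' \<in> \<Phi>" for F F'
      using \<iota> that q[OF that] by (auto simp: bij_betw_def inj_on_def)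
    show "sg F = 1 \<or> sg F = -1" for F by (simp add: sg_def)
    show sg\<sigma>: "sg (\<sigma> F) = - sg F" if "F \<in> \<Phi>" for F using r[of F] q\<sigma>[OF that] assms(2)[OF that] by (auto simp: sg_def)
    show "\<exists>F\<in>\<Phi>. \<iota> (q F) = i \<and> sg F = 1" if "i < card (q ` \<Phi>)" for i
    proof -
      have "i \<in> \<iota> ` (q ` \<Phi>)" using \<iota> that by (simp add: bij_betw_def)
      then obtain F where F: "F \<in> \<Phi>" "\<iota> (q F) = i" by auto
      show ?thesis
      proof (cases "sg F = 1")
        case False
        then have "sg (\<sigma> F) = 1" using sg\<sigma>[OF F(1)] by (auto simp: sg_def split: if_splits)
        then show ?thesis using F assms(2)[OF F(1)] q\<sigma>[OF F(1)] by (intro bexI[of _ "\<sigma> F"]) auto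
      qed (use F in blast)
    qed
  qed
qed

locale double_cover = fgraph V E s t for V :: "'v set" and E :: "'e set" and s t +
  fixes c :: "'e \<Rightarrow> bool"
begin

abbreviation "V2 \<equiv> V \<times> (UNIV :: bool set)"
abbreviation "E2 \<equiv> E \<times> (UNIV :: bool set)"
abbreviation "s2 \<equiv> \<lambda>(e, b::bool). (s e, b)"
abbreviation "t2 \<equiv> \<lambda>(e, b::bool). (t e, b \<noteq> c e)"

lemma fgraph2: "fgraph V2 E2 s2 t2"
  using finite_V finite_E ends_in_V by unfold_locales auto

lemma sum_E2: "(\<Sum>eb\<in>E2. f eb) = (\<Sum>e\<in>E. f (e, False) + f (e, True))"
proof -
  have "(\<Sum>eb\<in>E2. f eb) = (\<Sum>(e, b)\<in>E \<times> UNIV. f (e, b))" by simp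
  also have "\<dots> = (\<Sum>e\<in>E. \<Sum>b\<in>UNIV. f (e, b))" by (rule sum.cartesian_product[symmetric])
  finally show ?thesis by (simp add: UNIV_bool)
qed

text \<open>Summing a potential over the two sheets gives a potential of \<open>2 * x\<close>. Its
  differences along edges are even, so \<open>div 2\<close> halves them exactly, even where the
  values themselves are odd.\<close>

lemma coboundary_descends:
  assumes x: "x \<in> C1 E"
  shows "(\<lambda>(e, b). x e) \<in> coboundaries V2 E2 s2 t2 \<longleftrightarrow> x \<in> coboundaries V E s t"
proof
  assume "(\<lambda>(e, b). x e) \<in> coboundaries V2 E2 s2 t2"
  then obtain f where f: "(\<lambda>(e, b). x e) = coboundary E2 s2 t2 f" by (auto simp: coboundaries_def)
  define h where "h v = f (v, False) + f (v, True)" for v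
  have h: "2 * x e = h (t e) - h (s e)" if "e \<in> E" for e
    using fun_cong[OF f, of "(e, False)"] fun_cong[OF f, of "(e, True)"] that
    by (cases "c e") (simp_all add: coboundary_def h_def)
  have "x e = h (t e) div 2 - h (s e) div 2" if "e \<in> E" for e
    using h[OF that] by presburger
  then show "x \<in> coboundaries V E s t" by (intro coboundariesI[OF x, where f="\<lambda>v. h v div 2"])
next
  interpret C: fgraph V2 E2 s2 t2 by (rule fgraph2)
  assume "x \<in> coboundaries V E s t"
  then obtain f where "x = coboundary E s t f" by (auto simp: coboundaries_def)
  then show "(\<lambda>(e, b). x e) \<in> coboundaries V2 E2 s2 t2"
    by (intro C.coboundariesI[where f="f \<circ> fst"]) (auto simp: coboundary_def C1_def)
qed

text \<open>The two lifts of an edge have antisymmetric boundaries in the dual of the cover; identifying F with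
  minus its image under the involution turns the lattice of type A of the cover into one of type D.\<close>

lemma antisymmetric_dual_map_D:
  assumes D: "dual_data V2 E2 s2 t2 \<Phi> L R W"
    and \<sigma>: "\<And>F. F \<in> \<Phi> \<Longrightarrow> \<sigma> F \<in> \<Phi> \<and> \<sigma> F \<noteq> F \<and> \<sigma> (\<sigma> F) = F"
    and anti: "\<And>e b (h :: 'f \<Rightarrow> int). e \<in> E \<Longrightarrow> h (L (e, b)) - h (R (e, b)) = h (\<sigma> (R (e, \<not> b))) - h (\<sigma> (L (e, \<not> b)))"
    and good: "\<And>e. e \<in> E \<Longrightarrow> L (e, False) \<noteq> \<sigma> (R (e, False))"
  shows "has_emm_D V E s t (genus V E s t)"
proof -
  interpret D: dual_data V2 E2 s2 t2 \<Phi> L R W by (rule D)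
  interpret G: fgraph \<Phi> E2 R L by (rule D.fgraph_dual)
  obtain m :: nat and idx :: "'f \<Rightarrow> nat" and sg :: "'f \<Rightarrow> int" where
    idx: "\<And>F. F \<in> \<Phi> \<Longrightarrow> idx F < m" "\<And>F F'. F \<in> \<Phi> \<Longrightarrow> F' \<in> \<Phi> \<Longrightarrow> idx F = idx F' \<longleftrightarrow> F' = F \<or> F' = \<sigma> F"
    and sg: "\<And>F. F \<in> \<Phi> \<Longrightarrow> sg F = 1 \<or> sg F = -1" "\<And>F. F \<in> \<Phi> \<Longrightarrow> sg (\<sigma> F) = - sg F"
    and ex: "\<And>i. i < m \<Longrightarrow> \<exists>F\<in>\<Phi>. idx F = i \<and> sg F = 1"
    by (rule free_involution_index[OF D.finite_\<Phi> \<sigma>], assumption) (rule that, assumption+)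
  define \<pi> where "\<pi> i F = sg F * of_bool (idx F = i)" for i F
  have idx\<sigma>: "idx (\<sigma> F) = idx F" if "F \<in> \<Phi>" for F using idx(2)[OF that, of "\<sigma> F"] \<sigma>[OF that] by simp
  have \<pi>\<sigma>: "\<pi> i (\<sigma> F) = - \<pi> i F" if "F \<in> \<Phi>" for i F using that by (simp add: \<pi>_def sg(2) idx\<sigma>)
  \<comment> \<open>Only the lift \<open>(e, False)\<close> appears; by antisymmetry the other lift
    contributes the same value, as \<open>sheet\<close> shows.\<close>
  define \<phi> where "\<phi> x i = (\<Sum>e\<in>E. x e * (\<pi> i (L (e, False)) - \<pi> i (R (e, False))))" for x i
  have LR: "L (e, b) \<in> \<Phi>" "R (e, b) \<in> \<Phi>" if "e \<in> E" for e b using D.LR_\<Phi>[of "(e, b)"] that by auto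
  have sheet: "\<pi> i (L (e, True)) - \<pi> i (R (e, True)) = \<pi> i (L (e, False)) - \<pi> i (R (e, False))" if "e \<in> E" for e i
    using anti[OF that, of "\<pi> i" True] LR[OF that] by (simp add: \<pi>\<sigma>)
  have pair: "(\<Sum>F\<in>\<Phi>. \<pi> i F * bdry E2 R L y F) = \<phi> (\<lambda>e. y (e, False) + y (e, True)) i" for y i
    unfolding G.coboundary_pairing[symmetric] sum_E2 \<phi>_def
    by (intro sum.cong) (auto simp: sheet algebra_simps)
  \<comment> \<open>Pulled back to both lifts, \<open>x\<close> has an antisymmetric dual boundary
    with the values of \<open>\<phi> x\<close> up to sign. So the kernel of \<open>\<phi>\<close> is
    read off in the cover, and \<open>coboundary_descends\<close> transfers it to the graph.\<close>
  have bd: "bdry E2 R L (\<lambda>(e, b). x e) F = sg F * \<phi> x (idx F)" if F: "F \<in> \<Phi>" for x F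
  proof -
    define h :: "'f \<Rightarrow> int" where "h F' = of_bool (F' = F)" for F'
    have key: "h (L (e, True)) - h (R (e, True)) = h (\<sigma> (R (e, False))) - h (\<sigma> (L (e, False)))" if "e \<in> E" for e
      using anti[OF that, of h True] by simp
    have "bdry E2 R L (\<lambda>(e, b). x e) F = (\<Sum>e\<in>E. x e * (h (L (e, False)) - h (R (e, False))) + x e * (h (L (e, True)) - h (R (e, True))))"
      unfolding bdry_def sum_E2 h_def by simp
    also have "\<dots> = (\<Sum>e\<in>E. x e * ((h (L (e, False)) - h (\<sigma> (L (e, False)))) - (h (R (e, False)) - h (\<sigma> (R (e, False))))))"
      by (intro sum.cong refl) (simp add: key algebra_simps)
    also have "\<dots> = (\<Sum>e\<in>E. x e * (sg F * (\<pi> (idx F) (L (e, False)) - \<pi> (idx F) (R (e, False)))))"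
    proof -
      have "h F' - h (\<sigma> F') = sg F * \<pi> (idx F) F'" if F': "F' \<in> \<Phi>" for F'
      proof -
        have "F' = F \<or> F' = \<sigma> F \<longleftrightarrow> idx F' = idx F" using idx(2)[OF F F'] by auto
        moreover have "\<sigma> F' = F \<longleftrightarrow> F' = \<sigma> F" using \<sigma>[OF F] \<sigma>[OF F'] by auto
        ultimately show ?thesis
          using \<sigma>[OF F] sg(1)[OF F] sg(2)[OF F] by (auto simp: h_def \<pi>_def)
      qed
      then show ?thesis using LR by (intro sum.cong) (auto simp: algebra_simps)
    qed
    finally show ?thesis by (simp add: \<phi>_def sum_distrib_left mult_ac)
  qed
  have out: "\<phi> x i = 0" if "i \<ge> m" for x i
  proof -
    have "\<pi> i F = 0" if "F \<in> \<Phi>" for F using idx(1)[OF that] \<open>i \<ge> m\<close> by (auto simp: \<pi>_def)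
    then show ?thesis using LR by (auto simp: \<phi>_def intro!: sum.neutral)
  qed
  have "H1_map V E s t \<phi>"
  proof
    show "\<phi> (\<lambda>e. x e + y e) = (\<lambda>i. \<phi> x i + \<phi> y i)" for x y
      by (auto simp: \<phi>_def distrib_right sum.distrib)
    fix x assume x: "x \<in> C1 E"
    have "(\<lambda>(e, b). x e) \<in> C1 E2" using x by (auto simp: C1_def)
    then have "(\<forall>F\<in>\<Phi>. bdry E2 R L (\<lambda>(e, b). x e) F = 0) \<longleftrightarrow> x \<in> coboundaries V E s t"
      using D.bdry_dual_zero_iff coboundary_descends[OF x] by blast
    moreover have "\<phi> x = (\<lambda>i. 0) \<longleftrightarrow> (\<forall>F\<in>\<Phi>. bdry E2 R L (\<lambda>(e, b). x e) F = 0)"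
    proof
      assume 0: "\<forall>F\<in>\<Phi>. bdry E2 R L (\<lambda>(e, b). x e) F = 0"
      show "\<phi> x = (\<lambda>i. 0)"
      proof
        fix i
        show "\<phi> x i = 0"
        proof (cases "i < m")
          case True
          then obtain F where "F \<in> \<Phi>" "idx F = i" "sg F = 1" using ex by blast
          then show ?thesis using 0 bd by force
        qed (use out in simp)
      qed
    qed (simp add: bd)
    ultimately show "\<phi> x = (\<lambda>i. 0) \<longleftrightarrow> x \<in> coboundaries V E s t" by simp
  qed
  then interpret H1_map V E s t \<phi> .
  have sum\<pi>: "(\<Sum>i<m. \<pi> i F) = sg F" if "F \<in> \<Phi>" for F
    using idx(1)[OF that] by (simp add: \<pi>_def of_bool_def if_distrib cong: if_cong)
  have im: "\<phi> ` C1 E = D_lattice m"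
  proof (intro equalityI subsetI)
    fix y assume "y \<in> \<phi> ` C1 E"
    then obtain x where y: "y = \<phi> x" by auto
    have "(\<Sum>i<m. \<phi> x i) = (\<Sum>e\<in>E. x e * (sg (L (e, False)) - sg (R (e, False))))"
      unfolding \<phi>_def by (subst sum.swap) (auto simp: sum_distrib_left[symmetric] sum_subtractf sum\<pi> LR intro!: sum.cong)
    moreover have "even (sg (L (e, False)) - sg (R (e, False)))" if "e \<in> E" for e
      using sg(1)[OF LR(1)[OF that, of False]] sg(1)[OF LR(2)[OF that, of False]] by (elim disjE) simp_all
    ultimately have "even (\<Sum>i<m. \<phi> x i)" by (simp add: dvd_sum)
    then show "y \<in> D_lattice m" using out by (simp add: D_lattice_def y)
  next
    fix y assume y: "y \<in> D_lattice m"
    obtain F0 where F0: "F0 \<in> \<Phi>" using D.\<Phi>_nonempty by auto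
    obtain k where k: "(\<Sum>i<m. y i) = 2 * k" using y by (auto simp: D_lattice_def elim!: evenE)
    obtain G where G: "\<And>i. i < m \<Longrightarrow> G i \<in> \<Phi> \<and> idx (G i) = i \<and> sg (G i) = 1" using ex by metis
    define \<Phi>1 where "\<Phi>1 = {F \<in> \<Phi>. sg F = 1}"
    have \<Phi>1: "\<Phi>1 = G ` {..<m}"
    proof (intro equalityI subsetI)
      fix F assume "F \<in> \<Phi>1"
      then have F: "F \<in> \<Phi>" "sg F = 1" by (auto simp: \<Phi>1_def)
      then have "F = G (idx F)" using idx(2)[of "G (idx F)" F] G[OF idx(1)[OF F(1)]] sg(2)[of "G (idx F)"] by auto
      then show "F \<in> G ` {..<m}" using idx(1)[OF F(1)] by blast
    qed (use G in \<open>auto simp: \<Phi>1_def\<close>)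
    have Ginj: "inj_on G {..<m}" using G by (metis inj_onI lessThan_iff)
    have sum1: "(\<Sum>F\<in>\<Phi>. of_bool (sg F = 1) * f F) = (\<Sum>i<m. f (G i))" for f :: "'f \<Rightarrow> int"
    proof -
      have "(\<Sum>F\<in>\<Phi>. of_bool (sg F = 1) * f F) = (\<Sum>F\<in>\<Phi>1. f F)"
        unfolding \<Phi>1_def using D.finite_\<Phi> by (intro sum.mono_neutral_cong_right) auto
      then show ?thesis unfolding \<Phi>1 using sum.reindex[OF Ginj, of f] by simp
    qed
    have sum0: "(\<Sum>F\<in>\<Phi>. f F * of_bool (F = X)) = f X" if "X \<in> \<Phi>" for f :: "'f \<Rightarrow> int" and X
      using D.finite_\<Phi> that by (simp add: of_bool_def if_distrib cong: if_cong)
    \<comment> \<open>\<open>y\<close> is put on the positive faces, where its sum is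
      \<open>2 * k\<close>. Subtracting \<open>k\<close> at a face and at its partner makes the sum
      zero, and the correction cancels in the antisymmetric coordinates.\<close>
    define Y where "Y F = of_bool (sg F = 1) * y (idx F) - k * of_bool (F = F0) - k * of_bool (F = \<sigma> F0)" for F
    have "(\<Sum>F\<in>\<Phi>. Y F) = (\<Sum>i<m. y (idx (G i))) - k - k"
      unfolding Y_def sum_subtractf sum1[of "\<lambda>F. y (idx F)"] using sum0[OF F0, of "\<lambda>_. k"] sum0[of "\<sigma> F0" "\<lambda>_. k"] \<sigma>[OF F0] by simp
    also have "(\<Sum>i<m. y (idx (G i))) = (\<Sum>i<m. y i)" using G by (intro sum.cong) auto
    finally have "(\<Sum>F\<in>\<Phi>. Y F) = 0" using k by simp
    then obtain x where x: "x \<in> C1 E2" "\<And>F. F \<in> \<Phi> \<Longrightarrow> bdry E2 R L x F = Y F" using D.bdry_dual_surj by metis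
    define z where "z e = x (e, False) + x (e, True)" for e
    have "\<phi> z i = y i" for i
    proof (cases "i < m")
      case True
      have "\<phi> z i = (\<Sum>F\<in>\<Phi>. \<pi> i F * Y F)" unfolding z_def pair[symmetric] using x(2) by (intro sum.cong) auto
      also have "\<dots> = (\<Sum>F\<in>\<Phi>. of_bool (sg F = 1) * (\<pi> i F * y (idx F))) - (\<Sum>F\<in>\<Phi>. (k * \<pi> i F) * of_bool (F = F0)) - (\<Sum>F\<in>\<Phi>. (k * \<pi> i F) * of_bool (F = \<sigma> F0))"
        unfolding sum_subtractf[symmetric] by (intro sum.cong) (auto simp: Y_def algebra_simps)
      also have "\<dots> = (\<Sum>j<m. \<pi> i (G j) * y (idx (G j)))"
        unfolding sum1 using sum0[OF F0] sum0[of "\<sigma> F0"] \<sigma>[OF F0] \<pi>\<sigma>[OF F0] by simp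
      also have "\<dots> = (\<Sum>j<m. if j = i then y j else 0)" using G by (intro sum.cong) (auto simp: \<pi>_def)
      finally show ?thesis using True by simp
    next
      case False
      then show ?thesis using out y by (simp add: D_lattice_def)
    qed
    moreover have "z \<in> C1 E" using x(1) by (auto simp: z_def C1_def)
    ultimately show "y \<in> \<phi> ` C1 E" by (metis ext imageI)
  qed
  have g: "m = genus V E s t" using im by (rule rank_D)
  show ?thesis
  proof (rule has_emm_DI[OF im[unfolded g]])
    fix e assume e: "e \<in> E" "\<not> bridge E s t e"
    let ?L = "L (e, False)" and ?R = "R (e, False)"
    have co: "\<phi> (coedge e) = (\<lambda>i. \<pi> i ?L - \<pi> i ?R)"
      unfolding \<phi>_def using sum_mult_coedge(2)[OF finite_E e(1)] by auto
    have "?L \<noteq> ?R"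
    proof
      assume "?L = ?R"
      then have "\<phi> (coedge e) = (\<lambda>i. 0)" using co by simp
      then show False using \<phi>_kernel[OF coedge_C1[OF e(1)]] bridge_iff_coboundary[OF e(1)] e(2) by simp
    qed
    \<comment> \<open>If the sides were partners, the image would have a single entry 2 or -2 and
      squared norm 4; \<open>good\<close> excludes this.\<close>
    then have "idx ?R \<noteq> idx ?L" using idx(2)[OF LR(2) LR(1)] good e(1) by auto
    moreover have "\<phi> (coedge e) = (\<lambda>i. of_bool (i = idx ?L) * sg ?L + of_bool (i = idx ?R) * (- sg ?R))"
      unfolding co by (auto simp: \<pi>_def)
    ultimately show "sqnorm (\<phi> (coedge e)) (genus V E s t) = 2"
      using idx(1)[OF LR(1)[OF e(1), of False]] idx(1)[OF LR(2)[OF e(1), of False]]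
        sg(1)[OF LR(1)[OF e(1), of False]] sg(1)[OF LR(2)[OF e(1), of False]] g
      by (simp only:) (rule sqnorm_root, auto)
  qed
qed

end

subsection \<open>Graphs in the projective plane are planar or have a form of type D\<close>

context plane_graph begin

lemma plane_graph_subgraph:
  assumes "V' \<subseteq> V" "F \<subseteq> E" "\<And>e. e \<in> F \<Longrightarrow> s e \<in> V' \<and> t e \<in> V'"
  shows "plane_graph V' F s t p \<gamma>"
proof (intro plane_graph.intro plane_graph_axioms.intro)
  show "fgraph V' F s t" using assms finite_V finite_E by unfold_locales (auto intro: finite_subset)
  show "inj_on p V'" using p_inj assms(1) by (rule inj_on_subset)
  show "\<gamma> e ` {0<..<1} \<inter> p ` V' = {}" if "e \<in> F" for e using \<gamma>_V[of e] assms that by blast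
qed (use assms \<gamma>_simple \<gamma>_start \<gamma>_finish \<gamma>_disj in \<open>auto simp: subset_iff\<close>)

lemma subgraphs_intersection:
  assumes "V1 \<subseteq> V" "V2 \<subseteq> V" "E1 \<subseteq> E" "E2 \<subseteq> E" "E1 \<inter> E2 = {}"
    "\<And>e. e \<in> E1 \<Longrightarrow> s e \<in> V1 \<and> t e \<in> V1" "\<And>e. e \<in> E2 \<Longrightarrow> s e \<in> V2 \<and> t e \<in> V2"
    and x: "x \<in> p ` V1 \<union> (\<Union>e\<in>E1. path_image (\<gamma> e))" "x \<in> p ` V2 \<union> (\<Union>e\<in>E2. path_image (\<gamma> e))"
  shows "x \<in> p ` (V1 \<inter> V2)"
proof -
  have *: "x \<in> p ` V' \<or> (\<exists>e\<in>E'. x \<in> \<gamma> e ` {0<..<1})"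
    if "x \<in> p ` V' \<union> (\<Union>e\<in>E'. path_image (\<gamma> e))" "E' \<subseteq> E" "\<And>e. e \<in> E' \<Longrightarrow> s e \<in> V' \<and> t e \<in> V'" for V' E'
    using that edge_image by fast
  have A: "x \<notin> p ` V" "x \<notin> path_image (\<gamma> e')" if "e \<in> E" "x \<in> \<gamma> e ` {0<..<1}" "e' \<in> E" "e \<noteq> e'" for e e'
    using \<gamma>_V[OF that(1)] \<gamma>_disj[OF that(1,3,4)] that(2) by blast+
  have B: "x \<notin> p ` V" if "e \<in> E" "x \<in> \<gamma> e ` {0<..<1}" for e using \<gamma>_V[OF that(1)] that(2) by blast
  have C: "x \<in> path_image (\<gamma> e)" if "x \<in> \<gamma> e ` {0<..<1}" for e using that path_image_ends[of "\<gamma> e"] by auto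
  from *[OF x(1) assms(3,6)] *[OF x(2) assms(4,7)] consider
      "x \<in> p ` V1" "x \<in> p ` V2"
    | e where "e \<in> E1 \<union> E2" "x \<in> \<gamma> e ` {0<..<1}" "x \<in> p ` V"
    | e e' where "e \<in> E1" "x \<in> \<gamma> e ` {0<..<1}" "e' \<in> E2" "x \<in> \<gamma> e' ` {0<..<1}"
    using assms(1,2) by blast
  then show ?thesis
  proof cases
    case 1
    then obtain u w where "u \<in> V1" "w \<in> V2" "x = p u" "x = p w" by auto
    moreover from this have "u = w" using p_inj assms(1,2) by (meson inj_onD subsetD)
    ultimately show ?thesis by blast
  next
    case 2
    then show ?thesis using B assms(3,4) by blast
  next
    case 3
    then have "e \<noteq> e'" "e \<in> E" "e' \<in> E" using assms(3-5) by auto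
    then show ?thesis using A[of e e'] C 3 by blast
  qed
qed

lemma plane_graph_imp_planar: "planar V E s t"
proof -
  define h where "h z = (Re z, Im z)" for z
  have cont: "continuous_map (euclidean::complex topology) euclidean h"
    unfolding h_def by (simp add: continuous_on_Pair continuous_on_Re continuous_on_Im continuous_on_id)
  have inj: "inj_on h (topspace euclidean)" by (auto simp: h_def inj_on_def complex_eq_iff)
  have "graph_embeds (euclidean :: complex topology) V E s t"
    unfolding graph_embeds_def
  proof (intro exI[of _ p] exI[of _ \<gamma>] conjI ballI impI)
    fix e assume e: "e \<in> E"
    show "pathin euclidean (\<gamma> e)" using \<gamma>_path[OF e] by (simp add: pathin_euclidean)
    show "\<gamma> e 0 = p (s e)" "\<gamma> e 1 = p (t e)" using \<gamma>_start[OF e] \<gamma>_finish[OF e] by (simp_all add: pathstart_def pathfinish_def)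
    show "if s e = t e then inj_on (\<gamma> e) {0..<1} else inj_on (\<gamma> e) {0..1}"
    proof (cases "s e = t e")
      case True
      have "inj_on (\<gamma> e) {0..<1}"
        using \<gamma>_simple[OF e] by (force simp: simple_path_def loop_free_def inj_on_def)
      then show ?thesis using True by simp
    next
      case False
      then show ?thesis using \<gamma>_arc[OF e False] by (simp add: arc_def)
    qed
    show "\<gamma> e ` {0<..<1} \<inter> p ` V = {}" by (rule \<gamma>_V[OF e])
    fix e' assume "e' \<in> E" "e \<noteq> e'"
    then show "\<gamma> e ` {0<..<1} \<inter> \<gamma> e' ` {0..1} = {}" using \<gamma>_disj[OF e] by (simp add: path_image_def)
  qed (use p_inj in auto)
  then show ?thesis unfolding planar_def using cont inj by (rule graph_embeds_image)
qed

end

locale antipodal_graph = double_cover V E s t c +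
  C: plane_graph "V \<times> (UNIV :: bool set)" "E \<times> (UNIV :: bool set)" "\<lambda>(e, b::bool). (s e, b)" "\<lambda>(e, b::bool). (t e, b \<noteq> c e)" P \<Gamma>
  for V :: "'v set" and E :: "'e set" and s t c P \<Gamma> +
  assumes P_anti: "\<And>v b. v \<in> V \<Longrightarrow> P (v, b) \<noteq> 0 \<and> P (v, \<not> b) = antip (P (v, b))"
    and \<Gamma>_anti: "\<And>e b x. e \<in> E \<Longrightarrow> x \<in> {0..1} \<Longrightarrow> \<Gamma> (e, b) x \<noteq> 0 \<and> \<Gamma> (e, \<not> b) x = antip (\<Gamma> (e, b) x)"
begin

abbreviation KK :: "'e set \<Rightarrow> complex set" where "KK F \<equiv> C.K (F \<times> UNIV)"

text \<open>Some closed walk in \<open>F\<close> has an odd number of flags \<open>c\<close>, that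
  is, the cover is connected over some component. Reachability between the two lifts of a vertex
  expresses this without counting along walks.\<close>

definition unbalanced :: "'e set \<Rightarrow> bool" where
  "unbalanced F \<longleftrightarrow> (\<exists>v\<in>V. reach (F \<times> UNIV) s2 t2 (v, False) (v, True))"

lemma KK_antip: "F \<subseteq> E \<Longrightarrow> x \<in> KK F \<Longrightarrow> x \<noteq> 0 \<and> antip x \<in> KK F"
proof -
  assume F: "F \<subseteq> E" and x: "x \<in> KK F"
  then consider v b where "v \<in> V" "x = P (v, b)" | e b y where "e \<in> F" "y \<in> {0..1}" "x = \<Gamma> (e, b) y"
    unfolding C.K_def path_image_def by blast
  then show ?thesis
  proof cases
    case 1
    then have "x \<noteq> 0" "antip x = P (v, \<not> b)" using P_anti[OF 1(1), of b] by simp_all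
    then show ?thesis using C.p_in_K[of "(v, \<not> b)"] 1(1) by simp
  next
    case 2
    then have "x \<noteq> 0" "antip x = \<Gamma> (e, \<not> b) y" using \<Gamma>_anti[of e y b] F by auto
    then show ?thesis using C.edge_in_K[of "(e, \<not> b)" "F \<times> UNIV"] 2 by (auto simp: path_image_def)
  qed
qed

lemma zero_notin_KK: "F \<subseteq> E \<Longrightarrow> 0 \<notin> KK F"
  using KK_antip by blast

lemma antip_notin_KK: "F \<subseteq> E \<Longrightarrow> x \<notin> KK F \<Longrightarrow> x \<noteq> 0 \<Longrightarrow> antip x \<notin> KK F"
  using KK_antip antip_antip by metis

text \<open>The point 0 has no antipode in the plane; it can be removed since an open connected set
  of the plane stays connected without it.\<close>

lemma component_antip:
  assumes F: "F \<subseteq> E" and cc: "connected_component (- KK F) a b" and nz: "a \<noteq> 0" "b \<noteq> 0"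
  shows "connected_component (- KK F) (antip a) (antip b)"
proof -
  define S where "S = connected_component_set (- KK F) a"
  have "open (- KK F)" using C.closed_K[of "F \<times> UNIV"] F by auto
  then have "open S" unfolding S_def by (rule open_connected_component)
  moreover have "connected S" by (simp add: S_def)
  ultimately have conn: "connected (S - {0})" by (intro connected_open_delete) auto
  have SK: "S \<subseteq> - KK F" unfolding S_def by (rule connected_component_subset)
  have "connected (antip ` (S - {0}))" by (intro connected_continuous_image conn continuous_antip) auto
  moreover have "antip ` (S - {0}) \<subseteq> - KK F" using SK antip_notin_KK[OF F] by auto
  moreover have "a \<in> S" "b \<in> S" using cc unfolding S_def
    by (auto intro: connected_component_refl dest: connected_component_in)
  ultimately show ?thesis unfolding connected_component_def using nz by blast
qed

text \<open>A path in the drawing between the two lifts of a vertex, followed by its antipode, is a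
  closed curve. If a component contained an antipodal pair, the integral winding number there would
  equal that of the half turn around 0, which is 1/2 modulo 1.\<close>

lemma no_symmetric_component:
  assumes F: "F \<subseteq> E" "unbalanced F" and x: "x \<notin> KK F" "x \<noteq> 0"
  shows "\<not> connected_component (- KK F) x (antip x)"
proof
  assume cc: "connected_component (- KK F) x (antip x)"
  obtain v where v: "v \<in> V" "reach (F \<times> UNIV) s2 t2 (v, False) (v, True)" using F(2) by (auto simp: unbalanced_def)
  have "path_component (KK F) (P (v, False)) (P (v, True))"
    using v F(1) by (intro C.reach_path_component) auto
  then obtain \<alpha> where \<alpha>: "path \<alpha>" "path_image \<alpha> \<subseteq> KK F" "pathstart \<alpha> = P (v, False)" "pathfinish \<alpha> = P (v, True)"
    by (auto simp: path_component_def)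
  have ends: "P (v, True) = antip (P (v, False))" "P (v, False) = antip (P (v, True))"
    using P_anti[OF v(1), of False] P_anti[OF v(1), of True] by simp_all
  have nz: "\<alpha> y \<noteq> 0" if "y \<in> {0..1}" for y using \<alpha>(2) zero_notin_KK[OF F(1)] that by (force simp: path_image_def)
  define \<beta> where "\<beta> = antip \<circ> \<alpha>"
  have \<beta>: "path \<beta>" unfolding \<beta>_def
    using \<alpha> zero_notin_KK[OF F(1)] by (intro path_continuous_image continuous_antip) auto
  have \<beta>K: "path_image \<beta> \<subseteq> KK F" using \<alpha>(2) KK_antip[OF F(1)] by (auto simp: \<beta>_def path_image_compose)
  have ax: "antip x \<notin> KK F" "antip x \<noteq> 0" using antip_notin_KK[OF F(1) x] antip_nonzero x by auto
  have wn: "Re (winding_number \<beta> (antip y)) = Re (winding_number \<alpha> 0) - Re (winding_number \<alpha> y)"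
    if "y \<notin> KK F" "y \<noteq> 0" for y
    using winding_number_antip[OF \<alpha>(1) \<beta>, of y] nz that \<alpha>(2) by (auto simp: \<beta>_def)
  define C where "C = \<alpha> +++ \<beta>"
  have fin: "pathfinish \<alpha> = pathstart \<beta>" "pathfinish \<beta> = pathstart \<alpha>"
    by (simp add: \<beta>_def pathstart_compose \<alpha>(3,4) ends(1)[symmetric])
       (simp add: \<beta>_def pathfinish_compose \<alpha>(3,4) ends(2)[symmetric])
  have C: "path C" "pathfinish C = pathstart C" "path_image C \<subseteq> KK F"
    using \<alpha> \<beta> \<beta>K fin by (simp_all add: C_def path_image_join)
  have wC: "winding_number C y = winding_number \<alpha> y + winding_number \<beta> y" if "y \<notin> KK F" for y
    unfolding C_def using that \<alpha> \<beta> \<beta>K fin by (intro winding_number_join) auto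
  obtain S where S: "connected S" "S \<subseteq> - KK F" "x \<in> S" "antip x \<in> S" using cc by (auto simp: connected_component_def)
  have "winding_number C x = winding_number C (antip x)"
  proof -
    have "S \<inter> path_image C = {}" using S C(3) by blast
    then show ?thesis using winding_number_constant[OF C(1,2) S(1)] S(3,4) by (auto simp: constant_on_def)
  qed
  moreover have "winding_number C x \<in> \<int>" using integer_winding_number[OF C(1,2)] x C(3) by auto
  then obtain n where n: "winding_number C x = of_int n" by (elim Ints_cases)
  ultimately have "winding_number C (antip x) = of_int n" by simp
  then have "2 * of_int n = Re (winding_number C x) + Re (winding_number C (antip x))" using n by simp
  also have "\<dots> = 2 * Re (winding_number \<alpha> 0)"
    using wC[OF x(1)] wC[OF ax(1)] wn[OF x] wn[OF ax] antip_antip[OF x(2)] by simp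
  finally have "of_int n = Re (winding_number \<alpha> 0)" by simp
  moreover obtain k :: int where "Re (winding_number \<alpha> 0) = 1/2 + of_int k"
  proof (rule half_turn_winding[OF \<alpha>(1)])
    show "0 \<notin> path_image \<alpha>" using \<alpha>(2) zero_notin_KK[OF F(1)] by blast
    show "pathfinish \<alpha> = antip (pathstart \<alpha>)" unfolding \<alpha>(3,4) by (rule ends(1))
  qed (rule that)
  ultimately have "(of_int (2 * n) :: real) = of_int (2 * k + 1)" by simp
  then have "2 * n = 2 * k + 1" by (simp only: of_int_eq_iff)
  then show False by presburger
qed

lemma face_nonzero_point:
  assumes "X \<in> C.faces" obtains a where "a \<notin> KK E" "a \<noteq> 0" "X = C.face a"
proof -
  obtain a where a: "a \<notin> KK E" "X = C.face a" using assms by (auto simp: C.faces_def)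
  have "open (- KK E)" using C.closed_K[of E2] by auto
  then have op: "open X" unfolding a(2) C.face_def by (rule open_connected_component)
  moreover have "a \<in> X" using a by (simp add: C.face_def)
  ultimately have "X \<noteq> {0}" "X \<noteq> {}" using not_open_singleton by auto
  then obtain b where b: "b \<in> X" "b \<noteq> 0" by blast
  then have "connected_component (- KK E) a b" by (simp add: a(2) C.face_def)
  then have "C.face a = C.face b" "b \<notin> KK E" using C.face_eq_iff[OF a(1)] connected_component_in by blast+
  then show ?thesis using that[of b] a b by simp
qed

text \<open>The antipodal face. A representative different from 0 exists because faces are
  open.\<close>

definition sface :: "complex set \<Rightarrow> complex set" where
  "sface X = C.face (antip (SOME a. a \<notin> KK E \<and> a \<noteq> 0 \<and> X = C.face a))"

lemma sface_face: assumes "a \<notin> KK E" "a \<noteq> 0" shows "sface (C.face a) = C.face (antip a)"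
proof -
  define b where "b = (SOME b. b \<notin> KK E \<and> b \<noteq> 0 \<and> C.face a = C.face b)"
  have b: "b \<notin> KK E \<and> b \<noteq> 0 \<and> C.face a = C.face b" unfolding b_def by (rule someI[of _ a]) (use assms in auto)
  then have "connected_component (- KK E) (antip a) (antip b)"
    using C.face_eq_iff[OF assms(1)] component_antip[of E a b] assms by simp
  then have "C.face (antip a) = C.face (antip b)" using C.face_eq_iff[OF antip_notin_KK[OF order_refl assms]] by simp
  then show ?thesis unfolding sface_def b_def by simp
qed

lemma swap_cycle:
  assumes "is_cycle E2 s2 t2 z" shows "is_cycle E2 s2 t2 (\<lambda>(e, b). z (e, \<not> b))"
proof -
  have "bdry E2 s2 t2 (\<lambda>(e, b). z (e, \<not> b)) (v, d) = bdry E2 s2 t2 z (v, \<not> d)" for v d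
    unfolding bdry_def sum_E2 by (intro sum.cong refl) (cases d; auto simp: of_bool_def)
  then show ?thesis using assms by (auto simp: is_cycle_def)
qed

text \<open>The height at the face of 0 appears because the antipodal map moves infinity to 0. It is
  independent of \<open>a\<close> and cancels in the difference of the two sides of an edge.\<close>

lemma height_antip:
  assumes z: "is_cycle E2 s2 t2 z" and a: "a \<notin> KK E" "a \<noteq> 0"
  shows "C.height (\<lambda>(e, b). z (e, \<not> b)) (C.face (antip a)) = C.height z (C.face 0) - C.height z (C.face a)"
proof -
  have aa: "antip a \<notin> KK E" using antip_notin_KK[OF order_refl a] .
  have z0: "0 \<notin> KK E" using zero_notin_KK by blast
  have w: "Re (winding_number (\<Gamma> (e, \<not> b)) (antip a)) = Re (winding_number (\<Gamma> (e, b)) 0) - Re (winding_number (\<Gamma> (e, b)) a)"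
    if e: "e \<in> E" for e b
    using C.\<gamma>_path[of "(e, b)"] C.\<gamma>_path[of "(e, \<not> b)"] e \<Gamma>_anti[OF e] a C.edge_in_K[of "(e, b)" E2]
    by (intro winding_number_antip) auto
  have "Re (C.wind (\<lambda>(e, b). z (e, \<not> b)) (antip a)) = Re (C.wind z 0) - Re (C.wind z a)"
    unfolding C.wind_def Re_sum sum_E2 sum_subtractf[symmetric]
  proof (rule sum.cong[OF refl])
    fix e assume e: "e \<in> E"
    show "Re (of_int (case (e, False) of (e, b) \<Rightarrow> z (e, \<not> b)) * winding_number (\<Gamma> (e, False)) (antip a) +
            of_int (case (e, True) of (e, b) \<Rightarrow> z (e, \<not> b)) * winding_number (\<Gamma> (e, True)) (antip a)) =
        Re (of_int (z (e, False)) * winding_number (\<Gamma> (e, False)) 0 + of_int (z (e, True)) * winding_number (\<Gamma> (e, True)) 0) -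
        Re (of_int (z (e, False)) * winding_number (\<Gamma> (e, False)) a + of_int (z (e, True)) * winding_number (\<Gamma> (e, True)) a)"
      by (simp add: w[OF e, of False, simplified] w[OF e, of True, simplified] right_diff_distrib)
  qed
  then have "(of_int (C.height (\<lambda>(e, b). z (e, \<not> b)) (C.face (antip a))) :: real) = of_int (C.height z (C.face 0)) - of_int (C.height z (C.face a))"
    using C.height_face[OF swap_cycle[OF z] aa] C.height_face[OF z a(1)] C.height_face[OF z z0]
    by (metis Re_complex_of_real of_real_of_int_eq)
  then show ?thesis by (simp only: of_int_diff[symmetric] of_int_eq_iff)
qed

text \<open>The assumption on \<open>E - {e}\<close> excludes an edge whose sides are antipodal to
  each other: deleting both lifts of it would produce a component containing an antipodal pair,
  against \<open>no_symmetric_component\<close>.\<close>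

theorem unbalanced_has_emm_D:
  assumes unb: "unbalanced E" "\<And>e. e \<in> E \<Longrightarrow> unbalanced (E - {e})"
  shows "has_emm_D V E s t (genus V E s t)"
proof -
  obtain L R where D: "dual_data V2 E2 s2 t2 C.faces L R C.height"
    and near: "\<And>eb a b. eb \<in> E2 \<Longrightarrow> a \<in> L eb \<Longrightarrow> b \<in> R eb \<Longrightarrow> connected_component (- C.K (E2 - {eb})) a b"
    using C.plane_dual by blast
  interpret D: dual_data V2 E2 s2 t2 C.faces L R C.height by (rule D)
  have LR: "L (e, b) \<in> C.faces" "R (e, b) \<in> C.faces" if "e \<in> E" for e b using D.LR_\<Phi>[of "(e, b)"] that by auto
  have \<sigma>: "sface F \<in> C.faces \<and> sface F \<noteq> F \<and> sface (sface F) = F" if F: "F \<in> C.faces" for F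
  proof -
    obtain a where a: "a \<notin> KK E" "a \<noteq> 0" "F = C.face a" using face_nonzero_point[OF F] .
    have aa: "antip a \<notin> KK E" "antip a \<noteq> 0" using antip_notin_KK[OF order_refl a(1,2)] antip_nonzero[OF a(2)] by auto
    have "sface F = C.face (antip a)" using sface_face[OF a(1,2)] a(3) by simp
    moreover have "C.face a \<noteq> C.face (antip a)"
      using no_symmetric_component[OF order_refl unb(1) a(1,2)] C.face_eq_iff[OF a(1)] by simp
    moreover have "sface (C.face (antip a)) = C.face a" using sface_face[OF aa] antip_antip[OF a(2)] by simp
    ultimately show ?thesis using a aa by (auto simp: C.faces_def)
  qed
  show ?thesis
  proof (rule antisymmetric_dual_map_D[OF D \<sigma>])
    fix e b and h :: "complex set \<Rightarrow> int" assume e: "e \<in> E"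
    show "h (L (e, b)) - h (R (e, b)) = h (sface (R (e, \<not> b))) - h (sface (L (e, \<not> b)))"
    proof (rule D.sides_unique)
      show "sface (R (e, \<not> b)) \<in> C.faces" "sface (L (e, \<not> b)) \<in> C.faces" "(e, b) \<in> E2" using \<sigma> LR e by auto
      fix z assume z: "is_cycle E2 s2 t2 z"
      have h: "C.height (\<lambda>(e, b). z (e, \<not> b)) F = C.height z (C.face 0) - C.height z (sface F)" if F: "F \<in> C.faces" for F
      proof -
        obtain a where a: "a \<notin> KK E" "a \<noteq> 0" "sface F = C.face a" using face_nonzero_point[of "sface F"] \<sigma>[OF F] by blast
        have "F = C.face (antip a)" using sface_face[OF a(1,2)] a(3) \<sigma>[OF F] by metis
        then show ?thesis using height_antip[OF z a(1,2)] a(3) by simp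
      qed
      have "z (e, b) = C.height (\<lambda>(e, b). z (e, \<not> b)) (L (e, \<not> b)) - C.height (\<lambda>(e, b). z (e, \<not> b)) (R (e, \<not> b))"
        using D.W_jump[OF swap_cycle[OF z], of "(e, \<not> b)"] e by simp
      then show "z (e, b) = C.height z (sface (R (e, \<not> b))) - C.height z (sface (L (e, \<not> b)))"
        using h LR[OF e] by simp
    qed
  next
    fix e assume e: "e \<in> E"
    show "L (e, False) \<noteq> sface (R (e, False))"
    proof
      assume eq: "L (e, False) = sface (R (e, False))"
      obtain a where a: "a \<notin> KK E" "a \<noteq> 0" "R (e, False) = C.face a" using face_nonzero_point[OF LR(2)[OF e]] .
      have aa: "antip a \<notin> KK E" using antip_notin_KK[OF order_refl a(1,2)] .
      have "antip a \<in> L (e, False)" using eq sface_face[OF a(1,2)] a(3) aa by (simp add: C.face_def)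
      moreover have "a \<in> R (e, False)" using a by (simp add: C.face_def)
      ultimately have "connected_component (- C.K (E2 - {(e, False)})) (antip a) a" using near[of "(e, False)"] e by auto
      moreover have sub: "KK (E - {e}) \<subseteq> C.K (E2 - {(e, False)})" by (rule C.K_mono) auto
      ultimately have "connected_component (- KK (E - {e})) a (antip a)"
        by (meson Compl_subset_Compl_iff connected_component_of_subset connected_component_sym)
      moreover have "KK (E - {e}) \<subseteq> KK E" by (rule C.K_mono) auto
      ultimately show False using no_symmetric_component[of "E - {e}" a] unb(2)[OF e] a by auto
    qed
  qed
qed

text \<open>A section of the cover over \<open>F\<close>: the vertex \<open>v\<close> is represented
  by \<open>(v, b v)\<close>, and each edge of \<open>F\<close> has a lift between chosen
  vertices.\<close>

definition sheet :: "'e set \<Rightarrow> ('v \<Rightarrow> bool) \<Rightarrow> bool" where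
  "sheet F b \<longleftrightarrow> (\<forall>e\<in>F. b (t e) = (b (s e) \<noteq> c e))"

lemma sheet_balanced:
  assumes "sheet F b" shows "\<not> unbalanced F"
proof
  assume "unbalanced F"
  then obtain v where v: "reach (F \<times> UNIV) s2 t2 (v, False) (v, True)" by (auto simp: unbalanced_def)
  have "(\<lambda>(v, d). d = b v) (v, False) = (\<lambda>(v, d). d = b v) (v, True)"
    by (rule reach_invariant[OF v]) (use assms in \<open>auto simp: sheet_def\<close>)
  then show False by auto
qed

lemma reach_lift:
  assumes "reach F s t u w" shows "\<exists>d'. reach (F \<times> UNIV) s2 t2 (u, d) (w, d')"
  using assms unfolding reach_def[of F]
proof (induction rule: rtranclp_induct)
  case base
  show ?case by (rule exI, rule reach_refl)
next
  case (step y z)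
  then obtain d' where d': "reach (F \<times> UNIV) s2 t2 (u, d) (y, d')" by blast
  from step(2) obtain e where e: "e \<in> F" "(s e = y \<and> t e = z) \<or> (s e = z \<and> t e = y)" by (auto simp: adj_def)
  have "\<exists>d''. adj (F \<times> UNIV) s2 t2 (y, d') (z, d'')"
  proof (cases "s e = y \<and> t e = z")
    case True
    then have "adj (F \<times> UNIV) s2 t2 (y, d') (z, d' \<noteq> c e)"
      unfolding adj_def using e(1) by (intro bexI[of _ "(e, d')"]) auto
    then show ?thesis by blast
  next
    case False
    then have "adj (F \<times> UNIV) s2 t2 (y, d') (z, d' \<noteq> c e)"
      unfolding adj_def using e by (intro bexI[of _ "(e, d' \<noteq> c e)"]) auto
    then show ?thesis by blast
  qed
  then obtain d'' where "reach (F \<times> UNIV) s2 t2 (y, d') (z, d'')" unfolding reach_def by blast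
  then show ?case using d' by (blast intro: reach_trans)
qed

lemma balanced_sheet:
  assumes F: "F \<subseteq> E" "\<not> unbalanced F" obtains b where "sheet F b"
proof -
  define root where "root v = (SOME u. reach F s t v u)" for v
  have root: "reach F s t v (root v)" for v
    unfolding root_def by (rule someI[of _ v]) (rule reach_refl)
  have root_eq: "root u = root v" if "reach F s t u v" for u v
  proof -
    have "reach F s t u = reach F s t v" using that by (auto intro: reach_trans reach_sym)
    then show ?thesis by (simp add: root_def)
  qed
  define b where "b v = reach (F \<times> UNIV) s2 t2 (root v, False) (v, True)" for v
  have uniq: "b v = d" if "v \<in> V" "reach (F \<times> UNIV) s2 t2 (root v, False) (v, d)" for v d
  proof (cases d)
    case False
    have "\<not> b v"
    proof
      assume "b v"
      then have "reach (F \<times> UNIV) s2 t2 (v, False) (v, True)"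
        using that(2) False unfolding b_def by (auto intro: reach_trans[OF reach_sym])
      then show False using F(2) that(1) by (auto simp: unbalanced_def)
    qed
    then show ?thesis using False by simp
  qed (use that in \<open>simp add: b_def\<close>)
  have "b (t e) = (b (s e) \<noteq> c e)" if e: "e \<in> F" for e
  proof -
    have V: "s e \<in> V" "t e \<in> V" using e F(1) ends_in_V by auto
    obtain d where d: "reach (F \<times> UNIV) s2 t2 (root (s e), False) (s e, d)"
      using reach_lift[OF reach_sym[OF root[of "s e"]]] by blast
    have "reach (F \<times> UNIV) s2 t2 (s e, d) (t e, d \<noteq> c e)"
      using reach_edge(1)[of "(e, d)" "F \<times> UNIV" s2 t2] e by auto
    then have "reach (F \<times> UNIV) s2 t2 (root (t e), False) (t e, d \<noteq> c e)"
      using reach_trans[OF d] root_eq[OF reach_edge(1)[OF e]] by simp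
    then show ?thesis using uniq[OF V(1) d] uniq[OF V(2)] by blast
  qed
  then show ?thesis using that by (auto simp: sheet_def)
qed

lemma sheet_plane_graph:
  assumes F: "F \<subseteq> E" "sheet F b"
  shows "plane_graph V F s t (\<lambda>v. P (v, b v)) (\<lambda>e. \<Gamma> (e, b (s e)))"
proof (intro plane_graph.intro plane_graph_axioms.intro)
  show "fgraph V F s t" using F(1) by (rule fgraph_subset)
  show "inj_on (\<lambda>v. P (v, b v)) V" using C.p_inj by (auto simp: inj_on_def)
  fix e assume e: "e \<in> F"
  then have e2: "(e, b (s e)) \<in> E2" using F(1) by auto
  show "simple_path (\<Gamma> (e, b (s e)))" using C.\<gamma>_simple[OF e2] .
  show "pathstart (\<Gamma> (e, b (s e))) = P (s e, b (s e))" using C.\<gamma>_start[OF e2] by simp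
  show "pathfinish (\<Gamma> (e, b (s e))) = P (t e, b (t e))" using C.\<gamma>_finish[OF e2] F(2) e by (simp add: sheet_def)
  show "\<Gamma> (e, b (s e)) ` {0<..<1} \<inter> (\<lambda>v. P (v, b v)) ` V = {}" using C.\<gamma>_V[OF e2] by blast
  fix e' assume "e' \<in> F" "e \<noteq> e'"
  then show "\<Gamma> (e, b (s e)) ` {0<..<1} \<inter> path_image (\<Gamma> (e', b (s e'))) = {}"
    using C.\<gamma>_disj[OF e2, of "(e', b (s e'))"] F(1) by auto
qed

text \<open>The edge e0 is drawn through the other sheet of the double cover.\<close>

lemma almost_balanced_plane_graph:
  assumes e0: "e0 \<in> E" and un: "unbalanced E" and bal: "\<not> unbalanced (E - {e0})"
  shows "planar V E s t"
proof -
  obtain b where b: "sheet (E - {e0}) b" using balanced_sheet[OF _ bal] by auto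
  have bt: "b (t e0) \<noteq> (b (s e0) \<noteq> c e0)"
  proof
    assume "b (t e0) = (b (s e0) \<noteq> c e0)"
    then have "sheet E b" using b by (auto simp: sheet_def)
    then show False using sheet_balanced un by blast
  qed
  \<comment> \<open>Otherwise exchanging the sheets on the component of \<open>t e0\<close> would
    balance \<open>e0\<close> as well.\<close>
  have rch: "reach (E - {e0}) s t (t e0) (s e0)"
  proof (rule ccontr)
    assume nr: "\<not> reach (E - {e0}) s t (t e0) (s e0)"
    define b' where "b' v = (b v \<noteq> reach (E - {e0}) s t (t e0) v)" for v
    have "b' (t e) = (b' (s e) \<noteq> c e)" if e: "e \<in> E" for e
    proof (cases "e = e0")
      case True
      then show ?thesis using bt nr by (auto simp: b'_def reach_refl)
    next
      case False
      then have "reach (E - {e0}) s t (t e0) (s e) = reach (E - {e0}) s t (t e0) (t e)"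
        using e reach_edge[of e "E - {e0}" s t] by (blast intro: reach_trans)
      then show ?thesis using b e False by (auto simp: b'_def sheet_def)
    qed
    then have "sheet E b'" by (simp add: sheet_def)
    then show False using sheet_balanced un by blast
  qed
  define u where "u = (s e0, b (s e0))"
  define w where "w = (t e0, b (t e0))"
  \<comment> \<open>The chosen sheet \<open>V1\<close> carries \<open>E - {e0}\<close>; the new
    curve for \<open>e0\<close> runs in the rest. From \<open>u\<close> one lift of
    \<open>e0\<close> leads to the other sheet, which is crossed up to the second lift of
    \<open>e0\<close>, ending at \<open>w\<close>. The two parts of the drawing share only
    \<open>u\<close> and \<open>w\<close>.\<close>
  define V1 where "V1 = (\<lambda>v. (v, b v)) ` V"
  define V2' where "V2' = insert u (insert w ((\<lambda>v. (v, \<not> b v)) ` V))"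
  define E1 where "E1 = (\<lambda>e. (e, b (s e))) ` (E - {e0})"
  define E3 where "E3 = (\<lambda>e. (e, \<not> b (s e))) ` (E - {e0})"
  define E2' where "E2' = insert (e0, b (s e0)) (insert (e0, \<not> b (s e0)) E3)"
  have sub: "V1 \<subseteq> V2" "V2' \<subseteq> V2" "E1 \<subseteq> E2" "E2' \<subseteq> E2" "E1 \<inter> E2' = {}"
    using e0 ends_in_V by (auto simp: V1_def V2'_def E1_def E2'_def E3_def u_def w_def)
  have en1: "s2 e \<in> V1 \<and> t2 e \<in> V1" if "e \<in> E1" for e
    using that b ends_in_V by (auto simp: E1_def V1_def sheet_def)
  have en2: "s2 e \<in> V2' \<and> t2 e \<in> V2'" if "e \<in> E2'" for e
    using that b ends_in_V bt e0 by (auto simp: E2'_def E3_def V2'_def sheet_def u_def w_def image_iff)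
  define Q where "Q = P ` V2' \<union> (\<Union>e\<in>E2'. path_image (\<Gamma> e))"
  have V12: "V1 \<inter> V2' = {u, w}" using e0 ends_in_V by (auto simp: V1_def V2'_def u_def w_def)
  have inter: "x \<in> {P u, P w}" if "x \<in> Q" "x \<in> P ` V1 \<union> (\<Union>e\<in>E1. path_image (\<Gamma> e))" for x
    using C.subgraphs_intersection[OF sub(1-5) en1 en2, of x] that V12 unfolding Q_def by auto
  have start: "pathstart (\<Gamma> (e0, b (s e0))) = P u" "pathfinish (\<Gamma> (e0, \<not> b (s e0))) = P w"
    "pathfinish (\<Gamma> (e0, b (s e0))) = P (t e0, \<not> b (t e0))" "pathstart (\<Gamma> (e0, \<not> b (s e0))) = P (s e0, \<not> b (s e0))"
    using C.\<gamma>_start[of "(e0, b (s e0))"] C.\<gamma>_finish[of "(e0, \<not> b (s e0))"] C.\<gamma>_finish[of "(e0, b (s e0))"]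
      C.\<gamma>_start[of "(e0, \<not> b (s e0))"] e0 bt by (auto simp: u_def w_def)
  have "\<exists>q. simple_path q \<and> pathstart q = P u \<and> pathfinish q = P w \<and> path_image q \<subseteq> Q"
  proof (cases "s e0 = t e0")
    \<comment> \<open>For a loop the two lifts of \<open>e0\<close> already form the closed curve
      that is needed.\<close>
    case True
    have uw: "P u = P w" using True by (simp add: u_def w_def)
    have "u \<in> V2" "(t e0, \<not> b (t e0)) \<in> V2" "u \<noteq> (t e0, \<not> b (t e0))" using True e0 ends_in_V by (auto simp: u_def)
    then have "P u \<noteq> P (t e0, \<not> b (t e0))" using inj_onD[OF C.p_inj, of u "(t e0, \<not> b (t e0))"] by blast
    note uw = uw this
    have arcs: "arc (\<Gamma> (e0, b (s e0)))" "arc (\<Gamma> (e0, \<not> b (s e0)))"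
      using C.\<gamma>_simple[of "(e0, b (s e0))"] C.\<gamma>_simple[of "(e0, \<not> b (s e0))"] e0 start uw True
      by (auto simp: arc_simple_path)
    have "path_image (\<Gamma> (e0, b (s e0))) \<inter> path_image (\<Gamma> (e0, \<not> b (s e0))) \<subseteq> {P u, P (t e0, \<not> b (t e0))}"
      using C.\<gamma>_disj[of "(e0, b (s e0))" "(e0, \<not> b (s e0))"] e0 path_image_ends[of "\<Gamma> (e0, b (s e0))"] start by auto
    then have "simple_path (\<Gamma> (e0, b (s e0)) +++ \<Gamma> (e0, \<not> b (s e0)))"
      using arcs start uw True by (intro simple_path_join_loop) auto
    moreover have "path_image (\<Gamma> (e0, b (s e0)) +++ \<Gamma> (e0, \<not> b (s e0))) \<subseteq> Q"
      using start True by (subst path_image_join) (auto simp: Q_def E2'_def)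
    ultimately show ?thesis using start by (intro exI[of _ "\<Gamma> (e0, b (s e0)) +++ \<Gamma> (e0, \<not> b (s e0))"]) auto
  next
    case False
    interpret O: plane_graph V2' E2' s2 t2 P \<Gamma> using sub(2,4) en2 by (rule C.plane_graph_subgraph)
    have ot: "reach E3 s2 t2 (y, \<not> b y) (z, \<not> b z)" if "reach (E - {e0}) s t y z" for y z
      using that unfolding reach_def[of "E - {e0}"]
    proof (induction rule: rtranclp_induct)
      case base
      then show ?case by (rule reach_refl)
    next
      case (step y' z')
      from step(2) obtain e where e: "e \<in> E - {e0}" "(s e = y' \<and> t e = z') \<or> (s e = z' \<and> t e = y')" by (auto simp: adj_def)
      then have "(e, \<not> b (s e)) \<in> E3" "t2 (e, \<not> b (s e)) = (t e, \<not> b (t e))" using b by (auto simp: E3_def sheet_def)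
      then have "reach E3 s2 t2 (s e, \<not> b (s e)) (t e, \<not> b (t e))" using reach_edge(1)[of "(e, \<not> b (s e))" E3 s2 t2] by simp
      moreover from this have "reach E3 s2 t2 (t e, \<not> b (t e)) (s e, \<not> b (s e))" by (rule reach_sym)
      ultimately have "reach E3 s2 t2 (y', \<not> b y') (z', \<not> b z')" using e(2) by blast
      then show ?case by (rule reach_trans[OF step(3)])
    qed
    have "reach E2' s2 t2 u (t e0, \<not> b (t e0))"
      using reach_edge(1)[of "(e0, b (s e0))" E2' s2 t2] bt by (auto simp: E2'_def u_def)
    moreover have "reach E2' s2 t2 (t e0, \<not> b (t e0)) (s e0, \<not> b (s e0))"
      by (rule reach_mono[OF _ ot[OF rch]]) (auto simp: E2'_def)
    moreover have "reach E2' s2 t2 (s e0, \<not> b (s e0)) w"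
      using reach_edge(1)[of "(e0, \<not> b (s e0))" E2' s2 t2] bt by (auto simp: E2'_def w_def)
    ultimately have "reach E2' s2 t2 u w" by (meson reach_trans)
    then have "path_component (O.K E2') (P u) (P w)" by (rule O.reach_path_component) (auto simp: V2'_def)
    then obtain g where g: "path g" "path_image g \<subseteq> Q" "pathstart g = P u" "pathfinish g = P w"
      by (auto simp: path_component_def O.K_def Q_def)
    have "P u \<noteq> P w" using False e0 ends_in_V C.p_inj by (auto simp: u_def w_def inj_on_def)
    then obtain q where "arc q" "path_image q \<subseteq> path_image g" "pathstart q = P u" "pathfinish q = P w"
      using path_contains_arc[OF g(1), of "P u" "P w"] g by auto
    then show ?thesis using g(2) by (intro exI[of _ q]) (auto simp: arc_imp_simple_path)
  qed
  then obtain q where q: "simple_path q" "pathstart q = P u" "pathfinish q = P w" "path_image q \<subseteq> Q" by blast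
  have qint: "q x \<notin> P ` V1 \<union> (\<Union>e\<in>E1. path_image (\<Gamma> e))" if "x \<in> {0<..<1}" for x
  proof
    assume *: "q x \<in> P ` V1 \<union> (\<Union>e\<in>E1. path_image (\<Gamma> e))"
    have "q x \<in> Q" using q(4) that by (auto simp: path_image_def)
    then have "q x = q 0 \<or> q x = q 1" using inter[OF _ *] q(2,3) by (auto simp: pathstart_def pathfinish_def)
    then show False using q(1) that unfolding simple_path_def loop_free_def by force
  qed
  define \<gamma>' where "\<gamma>' e = (if e = e0 then q else \<Gamma> (e, b (s e)))" for e
  interpret M: plane_graph V "E - {e0}" s t "\<lambda>v. P (v, b v)" "\<lambda>e. \<Gamma> (e, b (s e))"
    using b by (intro sheet_plane_graph) auto
  have PV: "(\<lambda>v. P (v, b v)) ` V = P ` V1" by (auto simp: V1_def)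
  have E1im: "path_image (\<Gamma> (e, b (s e))) \<subseteq> (\<Union>e\<in>E1. path_image (\<Gamma> e))" if "e \<in> E - {e0}" for e
    using that by (auto simp: E1_def)
  have "plane_graph V E s t (\<lambda>v. P (v, b v)) \<gamma>'"
  proof (intro plane_graph.intro plane_graph_axioms.intro)
    show "fgraph V E s t" by unfold_locales
    show "inj_on (\<lambda>v. P (v, b v)) V" by (rule M.p_inj)
    fix e assume e: "e \<in> E"
    show "simple_path (\<gamma>' e)" using e q M.\<gamma>_simple[of e] by (simp add: \<gamma>'_def)
    show "pathstart (\<gamma>' e) = P (s e, b (s e))" using e q M.\<gamma>_start[of e] by (auto simp: \<gamma>'_def u_def)
    show "pathfinish (\<gamma>' e) = P (t e, b (t e))" using e q M.\<gamma>_finish[of e] by (auto simp: \<gamma>'_def w_def)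
    show "\<gamma>' e ` {0<..<1} \<inter> (\<lambda>v. P (v, b v)) ` V = {}"
    proof (cases "e = e0")
      case True
      then show ?thesis using qint unfolding PV by (auto simp: \<gamma>'_def simp del: image_iff) blast
    next
      case False
      then show ?thesis using e M.\<gamma>_V[of e] by (simp add: \<gamma>'_def)
    qed
    fix e' assume e': "e' \<in> E" "e \<noteq> e'"
    show "\<gamma>' e ` {0<..<1} \<inter> path_image (\<gamma>' e') = {}"
    proof (cases "e = e0 \<or> e' = e0")
      case False
      then show ?thesis using e e' M.\<gamma>_disj[of e e'] by (auto simp: \<gamma>'_def)
    next
      case True
      then consider "e = e0" "e' \<in> E - {e0}" | "e' = e0" "e \<in> E - {e0}" using e e' by blast
      then show ?thesis
      proof cases
        case 1
        then show ?thesis using qint E1im[OF 1(2)] by (auto simp: \<gamma>'_def)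
      next
        case 2
        have "x \<notin> path_image q" if x: "x \<in> \<Gamma> (e, b (s e)) ` {0<..<1}" for x
        proof
          assume "x \<in> path_image q"
          then have "x \<in> Q" using q(4) by auto
          moreover have "x \<in> path_image (\<Gamma> (e, b (s e)))" using x path_image_ends[of "\<Gamma> (e, b (s e))"] by auto
          ultimately have "x \<in> {P u, P w}" using inter[of x] E1im[OF 2(2)] by blast
          then have "x \<in> P ` V1" using e0 ends_in_V by (auto simp: V1_def u_def w_def)
          then show False using M.\<gamma>_V[OF 2(2)] x unfolding PV by blast
        qed
        then show ?thesis using 2 by (auto simp: \<gamma>'_def)
      qed
    qed
  qed
  then show ?thesis by (rule plane_graph.plane_graph_imp_planar)
qed

end

theorem projective_planar_cases:
  assumes "fgraph V E s t" "projective_planar V E s t"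
  shows "planar V E s t \<or> has_emm_D V E s t (genus V E s t)"
proof -
  obtain c P \<Gamma> where C: "plane_graph (V \<times> UNIV) (E \<times> UNIV) (\<lambda>(e, b). (s e, b)) (\<lambda>(e, b). (t e, b \<noteq> c e)) P \<Gamma>"
    "\<And>v b. v \<in> V \<Longrightarrow> P (v, b) \<noteq> 0 \<and> P (v, \<not> b) = antip (P (v, b))"
    "\<And>e b x. e \<in> E \<Longrightarrow> x \<in> {0..1} \<Longrightarrow> \<Gamma> (e, b) x \<noteq> 0 \<and> \<Gamma> (e, \<not> b) x = antip (\<Gamma> (e, b) x)"
    by (rule projective_lift[OF assms]) (rule that, assumption+)
  interpret antipodal_graph V E s t c P \<Gamma>
    by (intro antipodal_graph.intro antipodal_graph_axioms.intro double_cover.intro assms(1) C)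
  show ?thesis
  proof (cases "unbalanced E")
    case False
    then obtain b where "sheet E b" using balanced_sheet by blast
    then show ?thesis using sheet_plane_graph plane_graph.plane_graph_imp_planar by blast
  next
    case True
    then show ?thesis using unbalanced_has_emm_D almost_balanced_plane_graph by blast
  qed
qed

section \<open>Roots, and from type A to type D\<close>

lemma emm_map:
  assumes "fgraph V E s t" "Z_emm V E s t q" "H1_isometric V E s t q Lat n"
  obtains \<phi> where "H1_map V E s t \<phi>" "\<phi> ` C1 E = Lat"
    "\<And>e. e \<in> E \<Longrightarrow> \<not> bridge E s t e \<Longrightarrow> sqnorm (\<phi> (coedge e)) n = 2"
proof -
  interpret fgraph V E s t by fact
  obtain \<phi> :: "('b \<Rightarrow> int) \<Rightarrow> nat \<Rightarrow> int" where \<phi>: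
    "\<forall>x\<in>C1 E. \<forall>y\<in>C1 E. \<phi> (\<lambda>e. x e + y e) = (\<lambda>i. \<phi> x i + \<phi> y i)" "\<phi> ` C1 E = Lat"
    "\<forall>x\<in>C1 E. \<phi> x = (\<lambda>i. 0) \<longleftrightarrow> x \<in> coboundaries V E s t" "\<forall>x\<in>C1 E. sqnorm (\<phi> x) n = 2 * q x"
    using assms(3) unfolding H1_isometric_def by - (elim exE conjE, rule that, assumption+)
  have "H1_map V E s t \<phi>" using \<phi> by unfold_locales auto
  moreover have "sqnorm (\<phi> (coedge e)) n = 2" if "e \<in> E" "\<not> bridge E s t e" for e
    using \<phi>(4) coedge_C1[OF that(1)] assms(2) that by (simp add: Z_emm_def)
  ultimately show ?thesis using that \<phi>(2) by blast
qed

lemma sqnorm_eq_2: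
  assumes "sqnorm y n = 2"
  obtains a b where "a < n" "b < n" "a \<noteq> b" "(y a)^2 = 1" "(y b)^2 = 1" "\<And>i. i < n \<Longrightarrow> i \<noteq> a \<Longrightarrow> i \<noteq> b \<Longrightarrow> y i = 0"
proof -
  define S where "S = {i. i < n \<and> y i \<noteq> 0}"
  have fin: "finite S" by (simp add: S_def)
  have eq: "(\<Sum>i\<in>S. (y i)^2) = 2"
  proof -
    have "(\<Sum>i<n. (y i)^2) = (\<Sum>i\<in>S. (y i)^2)" by (rule sum.mono_neutral_right) (auto simp: S_def)
    then show ?thesis using assms by (simp add: sqnorm_def)
  qed
  have pos: "(y i)^2 \<ge> 1" if "i \<in> S" for i using that by (auto simp: S_def int_one_le_iff_zero_less)
  have one: "(y i)^2 = 1" if i: "i \<in> S" for i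
  proof (rule ccontr)
    assume "(y i)^2 \<noteq> 1"
    then have "\<bar>y i\<bar> \<ge> 2" using i by (auto simp: S_def power2_eq_1_iff)
    then have "(y i)^2 \<ge> 2^2" by (metis abs_ge_zero abs_numeral abs_le_square_iff)
    moreover have "(y i)^2 \<le> (\<Sum>i\<in>S. (y i)^2)" using fin i by (intro member_le_sum) auto
    ultimately show False using eq by simp
  qed
  have "(\<Sum>i\<in>S. (y i)^2) = int (card S)" using one by simp
  then have "card S = 2" using eq by simp
  then obtain a b where ab: "S = {a, b}" "a \<noteq> b" by (auto simp: card_2_iff)
  show ?thesis
  proof (rule that[of a b])
    show "a < n" "b < n" "(y a)^2 = 1" "(y b)^2 = 1" using ab one[of a] one[of b] unfolding S_def by auto
    show "y i = 0" if "i < n" "i \<noteq> a" "i \<noteq> b" for i using ab that by (auto simp: S_def)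
  qed (rule ab)
qed

text \<open>The isomorphism of groups from A to D that identifies the unit vector with index g with
  minus the one with index a.\<close>

definition fold_AD :: "nat \<Rightarrow> nat \<Rightarrow> (nat \<Rightarrow> int) \<Rightarrow> nat \<Rightarrow> int" where
  "fold_AD g a y i = (if i < g then y i - of_bool (i = a) * y g else 0)"

lemma fold_AD_add: "fold_AD g a (\<lambda>i. y i + z i) = (\<lambda>i. fold_AD g a y i + fold_AD g a z i)"
  by (auto simp: fold_AD_def algebra_simps)

lemma sum_fold_AD: "a < g \<Longrightarrow> (\<Sum>i<g. fold_AD g a y i) = (\<Sum>i\<le>g. y i) - 2 * y g"
  using sum_of_bool_single[of "{..<g}" a "\<lambda>_. y g"]
  by (simp add: fold_AD_def sum_subtractf lessThan_Suc_atMost[symmetric])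

lemma fold_AD_zero:
  assumes "a < g" "y \<in> A_lattice g" "fold_AD g a y = (\<lambda>i. 0)"
  shows "y = (\<lambda>i. 0)"
proof
  fix i
  have "2 * y g = 0" using sum_fold_AD[OF assms(1), of y] assms(2,3) by (simp add: A_lattice_def)
  then have g: "y g = 0" by simp
  show "y i = 0"
  proof (cases "i < g")
    case True
    then show ?thesis using fun_cong[OF assms(3), of i] g by (simp add: fold_AD_def)
  next
    case False
    then show ?thesis using g assms(2) by (cases "i = g") (auto simp: A_lattice_def)
  qed
qed

lemma fold_AD_image: assumes "a < g" shows "fold_AD g a ` A_lattice g = D_lattice g"
proof (intro equalityI subsetI)
  fix z assume "z \<in> fold_AD g a ` A_lattice g"
  then show "z \<in> D_lattice g" using sum_fold_AD[OF assms]
    by (auto simp: A_lattice_def D_lattice_def) (auto simp: fold_AD_def)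
next
  fix z assume z: "z \<in> D_lattice g"
  then obtain k where k: "(\<Sum>i<g. z i) = 2 * k" by (auto simp: D_lattice_def elim!: evenE)
  \<comment> \<open>By \<open>sum_fold_AD\<close> the coordinate sum of a folded vector is -2 times
    the last coordinate, which forces \<open>- k\<close> there.\<close>
  define y where "y i = (if i < g then z i - of_bool (i = a) * k else if i = g then - k else 0)" for i
  have "(\<Sum>i\<le>g. y i) = (\<Sum>i<g. z i - of_bool (i = a) * k) - k"
    by (simp add: lessThan_Suc_atMost[symmetric] y_def)
  also have "\<dots> = 0" using k assms sum_of_bool_single[of "{..<g}" a "\<lambda>_. k"] by (simp add: sum_subtractf)
  finally have "y \<in> A_lattice g" by (auto simp: A_lattice_def y_def)
  moreover have "fold_AD g a y = z" using z by (auto simp: fold_AD_def y_def D_lattice_def fun_eq_iff)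
  ultimately show "z \<in> fold_AD g a ` A_lattice g" by blast
qed

text \<open>Folding preserves the norm of vectors not supported at both coordinates; this is why the
  two coordinates must share no edge.\<close>

lemma sqnorm_fold_AD:
  assumes "a < g" shows "sqnorm (fold_AD g a y) g = sqnorm y (g + 1) - 2 * (y a * y g)"
proof -
  have "(fold_AD g a y i)^2 = (y i)^2 + of_bool (i = a) * ((y g)^2 - 2 * (y a * y g))" if "i < g" for i
    using that by (auto simp: fold_AD_def power2_eq_square algebra_simps)
  then have "sqnorm (fold_AD g a y) g = (\<Sum>i<g. (y i)^2 + of_bool (i = a) * ((y g)^2 - 2 * (y a * y g)))"
    unfolding sqnorm_def by (intro sum.cong) auto
  then show ?thesis using assms by (simp add: sqnorm_def sum.distrib sum_of_bool_single)
qed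

section \<open>Folding along two coordinates without a common edge\<close>

context H1_map begin

lemma H1_map_compose:
  assumes "\<And>x y. f (\<lambda>i. x i + y i) = (\<lambda>i. f x i + f y i)" "\<And>x. x \<in> C1 E \<Longrightarrow> f (\<phi> x) = (\<lambda>i. 0) \<Longrightarrow> \<phi> x = (\<lambda>i. 0)"
  shows "H1_map V E s t (\<lambda>x. f (\<phi> x))"
proof
  show "f (\<phi> (\<lambda>e. x e + y e)) = (\<lambda>i. f (\<phi> x) i + f (\<phi> y) i)" if "x \<in> C1 E" "y \<in> C1 E" for x y
    by (simp add: \<phi>_add[OF that] assms(1))
  have "f (\<lambda>i. 0) = (\<lambda>i. 0)" using assms(1)[of "\<lambda>i. 0" "\<lambda>i. 0"] by (simp add: fun_eq_iff)
  then show "f (\<phi> x) = (\<lambda>i. 0) \<longleftrightarrow> x \<in> coboundaries V E s t" if "x \<in> C1 E" for x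
    using assms(2)[OF that] \<phi>_kernel[OF that] by auto
qed

lemma bridge_zero: "bridge E s t e \<Longrightarrow> \<phi> (coedge e) = (\<lambda>i. 0)"
  using bridge_iff_coboundary \<phi>_kernel[OF coedge_C1] by (auto simp: bridge_def)

lemma nonadjacent_has_emm_D:
  assumes im: "\<phi> ` C1 E = A_lattice g"
    and root: "\<And>e. e \<in> E \<Longrightarrow> \<not> bridge E s t e \<Longrightarrow> sqnorm (\<phi> (coedge e)) (g + 1) = 2"
    and ab: "a \<le> g" "b \<le> g" "a \<noteq> b" "\<And>e. e \<in> E \<Longrightarrow> \<phi> (coedge e) a * \<phi> (coedge e) b = 0"
  shows "has_emm_D V E s t g"
proof -
  \<comment> \<open>A transposition moves \<open>b\<close> to the last coordinate, where
    \<open>fold_AD\<close> expects it.\<close>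
  define \<tau> where "\<tau> = Fun.swap b g id"
  have \<tau>: "\<tau> b = g" "\<tau> g = b" "\<And>i. \<tau> (\<tau> i) = i" "\<And>i. \<tau> i \<le> g \<longleftrightarrow> i \<le> g" "\<And>i. i > g \<Longrightarrow> \<tau> i = i"
    using ab(2) by (auto simp: \<tau>_def Fun.swap_def)
  have bij: "bij_betw \<tau> {..g} {..g}" by (rule bij_betw_byWitness[of _ \<tau>]) (auto simp: \<tau>)
  define a' where "a' = \<tau> a"
  have "a' \<noteq> g" using \<tau>(2,3) ab(3) by (metis a'_def)
  then have a': "a' < g" using \<tau>(4)[of a] ab(1) by (simp add: a'_def)
  define f where "f y = fold_AD g a' (\<lambda>i. y (\<tau> i))" for y
  have perm: "(\<lambda>i. y (\<tau> i)) \<in> A_lattice g" if "y \<in> A_lattice g" for y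
    using that sum.reindex_bij_betw[OF bij, of y] \<tau>(5) by (auto simp: A_lattice_def)
  have fA: "f ` A_lattice g = D_lattice g"
  proof -
    have "(\<lambda>y i. y (\<tau> i)) ` A_lattice g = A_lattice g"
    proof (intro equalityI subsetI)
      fix y assume y: "y \<in> A_lattice g"
      have "y = (\<lambda>y i. y (\<tau> i)) (\<lambda>i. y (\<tau> i))" by (simp add: \<tau>(3))
      then show "y \<in> (\<lambda>y i. y (\<tau> i)) ` A_lattice g" using perm[OF y] by (rule image_eqI)
    qed (use perm in auto)
    then show ?thesis using fold_AD_image[OF a'] unfolding f_def by (metis image_image)
  qed
  have f0: "y = (\<lambda>i. 0)" if "y \<in> A_lattice g" "f y = (\<lambda>i. 0)" for y
  proof -
    have "(\<lambda>i. y (\<tau> i)) = (\<lambda>i. 0)" using fold_AD_zero[OF a' perm[OF that(1)]] that(2) by (simp add: f_def)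
    then show ?thesis using \<tau>(3) by (metis (no_types, lifting))
  qed
  interpret F: H1_map V E s t "\<lambda>x. f (\<phi> x)"
  proof (rule H1_map_compose)
    show "f (\<lambda>i. x i + y i) = (\<lambda>i. f x i + f y i)" for x y by (simp add: f_def fold_AD_add)
    show "\<phi> x = (\<lambda>i. 0)" if "x \<in> C1 E" "f (\<phi> x) = (\<lambda>i. 0)" for x using f0 im that by blast
  qed
  have "sqnorm (\<lambda>i. y (\<tau> i)) (g + 1) = sqnorm y (g + 1)" for y
    using sum.reindex_bij_betw[OF bij, of "\<lambda>i. (y i)^2"] by (simp add: sqnorm_def lessThan_Suc_atMost)
  then have "sqnorm (f y) g = sqnorm y (g + 1) - 2 * (y a * y b)" for y
    unfolding f_def sqnorm_fold_AD[OF a'] using \<tau> by (simp add: a'_def)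
  then show ?thesis using im fA root ab(4) by (intro F.has_emm_DI) (auto simp: image_image[symmetric, of f \<phi>])
qed

end

lemma card_pairs: "2 * card {(a, b). a < b \<and> b \<le> (g::nat)} = g * (g + 1)"
proof -
  have "{(a, b). a < b \<and> b \<le> g} = prod.swap ` (SIGMA b:{..g}. {..<b})" by (auto simp: image_iff)
  then have "card {(a, b). a < b \<and> b \<le> g} = card (SIGMA b:{..g}. {..<b})" by (simp add: card_image)
  also have "\<dots> = (\<Sum>b\<le>g. b)" by simp
  finally show ?thesis using gauss_sum_nat[of g] by (simp add: atMost_atLeast0)
qed

context H1_map begin

text \<open>Otherwise contract all edges but one for each pair of indices. A vertex of the resulting graph has degree
  at least 3 because its star is a cycle in the complete graph, which contradicts the count of vertices and edges.\<close>

lemma exists_nonadjacent: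
  assumes im: "\<phi> ` C1 E = A_lattice g" and g: "g \<ge> 4"
    and root: "\<And>e. e \<in> E \<Longrightarrow> \<not> bridge E s t e \<Longrightarrow> sqnorm (\<phi> (coedge e)) (g + 1) = 2"
  obtains a b where "a \<le> g" "b \<le> g" "a \<noteq> b" "\<And>e. e \<in> E \<Longrightarrow> \<phi> (coedge e) a * \<phi> (coedge e) b = 0"
proof (rule ccontr)
  note goal = that
  assume nex: "\<not> thesis"
  define I where "I = {(a, b). a < b \<and> b \<le> g}"
  have "\<exists>e\<in>E. \<phi> (coedge e) a \<noteq> 0 \<and> \<phi> (coedge e) b \<noteq> 0" if "(a, b) \<in> I" for a b
  proof (rule ccontr)
    assume "\<not> (\<exists>e\<in>E. \<phi> (coedge e) a \<noteq> 0 \<and> \<phi> (coedge e) b \<noteq> 0)"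
    then have thesis using that by (intro goal[of a b]) (auto simp: I_def)
    then show False using nex by simp
  qed
  then have "\<forall>i\<in>I. \<exists>e. e \<in> E \<and> \<phi> (coedge e) (fst i) \<noteq> 0 \<and> \<phi> (coedge e) (snd i) \<noteq> 0" by fastforce
  then obtain \<epsilon> where "\<forall>i\<in>I. \<epsilon> i \<in> E \<and> \<phi> (coedge (\<epsilon> i)) (fst i) \<noteq> 0 \<and> \<phi> (coedge (\<epsilon> i)) (snd i) \<noteq> 0"
    by (rule bchoice[THEN exE])
  then have \<epsilon>: "\<epsilon> (a, b) \<in> E \<and> \<phi> (coedge (\<epsilon> (a, b))) a \<noteq> 0 \<and> \<phi> (coedge (\<epsilon> (a, b))) b \<noteq> 0" if "(a, b) \<in> I" for a b
    using that by force
  define S where "S = \<epsilon> ` I"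
  have SE: "S \<subseteq> E" using \<epsilon> by (auto simp: S_def)
  have finS: "finite S" using SE finite_E by (rule finite_subset)
  have supp: "\<phi> (coedge (\<epsilon> (a, b))) i \<noteq> 0 \<longleftrightarrow> i = a \<or> i = b" if "(a, b) \<in> I" "i \<le> g" for a b i
  proof -
    let ?y = "\<phi> (coedge (\<epsilon> (a, b)))"
    have nz: "?y a \<noteq> 0" "?y b \<noteq> 0" "\<epsilon> (a, b) \<in> E" using \<epsilon>[OF that(1)] by auto
    then have "\<not> bridge E s t (\<epsilon> (a, b))" using bridge_zero by metis
    then have "sqnorm ?y (g + 1) = 2" using root nz(3) by simp
    then obtain c d where cd: "c < g + 1" "d < g + 1" "c \<noteq> d" "(?y c)^2 = 1" "(?y d)^2 = 1"
      "\<And>i. i < g + 1 \<Longrightarrow> i \<noteq> c \<Longrightarrow> i \<noteq> d \<Longrightarrow> ?y i = 0" by (rule sqnorm_eq_2) (rule that, assumption+)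
    have "a < g + 1" "b < g + 1" "a \<noteq> b" using that by (auto simp: I_def)
    then have "{a, b} = {c, d}" using cd(3,6) nz(1,2) by (metis insert_commute)
    then show ?thesis using cd(6)[of i] that(2) nz(1,2) by (auto simp: doubleton_eq_iff)
  qed
  have inj: "inj_on \<epsilon> I"
  proof (rule inj_onI, clarify)
    fix a b a' b' assume I: "(a, b) \<in> I" "(a', b') \<in> I" and eq: "\<epsilon> (a, b) = \<epsilon> (a', b')"
    have "i = a \<or> i = b \<longleftrightarrow> i = a' \<or> i = b'" if "i \<le> g" for i
      using supp[OF I(1) that] supp[OF I(2) that] eq by simp
    from this[of a] this[of b] this[of a'] this[of b'] show "a = a' \<and> b = b'" using I by (auto simp: I_def)
  qed
  then have cS: "2 * card S = g * (g + 1)" using card_pairs[of g] by (simp add: S_def card_image I_def)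
  have Sinj: "e = e'" if e: "e \<in> S" "e' \<in> S" and sup: "\<And>i. i \<le> g \<Longrightarrow> \<phi> (coedge e) i \<noteq> 0 \<longleftrightarrow> \<phi> (coedge e') i \<noteq> 0" for e e'
  proof -
    obtain a b a' b' where I: "(a, b) \<in> I" "(a', b') \<in> I" "e = \<epsilon> (a, b)" "e' = \<epsilon> (a', b')"
      using e unfolding S_def by auto
    have "i = a \<or> i = b \<longleftrightarrow> i = a' \<or> i = b'" if "i \<le> g" for i
      using supp[OF I(1) that] supp[OF I(2) that] sup[OF that] I(3,4) by simp
    from this[of a] this[of b] this[of a'] this[of b'] show "e = e'" using I by (auto simp: I_def)
  qed
  \<comment> \<open>\<open>Q\<close> is the vertex set after contracting all edges outside
    \<open>S\<close>; \<open>\<delta> X\<close> is the coboundary of such a vertex and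
    \<open>N X\<close> its star.\<close>
  define Q where "Q = components V (E - S) s t"
  define \<delta> where "\<delta> X = coboundary E s t (\<lambda>v. of_bool (v \<in> X))" for X :: "'v set"
  define N where "N X = {e \<in> S. \<delta> X e \<noteq> 0}" for X
  have \<delta>v: "\<delta> X e = of_bool (t e \<in> X) - of_bool (s e \<in> X)" if "e \<in> E" for X e using that by (simp add: \<delta>_def coboundary_def)
  have cls: "v \<in> X \<Longrightarrow> w \<in> V \<Longrightarrow> reach (E - S) s t v w \<Longrightarrow> w \<in> X" if X: "X \<in> Q" for X v w
  proof -
    obtain u where u: "u \<in> V" "X = {w \<in> V. reach (E - S) s t u w}"
      using X unfolding Q_def components_def by (auto elim!: quotientE)
    then show "v \<in> X \<Longrightarrow> w \<in> V \<Longrightarrow> reach (E - S) s t v w \<Longrightarrow> w \<in> X" by (auto intro: reach_trans)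
  qed
  have same: "s e \<in> X \<longleftrightarrow> t e \<in> X" if "X \<in> Q" "e \<in> E - S" for X e
    using cls[OF that(1), of "s e" "t e"] cls[OF that(1), of "t e" "s e"] reach_edge[OF that(2), of s t] ends_in_V that(2) by auto
  have \<delta>0: "\<delta> X e = 0" if "X \<in> Q" "e \<notin> N X" for X e
  proof (cases "e \<in> E - S")
    case True
    then show ?thesis using same[OF that(1) True] \<delta>v by auto
  next
    case False
    then show ?thesis using that(2) by (auto simp: N_def \<delta>_def coboundary_def)
  qed
  have three: "card (N X) \<ge> 3" if X: "X \<in> Q" "N X \<noteq> {}" for X
  proof (rule ccontr)
    assume "\<not> card (N X) \<ge> 3"
    have finN: "finite (N X)" using finS by (simp add: N_def)
    have NE: "N X \<subseteq> E" using SE by (auto simp: N_def)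
    have "\<phi> (\<delta> X) = (\<lambda>i. 0)" unfolding \<delta>_def using \<phi>_kernel[OF C1_coboundary] coboundary_in_coboundaries by blast
    then have "(\<Sum>e\<in>E. \<delta> X e * \<phi> (coedge e) i) = 0" for i
      using \<phi>_expand[OF C1_coboundary[of E s t "\<lambda>v. of_bool (v \<in> X)"], folded \<delta>_def] by metis
    moreover have "(\<Sum>e\<in>E. \<delta> X e * \<phi> (coedge e) i) = (\<Sum>e\<in>N X. \<delta> X e * \<phi> (coedge e) i)" for i
      using NE \<delta>0[OF X(1)] finite_E by (intro sum.mono_neutral_right) auto
    ultimately have zero: "(\<Sum>e\<in>N X. \<delta> X e * \<phi> (coedge e) i) = 0" for i by simp
    have u: "\<delta> X e \<noteq> 0" "\<bar>\<delta> X e\<bar> = 1" if "e \<in> N X" for e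
    proof -
      show nz: "\<delta> X e \<noteq> 0" using that by (simp add: N_def)
      have "e \<in> E" using that NE by auto
      then show "\<bar>\<delta> X e\<bar> = 1" using nz \<delta>v by (auto simp: of_bool_def split: if_splits)
    qed
    have "card (N X) \<noteq> 0" using X(2) finN by simp
    \<comment> \<open>The roots chosen in \<open>S\<close> are nonzero with pairwise different
      supports, so one or two of them satisfy no relation with nonzero coefficients.\<close>
    then have "card (N X) = 1 \<or> card (N X) = 2" using \<open>\<not> card (N X) \<ge> 3\<close> by linarith
    then show False
    proof
      assume "card (N X) = 1"
      then obtain e where e: "N X = {e}" by (auto simp: card_1_singleton_iff)
      have "e \<in> S" using e unfolding N_def by blast
      then obtain a b where I: "(a, b) \<in> I" "e = \<epsilon> (a, b)" unfolding S_def by auto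
      then have "\<phi> (coedge e) a \<noteq> 0" using \<epsilon> by blast
      then show False using zero[of a] u(1)[of e] e by simp
    next
      assume "card (N X) = 2"
      then obtain e e' where e: "N X = {e, e'}" "e \<noteq> e'" by (auto simp: card_2_iff)
      have "\<phi> (coedge e) i \<noteq> 0 \<longleftrightarrow> \<phi> (coedge e') i \<noteq> 0" for i
      proof -
        have "\<delta> X e * \<phi> (coedge e) i = - (\<delta> X e' * \<phi> (coedge e') i)" using zero[of i] e by simp
        then show ?thesis using u[of e] u[of e'] e(1) by (metis insertCI mult_eq_0_iff neg_equal_0_iff_equal)
      qed
      then have "e = e'" using Sinj[of e e'] e(1) unfolding N_def by blast
      then show False using e(2) by simp
    qed
  qed
  have finQ: "finite Q" unfolding Q_def by (rule finite_components[OF finite_V])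
  define Q1 where "Q1 = {X \<in> Q. N X \<noteq> {}}"
  have disjQ: "X = Y" if "X \<in> Q" "Y \<in> Q" "v \<in> X" "v \<in> Y" for X Y v
    using quotient_disj[OF components_equiv, of X V "E - S" s t Y] that unfolding Q_def components_def by blast
  have "3 * card Q1 \<le> (\<Sum>X\<in>Q1. card (N X))"
    using three finQ sum_mono[of Q1 "\<lambda>_. 3" "\<lambda>X. card (N X)"] by (auto simp: Q1_def mult.commute)
  also have "\<dots> = (\<Sum>X\<in>Q1. \<Sum>e\<in>S. of_bool (e \<in> N X))"
  proof (rule sum.cong[OF refl])
    fix X
    have "S \<inter> {e. e \<in> N X} = N X" by (auto simp: N_def)
    then show "card (N X) = (\<Sum>e\<in>S. of_bool (e \<in> N X))" using finS by simp
  qed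
  also have "\<dots> = (\<Sum>e\<in>S. \<Sum>X\<in>Q1. of_bool (e \<in> N X))" by (rule sum.swap)
  also have "\<dots> \<le> (\<Sum>e\<in>S. 2)"
  proof (rule sum_mono)
    fix e assume e: "e \<in> S"
    have "(\<Sum>X\<in>Q1. of_bool (e \<in> N X)) = card {X \<in> Q1. e \<in> N X}"
    proof -
      have "Q1 \<inter> {X. e \<in> N X} = {X \<in> Q1. e \<in> N X}" by auto
      then show ?thesis using finQ by (simp add: Q1_def)
    qed
    also have "{X \<in> Q1. e \<in> N X} \<subseteq> {X \<in> Q. s e \<in> X} \<union> {X \<in> Q. t e \<in> X}"
      using e SE \<delta>v by (auto simp: Q1_def N_def)
    then have "card {X \<in> Q1. e \<in> N X} \<le> card ({X \<in> Q. s e \<in> X} \<union> {X \<in> Q. t e \<in> X})"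
      using finQ by (intro card_mono) auto
    also have "\<dots> \<le> card {X \<in> Q. s e \<in> X} + card {X \<in> Q. t e \<in> X}" by (rule card_Un_le)
    finally have "(\<Sum>X\<in>Q1. of_bool (e \<in> N X)) \<le> card {X \<in> Q. s e \<in> X} + card {X \<in> Q. t e \<in> X}" .
    moreover have "card {X \<in> Q. v \<in> X} \<le> Suc 0" for v
    proof -
      have "\<forall>X\<in>{X \<in> Q. v \<in> X}. \<forall>Y\<in>{X \<in> Q. v \<in> X}. X = Y" using disjQ by blast
      moreover have "finite {X \<in> Q. v \<in> X}" using finQ by simp
      ultimately show ?thesis using card_le_Suc0_iff_eq by blast
    qed
    from this[of "s e"] this[of "t e"] calculation show "(\<Sum>X\<in>Q1. of_bool (e \<in> N X)) \<le> (2::nat)" by linarith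
  qed
  finally have up: "3 * card Q1 \<le> 2 * card S" by simp
  \<comment> \<open>A contracted vertex with empty star is a whole component of the graph.\<close>
  have Q0: "Q - Q1 \<subseteq> components V E s t"
  proof
    fix X assume "X \<in> Q - Q1"
    then have X: "X \<in> Q" "N X = {}" by (auto simp: Q1_def)
    obtain u where u: "u \<in> V" "X = {w \<in> V. reach (E - S) s t u w}"
      using X(1) unfolding Q_def components_def by (auto elim!: quotientE)
    have st: "s e \<in> X \<longleftrightarrow> t e \<in> X" if "e \<in> E" for e using \<delta>0[OF X(1), of e] X(2) \<delta>v[OF that, of X] by (auto simp: of_bool_def split: if_splits)
    have "w \<in> X" if "w \<in> V" "reach E s t u w" for w
      using reach_invariant[OF that(2), of "\<lambda>v. v \<in> X"] st u by (auto simp: reach_refl)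
    moreover have "reach E s t u w" if "w \<in> X" for w using that u reach_mono[of "E - S" E s t u w] by auto
    ultimately have "X = {w \<in> V. reach E s t u w}" using u by auto
    then show "X \<in> components V E s t" unfolding components_def quotient_def using u(1) by auto
  qed
  have finC: "finite (components V E s t)" by (rule finite_components[OF finite_V])
  interpret S: fgraph V "E - S" s t by (rule fgraph_subset) auto
  have gg: "g = genus V E s t" using im by (rule rank_A)
  have "card Q + card (E - S) \<ge> card V" using S.genus_eq by (simp add: Q_def)
  moreover have "card (E - S) + card S = card E" using SE finite_E by (metis card_Diff_subset card_mono finS le_add_diff_inverse2)
  ultimately have cQ: "card Q + g \<ge> card S + card (components V E s t)" using genus_eq gg by linarith
  have cQ1: "card Q = card Q1 + card (Q - Q1)" using finQ by (metis (no_types, lifting) Q1_def card_Diff_subset card_mono finite_subset le_add_diff_inverse mem_Collect_eq subsetI)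
  show False
  proof (cases "Q1 = {}")
    case True
    then have "card Q \<le> card (components V E s t)" using Q0 finC by (simp add: card_mono)
    then have "card S \<le> g" using cQ by simp
    then have "g * (g + 1) \<le> g * 2" using cS by linarith
    then have "g + 1 \<le> 2" using g by (metis bot_nat_0.extremum_uniqueI nat_mult_le_cancel_disj neq0_conv numeral_eq_one_iff numeral_le_one_iff semiring_norm(69) zero_le_numeral)
    then show False using g by simp
  next
    case False
    then obtain X where X: "X \<in> Q1" by auto
    \<comment> \<open>The component containing a vertex with nonempty star is missing on the left.
      This gains the 1 on which the final inequality depends.\<close>
    have "Q - Q1 \<noteq> components V E s t"
    proof
      assume eq: "Q - Q1 = components V E s t"
      have "X \<in> Q" using X by (simp add: Q1_def)
      then obtain u where u: "u \<in> V" "X = {w \<in> V. reach (E - S) s t u w}"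
        unfolding Q_def components_def by (auto elim!: quotientE)
      have "{w \<in> V. reach E s t u w} \<in> components V E s t" unfolding components_def quotient_def using u(1) by auto
      then have "{w \<in> V. reach E s t u w} \<in> Q - Q1" using eq by simp
      moreover have "u \<in> X" "u \<in> {w \<in> V. reach E s t u w}" using u by (auto simp: reach_refl)
      ultimately have "X = {w \<in> V. reach E s t u w}" using \<open>X \<in> Q\<close> by (intro disjQ[of X _ u]) auto
      then show False using X \<open>{w \<in> V. reach E s t u w} \<in> Q - Q1\<close> by simp
    qed
    then have "card (Q - Q1) < card (components V E s t)" using Q0 finC by (intro psubset_card_mono) auto
    then have "card Q1 + g \<ge> card S + 1" using cQ cQ1 by linarith
    then have "card S + 3 \<le> 3 * g" using up by linarith
    \<comment> \<open>That is (g - 2) (g - 3) <= 0, impossible from 4 on; for g = 3 the complete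
      graph on four vertices attains equality.\<close>
    then have "g * (g + 1) + 6 \<le> 6 * g" using cS by linarith
    moreover obtain k where "g = k + 4" using g by (metis add.commute le_Suc_ex)
    ultimately show False by (simp add: algebra_simps)
  qed
qed

end

theorem has_emm_A_imp_has_emm_D:
  assumes "fgraph V E s t" "has_emm_A V E s t g" "g \<ge> 4"
  shows "has_emm_D V E s t g"
proof -
  obtain q where q: "Z_emm V E s t q" "H1_isometric V E s t q (A_lattice g) (g + 1)" using assms(2) by (auto simp: has_emm_A_def)
  obtain \<phi> where \<phi>: "H1_map V E s t \<phi>" "\<phi> ` C1 E = A_lattice g"
    "\<And>e. e \<in> E \<Longrightarrow> \<not> bridge E s t e \<Longrightarrow> sqnorm (\<phi> (coedge e)) (g + 1) = 2"
    using emm_map[OF assms(1) q] by blast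
  interpret H1_map V E s t \<phi> by (rule \<phi>)
  obtain a b where "a \<le> g" "b \<le> g" "a \<noteq> b" "\<And>e. e \<in> E \<Longrightarrow> \<phi> (coedge e) a * \<phi> (coedge e) b = 0"
    using exists_nonadjacent[OF \<phi>(2) assms(3) \<phi>(3)] by blast
  then show ?thesis using nonadjacent_has_emm_D[OF \<phi>(2,3)] by blast
qed

section \<open>Drawing a graph from a closed walk around a spanning tree\<close>

text \<open>The indices are read cyclically: two places of change cut the cycle of length
  \<open>N\<close> into two arcs on which \<open>f\<close> is constant, and one genuine change makes
  the two values differ.\<close>

lemma two_jumps:
  fixes f :: "nat \<Rightarrow> int"
  assumes "i < j" "j < N" "\<And>k. k < N \<Longrightarrow> k \<noteq> i \<Longrightarrow> k \<noteq> j \<Longrightarrow> f (Suc k) = f k"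
    "f (Suc i) \<noteq> f i" "f N = f 0"
  shows "\<And>k l. k \<le> N \<Longrightarrow> l \<le> N \<Longrightarrow> f k = f l \<longleftrightarrow> (i < k \<and> k \<le> j \<longleftrightarrow> i < l \<and> l \<le> j)"
proof -
  have const: "f k = f l" if "l \<le> k" "k \<le> N" "\<And>m. l \<le> m \<Longrightarrow> m < k \<Longrightarrow> m \<noteq> i \<and> m \<noteq> j" for k l
    using that
  proof (induction k)
    case (Suc k)
    then show ?case using assms(3)[of k] by (cases "l = Suc k") auto
  qed auto
  have a: "f k = f 0" if "k \<le> i" for k using const[of 0 k] that assms by auto
  have b: "f k = f (Suc i)" if "i < k" "k \<le> j" for k using const[of "Suc i" k] that assms by auto
  have c: "f k = f 0" if "j < k" "k \<le> N" for k using const[of k N] that assms by auto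
  have ne: "f (Suc i) \<noteq> f 0" using a[of i] assms by simp
  have *: "f k = (if i < k \<and> k \<le> j then f (Suc i) else f 0)" if "k \<le> N" for k
    using a b c that by (metis linorder_not_le)
  show "\<And>k l. k \<le> N \<Longrightarrow> l \<le> N \<Longrightarrow> f k = f l \<longleftrightarrow> (i < k \<and> k \<le> j \<longleftrightarrow> i < l \<and> l \<le> j)"
    using * ne by metis
qed

text \<open>Both other ends lie on the ray from \<open>p\<close> through \<open>z\<close>, so the
  shorter segment is contained in the longer one.\<close>

lemma segments_same_base:
  fixes p :: "'a::real_vector"
  assumes "z \<in> closed_segment p q" "z \<in> closed_segment p q'" "z \<noteq> p"
  shows "q \<in> closed_segment p q' \<or> q' \<in> closed_segment p q"
proof -
  have main: "q' \<in> closed_segment p q" if "0 \<le> u" "u \<le> u'" "u' \<noteq> 0" "u *\<^sub>R (q - p) = u' *\<^sub>R (q' - p)" for u u' :: real and q q'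
  proof -
    have "q' - p = (1/u') *\<^sub>R (u' *\<^sub>R (q' - p))" using that(3) by simp
    also have "\<dots> = (u/u') *\<^sub>R (q - p)" unfolding that(4)[symmetric] by simp
    finally have "q' = (1 - u/u') *\<^sub>R p + (u/u') *\<^sub>R q" by (simp add: algebra_simps)
    then show ?thesis using that unfolding in_segment by (intro exI[of _ "u/u'"]) (auto simp: field_simps)
  qed
  obtain u where u: "0 \<le> u" "z = (1 - u) *\<^sub>R p + u *\<^sub>R q" using assms(1) by (auto simp: in_segment)
  obtain u' where u': "0 \<le> u'" "z = (1 - u') *\<^sub>R p + u' *\<^sub>R q'" using assms(2) by (auto simp: in_segment)
  have "z - p = u *\<^sub>R (q - p)" using u(2) by (simp add: algebra_simps)
  moreover have "z - p = u' *\<^sub>R (q' - p)" using u'(2) by (simp add: algebra_simps)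
  ultimately have eq: "u *\<^sub>R (q - p) = u' *\<^sub>R (q' - p)" by simp
  have nz: "u \<noteq> 0" "u' \<noteq> 0" using u u' assms(3) by auto
  show ?thesis
  proof (cases "u \<le> u'")
    case True
    then show ?thesis using main[OF u(1) True nz(2) eq] by simp
  next
    case False
    then show ?thesis using main[OF u'(1) _ nz(1) eq[symmetric]] by simp
  qed
qed

lemma graph_embeds_arcs:
  assumes p: "inj_on p V" "p ` V \<subseteq> S"
    and \<gamma>: "\<And>e. e \<in> E \<Longrightarrow> arc (\<gamma> e) \<and> pathstart (\<gamma> e) = p (s e) \<and> pathfinish (\<gamma> e) = p (t e) \<and> path_image (\<gamma> e) \<subseteq> S"
    and V: "\<And>e. e \<in> E \<Longrightarrow> path_image (\<gamma> e) \<inter> p ` V \<subseteq> {p (s e), p (t e)}"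
    and d: "\<And>e e'. e \<in> E \<Longrightarrow> e' \<in> E \<Longrightarrow> e \<noteq> e' \<Longrightarrow> path_image (\<gamma> e) \<inter> path_image (\<gamma> e') \<subseteq> p ` V"
  shows "graph_embeds (top_of_set S) V E s t"
  unfolding graph_embeds_def
proof (intro exI[of _ p] exI[of _ \<gamma>] conjI ballI impI)
  have int: "\<gamma> e x \<noteq> p (s e)" "\<gamma> e x \<noteq> p (t e)" if "e \<in> E" "x \<in> {0<..<1}" for e x
  proof -
    have "inj_on (\<gamma> e) {0..1}" "\<gamma> e 0 = p (s e)" "\<gamma> e 1 = p (t e)"
      using \<gamma>[OF that(1)] by (auto simp: arc_def pathstart_def pathfinish_def)
    then show "\<gamma> e x \<noteq> p (s e)" "\<gamma> e x \<noteq> p (t e)"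
      using that(2) inj_onD[of "\<gamma> e" "{0..1}" x 0] inj_onD[of "\<gamma> e" "{0..1}" x 1] by auto
  qed
  have im: "\<gamma> e x \<in> path_image (\<gamma> e)" if "x \<in> {0<..<1}" for e x using that by (auto simp: path_image_def)
  fix e assume e: "e \<in> E"
  show "pathin (top_of_set S) (\<gamma> e)" using \<gamma>[OF e] by (auto simp: pathin_canon_iff arc_def path_image_def)
  show "\<gamma> e 0 = p (s e)" "\<gamma> e 1 = p (t e)" using \<gamma>[OF e] by (auto simp: pathstart_def pathfinish_def)
  show "if s e = t e then inj_on (\<gamma> e) {0..<1} else inj_on (\<gamma> e) {0..1}"
    using \<gamma>[OF e] by (auto simp: arc_def intro: inj_on_subset)
  show "\<gamma> e ` {0<..<1} \<inter> p ` V = {}" using int[OF e] im V[OF e] by blast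
  fix e' assume e': "e' \<in> E" "e \<noteq> e'"
  show "\<gamma> e ` {0<..<1} \<inter> \<gamma> e' ` {0..1} = {}"
    using int[OF e] im V[OF e] d[OF e e'] unfolding path_image_def[of "\<gamma> e'"] by blast
qed (use p in auto)

text \<open>\<open>T\<close> is a spanning tree of the graph itself, complementary to the dual tree
  and, with a crosscap, to one more edge. The word is read around a thickened \<open>T\<close>: a
  letter in \<open>T\<close> moves the corner \<open>vert\<close> along this edge, any other letter
  is a half-edge attached at the corner. \<open>pot e\<close> describes the fundamental cut of
  \<open>e\<close>.\<close>

locale contour = fgraph V E s t for V :: "'v set" and E :: "'e set" and s t +
  fixes N :: nat and lt :: "nat \<Rightarrow> 'e" and vert :: "nat \<Rightarrow> 'v" and T :: "'e set"
    and pos1 pos2 :: "'e \<Rightarrow> nat" and pot :: "'e \<Rightarrow> 'v \<Rightarrow> int"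
  assumes no_loops: "\<And>e. e \<in> E \<Longrightarrow> s e \<noteq> t e"
    and T_sub: "T \<subseteq> E"
    and pos: "\<And>e. e \<in> E \<Longrightarrow> pos1 e < pos2 e \<and> pos2 e < N \<and> lt (pos1 e) = e \<and> lt (pos2 e) = e"
    and pos_only: "\<And>k. k < N \<Longrightarrow> lt k \<in> E \<and> (k = pos1 (lt k) \<or> k = pos2 (lt k))"
    and vert_N: "vert N = vert 0"
    and vert_T: "\<And>k. k < N \<Longrightarrow> lt k \<in> T \<Longrightarrow> {vert k, vert (Suc k)} = {s (lt k), t (lt k)}"
    and vert_const: "\<And>k. k < N \<Longrightarrow> lt k \<notin> T \<Longrightarrow> vert (Suc k) = vert k"
    and ends_pos: "\<And>e. e \<in> E - T \<Longrightarrow> {vert (pos1 e), vert (pos2 e)} = {s e, t e}"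
    and vert_onto: "\<And>v. v \<in> V \<Longrightarrow> \<exists>k<N. vert k = v"
    and pot: "\<And>e f. e \<in> T \<Longrightarrow> f \<in> T \<Longrightarrow> pot e (t f) - pot e (s f) = of_bool (f = e)"
    and pot_sep: "\<And>u v. u \<in> V \<Longrightarrow> v \<in> V \<Longrightarrow> u \<noteq> v \<Longrightarrow> \<exists>e\<in>T. pot e u \<noteq> pot e v"
begin

text \<open>The walk around the tree crosses the cut of \<open>e\<close> only at the two occurrences
  of \<open>e\<close>, so the cut separates the corners between them from all others.\<close>

lemma pot_vert:
  assumes e: "e \<in> T" and k: "k \<le> N" and l: "l \<le> N"
  shows "pot e (vert k) = pot e (vert l) \<longleftrightarrow> (pos1 e < k \<and> k \<le> pos2 e \<longleftrightarrow> pos1 e < l \<and> l \<le> pos2 e)"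
proof (rule two_jumps[where f="\<lambda>k. pot e (vert k)"])
  have eE: "e \<in> E" using e T_sub by auto
  show "pos1 e < pos2 e" "pos2 e < N" using pos[OF eE] by auto
  fix k assume k: "k < N" "k \<noteq> pos1 e" "k \<noteq> pos2 e"
  show "pot e (vert (Suc k)) = pot e (vert k)"
  proof (cases "lt k \<in> T")
    case True
    have "lt k \<noteq> e" using pos_only[OF k(1)] k by auto
    then have "pot e (t (lt k)) = pot e (s (lt k))" using pot[OF e True] by simp
    then show ?thesis using vert_T[OF k(1) True] by (metis doubleton_eq_iff)
  qed (use vert_const k in simp)
next
  have eE: "e \<in> E" using e T_sub by auto
  have "{vert (pos1 e), vert (Suc (pos1 e))} = {s e, t e}" using vert_T[of "pos1 e"] pos[OF eE] e by auto
  moreover have "pot e (t e) \<noteq> pot e (s e)" using pot[OF e e] by simp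
  ultimately show "pot e (vert (Suc (pos1 e))) \<noteq> pot e (vert (pos1 e))" by (metis doubleton_eq_iff)
  show "pot e (vert N) = pot e (vert 0)" by (simp add: vert_N)
qed (use k l in auto)

definition kv :: "'v \<Rightarrow> nat" where "kv v = (SOME k. k < N \<and> vert k = v)"

lemma kv: "v \<in> V \<Longrightarrow> kv v < N \<and> vert (kv v) = v"
  unfolding kv_def using vert_onto by (rule someI_ex) 

definition inner :: "'e \<Rightarrow> nat \<Rightarrow> bool" where "inner e k \<longleftrightarrow> pos1 e < k \<and> k \<le> pos2 e"

definition par :: "nat \<Rightarrow> real \<times> real" where "par k = (real k, (real k)^2)"

text \<open>Corner \<open>k\<close> precedes letter \<open>k\<close>, hence the shift by 1/2. A
  chord spanning this corner is at least 1/4 above the parabola there, so a point at height 1/8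
  stays below it.\<close>

definition pt :: "'v \<Rightarrow> real \<times> real" where "pt v = (real (kv v) - 1/2, (real (kv v) - 1/2)^2 + 1/8)"

text \<open>A linear form that vanishes on the line through the two points of the parabola belonging
  to \<open>e\<close>. At \<open>(x, x^2)\<close> it factors as
  \<open>(x - pos1 e) * (x - pos2 e)\<close>, so its sign is a matter of order.\<close>

definition chord :: "'e \<Rightarrow> real \<times> real \<Rightarrow> real" where
  "chord e z = snd z - (real (pos1 e) + real (pos2 e)) * fst z + real (pos1 e) * real (pos2 e)"

definition mid :: "'e \<Rightarrow> real \<times> real" where
  "mid e = ((real (pos1 e) + real (pos2 e)) / 2, (real (pos1 e) + real (pos2 e))^2 / 2 - real (pos1 e) * real (pos2 e))"

definition hgt :: "real \<times> real \<Rightarrow> real" where "hgt z = snd z - (fst z)^2"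

text \<open>Both alternatives are strict, so a point on the line of a chord belongs to no
  region.\<close>

definition side :: "'e \<Rightarrow> nat \<Rightarrow> real \<times> real \<Rightarrow> bool" where
  "side e k z \<longleftrightarrow> (if inner e k then chord e z < 0 else chord e z > 0)"

definition region :: "'v \<Rightarrow> (real \<times> real) set" where
  "region v = {z. hgt z \<ge> 0 \<and> (\<forall>e\<in>T. side e (kv v) z)}"

lemma chord_affine: "chord e ((1 - u) *\<^sub>R z + u *\<^sub>R w) = (1 - u) * chord e z + u * chord e w"
  by (simp add: chord_def algebra_simps)

lemma hgt_segment: "hgt ((1 - u) *\<^sub>R z + u *\<^sub>R w) = (1 - u) * hgt z + u * hgt w + u * (1 - u) * (fst z - fst w)^2"
  by (simp add: hgt_def power2_eq_square algebra_simps)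

lemma chord_par: "chord e (par m) = (real m - real (pos1 e)) * (real m - real (pos2 e))"
  by (simp add: chord_def par_def power2_eq_square algebra_simps)

lemma chord_mid: "chord e (mid e) = 0"
  by (simp add: chord_def mid_def power2_eq_square algebra_simps add_divide_distrib)

lemma hgt_pt: "hgt (pt v) = 1/8" by (simp add: hgt_def pt_def)
lemma hgt_par: "hgt (par m) = 0" by (simp add: hgt_def par_def)
lemma hgt_mid: "hgt (mid e) = ((real (pos2 e) - real (pos1 e)) / 2)^2"
  by (simp add: hgt_def mid_def power2_eq_square field_simps)

lemma hgt_mid_pos: "e \<in> E \<Longrightarrow> hgt (mid e) > 0"
  using pos[of e] by (simp add: hgt_mid)

lemma side_pt: assumes "e \<in> T" shows "side e (kv v) (pt v)"
proof -
  have eE: "e \<in> E" using assms T_sub by auto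
  have c: "chord e (pt v) = (real (kv v) - 1/2 - real (pos1 e)) * (real (kv v) - 1/2 - real (pos2 e)) + 1/8"
    by (simp add: chord_def pt_def power2_eq_square algebra_simps)
  show ?thesis
  proof (cases "inner e (kv v)")
    case True
    then have "1/2 \<le> real (kv v) - 1/2 - real (pos1 e)" "1/2 \<le> real (pos2 e) - (real (kv v) - 1/2)" by (auto simp: inner_def)
    then have "1/2 * (1/2) \<le> (real (kv v) - 1/2 - real (pos1 e)) * (real (pos2 e) - (real (kv v) - 1/2))"
      by (intro mult_mono) auto
    then show ?thesis using True by (simp add: side_def c algebra_simps)
  next
    case False
    have "(real (kv v) - 1/2 - real (pos1 e)) * (real (kv v) - 1/2 - real (pos2 e)) \<ge> 0"
    proof (cases "kv v \<le> pos1 e")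
      case True
      then show ?thesis using pos[OF eE] by (intro mult_nonpos_nonpos) auto
    next
      case F: False
      then have "kv v > pos2 e" using False by (auto simp: inner_def)
      then show ?thesis using pos[OF eE] by (intro mult_nonneg_nonneg) auto
    qed
    then show ?thesis using False by (simp add: side_def c)
  qed
qed

lemma side_par:
  assumes "e \<in> T" "m \<noteq> pos1 e" "m \<noteq> pos2 e" shows "side e m (par m)"
proof -
  have p: "pos1 e < pos2 e" using pos[of e] assms T_sub by auto
  show ?thesis
  proof (cases "inner e m")
    case True
    then have "real m - real (pos1 e) > 0" "real m - real (pos2 e) < 0" using assms by (auto simp: inner_def)
    then show ?thesis using True by (simp add: side_def chord_par mult_pos_neg)
  next
    case False
    then have "m < pos1 e \<or> m > pos2 e" using assms p by (auto simp: inner_def)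
    then have "chord e (par m) > 0" unfolding chord_par using p by (auto intro: mult_pos_pos mult_neg_neg)
    then show ?thesis using False by (simp add: side_def)
  qed
qed

lemma inner_vert:
  assumes "e \<in> T" "k \<le> N" "l \<le> N" "vert k = vert l" shows "inner e k \<longleftrightarrow> inner e l"
  using pot_vert[OF assms(1-3)] assms(4) by (simp add: inner_def)

lemma inner_kv: "e \<in> T \<Longrightarrow> k < N \<Longrightarrow> vert k \<in> V \<Longrightarrow> inner e (kv (vert k)) \<longleftrightarrow> inner e k"
  using inner_vert[of e "kv (vert k)" k] kv[of "vert k"] by simp

lemma region_disjoint:
  assumes "u \<in> V" "v \<in> V" "u \<noteq> v" "z \<in> region u" "z \<in> region v" shows False
proof -
  obtain e where e: "e \<in> T" "pot e u \<noteq> pot e v" using pot_sep assms by blast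
  then have "inner e (kv u) \<noteq> inner e (kv v)"
    using pot_vert[OF e(1), of "kv u" "kv v"] kv[OF assms(1)] kv[OF assms(2)] by (simp add: inner_def)
  moreover have "side e (kv u) z" "side e (kv v) z" using assms(4,5) e(1) by (auto simp: region_def)
  ultimately show False by (auto simp: side_def split: if_splits)
qed

text \<open>A half-edge with base v and target q is drawn as the segment from pt v to q. The target is either
  a point of the parabola or the midpoint of the chord of a tree edge.\<close>

definition half_edge :: "'e \<Rightarrow> 'v \<Rightarrow> real \<times> real \<Rightarrow> bool" where
  "half_edge e v q \<longleftrightarrow> v \<in> V \<and> ((e \<in> E - T \<and> (\<exists>m<N. lt m = e \<and> vert m = v \<and> q = par m)) \<or>
     (e \<in> T \<and> (v = s e \<or> v = t e) \<and> q = mid e))"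

text \<open>Chords of tree edges do not cross. For a tree edge both ends of its chord, and therefore
  its midpoint, lie on the same side of any other chord as the base \<open>v\<close>.\<close>

lemma half_edge_target:
  assumes "half_edge e v q" "f \<in> T" "\<not> (f = e)" shows "side f (kv v) q"
proof (cases "e \<in> T")
  case False
  then obtain m where m: "m < N" "lt m = e" "vert m = v" "q = par m" "v \<in> V" using assms(1) by (auto simp: half_edge_def)
  have fE: "f \<in> E" using assms(2) T_sub by auto
  have "m \<noteq> pos1 f" "m \<noteq> pos2 f" using pos[OF fE] m(2) assms(3) by auto
  then show ?thesis using side_par[OF assms(2)] inner_kv[OF assms(2) m(1)] m by (simp add: side_def)
next
  case True
  have eE: "e \<in> E" and fE: "f \<in> E" using True assms(2) T_sub by auto
  have v: "v = s e \<or> v = t e" "q = mid e" "v \<in> V" using assms(1) True by (auto simp: half_edge_def)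
  have p: "pos1 e < N" "pos2 e < N" "lt (pos1 e) = e" "lt (pos2 e) = e" using pos[OF eE] by auto
  have ne: "pos1 e \<noteq> pos1 f" "pos1 e \<noteq> pos2 f" "pos2 e \<noteq> pos1 f" "pos2 e \<noteq> pos2 f"
    using pos[OF eE] pos[OF fE] assms(3) by metis+
  have "pot f (s e) = pot f (t e)" using pot[OF assms(2) True] assms(3) by auto
  then have same: "pot f w = pot f v" if "w \<in> {s e, t e}" for w using that v by auto
  have I: "inner f k \<longleftrightarrow> inner f (kv v)" if "k = pos1 e \<or> k = pos2 e" for k
  proof -
    have "vert k \<in> {s e, t e}" using vert_T[of k] p that True by auto
    then show ?thesis using pot_vert[OF assms(2), of k "kv v"] same[of "vert k"] p that kv[OF v(3)] by (auto simp: inner_def)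
  qed
  have S: "side f (kv v) (par (pos1 e))" "side f (kv v) (par (pos2 e))"
    using side_par[OF assms(2), of "pos1 e"] side_par[OF assms(2), of "pos2 e"] ne I by (auto simp: side_def)
  have "mid e = (1 - 1/2) *\<^sub>R par (pos1 e) + (1/2) *\<^sub>R par (pos2 e) "
    by (simp add: mid_def par_def power2_eq_square field_simps)
  then have "chord f (mid e) = (chord f (par (pos1 e)) + chord f (par (pos2 e))) / 2"
    using chord_affine[of f "1/2" "par (pos1 e)" "par (pos2 e)"] by simp
  then show ?thesis using S v(2) by (auto simp: side_def)
qed

lemma half_edge_hgt:
  assumes "half_edge e v q" shows "hgt q \<ge> 0" "hgt q = 0 \<longleftrightarrow> e \<notin> T"
  using assms hgt_mid_pos[of e] T_sub by (auto simp: half_edge_def hgt_par)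

lemma seg_side:
  assumes "side e k z" "side e k w" "x \<in> closed_segment z w" shows "side e k x"
proof -
  obtain u where u: "0 \<le> u" "u \<le> 1" "x = (1 - u) *\<^sub>R z + u *\<^sub>R w" using assms(3) by (auto simp: in_segment)
  show ?thesis
  proof (cases "u = 0 \<or> u = 1")
    case False
    then have "0 < u" "0 < 1 - u" using u by auto
    then show ?thesis using assms(1,2) unfolding u(3) side_def chord_affine
      by (auto simp: add_neg_neg mult_pos_neg add_pos_pos)
  qed (use assms u in auto)
qed

text \<open>By convexity the segment stays above the parabola and on the right sides of the chords;
  only its target can lie on the parabola or on the chord of \<open>e\<close> itself.\<close>

lemma half_edge_segment:
  assumes h: "half_edge e v q" and z: "z \<in> closed_segment (pt v) q"
  shows "hgt z \<ge> 0" "z \<noteq> q \<Longrightarrow> hgt z > 0" "f \<in> T \<Longrightarrow> f \<noteq> e \<Longrightarrow> side f (kv v) z"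
    "e \<in> T \<Longrightarrow> z \<noteq> q \<Longrightarrow> side e (kv v) z" "z \<noteq> q \<or> e \<notin> T \<Longrightarrow> z \<in> region v"
proof -
  obtain u where u: "0 \<le> u" "u \<le> 1" "z = (1 - u) *\<^sub>R pt v + u *\<^sub>R q" using z by (auto simp: in_segment)
  have hz: "hgt z = (1 - u) * (1/8) + u * hgt q + u * (1 - u) * (fst (pt v) - fst q)^2"
    unfolding u(3) hgt_segment hgt_pt ..
  show h0: "hgt z \<ge> 0" unfolding hz using u half_edge_hgt[OF h] by auto
  show h1: "hgt z > 0" if "z \<noteq> q"
  proof -
    have "u < 1" using that u by (metis add_0 diff_self linorder_not_less nle_le scaleR_one scaleR_zero_left)
    then have "(1 - u) * (1/8) > 0" by simp
    moreover have "u * hgt q \<ge> 0" "u * (1 - u) * (fst (pt v) - fst q)^2 \<ge> 0" using u half_edge_hgt[OF h] by auto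
    ultimately show ?thesis unfolding hz by linarith
  qed
  show h2: "side f (kv v) z" if "f \<in> T" "f \<noteq> e" for f
    using seg_side[OF side_pt[OF that(1)] half_edge_target[OF h that] z] .
  show h3: "side e (kv v) z" if "e \<in> T" "z \<noteq> q"
  proof -
    have q: "q = mid e" using h that by (auto simp: half_edge_def)
    have "u < 1" using that u by (metis add_0 diff_self linorder_not_less nle_le scaleR_one scaleR_zero_left)
    moreover have "chord e z = (1 - u) * chord e (pt v)" unfolding u(3) chord_affine q chord_mid by simp
    ultimately show ?thesis using side_pt[OF that(1), of v] by (auto simp: side_def mult_pos_neg)
  qed
  show "z \<in> region v" if "z \<noteq> q \<or> e \<notin> T"
    unfolding region_def
  proof (intro CollectI conjI ballI h0)
    show "side f (kv v) z" if "f \<in> T" for f using h2[OF that] h3 that \<open>z \<noteq> q \<or> e \<notin> T\<close> by (cases "f = e") auto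
  qed
qed

lemma pt_region: "v \<in> V \<Longrightarrow> pt v \<in> region v"
  using side_pt by (auto simp: region_def hgt_pt)

text \<open>Segments with different bases lie in disjoint regions, apart from a common chord
  midpoint. For a common base, a second common point would place one target on the other segment,
  which height and chord signs allow only for equal half-edges.\<close>

lemma half_edges_meet:
  assumes h: "half_edge e v q" and h': "half_edge e' v' q'"
    and z: "z \<in> closed_segment (pt v) q" "z \<in> closed_segment (pt v') q'"
  shows "(v = v' \<and> z = pt v) \<or> (e = e' \<and> v = v' \<and> q = q') \<or> (e = e' \<and> e \<in> T \<and> z = mid e)"
proof -
  have V: "v \<in> V" "v' \<in> V" using h h' by (auto simp: half_edge_def)
  have qT: "q = mid e" if "e \<in> T" using h that by (auto simp: half_edge_def)
  have qT': "q' = mid e'" if "e' \<in> T" using h' that by (auto simp: half_edge_def)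
  have qP: "e = e' \<and> q = q'" if "q = q'" "e \<notin> T" "e' \<notin> T"
    using h h' that by (auto simp: half_edge_def par_def)
  have A: False if "z = mid f" "f \<in> T" "z \<in> region w" for f w
    using that chord_mid[of f] by (auto simp: region_def side_def split: if_splits)
  have B: False if "e \<in> T" "z = q" "e' \<noteq> e"
    using half_edge_segment(3)[OF h' z(2), of e] that qT chord_mid[of e] by (auto simp: side_def split: if_splits)
  have B': False if "e' \<in> T" "z = q'" "e' \<noteq> e"
    using half_edge_segment(3)[OF h z(1), of e'] that qT' chord_mid[of e'] by (auto simp: side_def split: if_splits)
  show ?thesis
  proof (cases "v = v'")
    case False
    show ?thesis
    proof (cases "(z \<noteq> q \<or> e \<notin> T) \<and> (z \<noteq> q' \<or> e' \<notin> T)")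
      case True
      then show ?thesis using half_edge_segment(5)[OF h z(1)] half_edge_segment(5)[OF h' z(2)] region_disjoint[OF V False] by blast
    next
      case nT: False
      then have "e = e'" using B B' by blast
      then show ?thesis using nT qT qT' by auto
    qed
  next
    case True
    show ?thesis
    proof (cases "z = pt v")
      case False
      have key: "e = e' \<and> q = q'" if hh: "half_edge e v q" "half_edge e' v q'" "q \<in> closed_segment (pt v) q'" for e e' q q'
      proof (cases "e \<in> T")
        case eT: True
        have q: "q = mid e" using hh(1) eT by (auto simp: half_edge_def)
        have "e' = e"
        proof (rule ccontr)
          assume "e' \<noteq> e"
          then have "side e (kv v) q" using half_edge_segment(3)[OF hh(2,3) eT] by simp
          then show False using q chord_mid[of e] by (auto simp: side_def split: if_splits)
        qed
        then show ?thesis using hh q eT by (auto simp: half_edge_def)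
      next
        case eT: False
        then have "hgt q = 0" using half_edge_hgt(2)[OF hh(1)] by simp
        then have "q = q'" using half_edge_segment(2)[OF hh(2,3)] by force
        moreover have "e' \<notin> T" using half_edge_hgt(2)[OF hh(2)] \<open>hgt q = 0\<close> calculation by simp
        moreover obtain m where "lt m = e" "q = par m" using hh(1) eT unfolding half_edge_def by blast
        moreover obtain m' where "lt m' = e'" "q' = par m'" using hh(2) \<open>e' \<notin> T\<close> unfolding half_edge_def by blast
        ultimately show ?thesis by (simp add: par_def)
      qed
      have "half_edge e' v q'" using h' True by simp
      moreover have "z \<in> closed_segment (pt v) q'" using z(2) True by simp
      ultimately have "e = e' \<and> q = q'"
        using segments_same_base[OF z(1) _ False] key[OF h] key[of e' q' e q] h by blast
      then show ?thesis using True by simp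
    qed (use True in simp)
  qed
qed

section \<open>Edges assembled from half-edges and outer curves\<close>

definition base1 :: "'e \<Rightarrow> 'v" where "base1 e = (if e \<in> T then s e else vert (pos1 e))"
definition base2 :: "'e \<Rightarrow> 'v" where "base2 e = (if e \<in> T then t e else vert (pos2 e))"
definition tg1 :: "'e \<Rightarrow> real \<times> real" where "tg1 e = (if e \<in> T then mid e else par (pos1 e))"
definition tg2 :: "'e \<Rightarrow> real \<times> real" where "tg2 e = (if e \<in> T then mid e else par (pos2 e))"

lemma base_ends: "e \<in> E \<Longrightarrow> {base1 e, base2 e} = {s e, t e}"
  using ends_pos[of e] by (auto simp: base1_def base2_def)

lemma base_neq: assumes "e \<in> E" shows "base1 e \<noteq> base2 e"
proof
  assume "base1 e = base2 e"
  then have "{s e, t e} = {base1 e}" using base_ends[OF assms] by simp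
  then show False using no_loops[OF assms] by (metis doubleton_eq_iff insert_absorb2)
qed

lemma base_V: assumes "e \<in> E" shows "base1 e \<in> V" "base2 e \<in> V"
proof -
  have "{base1 e, base2 e} \<subseteq> V" using base_ends[OF assms] ends_in_V[OF assms] by simp
  then show "base1 e \<in> V" "base2 e \<in> V" by auto
qed

lemma half_edges:
  assumes "e \<in> E" shows "half_edge e (base1 e) (tg1 e)" "half_edge e (base2 e) (tg2 e)"
  using assms base_V[OF assms] pos[OF assms] unfolding half_edge_def base1_def base2_def tg1_def tg2_def
  by (auto intro: exI[of _ "pos1 e"] exI[of _ "pos2 e"])

lemma pt_neq_target: assumes "half_edge e v q" shows "pt w \<noteq> q"
proof
  assume eq: "pt w = q"
  show False
  proof (cases "e \<in> T")
    case True
    then have "q = mid e" using assms by (auto simp: half_edge_def)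
    then show False using side_pt[OF True, of w] eq chord_mid[of e] by (auto simp: side_def split: if_splits)
  next
    case False
    then show False using half_edge_hgt(2)[OF assms] eq hgt_pt[of w] by simp
  qed
qed

lemma pt_on_half_edge:
  assumes "half_edge e v q" "w \<in> V" "pt w \<in> closed_segment (pt v) q" shows "w = v"
proof (rule ccontr)
  assume "w \<noteq> v"
  moreover have "pt w \<in> region v" using half_edge_segment(5)[OF assms(1,3)] pt_neq_target[OF assms(1)] by blast
  moreover have "v \<in> V" using assms(1) by (simp add: half_edge_def)
  ultimately show False using region_disjoint[OF assms(2)] pt_region[OF assms(2)] by blast
qed

lemma pt_inj: "inj_on pt V"
proof (rule inj_onI)
  fix u v assume u: "u \<in> V" "v \<in> V" "pt u = pt v"
  then have "kv u = kv v" by (simp add: pt_def)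
  then show "u = v" using kv u by metis
qed

text \<open>\<open>\<iota>\<close> places the affine plane in the surface. An edge in
  \<open>T\<close> consists of two half-edges joined at the middle of its chord; any other edge
  consists of two half-edges and the outer curve \<open>oc e\<close>, which touches the closed
  region above the parabola only at its ends.\<close>

theorem contour_embeds:
  fixes \<iota> :: "real \<times> real \<Rightarrow> 'p::t2_space" and oc :: "'e \<Rightarrow> real \<Rightarrow> 'p"
  assumes inj: "inj \<iota>" and cont: "continuous_on UNIV \<iota>" and S: "range \<iota> \<subseteq> S"
    and oc: "\<And>e. e \<in> E - T \<Longrightarrow> arc (oc e) \<and> pathstart (oc e) = \<iota> (par (pos1 e)) \<and>
        pathfinish (oc e) = \<iota> (par (pos2 e)) \<and> path_image (oc e) \<subseteq> S"
    and oc_hgt: "\<And>e z. e \<in> E - T \<Longrightarrow> hgt z \<ge> 0 \<Longrightarrow> \<iota> z \<in> path_image (oc e) \<Longrightarrow> z = par (pos1 e) \<or> z = par (pos2 e)"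
    and oc_disj: "\<And>e e'. e \<in> E - T \<Longrightarrow> e' \<in> E - T \<Longrightarrow> e \<noteq> e' \<Longrightarrow> path_image (oc e) \<inter> path_image (oc e') = {}"
  shows "graph_embeds (top_of_set S) V E s t"
proof -
  define sg1 where "sg1 e = closed_segment (pt (base1 e)) (tg1 e)" for e
  define sg2 where "sg2 e = closed_segment (pt (base2 e)) (tg2 e)" for e
  define Im where "Im e = \<iota> ` (sg1 e \<union> sg2 e) \<union> (if e \<in> T then {} else path_image (oc e))" for e
  have arc\<iota>: "arc (\<iota> \<circ> g)" if "arc g" for g
    using that inj cont unfolding arc_def
    by (auto intro!: path_continuous_image comp_inj_on intro: continuous_on_subset inj_on_subset)
  have "\<exists>g. arc g \<and> pathstart g = \<iota> (pt (base1 e)) \<and> pathfinish g = \<iota> (pt (base2 e)) \<and> path_image g = Im e"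
    if e: "e \<in> E" for e
  proof -
    note H = half_edges[OF e]
    have meet: "z = mid e \<and> e \<in> T" if "z \<in> sg1 e" "z \<in> sg2 e" for z
      using half_edges_meet[OF H that[unfolded sg1_def sg2_def]] base_neq[OF e] by auto
    define a where "a = \<iota> \<circ> linepath (pt (base1 e)) (tg1 e)"
    define b where "b = \<iota> \<circ> linepath (tg2 e) (pt (base2 e))"
    have arcs: "arc a" "arc b" unfolding a_def b_def
      using pt_neq_target[OF H(1)] pt_neq_target[OF H(2)] by (intro arc\<iota> arc_linepath; metis)+
    have im: "path_image a = \<iota> ` sg1 e" "path_image b = \<iota> ` sg2 e"
      by (auto simp: a_def b_def path_image_compose sg1_def sg2_def closed_segment_commute)
    have ends: "pathstart a = \<iota> (pt (base1 e))" "pathfinish a = \<iota> (tg1 e)" "pathstart b = \<iota> (tg2 e)" "pathfinish b = \<iota> (pt (base2 e))"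
      by (simp_all add: a_def b_def pathstart_compose pathfinish_compose)
    show ?thesis
    proof (cases "e \<in> T")
      case True
      have t: "tg1 e = mid e" "tg2 e = mid e" using True by (simp_all add: tg1_def tg2_def)
      have "path_image a \<inter> path_image b \<subseteq> {pathstart b}" unfolding im ends t using meet inj by (auto dest: injD)
      then have "arc (a +++ b)" using arcs ends t by (intro arc_join) auto
      moreover have "path_image (a +++ b) = Im e" using ends t True by (subst path_image_join) (auto simp: im Im_def)
      ultimately show ?thesis using ends by (intro exI[of _ "a +++ b"]) auto
    next
      case False
      have eT: "e \<in> E - T" using e False by simp
      have t: "tg1 e = par (pos1 e)" "tg2 e = par (pos2 e)" using False by (simp_all add: tg1_def tg2_def)
      have ab: "path_image a \<inter> path_image b = {}" unfolding im using meet False inj by (auto dest: injD)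
      have hs: "hgt z \<ge> 0" if "z \<in> sg1 e \<union> sg2 e" for z
        using that half_edge_segment(1)[OF H(1), of z] half_edge_segment(1)[OF H(2), of z] by (auto simp: sg1_def sg2_def)
      have p2: "par (pos2 e) \<in> sg2 e" "par (pos1 e) \<in> sg1 e" by (simp_all add: sg1_def sg2_def t)
      then have n12: "par (pos2 e) \<notin> sg1 e" "par (pos1 e) \<notin> sg2 e" using meet False by blast+
      have ao: "path_image a \<inter> path_image (oc e) \<subseteq> {\<iota> (par (pos1 e))}"
        unfolding im using oc_hgt[OF eT] hs n12 by blast
      have bo: "path_image (oc e) \<inter> path_image b \<subseteq> {\<iota> (par (pos2 e))}"
        unfolding im using oc_hgt[OF eT] hs n12 by blast
      note o = oc[OF eT]
      have ob: "arc (oc e +++ b)" using arcs o ends t bo by (intro arc_join) auto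
      have iob: "path_image (oc e +++ b) = path_image (oc e) \<union> path_image b" using o ends t by (intro path_image_join) auto
      have "arc (a +++ (oc e +++ b))"
        by (rule arc_join[OF arcs(1) ob]) (use ao ab o ends t in \<open>auto simp: iob\<close>)
      moreover have "path_image (a +++ (oc e +++ b)) = Im e"
        using o ends t False by (subst path_image_join) (auto simp: iob im Im_def)
      ultimately show ?thesis using ends by (intro exI[of _ "a +++ (oc e +++ b)"]) auto
    qed
  qed
  then obtain g where g: "\<And>e. e \<in> E \<Longrightarrow> arc (g e) \<and> pathstart (g e) = \<iota> (pt (base1 e)) \<and>
      pathfinish (g e) = \<iota> (pt (base2 e)) \<and> path_image (g e) = Im e" by metis
  define \<gamma> where "\<gamma> e = (if base1 e = s e then g e else reversepath (g e))" for e
  have \<gamma>: "arc (\<gamma> e) \<and> pathstart (\<gamma> e) = \<iota> (pt (s e)) \<and> pathfinish (\<gamma> e) = \<iota> (pt (t e)) \<and> path_image (\<gamma> e) = Im e"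
    if e: "e \<in> E" for e
  proof (cases "base1 e = s e")
    case True
    then have "base2 e = t e" using base_ends[OF e] by (metis doubleton_eq_iff)
    then show ?thesis using True g[OF e] by (simp add: \<gamma>_def)
  next
    case False
    then have "base1 e = t e" "base2 e = s e" using base_ends[OF e] by (metis doubleton_eq_iff)+
    then show ?thesis using False g[OF e] by (simp add: \<gamma>_def arc_reversepath)
  qed
  have hz: "hgt z \<ge> 0" "hgt z = 0 \<Longrightarrow> e \<notin> T \<and> (z = par (pos1 e) \<or> z = par (pos2 e))"
    if ez: "e \<in> E" "z \<in> sg1 e \<union> sg2 e" for e z
  proof -
    obtain v q where vq: "half_edge e v q" "z \<in> closed_segment (pt v) q" "q = tg1 e \<or> q = tg2 e"
      using ez half_edges[OF ez(1)] unfolding sg1_def sg2_def by blast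
    show "hgt z \<ge> 0" using half_edge_segment(1)[OF vq(1,2)] .
    assume 0: "hgt z = 0"
    then have "z = q" using half_edge_segment(2)[OF vq(1,2)] by force
    moreover from this have "e \<notin> T" using half_edge_hgt(2)[OF vq(1)] 0 by simp
    ultimately show "e \<notin> T \<and> (z = par (pos1 e) \<or> z = par (pos2 e))" using vq(3) by (auto simp: tg1_def tg2_def)
  qed
  show ?thesis
  proof (rule graph_embeds_arcs[of "\<iota> \<circ> pt" _ _ _ \<gamma>])
    show "inj_on (\<iota> \<circ> pt) V" using pt_inj inj by (simp add: comp_inj_on inj_on_subset)
    show "(\<iota> \<circ> pt) ` V \<subseteq> S" using S by auto
    show "arc (\<gamma> e) \<and> pathstart (\<gamma> e) = (\<iota> \<circ> pt) (s e) \<and> pathfinish (\<gamma> e) = (\<iota> \<circ> pt) (t e) \<and> path_image (\<gamma> e) \<subseteq> S" if "e \<in> E" for e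
      using \<gamma>[OF that] oc[of e] that S by (auto simp: Im_def)
    show "path_image (\<gamma> e) \<inter> (\<iota> \<circ> pt) ` V \<subseteq> {(\<iota> \<circ> pt) (s e), (\<iota> \<circ> pt) (t e)}" if e: "e \<in> E" for e
    proof
      fix x assume "x \<in> path_image (\<gamma> e) \<inter> (\<iota> \<circ> pt) ` V"
      then obtain v where v: "v \<in> V" "x = \<iota> (pt v)" "\<iota> (pt v) \<in> Im e" using \<gamma>[OF e] by auto
      have "\<iota> (pt v) \<notin> path_image (oc e)" if "e \<notin> T"
        using oc_hgt[of e "pt v"] e that hgt_pt[of v] hgt_par by force
      then have "pt v \<in> sg1 e \<union> sg2 e" using v(3) inj by (auto simp: Im_def dest: injD split: if_splits)
      then have "v = base1 e \<or> v = base2 e"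
        using pt_on_half_edge[OF half_edges(1)[OF e] v(1)] pt_on_half_edge[OF half_edges(2)[OF e] v(1)] by (auto simp: sg1_def sg2_def)
      then have "v \<in> {s e, t e}" using base_ends[OF e] by auto
      then show "x \<in> {(\<iota> \<circ> pt) (s e), (\<iota> \<circ> pt) (t e)}" using v(2) by auto
    qed
    show "path_image (\<gamma> e) \<inter> path_image (\<gamma> e') \<subseteq> (\<iota> \<circ> pt) ` V" if e: "e \<in> E" "e' \<in> E" "e \<noteq> e'" for e e'
    proof
      fix x assume "x \<in> path_image (\<gamma> e) \<inter> path_image (\<gamma> e')"
      then have x: "x \<in> Im e" "x \<in> Im e'" using \<gamma>[OF e(1)] \<gamma>[OF e(2)] by auto
      have no: False if f: "f \<in> E" "f' \<in> E" "f \<noteq> f'" "x \<in> \<iota> ` (sg1 f \<union> sg2 f)" "f' \<notin> T" "x \<in> path_image (oc f')" for f f'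
      proof -
        obtain z where z: "z \<in> sg1 f \<union> sg2 f" "x = \<iota> z" using f(4) by auto
        have "z = par (pos1 f') \<or> z = par (pos2 f')" using oc_hgt[of f' z] f z hz(1)[OF f(1) z(1)] by auto
        moreover from this have "hgt z = 0" using hgt_par by auto
        then have "z = par (pos1 f) \<or> z = par (pos2 f)" using hz(2)[OF f(1) z(1)] by blast
        ultimately have "pos1 f' = pos1 f \<or> pos1 f' = pos2 f \<or> pos2 f' = pos1 f \<or> pos2 f' = pos2 f" by (auto simp: par_def)
        then show False using pos[OF f(1)] pos[OF f(2)] f(3) by metis
      qed
      consider "x \<in> \<iota> ` (sg1 e \<union> sg2 e)" "x \<in> \<iota> ` (sg1 e' \<union> sg2 e')"
        | "e \<notin> T" "e' \<notin> T" "x \<in> path_image (oc e)" "x \<in> path_image (oc e')"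
        using x no[OF e(1,2,3)] no[OF e(2,1)] e(3) by (auto simp: Im_def split: if_splits)
      then show "x \<in> (\<iota> \<circ> pt) ` V"
      proof cases
        case 1
        then obtain z where z: "x = \<iota> z" "z \<in> sg1 e \<union> sg2 e" "z \<in> sg1 e' \<union> sg2 e'" using inj by (auto dest: injD)
        obtain v q where vq: "half_edge e v q" "z \<in> closed_segment (pt v) q"
          using z(2) half_edges[OF e(1)] unfolding sg1_def sg2_def by blast
        obtain v' q' where vq': "half_edge e' v' q'" "z \<in> closed_segment (pt v') q'"
          using z(3) half_edges[OF e(2)] unfolding sg1_def sg2_def by blast
        have "z = pt v" using half_edges_meet[OF vq(1) vq'(1) vq(2) vq'(2)] e(3) by auto
        then show ?thesis using z(1) vq(1) by (auto simp: half_edge_def)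
      next
        case 2
        then show ?thesis using oc_disj[of e e'] e by auto
      qed
    qed
  qed
qed

text \<open>The depth below the parabola is proportional to the product of the distances to the two
  ends, so nested arcs have different depths everywhere. The factor \<open>\<kappa>\<close> will
  keep the arcs shallow next to the curves through the crosscap.\<close>

definition low :: "real \<Rightarrow> 'e \<Rightarrow> real \<Rightarrow> real \<times> real" where
  "low \<kappa> e x = (x, x^2 - \<kappa> * ((x - real (pos1 e)) * (real (pos2 e) - x)))"

definition lowpath :: "real \<Rightarrow> 'e \<Rightarrow> real \<Rightarrow> real \<times> real" where
  "lowpath \<kappa> e u = low \<kappa> e (real (pos1 e) + u * (real (pos2 e) - real (pos1 e)))"

lemma low_ends: "low \<kappa> e (real (pos1 e)) = par (pos1 e)" "low \<kappa> e (real (pos2 e)) = par (pos2 e)"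
  by (simp_all add: low_def par_def)

lemma lowpath_arc:
  assumes "e \<in> E"
  shows "arc (lowpath \<kappa> e)" "pathstart (lowpath \<kappa> e) = par (pos1 e)" "pathfinish (lowpath \<kappa> e) = par (pos2 e)"
proof -
  have p: "pos1 e < pos2 e" using pos[OF assms] by simp
  show "arc (lowpath \<kappa> e)" unfolding arc_def path_def
  proof
    show "continuous_on {0..1} (lowpath \<kappa> e)" unfolding lowpath_def low_def by (intro continuous_intros)
    show "inj_on (lowpath \<kappa> e) {0..1}" using p by (auto simp: inj_on_def lowpath_def low_def)
  qed
  show "pathstart (lowpath \<kappa> e) = par (pos1 e)" "pathfinish (lowpath \<kappa> e) = par (pos2 e)"
    by (simp_all add: pathstart_def pathfinish_def lowpath_def low_ends)
qed

lemma lowpath_image: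
  assumes "e \<in> E" "z \<in> path_image (lowpath \<kappa> e)"
  obtains x where "real (pos1 e) \<le> x" "x \<le> real (pos2 e)" "z = low \<kappa> e x"
proof -
  obtain u where u: "0 \<le> u" "u \<le> 1" "z = low \<kappa> e (real (pos1 e) + u * (real (pos2 e) - real (pos1 e)))"
    using assms(2) by (auto simp: path_image_def lowpath_def)
  have d: "0 \<le> real (pos2 e) - real (pos1 e)" using pos[OF assms(1)] by simp
  have "u * (real (pos2 e) - real (pos1 e)) \<le> 1 * (real (pos2 e) - real (pos1 e))"
    using u d by (intro mult_right_mono) auto
  moreover have "0 \<le> u * (real (pos2 e) - real (pos1 e))" using u d by simp
  ultimately show ?thesis using u(3) by (intro that) auto
qed

lemma low_hgt:
  assumes "\<kappa> > 0" "real (pos1 e) \<le> x" "x \<le> real (pos2 e)" "hgt (low \<kappa> e x) \<ge> 0"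
  shows "low \<kappa> e x = par (pos1 e) \<or> low \<kappa> e x = par (pos2 e)"
proof -
  have "\<kappa> * ((x - real (pos1 e)) * (real (pos2 e) - x)) \<le> 0" using assms(4) by (simp add: hgt_def low_def)
  then have "(x - real (pos1 e)) * (real (pos2 e) - x) \<le> 0" using assms(1) by (simp add: mult_le_0_iff)
  moreover have "(x - real (pos1 e)) * (real (pos2 e) - x) \<ge> 0" using assms by simp
  ultimately have "x = real (pos1 e) \<or> x = real (pos2 e)" by auto
  then show ?thesis using low_ends by auto
qed

text \<open>Noncrossing intervals with different ends are disjoint or nested; for nested ones both
  factors of the depth are strictly larger on the outer arc.\<close>

lemma lowpath_disjoint:
  assumes "\<kappa> > 0" and e: "e \<in> E" "e' \<in> E" "e \<noteq> e'"
    and nc: "\<not> (pos1 e < pos1 e' \<and> pos1 e' < pos2 e \<and> pos2 e < pos2 e')"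
      "\<not> (pos1 e' < pos1 e \<and> pos1 e < pos2 e' \<and> pos2 e' < pos2 e)"
  shows "path_image (lowpath \<kappa> e) \<inter> path_image (lowpath \<kappa> e') = {}"
proof (rule ccontr)
  assume "path_image (lowpath \<kappa> e) \<inter> path_image (lowpath \<kappa> e') \<noteq> {}"
  then obtain z where z: "z \<in> path_image (lowpath \<kappa> e)" "z \<in> path_image (lowpath \<kappa> e')" by auto
  obtain x where x: "real (pos1 e) \<le> x" "x \<le> real (pos2 e)" "z = low \<kappa> e x" using lowpath_image[OF e(1) z(1)] .
  obtain x' where x': "real (pos1 e') \<le> x'" "x' \<le> real (pos2 e')" "z = low \<kappa> e' x'" using lowpath_image[OF e(2) z(2)] .
  have "x' = x" using x(3) x'(3) by (simp add: low_def)
  then have eq: "(x - real (pos1 e)) * (real (pos2 e) - x) = (x - real (pos1 e')) * (real (pos2 e') - x)"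
    using x(3) x'(3) assms(1) by (simp add: low_def)
  have ne: "pos1 e \<noteq> pos1 e'" "pos1 e \<noteq> pos2 e'" "pos2 e \<noteq> pos1 e'" "pos2 e \<noteq> pos2 e'"
    using pos[OF e(1)] pos[OF e(2)] e(3) by metis+
  have "pos1 e < pos2 e" "pos1 e' < pos2 e'" using pos e by auto
  moreover have "real (pos1 e) \<le> real (pos2 e')" "real (pos1 e') \<le> real (pos2 e)" using x x' \<open>x' = x\<close> by linarith+
  ultimately have "(pos1 e < pos1 e' \<and> pos2 e' < pos2 e) \<or> (pos1 e' < pos1 e \<and> pos2 e < pos2 e')"
    using nc ne by auto
  then show False
  proof
    assume a: "pos1 e < pos1 e' \<and> pos2 e' < pos2 e"
    then have "(x - real (pos1 e')) * (real (pos2 e') - x) < (x - real (pos1 e)) * (real (pos2 e) - x)"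
      using x' \<open>x' = x\<close> by (intro mult_strict_mono') auto
    then show False using eq by simp
  next
    assume a: "pos1 e' < pos1 e \<and> pos2 e < pos2 e'"
    then have "(x - real (pos1 e)) * (real (pos2 e) - x) < (x - real (pos1 e')) * (real (pos2 e') - x)"
      using x by (intro mult_strict_mono') auto
    then show False using eq by simp
  qed
qed

theorem contour_planar:
  assumes nc: "\<And>e e'. e \<in> E - T \<Longrightarrow> e' \<in> E - T \<Longrightarrow> \<not> (pos1 e < pos1 e' \<and> pos1 e' < pos2 e \<and> pos2 e < pos2 e')"
  shows "planar V E s t"
proof -
  have "graph_embeds (top_of_set (UNIV :: (real \<times> real) set)) V E s t"
  proof (rule contour_embeds[of id UNIV "lowpath 1"])
    fix e assume e: "e \<in> E - T"
    then show "arc (lowpath 1 e) \<and> pathstart (lowpath 1 e) = id (par (pos1 e)) \<and> pathfinish (lowpath 1 e) = id (par (pos2 e)) \<and>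
      path_image (lowpath 1 e) \<subseteq> UNIV" using lowpath_arc[of e 1] by simp
    show "z = par (pos1 e) \<or> z = par (pos2 e)" if z: "hgt z \<ge> 0" "id z \<in> path_image (lowpath 1 e)" for z
    proof -
      have "e \<in> E" "z \<in> path_image (lowpath 1 e)" using e z(2) by auto
      then obtain x where "real (pos1 e) \<le> x" "x \<le> real (pos2 e)" "z = low 1 e x" by (rule lowpath_image)
      then show ?thesis using low_hgt[of 1 e x] z(1) by simp
    qed
    show "path_image (lowpath 1 e) \<inter> path_image (lowpath 1 e') = {}" if "e' \<in> E - T" "e \<noteq> e'" for e'
      using nc[OF e that(1)] nc[OF that(1) e] that e by (intro lowpath_disjoint) auto
  qed (auto intro: continuous_on_id)
  then show ?thesis by (simp add: planar_def)
qed

end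

subsection \<open>Homogeneous coordinates\<close>

definition hproj :: "real^3 \<Rightarrow> real^3^3" where "hproj w = veronese (w /\<^sub>R norm w)"

definition hom :: "real \<times> real \<Rightarrow> real^3" where "hom z = vector [fst z, snd z, 1]"

text \<open>The homogeneous version of \<open>hgt\<close>. Its degree is even, so its sign is well
  defined on projective points.\<close>

definition conic :: "real^3 \<Rightarrow> real" where "conic w = w $ 2 * w $ 3 - (w $ 1)^2"

lemma hom_nth: "hom z $ 1 = fst z" "hom z $ 2 = snd z" "hom z $ 3 = 1"
  by (simp_all add: hom_def)

lemma hom_nonzero: "hom z \<noteq> 0"
  using hom_nth(3)[of z] by (metis zero_index zero_neq_one)

lemma hproj_RP2: "w \<noteq> 0 \<Longrightarrow> hproj w \<in> RP2"
  by (simp add: hproj_def RP2_def)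

lemma hproj_eqD:
  assumes "w \<noteq> 0" "w' \<noteq> 0" "hproj w = hproj w'"
  obtains r where "w = r *\<^sub>R w'"
proof -
  have "w /\<^sub>R norm w = w' /\<^sub>R norm w' \<or> w /\<^sub>R norm w = - (w' /\<^sub>R norm w')"
    using assms veronese_eq_iff[of "w /\<^sub>R norm w" "w' /\<^sub>R norm w'"] by (simp add: hproj_def)
  moreover have "w = norm w *\<^sub>R (w /\<^sub>R norm w)" using assms(1) by simp
  ultimately have "w = norm w *\<^sub>R (w' /\<^sub>R norm w') \<or> w = norm w *\<^sub>R (- (w' /\<^sub>R norm w'))" by metis
  then show ?thesis using that[of "norm w / norm w'"] that[of "- (norm w / norm w')"] by (auto simp: divide_inverse)
qed

lemma hproj_minus: "hproj (- w) = hproj w"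
  by (simp add: hproj_def veronese_minus)

lemma continuous_hproj: "0 \<notin> A \<Longrightarrow> continuous_on A hproj"
  unfolding hproj_def by (intro continuous_on_compose2[OF continuous_veronese] continuous_intros) auto

lemma continuous_hom: "continuous_on A hom"
proof -
  have "hom z = fst z *\<^sub>R axis 1 1 + snd z *\<^sub>R axis 2 1 + axis 3 1" for z
    by (simp add: vec_eq_iff forall_3 hom_nth axis_def)
  then have "continuous_on A hom \<longleftrightarrow> continuous_on A (\<lambda>z. fst z *\<^sub>R axis 1 1 + snd z *\<^sub>R axis 2 1 + axis 3 1 :: real^3)"
    by (intro continuous_on_cong) auto
  then show ?thesis by (auto intro!: continuous_intros)
qed

lemma hproj_hom_inj: assumes "hproj (hom z) = hproj (hom z')" shows "z = z'"
proof -
  obtain r where r: "hom z = r *\<^sub>R hom z'" using hproj_eqD[OF hom_nonzero hom_nonzero assms] .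
  have "hom z $ i = r * hom z' $ i" for i using r by simp
  from this[of 1] this[of 2] this[of 3] show ?thesis by (simp add: hom_nth prod_eq_iff)
qed

section \<open>Outer segments of chords through the crosscap\<close>

context contour begin

text \<open>The minus sign selects the other projective segment on the line of the chord: it leaves
  the parabola outwards and passes through infinity at \<open>u = 1/2\<close>.\<close>

definition tw :: "'e \<Rightarrow> real \<Rightarrow> real^3" where
  "tw e u = (1 - u) *\<^sub>R hom (par (pos1 e)) - u *\<^sub>R hom (par (pos2 e))"

lemma tw_nth:
  "tw e u $ 1 = (1 - u) * real (pos1 e) - u * real (pos2 e)"
  "tw e u $ 2 = (1 - u) * (real (pos1 e))^2 - u * (real (pos2 e))^2"
  "tw e u $ 3 = (1 - u) - u"
  by (simp_all add: tw_def hom_nth par_def)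

lemma tw_nonzero: assumes "e \<in> E" shows "tw e u \<noteq> 0"
proof
  assume "tw e u = 0"
  then have "tw e u $ 1 = 0" "tw e u $ 3 = 0" by simp_all
  then have u: "u = 1/2" and c: "(1 - u) * real (pos1 e) - u * real (pos2 e) = 0" by (simp_all add: tw_nth)
  show False using c[unfolded u] pos[OF assms] by simp
qed

lemma conic_hom: "conic (hom z) = hgt z"
  by (simp add: conic_def hom_nth hgt_def)

lemma conic_scale: "conic (r *\<^sub>R w) = r^2 * conic w"
  by (simp add: conic_def power2_eq_square algebra_simps)

lemma conic_tw: "conic (tw e u) = - (u * (1 - u) * (real (pos1 e) - real (pos2 e))^2)"
  by (simp add: conic_def tw_nth power2_eq_square algebra_simps)

lemma tw_arc:
  assumes e: "e \<in> E"
  shows "arc (hproj \<circ> tw e)" "pathstart (hproj \<circ> tw e) = hproj (hom (par (pos1 e)))"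
    "pathfinish (hproj \<circ> tw e) = hproj (hom (par (pos2 e)))"
proof -
  have p: "real (pos1 e) - real (pos2 e) \<noteq> 0" using pos[OF e] by simp
  show "arc (hproj \<circ> tw e)" unfolding arc_def path_def
  proof
    have "continuous_on {0..1} (tw e)" unfolding tw_def by (intro continuous_intros)
    then show "continuous_on {0..1} (hproj \<circ> tw e)"
      using tw_nonzero[OF e] by (intro continuous_on_compose continuous_hproj) auto
    show "inj_on (hproj \<circ> tw e) {0..1}"
    proof (rule inj_onI)
      fix u u' :: real assume "(hproj \<circ> tw e) u = (hproj \<circ> tw e) u'"
      then obtain r where r: "tw e u = r *\<^sub>R tw e u'" using hproj_eqD[OF tw_nonzero[OF e] tw_nonzero[OF e]] by auto
      then have r1: "tw e u $ 1 = r * tw e u' $ 1" and r3: "tw e u $ 3 = r * tw e u' $ 3" by simp_all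
      \<comment> \<open>A linear form vanishing at the first end recovers the parameter up to the
        factor \<open>r\<close>; the third coordinate then forces \<open>r = 1\<close>.\<close>
      have K: "(real (pos1 e) - real (pos2 e)) * u = tw e u $ 1 - real (pos1 e) * tw e u $ 3" for u
        by (simp add: tw_nth algebra_simps)
      have "(real (pos1 e) - real (pos2 e)) * u = r * (tw e u' $ 1 - real (pos1 e) * tw e u' $ 3)"
        unfolding K[of u] r1 r3 by (simp only: algebra_simps)
      also have "\<dots> = (real (pos1 e) - real (pos2 e)) * (r * u')" unfolding K[symmetric] by (simp only: mult_ac)
      finally have ru: "u = r * u'" using p by simp
      then have "r = 1" using r3 by (simp add: tw_nth algebra_simps)
      then show "u = u'" using ru by simp
    qed
  qed
  show "pathstart (hproj \<circ> tw e) = hproj (hom (par (pos1 e)))" by (simp add: pathstart_def tw_def)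
  show "pathfinish (hproj \<circ> tw e) = hproj (hom (par (pos2 e)))" by (simp add: pathfinish_def tw_def hproj_minus)
qed

lemma tw_image:
  assumes "z \<in> path_image (hproj \<circ> tw e)" obtains u where "0 \<le> u" "u \<le> 1" "z = hproj (tw e u)"
  using assms by (auto simp: path_image_def)

lemma tw_hgt:
  assumes e: "e \<in> E" and z: "hgt z \<ge> 0" "hproj (hom z) \<in> path_image (hproj \<circ> tw e)"
  shows "z = par (pos1 e) \<or> z = par (pos2 e)"
proof -
  have p: "(real (pos1 e) - real (pos2 e))^2 > 0" using pos[OF e] by simp
  obtain u where u: "0 \<le> u" "u \<le> 1" "hproj (hom z) = hproj (tw e u)" using tw_image[OF z(2)] .
  obtain r where r: "hom z = r *\<^sub>R tw e u" using hproj_eqD[OF hom_nonzero tw_nonzero[OF e] u(3)] .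
  have r0: "r \<noteq> 0" using r hom_nonzero[of z] by auto
  have "hgt z = - (r^2 * (u * (1 - u)) * (real (pos1 e) - real (pos2 e))^2)"
    using conic_hom[of z] conic_scale[of r "tw e u"] conic_tw[of e u] r by simp
  moreover have "0 \<le> r^2 * (u * (1 - u)) * (real (pos1 e) - real (pos2 e))^2" using u by simp
  ultimately have "r^2 * (u * (1 - u)) * (real (pos1 e) - real (pos2 e))^2 = 0" using z(1) by linarith
  then have "u = 0 \<or> u = 1" using p r0 by auto
  then have "hproj (hom z) = hproj (hom (par (pos1 e))) \<or> hproj (hom z) = hproj (hom (par (pos2 e)))"
    using u(3) by (auto simp: tw_def hproj_minus)
  then show ?thesis using hproj_hom_inj by blast
qed

text \<open>Interlaced chords cross above the parabola, and two projective lines meet only once, so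
  the outer segments are disjoint.\<close>

lemma tw_disjoint:
  assumes e: "e \<in> E" "e' \<in> E" and il: "pos1 e < pos1 e'" "pos1 e' < pos2 e" "pos2 e < pos2 e'"
  shows "path_image (hproj \<circ> tw e) \<inter> path_image (hproj \<circ> tw e') = {}"
proof (rule ccontr)
  assume "path_image (hproj \<circ> tw e) \<inter> path_image (hproj \<circ> tw e') \<noteq> {}"
  then obtain z where z: "z \<in> path_image (hproj \<circ> tw e)" "z \<in> path_image (hproj \<circ> tw e')" by auto
  obtain u where u: "0 \<le> u" "u \<le> 1" "z = hproj (tw e u)" using tw_image[OF z(1)] .
  obtain u' where u': "0 \<le> u'" "u' \<le> 1" "z = hproj (tw e' u')" using tw_image[OF z(2)] .
  obtain r where r: "tw e u = r *\<^sub>R tw e' u'" using hproj_eqD[OF tw_nonzero[OF e(1)] tw_nonzero[OF e(2)]] u(3) u'(3) by metis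
  \<comment> \<open>Evaluate the linear form that vanishes at the two ends of the second chord.\<close>
  define l where "l w = w $ 2 - (real (pos1 e') + real (pos2 e')) * w $ 1 + real (pos1 e') * real (pos2 e') * w $ 3" for w :: "real^3"
  have "l (tw e' u') = 0" by (simp add: l_def tw_nth power2_eq_square algebra_simps)
  moreover have "l (r *\<^sub>R w) = r * l w" for w by (simp add: l_def algebra_simps)
  ultimately have "l (tw e u) = 0" by (simp add: r)
  moreover have "l (tw e u) = (1 - u) * ((real (pos1 e') - real (pos1 e)) * (real (pos2 e') - real (pos1 e)))
      + u * ((real (pos2 e) - real (pos1 e')) * (real (pos2 e') - real (pos2 e)))"
    by (simp add: l_def tw_nth power2_eq_square algebra_simps)
  moreover have "(real (pos1 e') - real (pos1 e)) * (real (pos2 e') - real (pos1 e)) > 0"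
    "(real (pos2 e) - real (pos1 e')) * (real (pos2 e') - real (pos2 e)) > 0" using il by simp_all
  ultimately show False using u(1,2)
    by (metis add_nonneg_eq_0_iff diff_ge_0_iff_ge eq_iff_diff_eq_0 less_eq_real_def mult_eq_0_iff mult_nonneg_nonneg less_irrefl zero_neq_one)
qed

text \<open>Where an outer segment passes over the interval of \<open>e\<close>, its abscissa is at
  distance at least 1 from both positions of \<open>e'\<close>, so it lies at depth at least 1 below
  the parabola. The low arc has depth less than 1.\<close>

lemma low_tw_disjoint:
  assumes e: "e \<in> E" "e' \<in> E" and \<kappa>: "0 < \<kappa>" "\<kappa> * (real N)^2 < 1"
    and out: "pos1 e' < pos1 e \<or> pos2 e < pos1 e'" "pos2 e' < pos1 e \<or> pos2 e < pos2 e'"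
  shows "(hproj \<circ> hom) ` path_image (lowpath \<kappa> e) \<inter> path_image (hproj \<circ> tw e') = {}"
proof (rule ccontr)
  assume "(hproj \<circ> hom) ` path_image (lowpath \<kappa> e) \<inter> path_image (hproj \<circ> tw e') \<noteq> {}"
  then obtain z where z: "z \<in> path_image (lowpath \<kappa> e)" "hproj (hom z) \<in> path_image (hproj \<circ> tw e')" by auto
  obtain x where x: "real (pos1 e) \<le> x" "x \<le> real (pos2 e)" "z = low \<kappa> e x" using lowpath_image[OF e(1) z(1)] .
  obtain u where u: "0 \<le> u" "u \<le> 1" "hproj (hom z) = hproj (tw e' u)" using tw_image[OF z(2)] .
  obtain r where r: "hom z = r *\<^sub>R tw e' u" using hproj_eqD[OF hom_nonzero tw_nonzero[OF e(2)] u(3)] .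
  \<comment> \<open>In affine coordinates the ends of \<open>e'\<close> have weights
    \<open>1 + b\<close> and \<open>- b\<close>; on the outer segment these have opposite signs or
    one vanishes, so \<open>b\<close> is nonnegative or at most -1.\<close>
  define b where "b = r * u"
  define i where "i = real (pos1 e')"
  define j where "j = real (pos2 e')"
  have ij: "i < j" using pos[OF e(2)] by (simp add: i_def j_def)
  have "hom z $ k = r * tw e' u $ k" for k using r by simp
  from this[of 1] this[of 2] this[of 3] have
    c: "x = r * ((1 - u) * i - u * j)" "snd z = r * ((1 - u) * i^2 - u * j^2)" "1 = r * (1 - u) - b"
    by (simp_all add: hom_nth tw_nth x(3) low_def b_def i_def j_def algebra_simps)
  have ra: "r * (1 - u) = 1 + b" using c(3) by simp
  have "x = (r * (1 - u)) * i - (r * u) * j" unfolding c(1) by (simp add: algebra_simps)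
  then have x1: "x = (1 + b) * i - b * j" unfolding ra b_def[symmetric] .
  have "snd z = (r * (1 - u)) * i^2 - (r * u) * j^2" unfolding c(2) by (simp add: algebra_simps)
  then have y1: "snd z = (1 + b) * i^2 - b * j^2" unfolding ra b_def[symmetric] .
  have bb: "b * (1 + b) \<ge> 0"
  proof -
    have "b * (1 + b) = (r * u) * (r * (1 - u))" by (simp only: ra b_def[symmetric])
    also have "\<dots> = r^2 * (u * (1 - u))" by (simp add: power2_eq_square algebra_simps)
    finally have "b * (1 + b) = r^2 * (u * (1 - u))" .
    then show ?thesis using u by simp
  qed
  have d: "\<kappa> * ((x - real (pos1 e)) * (real (pos2 e) - x)) = (x - i) * (x - j)"
  proof -
    have "\<kappa> * ((x - real (pos1 e)) * (real (pos2 e) - x)) = x^2 - snd z" by (simp add: x(3) low_def)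
    also have "\<dots> = (x - i) * (x - j)" unfolding y1 x1 by (simp add: power2_eq_square algebra_simps)
    finally show ?thesis .
  qed
  have "(x - real (pos1 e)) * (real (pos2 e) - x) \<le> real N * real N"
    using x pos[OF e(1)] by (intro mult_mono) auto
  then have "\<kappa> * ((x - real (pos1 e)) * (real (pos2 e) - x)) \<le> \<kappa> * (real N)^2"
    using \<kappa>(1) by (simp add: power2_eq_square)
  then have lt1: "(x - i) * (x - j) < 1" using d \<kappa>(2) by linarith
  have "b \<ge> 0 \<or> b \<le> -1" using bb by (auto simp: zero_le_mult_iff)
  then show False
  proof
    assume b: "b \<ge> 0"
    have "x = i - b * (j - i)" using x1 by (simp add: algebra_simps)
    then have xi: "x \<le> i" using b ij by simp
    then have "pos2 e < pos1 e'" using out(1) x(1) by (auto simp: i_def)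
    then have "i - x \<ge> 1" using x(2) by (auto simp: i_def)
    moreover have "j - x \<ge> 1" using calculation ij by simp
    ultimately have "1 * 1 \<le> (i - x) * (j - x)" by (intro mult_mono) auto
    then show False using lt1 by (simp add: algebra_simps)
  next
    assume b: "b \<le> -1"
    have "x = j + (- 1 - b) * (j - i)" using x1 by (simp add: algebra_simps)
    then have xj: "x \<ge> j" using b ij by simp
    then have "pos2 e' < pos1 e" using out(2) x(2) by (auto simp: j_def)
    then have "x - j \<ge> 1" using x(1) by (auto simp: j_def)
    moreover have "x - i \<ge> 1" using calculation ij by simp
    ultimately have "1 * 1 \<le> (x - i) * (x - j)" by (intro mult_mono) auto
    then show False using lt1 by simp
  qed
qed

text \<open>\<open>Tw\<close> collects the edges through the crosscap. Interlacing, which would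
  force crossings below the parabola in the plane, is what keeps them apart here; an untwisted arc
  may span no end of a twisted edge, because an outer segment starts there.\<close>

theorem contour_projective:
  assumes nc: "\<And>e e'. e \<in> E - T - Tw \<Longrightarrow> e' \<in> E - T - Tw \<Longrightarrow> \<not> (pos1 e < pos1 e' \<and> pos1 e' < pos2 e \<and> pos2 e < pos2 e')"
    and il: "\<And>e e'. e \<in> Tw \<Longrightarrow> e' \<in> Tw \<Longrightarrow> pos1 e < pos1 e' \<Longrightarrow> pos1 e' < pos2 e \<and> pos2 e < pos2 e'"
    and out: "\<And>e e'. e \<in> E - T - Tw \<Longrightarrow> e' \<in> Tw \<Longrightarrow> (pos1 e' < pos1 e \<or> pos2 e < pos1 e') \<and> (pos2 e' < pos1 e \<or> pos2 e < pos2 e')"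
    and Tw: "Tw \<subseteq> E - T"
  shows "projective_planar V E s t"
proof -
  \<comment> \<open>Small enough for \<open>\<kappa> * N^2 < 1\<close>, the depth bound of
    \<open>low_tw_disjoint\<close>; adding 1 avoids division by zero.\<close>
  define \<kappa> :: real where "\<kappa> = 1 / (real N + 1)^2"
  have \<kappa>: "\<kappa> > 0" by (simp add: \<kappa>_def)
  have "(real N)^2 < (real N + 1)^2" by (simp add: power_strict_mono)
  then have \<kappa>N: "\<kappa> * (real N)^2 < 1" by (simp add: \<kappa>_def divide_less_eq)
  define \<iota> where "\<iota> = hproj \<circ> hom"
  define oc where "oc e = (if e \<in> Tw then hproj \<circ> tw e else \<iota> \<circ> lowpath \<kappa> e)" for e
  have inj: "inj \<iota>" using hproj_hom_inj by (auto simp: inj_def \<iota>_def)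
  have cont: "continuous_on A \<iota>" for A
    unfolding \<iota>_def using hom_nonzero by (intro continuous_on_compose continuous_hom continuous_hproj) (metis imageE)
  have "graph_embeds (top_of_set RP2) V E s t"
  proof (rule contour_embeds[OF inj cont, of RP2 oc])
    show "range \<iota> \<subseteq> RP2" using hproj_RP2 hom_nonzero by (auto simp: \<iota>_def)
    fix e assume eT: "e \<in> E - T"
    then have e: "e \<in> E" by simp
    note l = lowpath_arc[OF e, of \<kappa>]
    show "arc (oc e) \<and> pathstart (oc e) = \<iota> (par (pos1 e)) \<and> pathfinish (oc e) = \<iota> (par (pos2 e)) \<and> path_image (oc e) \<subseteq> RP2"
    proof (cases "e \<in> Tw")
      case True
      then show ?thesis using tw_arc[OF e] hproj_RP2[OF tw_nonzero[OF e]] by (auto simp: oc_def \<iota>_def path_image_def)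
    next
      case False
      have "arc (\<iota> \<circ> lowpath \<kappa> e)" using l inj cont unfolding arc_def
        by (auto intro!: path_continuous_image comp_inj_on intro: inj_on_subset)
      then show ?thesis using False l \<open>range \<iota> \<subseteq> RP2\<close> by (auto simp: oc_def pathstart_compose pathfinish_compose path_image_compose)
    qed
    show "z = par (pos1 e) \<or> z = par (pos2 e)" if z: "hgt z \<ge> 0" "\<iota> z \<in> path_image (oc e)" for z
    proof (cases "e \<in> Tw")
      case True
      then show ?thesis using tw_hgt[OF e z(1)] z(2) by (auto simp: oc_def \<iota>_def)
    next
      case False
      then have "z \<in> path_image (lowpath \<kappa> e)" using z(2) inj by (auto simp: oc_def path_image_compose dest: injD)
      then obtain x where "real (pos1 e) \<le> x" "x \<le> real (pos2 e)" "z = low \<kappa> e x" using lowpath_image[OF e] by metis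
      then show ?thesis using low_hgt[OF \<kappa>, of e x] z(1) by simp
    qed
  next
    fix e e' assume e: "e \<in> E - T" "e' \<in> E - T" "e \<noteq> e'"
    have ne: "pos1 e \<noteq> pos1 e'" using pos[of e] pos[of e'] e by (metis DiffD1)
    consider "e \<in> Tw" "e' \<in> Tw" | "e \<notin> Tw" "e' \<notin> Tw" | "e \<in> Tw" "e' \<notin> Tw" | "e \<notin> Tw" "e' \<in> Tw" by blast
    then show "path_image (oc e) \<inter> path_image (oc e') = {}"
    proof cases
      case 1
      consider "pos1 e < pos1 e'" | "pos1 e' < pos1 e" using ne by linarith
      then show ?thesis
      proof cases
        case a: 1
        then show ?thesis using tw_disjoint[of e e'] il[OF 1 a] 1 e by (simp add: oc_def)
      next
        case a: 2
        then show ?thesis using tw_disjoint[of e' e] il[OF 1(2,1) a] 1 e by (simp add: oc_def Int_commute)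
      qed
    next
      case 2
      then have "path_image (lowpath \<kappa> e) \<inter> path_image (lowpath \<kappa> e') = {}"
        using nc[of e e'] nc[of e' e] e by (intro lowpath_disjoint[OF \<kappa>]) auto
      then show ?thesis using 2 inj by (auto simp: oc_def path_image_compose dest: injD)
    next
      case 3
      then show ?thesis using low_tw_disjoint[OF _ _ \<kappa> \<kappa>N, of e' e] out[of e' e] e
        by (simp add: oc_def path_image_compose \<iota>_def Int_commute)
    next
      case 4
      then show ?thesis using low_tw_disjoint[OF _ _ \<kappa> \<kappa>N, of e e'] out[of e e'] e
        by (simp add: oc_def path_image_compose \<iota>_def)
    qed
  qed
  then show ?thesis by (simp add: projective_planar_iff)
qed

end

section \<open>Two-connected graphs\<close>

text \<open>If both \<open>E1\<close> and its complement are nonempty, they meet at some vertex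
  \<open>v\<close>. As \<open>v\<close> is no cut vertex, a cycle passes through \<open>v\<close>
  along one edge of each, and its restriction to \<open>E1\<close> has nonzero boundary at
  \<open>v\<close>.\<close>

lemma (in fgraph) two_connected_no_separation:
  assumes tc: "two_connected V E s t" and ll: "loopless E s t" and E1: "E1 \<subseteq> E"
    and sep: "\<And>z. is_cycle E s t z \<Longrightarrow> is_cycle E s t (\<lambda>e. if e \<in> E1 then z e else 0)"
  shows "E1 = {} \<or> E1 = E"
proof (rule ccontr)
  assume "\<not> (E1 = {} \<or> E1 = E)"
  then obtain a b where ab: "a \<in> E1" "b \<in> E - E1" using E1 by blast
  define V1 where "V1 = s ` E1 \<union> t ` E1"
  have conn: "connected_graph V E s t" using tc by (simp add: two_connected_def)
  have "\<exists>v e1 e2. e1 \<in> E1 \<and> e2 \<in> E - E1 \<and> v \<in> {s e1, t e1} \<and> v \<in> {s e2, t e2}"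
  proof (rule ccontr)
    assume no: "\<not> (\<exists>v e1 e2. e1 \<in> E1 \<and> e2 \<in> E - E1 \<and> v \<in> {s e1, t e1} \<and> v \<in> {s e2, t e2})"
    have "(s e \<in> V1) = (t e \<in> V1)" if "e \<in> E" for e
    proof (cases "e \<in> E1")
      case False
      then have "s e \<notin> V1" "t e \<notin> V1" using no that unfolding V1_def by blast+
      then show ?thesis by simp
    qed (auto simp: V1_def)
    moreover have "reach E s t (s a) (s b)" using conn ab E1 ends_in_V by (auto simp: connected_graph_def)
    ultimately have "(s a \<in> V1) = (s b \<in> V1)" by (metis reach_invariant[where f="\<lambda>v. v \<in> V1"])
    moreover have "s a \<in> V1" using ab by (auto simp: V1_def)
    ultimately show False using no ab unfolding V1_def by blast
  qed
  then obtain v e1 e2 where v: "e1 \<in> E1" "e2 \<in> E - E1" "v \<in> {s e1, t e1}" "v \<in> {s e2, t e2}" by blast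
  have eE: "e1 \<in> E" "e2 \<in> E" "e1 \<noteq> e2" using v E1 by auto
  define u1 where "u1 = (if s e1 = v then t e1 else s e1)"
  define u2 where "u2 = (if s e2 = v then t e2 else s e2)"
  have nl: "s e1 \<noteq> t e1" "s e2 \<noteq> t e2" using ll eE by (auto simp: loopless_def)
  have u: "u1 \<in> V - {v}" "u2 \<in> V - {v}" "v \<in> V" using v eE nl ends_in_V by (auto simp: u1_def u2_def)
  define n1 :: int where "n1 = (if s e1 = v then 1 else -1)"
  define n2 :: int where "n2 = (if t e2 = v then 1 else -1)"
  define Ed where "Ed = del_edges E s t v"
  have Ed: "Ed \<subseteq> E" "\<And>e. e \<in> Ed \<Longrightarrow> s e \<noteq> v \<and> t e \<noteq> v" by (auto simp: Ed_def del_edges_def)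
  have "components V E s t = {V}"
    unfolding components_def quotient_def using conn u(3) by (auto simp: connected_graph_def)
  then have "card (components (V - {v}) Ed s t) \<le> Suc 0"
    using tc u(3) by (auto simp: two_connected_def cut_vertex_def Ed_def)
  moreover have "finite (components (V - {v}) Ed s t)" using finite_V by (intro finite_components) auto
  moreover have cl: "{w \<in> V - {v}. reach Ed s t x w} \<in> components (V - {v}) Ed s t" if "x \<in> V - {v}" for x
    unfolding components_def quotient_def using that by auto
  ultimately have "{w \<in> V - {v}. reach Ed s t u1 w} = {w \<in> V - {v}. reach Ed s t u2 w}"
    using cl[OF u(1)] cl[OF u(2)] card_le_Suc0_iff_eq[of "components (V - {v}) Ed s t"] by metis
  moreover have "u2 \<in> {w \<in> V - {v}. reach Ed s t u2 w}" using u(2) by (simp add: reach_refl)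
  ultimately have "u2 \<in> {w \<in> V - {v}. reach Ed s t u1 w}" by (simp only:)
  then have "reach Ed s t u1 u2" by simp
  from reach_chain[OF _ this] Ed(1) finite_E obtain c where c: "c \<in> C1 Ed"
    "\<forall>w. bdry Ed s t c w = of_bool (w = u2) - of_bool (w = u1)" by (meson finite_subset)
  have cE: "bdry E s t c w = of_bool (w = u2) - of_bool (w = u1)" for w
    using bdry_mono_neutral[OF finite_E Ed(1), of c s t w] c by (auto simp: C1_def)
  define z where "z e = c e + n1 * coedge e1 e + n2 * coedge e2 e" for e
  have h1: "n1 * (of_bool (t e1 = w) - of_bool (s e1 = w)) = of_bool (w = u1) - of_bool (w = v)" for w
    using v(3) nl(1) by (cases "s e1 = v") (simp_all add: n1_def u1_def eq_commute)
  have h2: "n2 * (of_bool (t e2 = w) - of_bool (s e2 = w)) = of_bool (w = v) - of_bool (w = u2)" for w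
    using v(4) nl(2) by (cases "s e2 = v") (simp_all add: n2_def u2_def eq_commute)
  have "is_cycle E s t z"
    unfolding is_cycle_def z_def bdry_add bdry_mult bdry_coedge[OF finite_E eE(1)] bdry_coedge[OF finite_E eE(2)] cE h1 h2
    by simp
  then have "bdry E s t (\<lambda>e. if e \<in> E1 then z e else 0) v = 0" using sep by (simp add: is_cycle_def)
  moreover have "bdry E s t (\<lambda>e. if e \<in> E1 then z e else 0) v = bdry E s t (\<lambda>e. n1 * coedge e1 e) v"
    unfolding bdry_def
  proof (rule sum.cong[OF refl])
    fix e assume e: "e \<in> E"
    have "c e = 0" if "s e = v \<or> t e = v" using Ed(2)[of e] c(1) that by (auto simp: C1_def)
    then show "(if e \<in> E1 then z e else 0) * (of_bool (t e = v) - of_bool (s e = v)) =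
        n1 * coedge e1 e * (of_bool (t e = v) - of_bool (s e = v))"
      using v(1,2) by (auto simp: z_def coedge_def)
  qed
  ultimately show False using v(3) nl(1) unfolding bdry_mult bdry_coedge[OF finite_E eE(1)] by (auto simp: n1_def)
qed

text \<open>Every cycle restricts to zero on a bridge, so a bridge is a separation by
  itself.\<close>

lemma (in fgraph) two_connected_bridge:
  assumes "two_connected V E s t" "loopless E s t" "bridge E s t e" shows "E = {e}"
proof -
  have e: "e \<in> E" using assms(3) by (simp add: bridge_def)
  have "{e} = {} \<or> {e} = E"
  proof (rule two_connected_no_separation[OF assms(1,2)])
    fix z assume "is_cycle E s t z"
    then have "(if e' \<in> {e} then z e' else 0) = 0" for e' using bridge_cycle_zero[OF assms(3)] by simp
    then show "is_cycle E s t (\<lambda>e'. if e' \<in> {e} then z e' else 0)" by (simp add: is_cycle_def bdry_def)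
  qed (use e in auto)
  then show ?thesis by auto
qed

text \<open>\<open>M e a\<close> is coordinate \<open>a\<close> of the root of \<open>e\<close>.
  Heights of cycles in \<open>cycle_height\<close> are doubled, because the dual of the lattice of
  type D contains half-integral vectors.\<close>

locale rows = fgraph V E s t for V :: "'v set" and E :: "'e set" and s t +
  fixes n :: nat and M :: "'e \<Rightarrow> nat \<Rightarrow> int" and L R :: "'e \<Rightarrow> nat"
  assumes LR: "\<And>e. e \<in> E \<Longrightarrow> L e < n \<and> R e < n \<and> L e \<noteq> R e"
    and M_unit: "\<And>e. e \<in> E \<Longrightarrow> (M e (L e) = 1 \<or> M e (L e) = -1) \<and> (M e (R e) = 1 \<or> M e (R e) = -1)"
    and M_zero: "\<And>e a. e \<in> E \<Longrightarrow> a < n \<Longrightarrow> a \<noteq> L e \<Longrightarrow> a \<noteq> R e \<Longrightarrow> M e a = 0"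
    and row_cycle: "\<And>a. a < n \<Longrightarrow> is_cycle E s t (\<lambda>e. M e a)"
    and cycle_height: "\<And>z. is_cycle E s t z \<Longrightarrow> \<exists>k. \<forall>e\<in>E. 2 * z e = k (L e) * M e (L e) + k (R e) * M e (R e)"
    and dual_conn: "\<And>U. U \<subseteq> {..<n} \<Longrightarrow> U \<noteq> {} \<Longrightarrow> U \<noteq> {..<n} \<Longrightarrow> \<exists>e\<in>E. (L e \<in> U) \<noteq> (R e \<in> U)"
    and kernel: "\<And>x. x \<in> C1 E \<Longrightarrow> (\<And>a. a < n \<Longrightarrow> (\<Sum>e\<in>E. x e * M e a) = 0) \<Longrightarrow> x \<in> coboundaries V E s t"
    and two_conn: "two_connected V E s t" and no_loop: "loopless E s t"
begin

lemma M_sum: assumes "e \<in> E" shows "(\<Sum>a<n. k a * M e a) = k (L e) * M e (L e) + k (R e) * M e (R e)"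
proof -
  have "(\<Sum>a<n. k a * M e a) = (\<Sum>a\<in>{L e, R e}. k a * M e a)"
    using LR[OF assms] M_zero[OF assms] by (intro sum.mono_neutral_right) auto
  then show ?thesis using LR[OF assms] by simp
qed

lemma combination_cycle: "is_cycle E s t (\<lambda>e. k (L e) * M e (L e) + k (R e) * M e (R e))"
proof -
  have "is_cycle E s t (\<lambda>e. \<Sum>a<n. k a * M e a)" using row_cycle by (intro is_cycle_sum) auto
  then show ?thesis using M_sum is_cycle_cong by (metis (mono_tags, lifting))
qed

lemma half_combination_cycle:
  assumes "\<And>e. e \<in> E \<Longrightarrow> 2 * z e = k (L e) * M e (L e) + k (R e) * M e (R e)"
  shows "is_cycle E s t z"
proof -
  have "is_cycle E s t (\<lambda>e. 2 * z e)"
    using is_cycle_cong[of E "\<lambda>e. 2 * z e"] assms combination_cycle[of k] by (metis (mono_tags, lifting))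
  then show ?thesis using is_cycle_mult_iff[of 2 E s t z] by simp
qed

text \<open>Shifting the heights on \<open>B\<close> by \<open>\<eta>\<close> times the height of
  row \<open>a\<close>, and setting them to 0 elsewhere, cuts a cycle down to the edges touching
  \<open>B\<close>. So these edges form a separation; connectedness of the dual graph and the row
  \<open>u\<close> make it proper.\<close>

lemma no_coherent_separation:
  assumes a: "a < n" and B: "B \<subseteq> {..<n} - {a}" "B \<noteq> {}" and u: "u < n" "u \<noteq> a" "u \<notin> B"
    and out: "\<And>e. e \<in> E \<Longrightarrow> L e \<in> B \<Longrightarrow> R e \<in> B \<or> R e = a" "\<And>e. e \<in> E \<Longrightarrow> R e \<in> B \<Longrightarrow> L e \<in> B \<or> L e = a"
    and coh: "\<And>e. e \<in> E \<Longrightarrow> L e \<in> B \<or> R e \<in> B \<Longrightarrow> \<eta> (L e) * M e (L e) + \<eta> (R e) * M e (R e) = 0"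
    and \<eta>a: "\<eta> a = (-1::int)"
  shows False
proof -
  define E1 where "E1 = {e \<in> E. L e \<in> B \<or> R e \<in> B}"
  have aB: "a \<notin> B" using B by auto
  have "E1 = {} \<or> E1 = E"
  proof (rule two_connected_no_separation[OF two_conn no_loop])
    show "E1 \<subseteq> E" by (auto simp: E1_def)
    fix z assume "is_cycle E s t z"
    then obtain k where k: "\<forall>e\<in>E. 2 * z e = k (L e) * M e (L e) + k (R e) * M e (R e)" using cycle_height by blast
    define k' where "k' b = (if b \<in> B then k b + \<eta> b * k a else 0)" for b
    show "is_cycle E s t (\<lambda>e. if e \<in> E1 then z e else 0)"
    proof (rule half_combination_cycle[of _ k'])
      fix e assume e: "e \<in> E"
      note ke = k[rule_format, OF e]
      consider "L e \<in> B" "R e \<in> B" | "L e \<in> B" "R e = a" | "L e = a" "R e \<in> B" | "L e \<notin> B" "R e \<notin> B"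
        using out[OF e] by blast
      then show "2 * (if e \<in> E1 then z e else 0) = k' (L e) * M e (L e) + k' (R e) * M e (R e)"
      proof cases
        case 1
        have "k' (L e) * M e (L e) + k' (R e) * M e (R e) = k (L e) * M e (L e) + k (R e) * M e (R e)
            + k a * (\<eta> (L e) * M e (L e) + \<eta> (R e) * M e (R e))" using 1 by (simp add: k'_def algebra_simps)
        then show ?thesis using coh[OF e] 1 ke e by (simp add: E1_def)
      next
        case 2
        then have "\<eta> (L e) * M e (L e) = M e a" using coh[OF e] \<eta>a by simp
        moreover have "k' (L e) * M e (L e) + k' (R e) * M e (R e) = k (L e) * M e (L e) + k a * (\<eta> (L e) * M e (L e))"
          using 2 aB by (simp add: k'_def algebra_simps)
        ultimately show ?thesis using 2 ke e by (simp add: E1_def)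
      next
        case 3
        then have "\<eta> (R e) * M e (R e) = M e a" using coh[OF e] \<eta>a by simp
        moreover have "k' (L e) * M e (L e) + k' (R e) * M e (R e) = k (R e) * M e (R e) + k a * (\<eta> (R e) * M e (R e))"
          using 3 aB by (simp add: k'_def algebra_simps)
        ultimately show ?thesis using 3 ke e by (simp add: E1_def)
      next
        case 4
        then show ?thesis by (simp add: E1_def k'_def)
      qed
    qed
  qed
  moreover have "E1 \<noteq> {}"
  proof -
    have "B \<noteq> {..<n}" using a aB by auto
    then obtain e where "e \<in> E" "(L e \<in> B) \<noteq> (R e \<in> B)" using dual_conn[of B] B by auto
    then show ?thesis by (auto simp: E1_def)
  qed
  moreover have "E1 \<noteq> E"
  proof -
    define U where "U = {..<n} - insert a B"
    have "U \<noteq> {}" "U \<noteq> {..<n}" using u a by (auto simp: U_def)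
    then obtain e where e: "e \<in> E" "(L e \<in> U) \<noteq> (R e \<in> U)" using dual_conn[of U] by (auto simp: U_def)
    then have "e \<notin> E1" using out[OF e(1)] LR[OF e(1)] aB by (auto simp: U_def E1_def)
    then show ?thesis using e(1) by auto
  qed
  ultimately show False by blast
qed

text \<open>Otherwise the support of the subcycle and the remaining edges would form a separation.\<close>

lemma subcycle_zero:
  assumes a: "a < n" and z: "\<And>e. e \<in> E \<Longrightarrow> z e = 0 \<or> z e = M e a"
    and k: "\<And>e. e \<in> E \<Longrightarrow> 2 * z e = k (L e) * M e (L e) + k (R e) * M e (R e)"
    and ka: "k a = 0" and u: "u < n" "u \<noteq> a" "k u = 0"
  shows "\<And>e. e \<in> E \<Longrightarrow> z e = 0"
proof (rule ccontr)
  fix e0 assume e0: "e0 \<in> E" "z e0 \<noteq> 0"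
  \<comment> \<open>\<open>z\<close> vanishes on edges avoiding row \<open>a\<close>, so the
    absolute value of \<open>k\<close> is constant along them: no such edge leaves the rows of
    nonzero height, and the signs of their heights provide the coherent pattern.\<close>
  define B where "B = {b. b < n \<and> b \<noteq> a \<and> k b \<noteq> 0}"
  define \<eta> where "\<eta> b = (if b = a then -1 else sgn (k b))" for b
  have z0: "z e = 0" if "e \<in> E" "L e \<noteq> a" "R e \<noteq> a" for e using z[OF that(1)] M_zero[OF that(1) a] that by auto
  have abs: "\<bar>k (L e)\<bar> = \<bar>k (R e)\<bar>" "k (L e) * M e (L e) = - (k (R e) * M e (R e))" if "e \<in> E" "L e \<noteq> a" "R e \<noteq> a" for e
    using k[OF that(1)] z0[OF that] M_unit[OF that(1)] by auto
  have B: "b \<in> B \<longleftrightarrow> k b \<noteq> 0" if "b < n" for b using that ka by (auto simp: B_def)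
  show False
  proof (rule no_coherent_separation[OF a, of B u \<eta>])
    show "B \<subseteq> {..<n} - {a}" "u \<notin> B" "\<eta> a = -1" using u by (auto simp: B_def \<eta>_def)
    show "B \<noteq> {}"
    proof
      assume "B = {}"
      then have "k (L e0) = 0" "k (R e0) = 0" using B LR[OF e0(1)] by auto
      then show False using k[OF e0(1)] e0(2) by simp
    qed
    fix e assume e: "e \<in> E"
    show "R e \<in> B \<or> R e = a" if "L e \<in> B" using abs(1)[OF e] that LR[OF e] by (cases "R e = a") (auto simp: B_def)
    show "L e \<in> B \<or> L e = a" if "R e \<in> B" using abs(1)[OF e] that LR[OF e] by (cases "L e = a") (auto simp: B_def)
    show "\<eta> (L e) * M e (L e) + \<eta> (R e) * M e (R e) = 0" if LRB: "L e \<in> B \<or> R e \<in> B"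
    proof (cases "L e \<noteq> a \<and> R e \<noteq> a")
      case True
      have "sgn (k (L e)) * M e (L e) = - (sgn (k (R e)) * M e (R e))"
        using abs[OF e] True M_unit[OF e] by (auto simp: sgn_if abs_if split: if_splits)
      then show ?thesis using True by (simp add: \<eta>_def)
    next
      case False
      have touch: "sgn (k b) * M e b = M e a"
        if "b = L e \<and> R e = a \<or> b = R e \<and> L e = a" "k b \<noteq> 0" for b
      proof -
        have kb: "2 * z e = k b * M e b" using k[OF e] that ka by auto
        have mb: "M e b = 1 \<or> M e b = -1" "M e a = 1 \<or> M e a = -1" using M_unit[OF e] that by auto
        then have "z e \<noteq> 0" using kb that(2) by auto
        then have "k b * M e b = 2 * M e a" using z[OF e] kb by auto
        then show ?thesis using mb by (auto simp: sgn_if split: if_splits)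
      qed
      show ?thesis
      proof (cases "L e = a")
        case True
        then have "k (R e) \<noteq> 0" "R e \<noteq> a" using LRB LR[OF e] by (auto simp: B_def)
        then show ?thesis using touch[of "R e"] True by (simp add: \<eta>_def)
      next
        case F: False
        then have "R e = a" "k (L e) \<noteq> 0" using False LRB by (auto simp: B_def)
        then show ?thesis using touch[of "L e"] F by (simp add: \<eta>_def)
      qed
    qed
  qed (use u in auto)
qed

text \<open>The row is no sum of two nonzero cycles with disjoint supports. This is what makes a
  traversal of the row a single closed walk.\<close>

definition indecomposable :: "nat \<Rightarrow> bool" where
  "indecomposable a \<longleftrightarrow> (\<forall>z. is_cycle E s t z \<longrightarrow> (\<forall>e\<in>E. z e = 0 \<or> z e = M e a) \<longrightarrow>
     (\<forall>e\<in>E. z e = 0) \<or> (\<forall>e\<in>E. z e = M e a))"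

text \<open>The obstruction to indecomposability in type D. Up to switching signs of rows,
  incoherent edges occur only at row \<open>a\<close>, and then type D unfolds to type A at this
  coordinate.\<close>

definition balancing :: "nat \<Rightarrow> bool" where
  "balancing a \<longleftrightarrow> (\<exists>\<eta>. (\<forall>b. \<eta> b = 1 \<or> \<eta> b = (-1::int)) \<and>
     (\<forall>e\<in>E. L e \<noteq> a \<longrightarrow> R e \<noteq> a \<longrightarrow> \<eta> (L e) * M e (L e) + \<eta> (R e) * M e (R e) = 0))"

text \<open>If no height away from \<open>a\<close> vanished, the signs of the heights would be
  balancing. Otherwise some edge joins row \<open>a\<close> to a row of height 0, which forces
  doubled height 0 or 2 at \<open>a\<close>; then \<open>subcycle_zero\<close> applies to
  \<open>z\<close> or to its complement in the row.\<close>

lemma indecomposable_unless_balancing: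
  assumes a: "a < n" and nb: "\<not> balancing a" shows "indecomposable a"
  unfolding indecomposable_def
proof (intro allI impI)
  fix z assume zc: "is_cycle E s t z" and z: "\<forall>e\<in>E. z e = 0 \<or> z e = M e a"
  obtain k where k: "\<forall>e\<in>E. 2 * z e = k (L e) * M e (L e) + k (R e) * M e (R e)" using cycle_height[OF zc] by blast
  have z0: "z e = 0" if "e \<in> E" "L e \<noteq> a" "R e \<noteq> a" for e using z M_zero[OF that(1) a] that by auto
  have abs: "\<bar>k (L e)\<bar> = \<bar>k (R e)\<bar>" "k (L e) * M e (L e) = - (k (R e) * M e (R e))" if "e \<in> E" "L e \<noteq> a" "R e \<noteq> a" for e
    using k z0[OF that] M_unit[OF that(1)] that(1) by auto
  have "\<exists>u<n. u \<noteq> a \<and> k u = 0"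
  proof (rule ccontr)
    assume no: "\<not> (\<exists>u<n. u \<noteq> a \<and> k u = 0)"
    define \<eta> where "\<eta> b = (if k b < 0 then -1 else (1::int))" for b
    have "\<eta> (L e) * M e (L e) + \<eta> (R e) * M e (R e) = 0" if e: "e \<in> E" "L e \<noteq> a" "R e \<noteq> a" for e
    proof -
      have "k (L e) \<noteq> 0" "k (R e) \<noteq> 0" using no LR[OF e(1)] e by auto
      then show ?thesis using abs[OF e] M_unit[OF e(1)] by (auto simp: \<eta>_def abs_if split: if_splits)
    qed
    then have "balancing a" unfolding balancing_def by (intro exI[of _ \<eta>]) (auto simp: \<eta>_def)
    then show False using nb by simp
  qed
  then obtain u where u: "u < n" "u \<noteq> a" "k u = 0" by blast
  define U where "U = {b. b < n \<and> b \<noteq> a \<and> k b = 0}"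
  have "U \<noteq> {}" "U \<noteq> {..<n}" "U \<subseteq> {..<n}" using u a by (auto simp: U_def)
  then obtain e where e: "e \<in> E" "(L e \<in> U) \<noteq> (R e \<in> U)" using dual_conn[of U] by blast
  have "L e = a \<or> R e = a"
  proof (rule ccontr)
    assume "\<not> (L e = a \<or> R e = a)"
    then show False using abs[OF e(1)] e LR[OF e(1)] by (auto simp: U_def)
  qed
  then have "2 * z e = k a * M e a" "M e a = 1 \<or> M e a = -1"
    using k e LR[OF e(1)] M_unit[OF e(1)] by (auto simp: U_def)
  then have "k a = 0 \<or> k a = 2" using z e(1) by auto
  then show "(\<forall>e\<in>E. z e = 0) \<or> (\<forall>e\<in>E. z e = M e a)"
  proof
    assume "k a = 0"
    then show ?thesis using subcycle_zero[OF a, of z k u] z k u by blast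
  next
    assume ka: "k a = 2"
    define k' where "k' b = 2 * of_bool (b = a) - k b" for b
    define z' where "z' e = M e a - z e" for e
    have "2 * z' e = k' (L e) * M e (L e) + k' (R e) * M e (R e)" if e: "e \<in> E" for e
    proof -
      have "M e a = of_bool (L e = a) * M e (L e) + of_bool (R e = a) * M e (R e)"
        using M_zero[OF e a] LR[OF e] by auto
      then show ?thesis using k e by (simp add: z'_def k'_def algebra_simps)
    qed
    moreover have "z' e = 0 \<or> z' e = M e a" if "e \<in> E" for e using z that by (auto simp: z'_def)
    ultimately have "z' e = 0" if "e \<in> E" for e
      using subcycle_zero[OF a, of z' k' u e] ka u that by (auto simp: k'_def)
    then show ?thesis by (auto simp: z'_def)
  qed
qed

text \<open>Constant heights contribute nothing to coherent edges, so the height of row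
  \<open>a\<close> can be normalised to 0. If no other height vanishes then, \<open>z\<close> is
  nonzero on every edge of the row.\<close>

lemma indecomposable_coherent:
  assumes a: "a < n" and coh: "\<And>e. e \<in> E \<Longrightarrow> M e (L e) + M e (R e) = 0" shows "indecomposable a"
  unfolding indecomposable_def
proof (intro allI impI)
  fix z assume zc: "is_cycle E s t z" and z: "\<forall>e\<in>E. z e = 0 \<or> z e = M e a"
  obtain k where k: "\<forall>e\<in>E. 2 * z e = k (L e) * M e (L e) + k (R e) * M e (R e)" using cycle_height[OF zc] by blast
  define k' where "k' b = k b - k a" for b
  have k': "2 * z e = k' (L e) * M e (L e) + k' (R e) * M e (R e)" if "e \<in> E" for e
  proof -
    have "k' (L e) * M e (L e) + k' (R e) * M e (R e) = k (L e) * M e (L e) + k (R e) * M e (R e) - k a * (M e (L e) + M e (R e))"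
      by (simp add: k'_def algebra_simps)
    then show ?thesis using k coh[OF that] that by simp
  qed
  show "(\<forall>e\<in>E. z e = 0) \<or> (\<forall>e\<in>E. z e = M e a)"
  proof (cases "\<exists>u<n. u \<noteq> a \<and> k' u = 0")
    case True
    then show ?thesis using subcycle_zero[OF a, of z k'] z k' by (auto simp: k'_def)
  next
    case False
    have "z e = M e a" if e: "e \<in> E" for e
    proof (cases "L e = a \<or> R e = a")
      case True
      then have "2 * z e \<noteq> 0" using k'[OF e] LR[OF e] M_unit[OF e] False by (auto simp: k'_def)
      then show ?thesis using z e by auto
    next
      case F: False
      then show ?thesis using z e M_zero[OF e a] by auto
    qed
    then show ?thesis by simp
  qed
qed

end

section \<open>The tour around a dual spanning tree\<close>

text \<open>By injectivity the first repetition along the orbit is a return to \<open>d0\<close>.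
  The points visited before form a closed set, hence all of \<open>D\<close>.\<close>

lemma single_orbit_enumeration:
  assumes fin: "finite D" and \<tau>: "\<tau> ` D \<subseteq> D" "inj_on \<tau> D" and d0: "d0 \<in> D"
    and orb: "\<And>Q. Q \<subseteq> D \<Longrightarrow> Q \<noteq> {} \<Longrightarrow> \<tau> ` Q \<subseteq> Q \<Longrightarrow> Q = D"
  shows "bij_betw (\<lambda>k. (\<tau> ^^ k) d0) {..<card D} D" "(\<tau> ^^ card D) d0 = d0"
proof -
  define f where "f k = (\<tau> ^^ k) d0" for k
  have fS: "f (Suc k) = \<tau> (f k)" for k by (simp add: f_def)
  have fD: "f k \<in> D" for k using d0 \<tau>(1) by (induction k) (auto simp: f_def)
  have cancel: "f i = f (i + j) \<Longrightarrow> f 0 = f j" for i j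
  proof (induction i)
    case (Suc i)
    then have "\<tau> (f i) = \<tau> (f (i + j))" using fS by simp
    then show ?case using Suc.IH \<tau>(2) fD by (auto dest: inj_onD)
  qed simp
  have "\<not> inj f"
  proof
    assume "inj f"
    moreover have "range f \<subseteq> D" using fD by auto
    ultimately have "finite (UNIV :: nat set)" using fin by (metis finite_imageD finite_subset)
    then show False by simp
  qed
  then obtain a b where ab: "f a = f b" "a < b" by (metis injI linorder_neqE_nat)
  then have "f 0 = f (b - a)" using cancel[of a "b - a"] by simp
  then have ex: "\<exists>p>0. f p = f 0" using ab(2) by (intro exI[of _ "b - a"]) auto
  define p where "p = (LEAST p. p > 0 \<and> f p = f 0)"
  have p: "p > 0" "f p = f 0" using LeastI_ex[OF ex] by (auto simp: p_def)
  have inj: "inj_on f {..<p}"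
  proof (rule inj_onI)
    have *: "i = j" if "i \<le> j" "j < p" "f i = f j" for i j
    proof (rule ccontr)
      assume "i \<noteq> j"
      then have "j - i > 0" "f (j - i) = f 0" using cancel[of i "j - i"] that by auto
      then have "p \<le> j - i" unfolding p_def by (intro Least_le) auto
      then show False using that by simp
    qed
    fix i j assume "i \<in> {..<p}" "j \<in> {..<p}" "f i = f j"
    then show "i = j" using *[of i j] *[of j i] by (cases "i \<le> j") auto
  qed
  have "f ` {..<p} = D"
  proof (rule orb)
    show "f ` {..<p} \<subseteq> D" using fD by auto
    show "f ` {..<p} \<noteq> {}" using p(1) by auto
    show "\<tau> ` f ` {..<p} \<subseteq> f ` {..<p}"
    proof clarify
      fix k assume "k < p"
      then show "\<tau> (f k) \<in> f ` {..<p}"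
        using p fS[of k] by (cases "Suc k = p") (auto intro: image_eqI[of _ _ 0] image_eqI[of _ _ "Suc k"])
    qed
  qed
  moreover from this have "card D = p" using inj by (metis card_image card_lessThan)
  ultimately show "bij_betw (\<lambda>k. (\<tau> ^^ k) d0) {..<card D} D" "(\<tau> ^^ card D) d0 = d0"
    using inj p(2) by (simp_all add: bij_betw_def f_def[symmetric]) (simp add: f_def)
qed

context rows begin

text \<open>Occurrences of edges in rows, two for each edge; \<open>tl\<close> and \<open>hd\<close>
  orient an occurrence by the sign with which the edge enters the row.\<close>

definition darts :: "('e \<times> nat) set" where
  "darts = {(e, a). e \<in> E \<and> (a = L e \<or> a = R e)}"

definition tl :: "'e \<times> nat \<Rightarrow> 'v" where
  "tl d = (if M (fst d) (snd d) = 1 then s (fst d) else t (fst d))"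

definition hd :: "'e \<times> nat \<Rightarrow> 'v" where
  "hd d = (if M (fst d) (snd d) = 1 then t (fst d) else s (fst d))"

definition opp :: "'e \<times> nat \<Rightarrow> 'e \<times> nat" where
  "opp d = (fst d, if snd d = L (fst d) then R (fst d) else L (fst d))"

lemma darts_eq: "darts = (\<lambda>e. (e, L e)) ` E \<union> (\<lambda>e. (e, R e)) ` E"
  by (auto simp: darts_def)

lemma finite_darts: "finite darts"
  using finite_E by (simp add: darts_eq)

lemma dart: "d \<in> darts \<Longrightarrow> fst d \<in> E \<and> snd d < n \<and> (M (fst d) (snd d) = 1 \<or> M (fst d) (snd d) = -1)"
  using LR[of "fst d"] M_unit[of "fst d"] by (cases d) (auto simp: darts_def)

lemma opp_dart: "d \<in> darts \<Longrightarrow> opp d \<in> darts \<and> opp (opp d) = d \<and> opp d \<noteq> d \<and> fst (opp d) = fst d"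
  using LR[of "fst d"] by (cases d) (auto simp: darts_def opp_def)

lemma dart_bdry:
  assumes Q: "Q \<subseteq> darts" "\<And>d. d \<in> Q \<Longrightarrow> snd d = a"
  shows "(\<Sum>d\<in>Q. of_bool (hd d = v) - of_bool (tl d = v)) = bdry E s t (\<lambda>e. if (e, a) \<in> Q then M e a else 0) v"
proof -
  define F where "F = {e \<in> E. (e, a) \<in> Q}"
  have OF: "Q = (\<lambda>e. (e, a)) ` F"
  proof (intro equalityI subsetI)
    fix d assume d: "d \<in> Q"
    then have "d = (fst d, a)" "fst d \<in> E" using Q(2)[OF d] dart[of d] Q(1) by (auto simp: prod_eq_iff)
    then show "d \<in> (\<lambda>e. (e, a)) ` F" using d unfolding F_def by (metis (mono_tags, lifting) imageI mem_Collect_eq)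
  qed (auto simp: F_def)
  have "(\<Sum>d\<in>Q. of_bool (hd d = v) - of_bool (tl d = v) :: int) = (\<Sum>e\<in>F. of_bool (hd (e, a) = v) - of_bool (tl (e, a) = v))"
    unfolding OF by (subst sum.reindex) (auto simp: inj_on_def)
  also have "\<dots> = (\<Sum>e\<in>F. M e a * (of_bool (t e = v) - of_bool (s e = v)))"
  proof (rule sum.cong[OF refl])
    fix e assume "e \<in> F"
    then have "M e a = 1 \<or> M e a = -1" using dart[of "(e, a)"] Q(1) by (auto simp: F_def)
    then show "of_bool (hd (e, a) = v) - of_bool (tl (e, a) = v) = M e a * (of_bool (t e = v) - of_bool (s e = v))"
      by (auto simp: hd_def tl_def)
  qed
  also have "\<dots> = bdry E s t (\<lambda>e. if (e, a) \<in> Q then M e a else 0) v"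
    unfolding bdry_def F_def using finite_E by (intro sum.mono_neutral_cong_left) auto
  finally show ?thesis .
qed

text \<open>A row is a cycle, so at each vertex it has as many incoming as outgoing darts, and any
  matching of them is a successor map. Whichever matching is chosen, indecomposability will make it
  transitive on the row.\<close>

lemma next_exists:
  "\<exists>nx. inj_on nx darts \<and> (\<forall>d\<in>darts. nx d \<in> darts \<and> snd (nx d) = snd d \<and> tl (nx d) = hd d)"
proof -
  define H where "H a v = {d \<in> darts. snd d = a \<and> hd d = v}" for a v
  define T where "T a v = {d \<in> darts. snd d = a \<and> tl d = v}" for a v
  have "\<exists>h. bij_betw h (H a v) (T a v)" for a v
  proof -
    have fin: "finite (H a v)" "finite (T a v)" using finite_darts by (auto simp: H_def T_def)
    have "card (H a v) = card (T a v)"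
    proof (cases "a < n")
      case True
      define Q where "Q = {d \<in> darts. snd d = a}"
      have finO: "finite Q" using finite_darts by (simp add: Q_def)
      have "(\<Sum>d\<in>Q. of_bool (hd d = v) - of_bool (tl d = v)) = bdry E s t (\<lambda>e. if (e, a) \<in> Q then M e a else 0) v"
        by (rule dart_bdry) (auto simp: Q_def)
      also have "\<dots> = bdry E s t (\<lambda>e. M e a) v"
        using M_zero True by (intro bdry_cong) (auto simp: Q_def darts_def)
      also have "\<dots> = 0" using row_cycle[OF True] by (simp add: is_cycle_def)
      finally have "(\<Sum>d\<in>Q. of_bool (hd d = v)) = (\<Sum>d\<in>Q. of_bool (tl d = v) :: int)" by (simp add: sum_subtractf)
      then have "int (card (Q \<inter> {d. hd d = v})) = int (card (Q \<inter> {d. tl d = v}))" using finO by simp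
      moreover have "Q \<inter> {d. hd d = v} = H a v" "Q \<inter> {d. tl d = v} = T a v" by (auto simp: Q_def H_def T_def)
      ultimately show ?thesis by simp
    next
      case False
      then have "H a v = {}" "T a v = {}" using dart by (auto simp: H_def T_def)
      then show ?thesis by simp
    qed
    then show ?thesis using fin finite_same_card_bij by blast
  qed
  then obtain h where h: "\<And>a v. bij_betw (h a v) (H a v) (T a v)" by metis
  define nx where "nx d = h (snd d) (hd d) d" for d
  have nx: "nx d \<in> T (snd d) (hd d)" if "d \<in> darts" for d
    using h[of "snd d" "hd d"] that unfolding nx_def bij_betw_def H_def by blast
  have "inj_on nx darts"
  proof (rule inj_onI)
    fix d d' assume d: "d \<in> darts" "d' \<in> darts" "nx d = nx d'"
    then have eq: "snd d = snd d'" "hd d = hd d'" using nx[OF d(1)] nx[OF d(2)] by (auto simp: T_def)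
    then have "h (snd d) (hd d) d = h (snd d) (hd d) d'" using d(3) by (simp add: nx_def)
    moreover have "d \<in> H (snd d) (hd d)" "d' \<in> H (snd d) (hd d)" using d eq by (auto simp: H_def)
    ultimately show "d = d'" using h[of "snd d" "hd d"] by (auto simp: bij_betw_def dest: inj_onD)
  qed
  then show ?thesis using nx by (intro exI[of _ nx]) (auto simp: T_def)
qed

end

locale tour = rows V E s t n M L R for V :: "'v set" and E :: "'e set" and s t n M L R +
  fixes Ts :: "'e set" and nx :: "'e \<times> nat \<Rightarrow> 'e \<times> nat" and d0 :: "'e \<times> nat"
  assumes Ts_sub: "Ts \<subseteq> E" and Ts_coh: "\<And>e. e \<in> Ts \<Longrightarrow> M e (L e) + M e (R e) = 0"
    and Ts_reach: "\<And>a b. a < n \<Longrightarrow> b < n \<Longrightarrow> reach Ts R L a b" and Ts_bridge: "\<And>e. e \<in> Ts \<Longrightarrow> bridge Ts R L e"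
    and indec: "\<And>a. a < n \<Longrightarrow> indecomposable a"
    and nx_inj: "inj_on nx darts" and nx: "\<And>d. d \<in> darts \<Longrightarrow> nx d \<in> darts \<and> snd (nx d) = snd d \<and> tl (nx d) = hd d"
    and d0: "d0 \<in> darts"
begin

text \<open>At an edge of the dual tree the walk continues in the row on the other side, as along
  the boundary of two discs glued at this edge; the letter itself stays in the word as a
  marker.\<close>

definition \<tau> :: "'e \<times> nat \<Rightarrow> 'e \<times> nat" where
  "\<tau> d = (if fst d \<in> Ts then nx (opp d) else nx d)"

lemma dual_fgraph: "fgraph {..<n} Ts R L"
  using finite_E Ts_sub LR by unfold_locales (auto intro: finite_subset)

lemma \<tau>_dart: "d \<in> darts \<Longrightarrow> \<tau> d \<in> darts"
  using nx opp_dart by (auto simp: \<tau>_def)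

lemma \<tau>_inj: "inj_on \<tau> darts"
proof (rule inj_onI)
  fix d d' assume d: "d \<in> darts" "d' \<in> darts" "\<tau> d = \<tau> d'"
  define f where "f d = (if fst d \<in> Ts then opp d else d)" for d
  have f: "f d \<in> darts" "f (f d) = d" if "d \<in> darts" for d using opp_dart[OF that] that by (auto simp: f_def)
  have "\<tau> d = nx (f d)" for d by (simp add: \<tau>_def f_def)
  then have "f d = f d'" using d f(1) nx_inj by (metis inj_onD)
  then show "d = d'" using f(2) d by metis
qed

lemma image_closed:
  assumes "Q \<subseteq> darts" "\<tau> ` Q \<subseteq> Q" "d \<in> darts" shows "\<tau> d \<in> Q \<longleftrightarrow> d \<in> Q"
proof
  have "finite Q" using assms(1) finite_darts by (rule finite_subset)
  then have "\<tau> ` Q = Q" using assms(1,2) \<tau>_inj by (meson endo_inj_surj inj_on_subset)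
  then show "\<tau> d \<in> Q \<Longrightarrow> d \<in> Q" using inj_on_image_mem_iff[OF \<tau>_inj assms(3,1)] by simp
qed (use assms(2) in auto)

text \<open>A subset of a row closed under \<open>nx\<close> has as many heads as tails at every
  vertex, so it is the support of a subcycle of the row.\<close>

lemma row_transitive:
  assumes Q: "Q \<subseteq> darts" "\<And>d. d \<in> Q \<Longrightarrow> snd d = a" "a < n" "nx ` Q \<subseteq> Q"
  shows "Q = {} \<or> Q = {d \<in> darts. snd d = a}"
proof -
  define z where "z e = (if (e, a) \<in> Q then M e a else 0)" for e
  have finO: "finite Q" using Q(1) finite_darts by (rule finite_subset)
  have nxO: "bij_betw nx Q Q"
  proof -
    have "inj_on nx Q" using nx_inj Q(1) by (rule inj_on_subset)
    then show ?thesis using endo_inj_surj[OF finO Q(4)] by (simp add: bij_betw_def)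
  qed
  have "bdry E s t z v = 0" for v
  proof -
    have "bdry E s t z v = (\<Sum>d\<in>Q. of_bool (hd d = v) - of_bool (tl d = v))"
      unfolding z_def using dart_bdry[OF Q(1,2)] by simp
    also have "\<dots> = (\<Sum>d\<in>Q. of_bool (tl (nx d) = v)) - (\<Sum>d\<in>Q. of_bool (tl d = v))"
      unfolding sum_subtractf using nx Q(1) by (intro arg_cong2[of _ _ _ _ "(-)"] sum.cong) auto
    also have "(\<Sum>d\<in>Q. of_bool (tl (nx d) = v)) = (\<Sum>d\<in>Q. of_bool (tl d = v) :: int)"
      using sum.reindex_bij_betw[OF nxO, of "\<lambda>d. of_bool (tl d = v)"] .
    finally show ?thesis by simp
  qed
  then have "is_cycle E s t z" by (simp add: is_cycle_def)
  moreover have "\<forall>e\<in>E. z e = 0 \<or> z e = M e a" by (auto simp: z_def)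
  ultimately have "(\<forall>e\<in>E. z e = 0) \<or> (\<forall>e\<in>E. z e = M e a)" using indec[OF Q(3)] by (simp add: indecomposable_def)
  then show ?thesis
  proof
    assume z0: "\<forall>e\<in>E. z e = 0"
    have "Q = {}"
    proof (rule ccontr)
      assume "Q \<noteq> {}"
      then obtain d where d: "d \<in> Q" by auto
      then have "d = (fst d, a)" using Q(2) by (simp add: prod_eq_iff)
      then have "z (fst d) = M (fst d) a" using d by (simp add: z_def)
      then show False using z0 dart[of d] d Q(1,2) by auto
    qed
    then show ?thesis by simp
  next
    assume zM: "\<forall>e\<in>E. z e = M e a"
    have "d \<in> Q" if d: "d \<in> darts" "snd d = a" for d
    proof (rule ccontr)
      assume "d \<notin> Q"
      then have "z (fst d) = 0" using d by (simp add: z_def prod_eq_iff[symmetric]) (metis prod.collapse)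
      then show False using zM dart[OF d(1)] d(2) by auto
    qed
    then show ?thesis using Q(1,2) by blast
  qed
qed

text \<open>An orbit meets the darts of a tree edge in a flow on the dual tree, which vanishes. So it is a union of
  rows and closed under crossing tree edges.\<close>

lemma single_orbit:
  assumes Q: "Q \<subseteq> darts" "Q \<noteq> {}" "\<tau> ` Q \<subseteq> Q"
  shows "Q = darts"
proof -
  interpret T: fgraph "{..<n}" Ts R L by (rule dual_fgraph)
  define ch :: "'e \<times> nat \<Rightarrow> int" where "ch d = of_bool (d \<in> Q)" for d
  define row where "row a = {d \<in> darts. snd d = a}" for a
  have finrow: "finite (row a)" for a using finite_darts by (simp add: row_def)
  have nxO: "nx d \<in> Q \<longleftrightarrow> (if fst d \<in> Ts then opp d \<in> Q else d \<in> Q)" if d: "d \<in> darts" for d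
  proof (cases "fst d \<in> Ts")
    case True
    have "\<tau> (opp d) = nx d" using opp_dart[OF d] True by (simp add: \<tau>_def)
    then show ?thesis using image_closed[OF Q(1,3), of "opp d"] opp_dart[OF d] True by simp
  next
    case False
    then have "\<tau> d = nx d" by (simp add: \<tau>_def)
    then show ?thesis using image_closed[OF Q(1,3) d] False by simp
  qed
  \<comment> \<open>The flow on the dual tree compares the memberships of the two darts of an edge.
    It is conserved at each row because \<open>nx\<close> permutes the darts of that row.\<close>
  define y where "y e = ch (e, L e) - ch (e, R e)" for e
  have "bdry Ts R L y a = 0" for a
  proof (cases "a < n")
    case False
    then have "L e \<noteq> a" "R e \<noteq> a" if "e \<in> Ts" for e using that Ts_sub LR by auto
    then show ?thesis by (simp add: bdry_def)
  next
    case True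
    have bij: "bij_betw nx (row a) (row a)"
    proof -
      have "nx ` row a \<subseteq> row a" using nx by (auto simp: row_def)
      moreover have "inj_on nx (row a)" using nx_inj by (rule inj_on_subset) (auto simp: row_def)
      ultimately show ?thesis using finrow by (metis bij_betw_def endo_inj_surj)
    qed
    have "(\<Sum>d\<in>row a. ch (nx d)) = (\<Sum>d\<in>row a. ch d)" using sum.reindex_bij_betw[OF bij, of ch] .
    moreover have "ch (nx d) = ch d + of_bool (fst d \<in> Ts) * (ch (opp d) - ch d)" if "d \<in> row a" for d
      using nxO[of d] that by (auto simp: ch_def row_def)
    ultimately have "(\<Sum>d\<in>row a. of_bool (fst d \<in> Ts) * (ch (opp d) - ch d)) = 0" by (simp add: sum.distrib)
    moreover have "bdry Ts R L y a = - (\<Sum>d\<in>row a. of_bool (fst d \<in> Ts) * (ch (opp d) - ch d))"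
    proof -
      define F where "F = {e \<in> Ts. L e = a \<or> R e = a}"
      have "(\<Sum>d\<in>row a. of_bool (fst d \<in> Ts) * (ch (opp d) - ch d)) = (\<Sum>d\<in>(\<lambda>e. (e, a)) ` F. ch (opp d) - ch d)"
      proof (rule sum.mono_neutral_cong_right)
        show "(\<lambda>e. (e, a)) ` F \<subseteq> row a" using Ts_sub by (auto simp: F_def row_def darts_def)
        show "\<forall>d\<in>row a - (\<lambda>e. (e, a)) ` F. of_bool (fst d \<in> Ts) * (ch (opp d) - ch d) = 0"
          by (auto simp: F_def row_def darts_def)
      qed (auto simp: finrow F_def)
      also have "\<dots> = (\<Sum>e\<in>F. ch (opp (e, a)) - ch (e, a))" by (subst sum.reindex) (auto simp: inj_on_def)
      also have "\<dots> = (\<Sum>e\<in>F. - (y e * (of_bool (L e = a) - of_bool (R e = a))))"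
      proof (rule sum.cong[OF refl])
        fix e assume "e \<in> F"
        then have "e \<in> E" "L e = a \<or> R e = a" using Ts_sub by (auto simp: F_def)
        then show "ch (opp (e, a)) - ch (e, a) = - (y e * (of_bool (L e = a) - of_bool (R e = a)))"
          using LR[of e] by (auto simp: y_def opp_def)
      qed
      also have "\<dots> = - bdry Ts R L y a"
        unfolding bdry_def sum_negf using T.finite_E by (subst sum.mono_neutral_left[of Ts F]) (auto simp: F_def)
      finally show ?thesis by simp
    qed
    ultimately show ?thesis by simp
  qed
  then have "is_cycle Ts R L y" by (simp add: is_cycle_def)
  then have y0: "y e = 0" if "e \<in> Ts" for e using T.bridge_cycle_zero[OF Ts_bridge[OF that]] by blast
  then have sym: "(e, L e) \<in> Q \<longleftrightarrow> (e, R e) \<in> Q" if "e \<in> Ts" for e using y0[OF that] by (auto simp: y_def ch_def split: if_splits)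
  have opO: "opp d \<in> Q \<longleftrightarrow> d \<in> Q" if "d \<in> darts" "fst d \<in> Ts" for d
    using sym[OF that(2)] that LR[of "fst d"] by (cases d) (auto simp: opp_def darts_def)
  have nxO': "nx d \<in> Q \<longleftrightarrow> d \<in> Q" if "d \<in> darts" for d using nxO[OF that] opO[OF that] by auto
  have rows: "row a \<subseteq> Q \<or> row a \<inter> Q = {}" if "a < n" for a
  proof -
    have "nx ` (row a \<inter> Q) \<subseteq> row a \<inter> Q" using nx nxO' by (auto simp: row_def)
    then have "row a \<inter> Q = {} \<or> row a \<inter> Q = row a"
      using row_transitive[of "row a \<inter> Q" a] that unfolding row_def by fast
    then show ?thesis by blast
  qed
  have rowne: "row a \<noteq> {}" if "a < n" for a
  proof -
    obtain e where "e \<in> E" using d0 by (auto simp: darts_def)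
    then have "{a} \<noteq> {..<n}" using LR[of e] by (metis lessThan_iff singletonD)
    then obtain e where "e \<in> E" "(L e \<in> {a}) \<noteq> (R e \<in> {a})" using dual_conn[of "{a}"] \<open>a < n\<close> by blast
    then show ?thesis by (auto simp: row_def darts_def)
  qed
  have inv: "(row (R e) \<subseteq> Q) = (row (L e) \<subseteq> Q)" if e: "e \<in> Ts" for e
  proof -
    have eE: "e \<in> E" using e Ts_sub by auto
    have "(e, L e) \<in> row (L e)" "(e, R e) \<in> row (R e)" using eE by (auto simp: row_def darts_def)
    then show ?thesis using sym[OF e] rows[of "L e"] rows[of "R e"] LR[OF eE] by blast
  qed
  obtain d where d: "d \<in> Q" using Q(2) by auto
  then have dd: "d \<in> row (snd d)" "snd d < n" using Q(1) dart[of d] by (auto simp: row_def)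
  then have "row (snd d) \<subseteq> Q" using rows d by blast
  then have all: "row a \<subseteq> Q" if "a < n" for a
    using reach_invariant[OF Ts_reach[OF dd(2) that], of "\<lambda>a. row a \<subseteq> Q"] inv by simp
  have "darts \<subseteq> Q"
  proof
    fix d assume "d \<in> darts"
    then show "d \<in> Q" using all[of "snd d"] dart[of d] by (auto simp: row_def)
  qed
  then show ?thesis using Q(1) by blast
qed

definition N :: nat where "N = card darts"
definition dk :: "nat \<Rightarrow> 'e \<times> nat" where "dk k = (\<tau> ^^ k) d0"

lemma dk_bij: "bij_betw dk {..<N} darts" and dk_N: "dk N = dk 0" and dk_Suc: "dk (Suc k) = \<tau> (dk k)" and dk_0: "dk 0 = d0"
proof -
  have "\<tau> ` darts \<subseteq> darts" using \<tau>_dart by auto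
  note * = single_orbit_enumeration[OF finite_darts this \<tau>_inj d0 single_orbit]
  show "bij_betw dk {..<N} darts" using *(1) unfolding dk_def N_def .
  show "dk N = dk 0" using *(2) by (simp add: dk_def N_def)
qed (simp_all add: dk_def)

lemma dk_dart: "dk k \<in> darts"
  using d0 \<tau>_dart by (induction k) (auto simp: dk_def)

definition vt :: "nat \<Rightarrow> 'v" where "vt k = tl (dk k)"

text \<open>At a tree letter the corner stays: by coherence the opposite dart ends where the current
  one starts.\<close>

lemma vt_Suc: "vt (Suc k) = (if fst (dk k) \<in> Ts then vt k else hd (dk k))"
proof (cases "fst (dk k) \<in> Ts")
  case True
  let ?d = "dk k"
  have e: "fst ?d \<in> Ts" "?d \<in> darts" using True dk_dart by auto
  have "vt (Suc k) = hd (opp ?d)" using nx opp_dart[OF e(2)] True by (simp add: vt_def dk_Suc \<tau>_def)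
  moreover have "M (fst ?d) (snd (opp ?d)) = - M (fst ?d) (snd ?d)"
    using Ts_coh[OF e(1)] e(2) by (cases ?d) (auto simp: opp_def darts_def)
  then have "hd (opp ?d) = tl ?d" using dart[OF e(2)] opp_dart[OF e(2)] by (auto simp: hd_def tl_def)
  ultimately show ?thesis using True by (simp add: vt_def)
next
  case False
  then show ?thesis using nx[OF dk_dart] by (simp add: vt_def dk_Suc \<tau>_def)
qed

lemma vt_N: "vt N = vt 0" by (simp add: vt_def dk_N)

definition pL :: "'e \<Rightarrow> nat" where "pL e = the_inv_into {..<N} dk (e, L e)"
definition pR :: "'e \<Rightarrow> nat" where "pR e = the_inv_into {..<N} dk (e, R e)"

lemma pLR:
  assumes "e \<in> E"
  shows "pL e < N" "dk (pL e) = (e, L e)" "pR e < N" "dk (pR e) = (e, R e)" "pL e \<noteq> pR e"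
proof -
  have d: "(e, L e) \<in> darts" "(e, R e) \<in> darts" using assms by (auto simp: darts_def)
  have inj: "inj_on dk {..<N}" and im: "dk ` {..<N} = darts" using dk_bij by (auto simp: bij_betw_def)
  show *: "dk (pL e) = (e, L e)" "dk (pR e) = (e, R e)"
    unfolding pL_def pR_def using f_the_inv_into_f[OF inj] d im by auto
  show "pL e < N" "pR e < N"
    unfolding pL_def pR_def using the_inv_into_into[OF inj _ order_refl] d im by auto
  show "pL e \<noteq> pR e" using * LR[OF assms] by (metis prod.inject)
qed

lemma pLR_only:
  assumes "k < N" shows "fst (dk k) \<in> E" "k = pL (fst (dk k)) \<or> k = pR (fst (dk k))"
proof -
  let ?e = "fst (dk k)"
  show e: "?e \<in> E" using dart[OF dk_dart] by simp
  have "dk k = (?e, L ?e) \<or> dk k = (?e, R ?e)" using dk_dart[of k] by (cases "dk k") (auto simp: darts_def)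
  moreover have "inj_on dk {..<N}" using dk_bij by (auto simp: bij_betw_def)
  ultimately show "k = pL ?e \<or> k = pR ?e" using pLR[OF e] assms by (metis inj_onD lessThan_iff)
qed

definition lo :: "'e \<Rightarrow> nat" where "lo e = min (pL e) (pR e)"
definition hi :: "'e \<Rightarrow> nat" where "hi e = max (pL e) (pR e)"

lemma lo_hi: "e \<in> E \<Longrightarrow> lo e < hi e \<and> hi e < N \<and> fst (dk (lo e)) = e \<and> fst (dk (hi e)) = e"
  using pLR[of e] by (auto simp: lo_def hi_def min_def max_def)

lemma lo_hi_only: "k < N \<Longrightarrow> fst (dk k) \<in> E \<and> (k = lo (fst (dk k)) \<or> k = hi (fst (dk k)))"
  using pLR_only[of k] by (auto simp: lo_def hi_def min_def max_def)

lemma darts_lo_hi: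
  assumes "e \<in> E" shows "{dk (lo e), dk (hi e)} = {(e, L e), (e, R e)}"
  using pLR[OF assms] by (auto simp: lo_def hi_def min_def max_def)

text \<open>Removing \<open>e\<close> splits the dual tree into two sides. The tour changes sides
  only at the occurrences of \<open>e\<close>, while both rows of another tree edge lie on the same
  side.\<close>

lemma tree_noncrossing:
  assumes e: "e \<in> Ts" "e' \<in> Ts" "e \<noteq> e'"
  shows "lo e < lo e' \<and> lo e' \<le> hi e \<longleftrightarrow> lo e < hi e' \<and> hi e' \<le> hi e"
proof -
  interpret T: fgraph "{..<n}" Ts R L by (rule dual_fgraph)
  have eE: "e \<in> E" "e' \<in> E" using e Ts_sub by auto
  obtain h :: "nat \<Rightarrow> int" where h: "\<And>f. f \<in> Ts \<Longrightarrow> h (L f) - h (R f) = of_bool (f = e)"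
    using T.forest_potential[OF order_refl Ts_bridge, of "\<lambda>f. of_bool (f = e)"] by blast
  define f where "f k = h (snd (dk k))" for k
  have other: "snd (dk (Suc k)) = (if fst (dk k) \<in> Ts then snd (opp (dk k)) else snd (dk k))" for k
    using nx[OF dk_dart[of k]] nx[of "opp (dk k)"] opp_dart[OF dk_dart[of k]] by (auto simp: dk_Suc \<tau>_def)
  have jump: "h (snd (opp (dk k))) = h (snd (dk k)) \<longleftrightarrow> fst (dk k) \<noteq> e" if "fst (dk k) \<in> Ts" for k
    using h[OF that] dk_dart[of k] by (cases "dk k") (auto simp: opp_def darts_def)
  have "f k = f l \<longleftrightarrow> (lo e < k \<and> k \<le> hi e \<longleftrightarrow> lo e < l \<and> l \<le> hi e)" if "k \<le> N" "l \<le> N" for k l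
  proof (rule two_jumps[OF _ _ _ _ _ that])
    show "lo e < hi e" "hi e < N" using lo_hi[OF eE(1)] by auto
    show "f (Suc k) = f k" if "k < N" "k \<noteq> lo e" "k \<noteq> hi e" for k
    proof -
      have "fst (dk k) \<noteq> e" using lo_hi_only[OF that(1)] that by auto
      then show ?thesis using other[of k] jump[of k] by (auto simp: f_def)
    qed
    show "f (Suc (lo e)) \<noteq> f (lo e)"
      using other[of "lo e"] jump[of "lo e"] lo_hi[OF eE(1)] e(1) by (auto simp: f_def)
    show "f N = f 0" by (simp add: f_def dk_N)
  qed
  moreover have "f (lo e') = f (hi e')"
  proof -
    have "h (L e') = h (R e')" using h[OF e(2)] e(3) by simp
    moreover have "snd (dk (lo e')) \<in> {L e', R e'}" "snd (dk (hi e')) \<in> {L e', R e'}"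
      using pLR[OF eE(2)] by (auto simp: lo_def hi_def min_def max_def)
    ultimately show ?thesis by (auto simp: f_def)
  qed
  ultimately show ?thesis using lo_hi[OF eE(2)] by (meson less_imp_le_nat order.strict_trans)
qed

end

section \<open>Drawing a graph along the tour\<close>

context rows begin

text \<open>By \<open>span\<close> each edge outside \<open>B\<close> differs from a combination of
  \<open>B\<close> by a coboundary, which is its fundamental cut. By \<open>ext\<close> a chain
  between two vertices can be moved off \<open>B\<close>, so some cut separates them. Thus
  \<open>E - B\<close> acts as a spanning tree.\<close>

lemma potentials:
  assumes B: "B \<subseteq> E"
    and span: "\<And>e. e \<in> E - B \<Longrightarrow> \<exists>c. \<forall>a<n. M e a = (\<Sum>f\<in>B. c f * M f a)"
    and ext: "\<And>c. \<exists>z. is_cycle E s t z \<and> (\<forall>f\<in>B. z f = c f)"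
  obtains pot :: "'e \<Rightarrow> 'v \<Rightarrow> int"
  where "\<And>e f. e \<in> E - B \<Longrightarrow> f \<in> E - B \<Longrightarrow> pot e (t f) - pot e (s f) = of_bool (f = e)"
    "\<And>u v. u \<in> V \<Longrightarrow> v \<in> V \<Longrightarrow> u \<noteq> v \<Longrightarrow> \<exists>e\<in>E - B. pot e u \<noteq> pot e v"
proof -
  have "\<exists>p. \<forall>f\<in>E - B. p (t f) - p (s f) = (of_bool (f = e) :: int)" if e: "e \<in> E - B" for e
  proof -
    obtain c where c: "\<forall>a<n. M e a = (\<Sum>f\<in>B. c f * M f a)" using span[OF e] by blast
    define x :: "'e \<Rightarrow> int" where "x f = of_bool (f = e) - (if f \<in> B then c f else 0)" for f
    have "(\<Sum>f\<in>E. x f * M f a) = 0" if "a < n" for a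
    proof -
      have "(\<Sum>f\<in>E. of_bool (f = e) * M f a) = M e a" using e finite_E by (simp add: sum_of_bool_single)
      moreover have "(\<Sum>f\<in>E. (if f \<in> B then c f else 0) * M f a) = (\<Sum>f\<in>B. c f * M f a)"
        using B finite_E by (intro sum.mono_neutral_cong_right) auto
      ultimately show ?thesis using c that by (simp add: x_def left_diff_distrib sum_subtractf)
    qed
    moreover have "x \<in> C1 E" using e B by (auto simp: x_def C1_def)
    ultimately have "x \<in> coboundaries V E s t" using kernel by blast
    then obtain p where "x = coboundary E s t p" by (auto simp: coboundaries_def)
    then have "p (t f) - p (s f) = x f" if "f \<in> E" for f using that by (simp add: coboundary_def)
    then show ?thesis by (intro exI[of _ p]) (auto simp: x_def)
  qed
  then obtain pot where pot: "\<And>e f. e \<in> E - B \<Longrightarrow> f \<in> E - B \<Longrightarrow> pot e (t f) - pot e (s f) = (of_bool (f = e) :: int)" by metis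
  show ?thesis
  proof (rule that[OF pot])
    fix u v assume uv: "u \<in> V" "v \<in> V" "u \<noteq> v"
    then have "reach E s t u v" using two_conn by (auto simp: two_connected_def connected_graph_def)
    then obtain c where c: "\<forall>w. bdry E s t c w = of_bool (w = v) - of_bool (w = u)" using reach_chain[OF finite_E, of s t u v] by blast
    obtain z where z: "is_cycle E s t z" "\<forall>f\<in>B. z f = c f" using ext by blast
    define d where "d f = c f - z f" for f
    have bd: "bdry E s t d w = of_bool (w = v) - of_bool (w = u)" for w
      unfolding d_def bdry_diff using c z(1) by (simp add: is_cycle_def)
    have dB: "d f = 0" if "f \<in> B" for f using z(2) that by (simp add: d_def)
    have "\<exists>e\<in>E. d e \<noteq> 0"
    proof (rule ccontr)
      assume "\<not> (\<exists>e\<in>E. d e \<noteq> 0)"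
      then have "bdry E s t d v = 0" by (simp add: bdry_def)
      then show False using bd[of v] uv by simp
    qed
    then obtain e where e: "e \<in> E - B" "d e \<noteq> 0" using dB by blast
    have "(\<Sum>f\<in>E. (pot e (t f) - pot e (s f)) * d f) = (\<Sum>f\<in>E. of_bool (f = e) * d f)"
    proof (rule sum.cong[OF refl])
      fix f assume "f \<in> E"
      then show "(pot e (t f) - pot e (s f)) * d f = of_bool (f = e) * d f"
        using pot[OF e(1), of f] dB[of f] by (cases "f \<in> B") auto
    qed
    also have "\<dots> = d e" using e finite_E by (simp add: sum_of_bool_single)
    finally have "(\<Sum>w\<in>V. pot e w * bdry E s t d w) = d e" by (simp add: coboundary_pairing)
    moreover have "(\<Sum>w\<in>V. pot e w * bdry E s t d w) = pot e v - pot e u"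
    proof -
      have "pot e w * bdry E s t d w = of_bool (w = v) * pot e w - of_bool (w = u) * pot e w" for w
        by (simp add: bd algebra_simps)
      then show ?thesis using uv finite_V by (simp add: sum_subtractf sum_of_bool_single)
    qed
    ultimately show "\<exists>e\<in>E - B. pot e u \<noteq> pot e v" using e by (intro bexI[of _ e]) auto
  qed
qed

end

context tour begin

lemma M_formula: "e \<in> E \<Longrightarrow> a < n \<Longrightarrow> M e a = of_bool (a = L e) * M e (L e) + of_bool (a = R e) * M e (R e)"
  using M_zero[of e a] LR[of e] by auto

text \<open>A path in the dual tree telescopes to the difference of its ends; the factor
  \<open>M f (L f)\<close> adjusts the orientation of each edge.\<close>

lemma tree_span:
  assumes "a < n" "b < n"
  shows "\<exists>c. \<forall>x<n. of_bool (x = b) - of_bool (x = a) = (\<Sum>f\<in>Ts. c f * M f x)"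
proof -
  interpret T: fgraph "{..<n}" Ts R L by (rule dual_fgraph)
  obtain c where c: "\<forall>v. bdry Ts R L c v = of_bool (v = b) - of_bool (v = a)"
    using reach_chain[OF T.finite_E Ts_reach[OF assms]] by blast
  have "(\<Sum>f\<in>Ts. c f * M f (L f) * M f x) = bdry Ts R L c x" if "x < n" for x
    unfolding bdry_def
  proof (rule sum.cong[OF refl])
    fix f assume f: "f \<in> Ts"
    then have fE: "f \<in> E" using Ts_sub by auto
    have "M f (R f) = - M f (L f)" using Ts_coh[OF f] by simp
    then have "M f (L f) * M f x = M f (L f) * M f (L f) * (of_bool (L f = x) - of_bool (R f = x))"
      using M_formula[OF fE that] by (auto simp: algebra_simps)
    moreover have "M f (L f) * M f (L f) = 1" using M_unit[OF fE] by auto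
    ultimately show "c f * M f (L f) * M f x = c f * (of_bool (L f = x) - of_bool (R f = x))" by (simp add: mult.assoc)
  qed
  then show ?thesis using c by (intro exI[of _ "\<lambda>f. c f * M f (L f)"]) auto
qed

lemma coherent_span:
  assumes e: "e \<in> E" "M e (L e) + M e (R e) = 0"
  shows "\<exists>c. \<forall>x<n. M e x = (\<Sum>f\<in>Ts. c f * M f x)"
proof -
  obtain c where c: "\<forall>x<n. of_bool (x = L e) - of_bool (x = R e) = (\<Sum>f\<in>Ts. c f * M f x)"
    using tree_span[of "R e" "L e"] LR[OF e(1)] by blast
  have "M e x = (\<Sum>f\<in>Ts. M e (L e) * c f * M f x)" if x: "x < n" for x
  proof -
    have "M e (R e) = - M e (L e)" using e(2) by simp
    then have "M e x = M e (L e) * (of_bool (x = L e) - of_bool (x = R e))"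
      using M_formula[OF e(1) x] by (auto simp: algebra_simps)
    also have "\<dots> = M e (L e) * (\<Sum>f\<in>Ts. c f * M f x)" using c x by simp
    finally show ?thesis by (simp add: sum_distrib_left mult.assoc)
  qed
  then show ?thesis by (intro exI[of _ "\<lambda>f. M e (L e) * c f"]) simp
qed

lemma tree_height:
  obtains h :: "nat \<Rightarrow> int" where "\<And>f. f \<in> Ts \<Longrightarrow> h (L f) * M f (L f) + h (R f) * M f (R f) = c f"
proof -
  interpret T: fgraph "{..<n}" Ts R L by (rule dual_fgraph)
  obtain h :: "nat \<Rightarrow> int" where h: "\<And>f. f \<in> Ts \<Longrightarrow> h (L f) - h (R f) = M f (L f) * c f"
    using T.forest_potential[OF order_refl Ts_bridge, of "\<lambda>f. M f (L f) * c f"] by blast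
  have "h (L f) * M f (L f) + h (R f) * M f (R f) = c f" if f: "f \<in> Ts" for f
  proof -
    have fE: "f \<in> E" using f Ts_sub by auto
    have "M f (R f) = - M f (L f)" using Ts_coh[OF f] by simp
    then have "h (L f) * M f (L f) + h (R f) * M f (R f) = (h (L f) - h (R f)) * M f (L f)" by (simp add: algebra_simps)
    then show ?thesis using h[OF f] M_unit[OF fE] by auto
  qed
  then show ?thesis by (rule that)
qed

lemma vt_onto: assumes v: "v \<in> V" shows "\<exists>k<N. vt k = v"
proof -
  have "\<exists>d\<in>darts. tl d = v"
  proof -
    obtain e where e: "e \<in> E" using d0 by (auto simp: darts_def)
    have "reach E s t v (s e)" using v e two_conn ends_in_V by (auto simp: two_connected_def connected_graph_def)
    then have "v = s e \<or> (\<exists>w. adj E s t v w)" unfolding reach_def by (metis converse_rtranclpE)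
    then obtain f where f: "f \<in> E" "v = s f \<or> v = t f" using e by (auto simp: adj_def)
    let ?d = "(f, L f)"
    have d: "?d \<in> darts" using f by (auto simp: darts_def)
    have "v = tl ?d \<or> v = hd ?d" using f by (auto simp: tl_def hd_def)
    then show ?thesis using nx[OF d] d by metis
  qed
  then obtain d where d: "d \<in> darts" "tl d = v" by blast
  then have "d \<in> dk ` {..<N}" using dk_bij by (simp add: bij_betw_def)
  then obtain k where "k < N" "dk k = d" by blast
  then show ?thesis using d by (auto simp: vt_def)
qed

lemma vt_ends:
  assumes "k < N" "fst (dk k) \<notin> Ts" shows "{vt k, vt (Suc k)} = {s (fst (dk k)), t (fst (dk k))}"
  using assms vt_Suc[of k] by (auto simp: vt_def tl_def hd_def)

lemma tree_ends: assumes "e \<in> Ts" shows "{vt (lo e), vt (hi e)} = {s e, t e}"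
proof -
  have eE: "e \<in> E" using assms Ts_sub by auto
  have "{vt (lo e), vt (hi e)} = {tl (e, L e), tl (e, R e)}"
    using darts_lo_hi[OF eE] unfolding vt_def by (metis image_empty image_insert)
  moreover have "M e (L e) = 1 \<and> M e (R e) = -1 \<or> M e (L e) = -1 \<and> M e (R e) = 1"
    using M_unit[OF eE] Ts_coh[OF assms] by auto
  ultimately show ?thesis by (auto simp: tl_def)
qed

lemma lo_hi_distinct:
  assumes "e \<in> E" "f \<in> E" "e \<noteq> f" shows "lo e \<noteq> lo f" "lo e \<noteq> hi f" "hi e \<noteq> lo f" "hi e \<noteq> hi f"
  using lo_hi[OF assms(1)] lo_hi[OF assms(2)] assms(3) by metis+

lemma tree_not_crossing:
  assumes "e \<in> Ts" "e' \<in> Ts" shows "\<not> (lo e < lo e' \<and> lo e' < hi e \<and> hi e < hi e')"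
proof
  assume c: "lo e < lo e' \<and> lo e' < hi e \<and> hi e < hi e'"
  then have "e \<noteq> e'" by auto
  from tree_noncrossing[OF assms this] c show False by auto
qed

text \<open>With only coherent columns the dual tree spans all of them, so its complement is a
  spanning tree of the graph and the tour is the contour of that tree. The remaining edges are
  noncrossing by \<open>tree_noncrossing\<close>.\<close>

theorem coherent_planar:
  assumes coh: "\<And>e. e \<in> E \<Longrightarrow> M e (L e) + M e (R e) = 0"
  shows "planar V E s t"
proof -
  have ext: "\<exists>z. is_cycle E s t z \<and> (\<forall>f\<in>Ts. z f = c f)" for c
  proof -
    obtain h where "\<And>f. f \<in> Ts \<Longrightarrow> h (L f) * M f (L f) + h (R f) * M f (R f) = c f" using tree_height[of c] by blast
    then show ?thesis using combination_cycle[of h] by blast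
  qed
  have span: "\<exists>c. \<forall>a<n. M e a = (\<Sum>f\<in>Ts. c f * M f a)" if "e \<in> E - Ts" for e
    using coherent_span[of e] coh that by blast
  obtain pot :: "'e \<Rightarrow> 'v \<Rightarrow> int"
    where pot: "\<And>e f. e \<in> E - Ts \<Longrightarrow> f \<in> E - Ts \<Longrightarrow> pot e (t f) - pot e (s f) = of_bool (f = e)"
      "\<And>u v. u \<in> V \<Longrightarrow> v \<in> V \<Longrightarrow> u \<noteq> v \<Longrightarrow> \<exists>e\<in>E - Ts. pot e u \<noteq> pot e v"
    by (rule potentials[OF Ts_sub span ext]) (assumption | rule that)+
  interpret C: contour V E s t N "\<lambda>k. fst (dk k)" vt "E - Ts" lo hi pot
  proof
    show "s e \<noteq> t e" if "e \<in> E" for e using no_loop that by (auto simp: loopless_def)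
    show "{vt (lo e), vt (hi e)} = {s e, t e}" if "e \<in> E - (E - Ts)" for e using tree_ends that by blast
    show "vt (Suc k) = vt k" if "k < N" "fst (dk k) \<notin> E - Ts" for k using vt_Suc[of k] lo_hi_only[OF that(1)] that by auto
    show "{vt k, vt (Suc k)} = {s (fst (dk k)), t (fst (dk k))}" if "k < N" "fst (dk k) \<in> E - Ts" for k
      using vt_ends that by blast
  qed (use lo_hi lo_hi_only vt_N vt_onto pot in auto)
  show ?thesis using tree_not_crossing by (intro C.contour_planar) auto
qed

end

text \<open>The tour starts at an edge \<open>f0\<close> with equal signs in its two rows; this edge
  is therefore traversed twice in the same direction.\<close>

locale twisted_tour = tour V E s t n M L R Ts nx "(f0, L f0)"
  for V :: "'v set" and E :: "'e set" and s t n M L R Ts nx f0 +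
  assumes f0: "f0 \<in> E" and f0_sign: "M f0 (L f0) = M f0 (R f0)"
begin

lemma f0_tree: "f0 \<notin> Ts"
  using Ts_coh[of f0] M_unit[OF f0] f0_sign by auto

definition m :: nat where "m = pR f0"

lemma pL_f0: "pL f0 = 0"
proof -
  have "dk 0 = dk (pL f0)" using dk_0 pLR[OF f0] by simp
  moreover have "0 < N" using pLR[OF f0] by simp
  ultimately show ?thesis using dk_bij pLR(1)[OF f0] unfolding bij_betw_def inj_on_def by (metis lessThan_iff)
qed

lemma m: "0 < m" "m < N" "lo f0 = 0" "hi f0 = m" "fst (dk m) = f0" "fst (dk 0) = f0"
  using pLR[OF f0] pL_f0 by (auto simp: m_def lo_def hi_def)

lemma f0_pos: "k < N \<Longrightarrow> fst (dk k) = f0 \<Longrightarrow> k = 0 \<or> k = m"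
  using lo_hi_only[of k] m by auto

lemma vt_f0: "vt m = vt 0" "vt (Suc m) = vt (Suc 0)"
proof -
  have d: "dk 0 = (f0, L f0)" "dk m = (f0, R f0)" using dk_0 pLR[OF f0] by (auto simp: m_def)
  show "vt m = vt 0" using f0_sign d by (simp add: vt_def tl_def)
  show "vt (Suc m) = vt (Suc 0)" using f0_sign d f0_tree vt_Suc[of 0] vt_Suc[of m] by (simp add: hd_def)
qed

text \<open>An involution on positions: it reverses the part of the word after \<open>m\<close> and
  fixes the two letters \<open>f0\<close>.\<close>

definition \<kappa> :: "nat \<Rightarrow> nat" where "\<kappa> k = (if k \<le> m then k else N + m - k)"

lemma \<kappa>: "k < N \<Longrightarrow> \<kappa> k < N" "k < N \<Longrightarrow> \<kappa> (\<kappa> k) = k" "k \<le> m \<Longrightarrow> \<kappa> k = k" "m < k \<Longrightarrow> k < N \<Longrightarrow> m < \<kappa> k"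
  using m by (auto simp: \<kappa>_def)

text \<open>Reversal turns the corner after a letter into the corner before it, hence
  \<open>Suc\<close>. Since \<open>f0\<close> no longer moves the corner, corner 0 is the starting
  corner \<open>vt (Suc 0)\<close> of the first part.\<close>

definition wvert :: "nat \<Rightarrow> 'v" where
  "wvert k = (if k = 0 then vt (Suc 0) else if k \<le> m then vt k else vt (Suc (N + m - k)))"

definition q1 :: "'e \<Rightarrow> nat" where "q1 e = min (\<kappa> (lo e)) (\<kappa> (hi e))"
definition q2 :: "'e \<Rightarrow> nat" where "q2 e = max (\<kappa> (lo e)) (\<kappa> (hi e))"

lemma q_low: "e \<in> E \<Longrightarrow> hi e \<le> m \<Longrightarrow> q1 e = lo e \<and> q2 e = hi e"
  using lo_hi[of e] by (auto simp: q1_def q2_def \<kappa>_def)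
lemma q_high: "e \<in> E \<Longrightarrow> m < lo e \<Longrightarrow> q1 e = N + m - hi e \<and> q2 e = N + m - lo e"
  using lo_hi[of e] by (auto simp: q1_def q2_def \<kappa>_def)
lemma q_mixed: "e \<in> E \<Longrightarrow> lo e \<le> m \<Longrightarrow> m < hi e \<Longrightarrow> q1 e = lo e \<and> q2 e = N + m - hi e"
  using lo_hi[of e] by (auto simp: q1_def q2_def \<kappa>_def)

lemma q_pair: "(q1 e = \<kappa> (lo e) \<and> q2 e = \<kappa> (hi e)) \<or> (q1 e = \<kappa> (hi e) \<and> q2 e = \<kappa> (lo e))"
  by (auto simp: q1_def q2_def min_def max_def)

lemma q_pos: assumes "e \<in> E" shows "q1 e < q2 e \<and> q2 e < N \<and> fst (dk (\<kappa> (q1 e))) = e \<and> fst (dk (\<kappa> (q2 e))) = e"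
proof -
  have l: "lo e < hi e" "hi e < N" "lo e < N" "fst (dk (lo e)) = e" "fst (dk (hi e)) = e" using lo_hi[OF assms] by auto
  then have "\<kappa> (lo e) \<noteq> \<kappa> (hi e)" using \<kappa>(2) by (metis less_irrefl)
  then have "q1 e < q2 e" by (auto simp: q1_def q2_def)
  then show ?thesis using q_pair[of e] \<kappa>(1,2) l by auto
qed

lemma q_only: assumes "k < N" shows "fst (dk (\<kappa> k)) \<in> E \<and> (k = q1 (fst (dk (\<kappa> k))) \<or> k = q2 (fst (dk (\<kappa> k))))"
  using lo_hi_only[OF \<kappa>(1)[OF assms]] \<kappa>(2)[OF assms] q_pair[of "fst (dk (\<kappa> k))"] by metis

lemma wvert_step:
  assumes k: "k < N" "k \<noteq> 0" "k \<noteq> m"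
  shows "{wvert k, wvert (Suc k)} = {vt (\<kappa> k), vt (Suc (\<kappa> k))}"
proof (cases "k < m")
  case False
  then have "Suc (N + m - Suc k) = N + m - k" using k by simp
  then show ?thesis using k False by (auto simp: wvert_def \<kappa>_def)
qed (use k in \<open>auto simp: wvert_def \<kappa>_def\<close>)

lemma wvert_f0: "wvert 0 = vt (Suc 0)" "wvert (Suc 0) = vt (Suc 0)" "wvert m = vt 0" "wvert (Suc m) = vt 0" "wvert N = vt (Suc 0)"
proof -
  show "wvert 0 = vt (Suc 0)" "wvert (Suc 0) = vt (Suc 0)" "wvert m = vt 0" "wvert N = vt (Suc 0)"
    using m vt_f0 by (auto simp: wvert_def)
  have "wvert (Suc m) = vt (Suc (N - 1))" by (simp add: wvert_def)
  then show "wvert (Suc m) = vt 0" using m vt_N by simp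
qed

lemma wvert_tree: assumes "k < N" "fst (dk k) \<in> Ts" shows "wvert (\<kappa> k) = vt k"
proof -
  have "k \<noteq> 0" "k \<noteq> m" using assms(2) f0_tree m(5,6) by metis+
  then show ?thesis using assms vt_Suc[of k] by (auto simp: wvert_def \<kappa>_def)
qed

lemma wvert_onto: assumes "v \<in> V" shows "\<exists>k<N. wvert k = v"
proof -
  obtain k where k: "k < N" "vt k = v" using vt_onto[OF assms] by blast
  consider "k = 0" | "0 < k" "k \<le> m" | "k = Suc m" | "Suc m < k" by linarith
  then show ?thesis
  proof cases
    case 1
    then show ?thesis using k wvert_f0(3) m(2) by metis
  next
    case 2
    then show ?thesis using k by (intro exI[of _ k]) (auto simp: wvert_def)
  next
    case 3
    then show ?thesis using k wvert_f0(1) vt_f0(2) m by (intro exI[of _ 0]) auto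
  next
    case 4
    then have "wvert (Suc (N + m - k)) = vt k" using k by (auto simp: wvert_def)
    then show ?thesis using k 4 by (intro exI[of _ "Suc (N + m - k)"]) auto
  qed
qed

text \<open>Besides \<open>f0\<close> these are the tree edges with one occurrence in each part of
  the word; reversing one part twists exactly them.\<close>

definition Tw :: "'e set" where "Tw = insert f0 {e \<in> Ts. lo e < m \<and> m < hi e}"

lemma untwisted: assumes "e \<in> insert f0 Ts - Tw" shows "e \<in> Ts" "hi e < m \<or> m < lo e"
proof -
  show e: "e \<in> Ts" using assms by (auto simp: Tw_def)
  then have "e \<noteq> f0" "e \<in> E" using f0_tree Ts_sub by auto
  then have "lo e \<noteq> m" "hi e \<noteq> m" using lo_hi_distinct[of e f0] f0 m by auto
  then show "hi e < m \<or> m < lo e" using assms e by (auto simp: Tw_def)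
qed

text \<open>Coherent columns come from the tree alone. An incoherent column has two equal entries,
  like the column of \<open>f0\<close>, and each entry can be moved along the tree to a position of
  \<open>f0\<close>.\<close>

lemma insert_span:
  assumes e: "e \<in> E - insert f0 Ts" shows "\<exists>c. \<forall>x<n. M e x = (\<Sum>f\<in>insert f0 Ts. c f * M f x)"
proof (cases "M e (L e) + M e (R e) = 0")
  case True
  have fin: "finite Ts" using finite_subset[OF Ts_sub finite_E] .
  obtain c where c: "\<forall>x<n. M e x = (\<Sum>f\<in>Ts. c f * M f x)" using coherent_span[OF _ True] e by blast
  have "(\<Sum>f\<in>insert f0 Ts. (c(f0 := 0)) f * M f x) = (\<Sum>f\<in>Ts. c f * M f x)" for x
    using fin f0_tree by (simp add: sum.insert) (intro sum.cong; auto)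
  then show ?thesis using c by (intro exI[of _ "c(f0 := 0)"]) simp
next
  case False
  have fin: "finite Ts" using finite_subset[OF Ts_sub finite_E] .
  define \<epsilon> where "\<epsilon> = M e (L e)"
  have eE: "e \<in> E" using e by simp
  have \<epsilon>: "M e (R e) = \<epsilon>" "\<epsilon> * \<epsilon> = 1" using False M_unit[OF eE] by (auto simp: \<epsilon>_def)
  define \<delta> where "\<delta> = M f0 (L f0)"
  have \<delta>: "M f0 (R f0) = \<delta>" "\<delta> * \<delta> = 1" using f0_sign M_unit[OF f0] by (auto simp: \<delta>_def)
  obtain c where c: "\<forall>x<n. of_bool (x = L e) - of_bool (x = L f0) = (\<Sum>f\<in>Ts. c f * M f x)"
    using tree_span[of "L f0" "L e"] LR[OF eE] LR[OF f0] by blast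
  obtain d where d: "\<forall>x<n. of_bool (x = R e) - of_bool (x = R f0) = (\<Sum>f\<in>Ts. d f * M f x)"
    using tree_span[of "R f0" "R e"] LR[OF eE] LR[OF f0] by blast
  define b where "b f = (if f = f0 then \<epsilon> * \<delta> else \<epsilon> * (c f + d f))" for f
  have "M e x = (\<Sum>f\<in>insert f0 Ts. b f * M f x)" if x: "x < n" for x
  proof -
    have "(\<Sum>f\<in>insert f0 Ts. b f * M f x) = \<epsilon> * \<delta> * M f0 x + (\<Sum>f\<in>Ts. b f * M f x)"
      using fin f0_tree by (simp add: b_def)
    also have "(\<Sum>f\<in>Ts. b f * M f x) = (\<Sum>f\<in>Ts. \<epsilon> * (c f * M f x) + \<epsilon> * (d f * M f x))"
      using f0_tree by (intro sum.cong) (auto simp: b_def algebra_simps)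
    also have "\<dots> = \<epsilon> * (\<Sum>f\<in>Ts. c f * M f x) + \<epsilon> * (\<Sum>f\<in>Ts. d f * M f x)" by (simp add: sum.distrib sum_distrib_left)
    also have "\<dots> = \<epsilon> * (of_bool (x = L e) - of_bool (x = L f0)) + \<epsilon> * (of_bool (x = R e) - of_bool (x = R f0))"
      using c d x by simp
    also have "M f0 x = \<delta> * (of_bool (x = L f0) + of_bool (x = R f0))"
      using M_formula[OF f0 x] \<delta>(1) by (simp add: \<delta>_def algebra_simps)
    also have "\<epsilon> * \<delta> * (\<delta> * (of_bool (x = L f0) + of_bool (x = R f0))) = \<epsilon> * (of_bool (x = L f0) + of_bool (x = R f0)) * (\<delta> * \<delta>)"
      by (simp add: algebra_simps)
    also have "\<epsilon> * (of_bool (x = L f0) + of_bool (x = R f0)) * (\<delta> * \<delta>) + (\<epsilon> * (of_bool (x = L e) - of_bool (x = L f0)) + \<epsilon> * (of_bool (x = R e) - of_bool (x = R f0)))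
        = of_bool (x = L e) * \<epsilon> + of_bool (x = R e) * \<epsilon>" unfolding \<delta>(2) by (simp add: algebra_simps)
    also have "\<dots> = M e x" using M_formula[OF eE x] \<epsilon>(1) by (simp add: \<epsilon>_def)
    finally show ?thesis by simp
  qed
  then show ?thesis by blast
qed

text \<open>After adjusting heights to the tree, adding half of a constant height \<open>r\<close>
  changes nothing on coherent edges and corrects the value at \<open>f0\<close>. The result is
  integral because both entries of a column are odd.\<close>

lemma insert_cycle: "\<exists>z. is_cycle E s t z \<and> (\<forall>f\<in>insert f0 Ts. z f = c f)"
proof -
  obtain h where h: "\<And>f. f \<in> Ts \<Longrightarrow> h (L f) * M f (L f) + h (R f) * M f (R f) = c f" using tree_height[of c] by blast
  define H where "H e = h (L e) * M e (L e) + h (R e) * M e (R e)" for e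
  define r where "r = M f0 (L f0) * (c f0 - H f0)"
  define z where "z e = H e + r * ((M e (L e) + M e (R e)) div 2)" for e
  have "is_cycle E s t z"
  proof (rule half_combination_cycle[of _ "\<lambda>b. 2 * h b + r"])
    fix e assume "e \<in> E"
    then have "2 * ((M e (L e) + M e (R e)) div 2) = M e (L e) + M e (R e)" using M_unit[of e] by auto
    then have "2 * z e = 2 * H e + r * (M e (L e) + M e (R e))" unfolding z_def by (simp add: distrib_left mult.left_commute[of 2])
    then show "2 * z e = (2 * h (L e) + r) * M e (L e) + (2 * h (R e) + r) * M e (R e)" by (simp add: H_def algebra_simps)
  qed
  moreover have "z f = c f" if "f \<in> Ts" for f using h[OF that] Ts_coh[OF that] by (simp add: z_def H_def)
  moreover have "z f0 = c f0"
  proof -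
    have "M f0 (L f0) * M f0 (L f0) = 1" using M_unit[OF f0] by auto
    moreover have "z f0 = H f0 + r * M f0 (L f0)" using f0_sign by (simp add: z_def)
    moreover have "r * M f0 (L f0) = (c f0 - H f0) * (M f0 (L f0) * M f0 (L f0))" by (simp add: r_def algebra_simps)
    ultimately show ?thesis by simp
  qed
  ultimately show ?thesis by blast
qed

text \<open>Cutting the word f0 u f0 v of the tour at f0 and reversing v yields the word of a disc; the edge f0 and the
  tree edges between u and v become pairwise interlaced and are drawn through the crosscap.\<close>

theorem twisted_projective: "projective_planar V E s t"
proof -
  have B: "insert f0 Ts \<subseteq> E" using f0 Ts_sub by auto
  obtain pot :: "'e \<Rightarrow> 'v \<Rightarrow> int"
    where pot: "\<And>e f. e \<in> E - insert f0 Ts \<Longrightarrow> f \<in> E - insert f0 Ts \<Longrightarrow> pot e (t f) - pot e (s f) = of_bool (f = e)"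
      "\<And>u v. u \<in> V \<Longrightarrow> v \<in> V \<Longrightarrow> u \<noteq> v \<Longrightarrow> \<exists>e\<in>E - insert f0 Ts. pot e u \<noteq> pot e v"
    by (rule potentials[OF B insert_span insert_cycle]) (assumption | rule that)+
  have step: "{wvert k, wvert (Suc k)} = {vt (\<kappa> k), vt (Suc (\<kappa> k))}" if "k < N" "fst (dk (\<kappa> k)) \<noteq> f0" for k
  proof (rule wvert_step[OF that(1)])
    show "k \<noteq> 0" "k \<noteq> m" using that(2) m(5,6) \<kappa>(3)[of k] by (metis le0 order_refl)+
  qed
  interpret C: contour V E s t N "\<lambda>k. fst (dk (\<kappa> k))" wvert "E - insert f0 Ts" q1 q2 pot
  proof
    show "s e \<noteq> t e" if "e \<in> E" for e using no_loop that by (auto simp: loopless_def)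
    show "wvert N = wvert 0" using wvert_f0 by simp
    show "{wvert (q1 e), wvert (q2 e)} = {s e, t e}" if e: "e \<in> E - (E - insert f0 Ts)" for e
    proof (cases "e = f0")
      case True
      have "q1 e = 0" "q2 e = m" using q_low[OF f0] m True by auto
      then show ?thesis using True vt_ends[of 0] m f0_tree wvert_f0 by (auto simp: insert_commute)
    next
      case False
      then have eT: "e \<in> Ts" "e \<in> E" using e by auto
      have "wvert (\<kappa> (lo e)) = vt (lo e)" "wvert (\<kappa> (hi e)) = vt (hi e)"
        using wvert_tree[of "lo e"] wvert_tree[of "hi e"] lo_hi[OF eT(2)] eT(1) by auto
      then have "{wvert (q1 e), wvert (q2 e)} = {vt (lo e), vt (hi e)}" using q_pair[of e] by auto
      then show ?thesis using tree_ends[OF eT(1)] by simp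
    qed
    show "wvert (Suc k) = wvert k" if k: "k < N" "fst (dk (\<kappa> k)) \<notin> E - insert f0 Ts" for k
    proof (cases "fst (dk (\<kappa> k)) = f0")
      case True
      then have "\<kappa> k = 0 \<or> \<kappa> k = m" using f0_pos \<kappa>(1)[OF k(1)] by blast
      then have "k = 0 \<or> k = m" using \<kappa>(2)[OF k(1)] \<kappa>(3)[of "\<kappa> k"] by auto
      then show ?thesis using wvert_f0 by auto
    next
      case False
      then have "fst (dk (\<kappa> k)) \<in> Ts" using k q_only[OF k(1)] by auto
      then show ?thesis using step[OF k(1) False] vt_Suc[of "\<kappa> k"] by (auto simp: doubleton_eq_iff)
    qed
    show "{wvert k, wvert (Suc k)} = {s (fst (dk (\<kappa> k))), t (fst (dk (\<kappa> k)))}"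
      if "k < N" "fst (dk (\<kappa> k)) \<in> E - insert f0 Ts" for k
      using step[OF that(1)] vt_ends[of "\<kappa> k"] \<kappa>(1)[OF that(1)] that(2) by auto
    show "\<exists>k<N. wvert k = v" if "v \<in> V" for v using wvert_onto that .
  qed (use q_pos q_only pot in auto)
  have comp: "E - (E - insert f0 Ts) = insert f0 Ts" using B by blast
  have lh: "lo e < hi e" "hi e < N" if "e \<in> E" for e using lo_hi[OF that] by auto
  have TsE: "e \<in> Ts \<Longrightarrow> e \<in> E" for e using Ts_sub by auto
  have twist: "(e = f0 \<and> q1 e = 0 \<and> q2 e = m) \<or> (e \<in> Ts \<and> 0 < lo e \<and> lo e < m \<and> m < hi e \<and> q1 e = lo e \<and> q2 e = N + m - hi e)"
    if "e \<in> Tw" for e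
  proof (cases "e = f0")
    case True
    then show ?thesis using q_low[OF f0] m by auto
  next
    case False
    then have e: "e \<in> Ts" "lo e < m" "m < hi e" using that by (auto simp: Tw_def)
    then have "lo e \<noteq> 0" using lo_hi_distinct(1)[OF TsE f0] False m(3) by auto
    then show ?thesis using e q_mixed[OF TsE[OF e(1)]] by auto
  qed
  show ?thesis
  proof (rule C.contour_projective[of Tw], unfold comp)
    show "Tw \<subseteq> insert f0 Ts" by (auto simp: Tw_def)
    fix e e'
    show "\<not> (q1 e < q1 e' \<and> q1 e' < q2 e \<and> q2 e < q2 e')" if ee: "e \<in> insert f0 Ts - Tw" "e' \<in> insert f0 Ts - Tw"
    proof -
      note u = untwisted[OF ee(1)] and u' = untwisted[OF ee(2)]
      note q = q_low[OF TsE[OF u(1)]] q_high[OF TsE[OF u(1)]] q_low[OF TsE[OF u'(1)]] q_high[OF TsE[OF u'(1)]]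
      note l = lh[OF TsE[OF u(1)]] lh[OF TsE[OF u'(1)]]
      have x: "\<not> (lo e < lo e' \<and> lo e' < hi e \<and> hi e < hi e')" "\<not> (lo e' < lo e \<and> lo e < hi e' \<and> hi e' < hi e)"
        using tree_not_crossing u(1) u'(1) by blast+
      consider "hi e < m" "hi e' < m" | "hi e < m" "m < lo e'" | "m < lo e" "hi e' < m" | "m < lo e" "m < lo e'"
        using u(2) u'(2) by blast
      then show ?thesis
      proof cases
        case 1
        then show ?thesis using q(1,3) x(1) by simp
      next
        case 2
        then have "q2 e = hi e" "m < q1 e'" using q(1,4) l by auto
        then show ?thesis using 2 by linarith
      next
        case 3
        then have "q2 e' = hi e'" "m < q1 e" "q1 e' = lo e'" using q(2,3) l by auto
        then show ?thesis using 3 l by linarith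
      next
        case 4
        then have "q1 e = N + m - hi e" "q2 e = N + m - lo e" "q1 e' = N + m - hi e'" "q2 e' = N + m - lo e'" using q(2,4) by auto
        then show ?thesis using x(2) l by linarith
      qed
    qed
    \<comment> \<open>Two tree edges joining the parts were nested before the reversal; reversing
      the order of their second ends makes them interlaced.\<close>
    show "q1 e' < q2 e \<and> q2 e < q2 e'" if ee: "e \<in> Tw" "e' \<in> Tw" "q1 e < q1 e'"
    proof -
      have e': "e' \<in> Ts" "lo e' < m" "m < hi e'" "q1 e' = lo e'" "q2 e' = N + m - hi e'" "hi e' < N"
        using twist[OF ee(2)] ee(3) lh[OF TsE, of e'] by auto
      show ?thesis
      proof (cases "e = f0")
        case True
        then show ?thesis using twist[OF ee(1)] e' f0_tree by auto
      next
        case False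
        then have e: "e \<in> Ts" "lo e < m" "m < hi e" "q1 e = lo e" "q2 e = N + m - hi e" "hi e < N"
          using twist[OF ee(1)] lh[OF TsE, of e] by auto
        have "e \<noteq> e'" using ee(3) by auto
        then have "hi e \<noteq> hi e'" using lo_hi_distinct[OF TsE[OF e(1)] TsE[OF e'(1)]] by auto
        moreover have "\<not> (hi e < hi e')" using tree_not_crossing[OF e(1) e'(1)] e e' ee(3) by auto
        ultimately show ?thesis using e e' ee(3) by auto
      qed
    qed
    show "(q1 e' < q1 e \<or> q2 e < q1 e') \<and> (q2 e' < q1 e \<or> q2 e < q2 e')" if ee: "e \<in> insert f0 Ts - Tw" "e' \<in> Tw"
    proof -
      note u = untwisted[OF ee(1)]
      note q = q_low[OF TsE[OF u(1)]] q_high[OF TsE[OF u(1)]]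
      note l = lh[OF TsE[OF u(1)]]
      have ne: "e \<noteq> e'" using ee by auto
      have e0: "lo e \<noteq> 0" using lo_hi_distinct(1)[OF TsE[OF u(1)] f0] u(1) f0_tree m(3) by auto
      show ?thesis
      proof (cases "e' = f0")
        case True
        then have "q1 e' = 0" "q2 e' = m" using twist[OF ee(2)] f0_tree by auto
        then show ?thesis using u(2) q l e0 by (elim disjE; auto)
      next
        case False
        then have e': "e' \<in> Ts" "lo e' < m" "m < hi e'" "q1 e' = lo e'" "q2 e' = N + m - hi e'" "hi e' < N"
          using twist[OF ee(2)] lh[OF TsE, of e'] by auto
        have x: "\<not> (lo e < lo e' \<and> lo e' < hi e \<and> hi e < hi e')" "\<not> (lo e' < lo e \<and> lo e < hi e' \<and> hi e' < hi e)"
          using tree_not_crossing u(1) e'(1) by blast+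
        note d = lo_hi_distinct[OF TsE[OF u(1)] TsE[OF e'(1)] ne]
        show ?thesis using u(2)
        proof
          assume h: "hi e < m"
          then show ?thesis using q(1) e' x(1) d l by auto
        next
          assume h: "m < lo e"
          then show ?thesis using q(2) e' x(2) d l by auto
        qed
      qed
    qed
  qed
qed

end

section \<open>From a root lattice to a drawing\<close>

context rows begin

text \<open>Sign changes of coordinates are isometries of the ambient lattice, and doubled heights
  absorb the same signs.\<close>

lemma rows_switch:
  assumes \<eta>: "\<And>b. \<eta> b = 1 \<or> \<eta> b = (-1::int)"
  shows "rows V E s t n (\<lambda>e a. \<eta> a * M e a) L R"
proof
  fix e assume e: "e \<in> E"
  show "L e < n \<and> R e < n \<and> L e \<noteq> R e" using LR[OF e] .
  show "(\<eta> (L e) * M e (L e) = 1 \<or> \<eta> (L e) * M e (L e) = - 1) \<and> (\<eta> (R e) * M e (R e) = 1 \<or> \<eta> (R e) * M e (R e) = - 1)"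
    using M_unit[OF e] \<eta>[of "L e"] \<eta>[of "R e"] by auto
  show "\<eta> a * M e a = 0" if "a < n" "a \<noteq> L e" "a \<noteq> R e" for a using M_zero[OF e that] by simp
next
  fix a assume "a < n"
  moreover have "\<eta> a \<noteq> 0" using \<eta>[of a] by auto
  ultimately show "is_cycle E s t (\<lambda>e. \<eta> a * M e a)" using is_cycle_mult_iff[of "\<eta> a" E s t "\<lambda>e. M e a"] row_cycle by blast
next
  fix z assume "is_cycle E s t z"
  then obtain k where k: "\<forall>e\<in>E. 2 * z e = k (L e) * M e (L e) + k (R e) * M e (R e)" using cycle_height by blast
  have "k b * x = k b * \<eta> b * (\<eta> b * x)" for b x using \<eta>[of b] by auto
  then show "\<exists>k. \<forall>e\<in>E. 2 * z e = k (L e) * (\<eta> (L e) * M e (L e)) + k (R e) * (\<eta> (R e) * M e (R e))"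
    using k by (intro exI[of _ "\<lambda>b. k b * \<eta> b"]) metis
next
  fix x assume x: "x \<in> C1 E" "\<And>a. a < n \<Longrightarrow> (\<Sum>e\<in>E. x e * (\<eta> a * M e a)) = 0"
  have "(\<Sum>e\<in>E. x e * M e a) = 0" if "a < n" for a
  proof -
    have "\<eta> a * (\<Sum>e\<in>E. x e * M e a) = 0" using x(2)[OF that] by (simp add: sum_distrib_left algebra_simps)
    then show ?thesis using \<eta>[of a] by auto
  qed
  then show "x \<in> coboundaries V E s t" using kernel x(1) by blast
qed (use dual_conn two_conn no_loop in auto)

lemma dual_tree:
  obtains Ts where "Ts \<subseteq> E" "\<And>a b. a < n \<Longrightarrow> b < n \<Longrightarrow> reach Ts R L a b" "\<And>e. e \<in> Ts \<Longrightarrow> bridge Ts R L e"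
proof -
  interpret D: fgraph "{..<n}" E R L using LR finite_E by unfold_locales auto
  obtain Ts where Ts: "Ts \<subseteq> E" "\<And>u w. reach Ts R L u w = reach E R L u w" "\<And>e. e \<in> Ts \<Longrightarrow> bridge Ts R L e"
    by (rule D.spanning_forest) (rule that, assumption+)
  have "reach E R L a b" if ab: "a < n" "b < n" for a b
  proof (rule ccontr)
    assume no: "\<not> reach E R L a b"
    define U where "U = {b. b < n \<and> reach E R L a b}"
    have "U \<subseteq> {..<n}" "U \<noteq> {}" "U \<noteq> {..<n}" using ab no reach_refl[of E R L a] by (auto simp: U_def)
    then obtain e where e: "e \<in> E" "(L e \<in> U) \<noteq> (R e \<in> U)" using dual_conn by blast
    have "adj E R L (R e) (L e)" using e(1) by (auto simp: adj_def)
    then have "reach E R L (R e) (L e)" by (simp add: reach_def r_into_rtranclp)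
    then have "reach E R L a (R e) = reach E R L a (L e)" using reach_trans reach_sym by metis
    then show False using e LR[OF e(1)] by (auto simp: U_def)
  qed
  then show ?thesis using that Ts by blast
qed

end

context H1_map begin

text \<open>The vector \<open>c\<close> accounts for the two types. The double of a unit vector lies
  in the lattice of type D, but in type A it needs a fixed correction, which is harmless because
  there the coordinate sum of a root is 0.\<close>

lemma root_rows:
  assumes tc: "two_connected V E s t" "loopless E s t"
    and root: "\<And>e. e \<in> E \<Longrightarrow> sqnorm (\<phi> (coedge e)) n = 2"
    and zero: "\<And>x. x \<in> C1 E \<Longrightarrow> (\<And>a. a < n \<Longrightarrow> \<phi> x a = 0) \<Longrightarrow> \<phi> x = (\<lambda>i. 0)"
    and unit: "\<And>a. a < n \<Longrightarrow> \<exists>x\<in>C1 E. \<forall>i<n. \<phi> x i = 2 * of_bool (i = a) - c i"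
    and orth: "\<And>e i. e \<in> E \<Longrightarrow> (\<Sum>a<n. \<phi> (coedge e) a) * c i = 0"
    and diff: "\<And>a b. a < n \<Longrightarrow> b < n \<Longrightarrow> a \<noteq> b \<Longrightarrow> \<exists>x\<in>C1 E. \<forall>i<n. \<phi> x i = of_bool (i = a) - of_bool (i = b)"
  obtains L R where "rows V E s t n (\<lambda>e. \<phi> (coedge e)) L R"
proof -
  have "\<exists>a b. a < n \<and> b < n \<and> a \<noteq> b \<and> (\<phi> (coedge e) a)^2 = 1 \<and> (\<phi> (coedge e) b)^2 = 1 \<and>
      (\<forall>i<n. i \<noteq> a \<longrightarrow> i \<noteq> b \<longrightarrow> \<phi> (coedge e) i = 0)" if "e \<in> E" for e
    by (rule sqnorm_eq_2[OF root[OF that]]) blast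
  then obtain L R where LR: "\<And>e. e \<in> E \<Longrightarrow> L e < n \<and> R e < n \<and> L e \<noteq> R e \<and> (\<phi> (coedge e) (L e))^2 = 1 \<and> (\<phi> (coedge e) (R e))^2 = 1 \<and>
      (\<forall>i<n. i \<noteq> L e \<longrightarrow> i \<noteq> R e \<longrightarrow> \<phi> (coedge e) i = 0)" by metis
  have Msum: "(\<Sum>a\<in>U. k a * \<phi> (coedge e) a) = of_bool (L e \<in> U) * (k (L e) * \<phi> (coedge e) (L e)) + of_bool (R e \<in> U) * (k (R e) * \<phi> (coedge e) (R e))"
    if "e \<in> E" "U \<subseteq> {..<n}" for e U k
  proof -
    have "(\<Sum>a\<in>U. k a * \<phi> (coedge e) a) = (\<Sum>a\<in>U \<inter> {L e, R e}. k a * \<phi> (coedge e) a)"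
      using LR[OF that(1)] that(2) finite_subset[OF that(2)] by (intro sum.mono_neutral_right) auto
    also have "U \<inter> {L e, R e} = (if L e \<in> U then {L e} else {}) \<union> (if R e \<in> U then {R e} else {})" by auto
    finally show ?thesis using LR[OF that(1)] by auto
  qed
  have ker: "x \<in> coboundaries V E s t" if "x \<in> C1 E" "\<And>a. a < n \<Longrightarrow> \<phi> x a = 0" for x
    using zero[OF that] \<phi>_kernel[OF that(1)] by simp
  have "rows V E s t n (\<lambda>e. \<phi> (coedge e)) L R"
  proof
    fix e assume e: "e \<in> E"
    show "L e < n \<and> R e < n \<and> L e \<noteq> R e" using LR[OF e] by auto
    show "(\<phi> (coedge e) (L e) = 1 \<or> \<phi> (coedge e) (L e) = - 1) \<and> (\<phi> (coedge e) (R e) = 1 \<or> \<phi> (coedge e) (R e) = - 1)"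
      using LR[OF e] by (simp add: power2_eq_1_iff)
    show "\<phi> (coedge e) a = 0" if "a < n" "a \<noteq> L e" "a \<noteq> R e" for a using LR[OF e] that by auto
  next
    fix a assume "a < n"
    have "bdry E s t (\<lambda>e. \<phi> (coedge e) a) v = 0" for v
    proof -
      define x :: "'e \<Rightarrow> int" where "x e = (if e \<in> E then of_bool (t e = v) - of_bool (s e = v) else 0)" for e
      have xC: "x \<in> C1 E" by (auto simp: x_def C1_def)
      moreover have "x \<in> coboundaries V E s t"
        by (rule coboundariesI[OF xC, of "\<lambda>w. of_bool (w = v)"]) (simp add: x_def)
      ultimately have "\<phi> x = (\<lambda>i. 0)" using \<phi>_kernel by blast
      then have "\<phi> x a = 0" by simp
      moreover have "\<phi> x a = (\<Sum>e\<in>E. x e * \<phi> (coedge e) a)" using \<phi>_expand[OF xC] by (rule fun_cong)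
      moreover have "\<dots> = bdry E s t (\<lambda>e. \<phi> (coedge e) a) v" unfolding bdry_def by (intro sum.cong) (auto simp: x_def)
      ultimately show ?thesis by simp
    qed
    then show "is_cycle E s t (\<lambda>e. \<phi> (coedge e) a)" by (simp add: is_cycle_def)
  next
    fix z assume z: "is_cycle E s t z"
    obtain X where X: "\<And>a. a < n \<Longrightarrow> X a \<in> C1 E \<and> (\<forall>i<n. \<phi> (X a) i = 2 * of_bool (i = a) - c i)" using unit by metis
    \<comment> \<open>Heights are pairings of the cycle with preimages of the doubled unit vectors.
      Expanding twice the root of \<open>e\<close> in these leaves a remainder in the kernel, which
      is orthogonal to every cycle.\<close>
    define k where "k a = (\<Sum>e'\<in>E. X a e' * z e')" for a
    have "2 * z e = k (L e) * \<phi> (coedge e) (L e) + k (R e) * \<phi> (coedge e) (R e)" if e: "e \<in> E" for e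
    proof -
      define y where "y e' = (\<Sum>a<n. \<phi> (coedge e) a * X a e')" for e'
      define u where "u e' = 2 * coedge e e' - y e'" for e'
      have yC: "y \<in> C1 E" using X by (auto simp: y_def C1_def)
      have wC: "(\<lambda>e'. 2 * coedge e e') \<in> C1 E" using coedge_C1[OF e] by (auto simp: C1_def)
      have uC: "u \<in> C1 E" using yC wC by (auto simp: u_def C1_def)
      have "\<phi> u i = 0" if i: "i < n" for i
      proof -
        have "\<phi> u i = 2 * \<phi> (coedge e) i - \<phi> y i"
          unfolding u_def using \<phi>_diff[OF wC yC] \<phi>_scale[OF coedge_C1[OF e], of 2] by (simp add: fun_eq_iff)
        also have "\<phi> y i = (\<Sum>a<n. \<phi> (coedge e) a * \<phi> (X a) i)"
          unfolding y_def using \<phi>_sum[of "{..<n}" X "\<phi> (coedge e)"] X by (simp add: fun_eq_iff)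
        also have "\<dots> = (\<Sum>a<n. of_bool (a = i) * (2 * \<phi> (coedge e) a) - \<phi> (coedge e) a * c i)"
        proof (rule sum.cong[OF refl])
          fix a assume "a \<in> {..<n}"
          then have "\<phi> (X a) i = 2 * of_bool (i = a) - c i" using X i by blast
          then show "\<phi> (coedge e) a * \<phi> (X a) i = of_bool (a = i) * (2 * \<phi> (coedge e) a) - \<phi> (coedge e) a * c i"
            by (simp only: right_diff_distrib) (simp add: eq_commute)
        qed
        also have "\<dots> = 2 * \<phi> (coedge e) i" using i orth[OF e, of i] by (simp add: sum_subtractf sum_of_bool_single sum_distrib_right[symmetric])
        finally show ?thesis by simp
      qed
      then have "(\<Sum>e'\<in>E. u e' * z e') = 0" using coboundaries_orthogonal[OF ker[OF uC] z] by blast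
      moreover have "(\<Sum>e'\<in>E. u e' * z e') = 2 * (\<Sum>e'\<in>E. coedge e e' * z e') - (\<Sum>e'\<in>E. y e' * z e')"
        by (simp add: u_def left_diff_distrib sum_subtractf sum_distrib_left mult.assoc)
      moreover have "(\<Sum>e'\<in>E. y e' * z e') = (\<Sum>a<n. k a * \<phi> (coedge e) a)"
        unfolding y_def k_def sum_distrib_right by (subst sum.swap) (simp add: algebra_simps)
      ultimately show ?thesis using Msum[OF e order_refl, of k] LR[OF e] sum_mult_coedge(2)[OF finite_E e, of z] by simp
    qed
    then show "\<exists>k. \<forall>e\<in>E. 2 * z e = k (L e) * \<phi> (coedge e) (L e) + k (R e) * \<phi> (coedge e) (R e)" by blast
  next
    fix U assume U: "U \<subseteq> {..<n}" "U \<noteq> {}" "U \<noteq> {..<n}"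
    show "\<exists>e\<in>E. (L e \<in> U) \<noteq> (R e \<in> U)"
    proof (rule ccontr)
      assume no: "\<not> (\<exists>e\<in>E. (L e \<in> U) \<noteq> (R e \<in> U))"
      obtain a b where ab: "a \<in> U" "b < n" "b \<notin> U" using U by blast
      then obtain x where x: "x \<in> C1 E" "\<forall>i<n. \<phi> x i = of_bool (i = a) - of_bool (i = b)" using diff[of a b] U by blast
      \<comment> \<open>If no edge left \<open>U\<close>, the coordinates in \<open>U\<close> would
        have even sum on the whole image, against the difference of the unit vectors at
        \<open>a\<close> and \<open>b\<close>.\<close>
      have ev: "even (\<Sum>i\<in>U. \<phi> (coedge e) i)" if e: "e \<in> E" for e
      proof -
        have "\<phi> (coedge e) (L e) \<in> {1, -1}" "\<phi> (coedge e) (R e) \<in> {1, -1}" using LR[OF e] by (auto simp: power2_eq_1_iff)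
        then show ?thesis using Msum[OF e U(1), of "\<lambda>_. 1"] no e by auto
      qed
      have "(\<Sum>i\<in>U. \<phi> x i) = (\<Sum>e\<in>E. x e * (\<Sum>i\<in>U. \<phi> (coedge e) i))"
        unfolding \<phi>_expand[OF x(1)] sum_distrib_left by (rule sum.swap)
      then have "even (\<Sum>i\<in>U. \<phi> x i)" using ev by (simp add: dvd_sum)
      moreover have "(\<Sum>i\<in>U. \<phi> x i) = (\<Sum>i\<in>U. of_bool (i = a) * 1)"
        using x(2) U(1) ab by (intro sum.cong) auto
      ultimately show False using ab finite_subset[OF U(1)] by (simp add: sum_of_bool_single)
    qed
  next
    fix x assume x: "x \<in> C1 E" "\<And>a. a < n \<Longrightarrow> (\<Sum>e\<in>E. x e * \<phi> (coedge e) a) = 0"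
    then show "x \<in> coboundaries V E s t" using ker[OF x(1)] \<phi>_expand[OF x(1)] by (simp add: fun_eq_iff)
  qed (use tc in auto)
  then show ?thesis by (rule that)
qed

end

text \<open>A single edge is a bridge here, so its image is 0 and not a root; this case is drawn by
  hand.\<close>

lemma (in fgraph) small_planar:
  assumes "connected_graph V E s t" "loopless E s t" "E \<subseteq> {e}"
  shows "planar V E s t"
proof -
  define p :: "'v \<Rightarrow> real \<times> real" where "p v = (if v = s e then (0, 0) else (1, 0))" for v
  have r: "v = w \<or> (E = {e} \<and> v \<in> {s e, t e})" if "v \<in> V" "w \<in> V" for v w
  proof -
    have "reach E s t v w" using assms(1) that by (auto simp: connected_graph_def)
    then have "v = w \<or> (\<exists>u. adj E s t v u)" unfolding reach_def by (metis converse_rtranclpE)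
    then show ?thesis using assms(3) by (auto simp: adj_def)
  qed
  define \<gamma> :: "real \<Rightarrow> real \<times> real" where "\<gamma> = linepath (0, 0) (1, 0)"
  have inj: "inj_on p V"
  proof (rule inj_onI)
    fix v w assume "v \<in> V" "w \<in> V" "p v = p w"
    then show "v = w" using r[of v w] r[of w v] by (auto simp: p_def split: if_splits)
  qed
  have "graph_embeds (top_of_set (UNIV :: (real \<times> real) set)) V E s t"
  proof (rule graph_embeds_arcs[OF inj, where \<gamma>="\<lambda>_. \<gamma>"])
    fix e' assume "e' \<in> E"
    then have e: "e' = e" "E = {e}" "s e \<noteq> t e" using assms(2,3) by (auto simp: loopless_def)
    then have p: "p (s e') = (0, 0)" "p (t e') = (1, 0)" by (auto simp: p_def)
    then show "arc \<gamma> \<and> pathstart \<gamma> = p (s e') \<and> pathfinish \<gamma> = p (t e') \<and> path_image \<gamma> \<subseteq> UNIV" by (simp add: \<gamma>_def arc_linepath)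
    show "path_image \<gamma> \<inter> p ` V \<subseteq> {p (s e'), p (t e')}" unfolding p by (auto simp: p_def)
  qed (use assms(3) in auto)
  then show ?thesis by (simp add: planar_def)
qed

lemma planar_imp_projective_planar:
  assumes "planar V E s t" shows "projective_planar V E s t"
proof -
  have "graph_embeds (top_of_set RP2) V E s t"
  proof (rule graph_embeds_image[of euclidean _ _ _ _ _ "hproj \<circ> hom"])
    show "graph_embeds (euclidean :: (real \<times> real) topology) V E s t" using assms by (simp add: planar_def)
    have "0 \<notin> range hom" using hom_nonzero by (metis imageE)
    then have "continuous_on UNIV (hproj \<circ> hom)" by (intro continuous_on_compose continuous_hom continuous_hproj)
    then show "continuous_map euclidean (top_of_set RP2) (hproj \<circ> hom)"
      using hproj_RP2 hom_nonzero by (auto simp: continuous_map_in_subtopology)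
    show "inj_on (hproj \<circ> hom) (topspace euclidean)" using hproj_hom_inj by (auto simp: inj_on_def)
  qed
  then show ?thesis by (simp add: projective_planar_iff)
qed

theorem has_emm_A_imp_planar:
  assumes G: "fgraph V E s t" and tc: "two_connected V E s t" "loopless E s t" and emm: "has_emm_A V E s t g"
  shows "planar V E s t"
proof -
  interpret fgraph V E s t by fact
  have conn: "connected_graph V E s t" using tc(1) by (simp add: two_connected_def)
  show ?thesis
  proof (cases "\<exists>e. E \<subseteq> {e}")
    case True
    then show ?thesis using small_planar[OF conn tc(2)] by blast
  next
    case False
    then have nb: "\<not> bridge E s t e" for e using two_connected_bridge[OF tc] by blast
    obtain q where q: "Z_emm V E s t q" "H1_isometric V E s t q (A_lattice g) (g + 1)" using emm by (auto simp: has_emm_A_def)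
    obtain \<phi> where \<phi>: "H1_map V E s t \<phi>" "\<phi> ` C1 E = A_lattice g"
      "\<And>e. e \<in> E \<Longrightarrow> \<not> bridge E s t e \<Longrightarrow> sqnorm (\<phi> (coedge e)) (g + 1) = 2"
      by (rule emm_map[OF G q]) (rule that, assumption+)
    interpret H1_map V E s t \<phi> by fact
    have lat: "(\<forall>i>g. \<phi> x i = 0) \<and> (\<Sum>i<g + 1. \<phi> x i) = 0" if "x \<in> C1 E" for x
    proof -
      have "\<phi> x \<in> A_lattice g" using \<phi>(2) that by blast
      then show ?thesis by (simp add: A_lattice_def lessThan_Suc_atMost)
    qed
    have surj: "\<exists>x\<in>C1 E. \<forall>i<g + 1. \<phi> x i = r * (of_bool (i = a) - of_bool (i = b))" if "a < g + 1" "b < g + 1" for a b r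
    proof -
      have "(\<Sum>i\<le>g. of_bool (i = a) * r - of_bool (i = b) * r) = 0" using that by (simp add: sum_subtractf sum_of_bool_single del: sum_of_bool_mult_eq)
      then have "(\<lambda>i. of_bool (i = a) * r - of_bool (i = b) * r) \<in> A_lattice g" using that by (auto simp: A_lattice_def)
      then have "(\<lambda>i. of_bool (i = a) * r - of_bool (i = b) * r) \<in> \<phi> ` C1 E" by (simp only: \<phi>(2))
      then obtain x where "x \<in> C1 E" "\<phi> x = (\<lambda>i. of_bool (i = a) * r - of_bool (i = b) * r)" by (elim imageE) simp
      then show ?thesis by (intro bexI[of _ x]) (auto simp: algebra_simps)
    qed
    obtain L R where rows: "rows V E s t (g + 1) (\<lambda>e. \<phi> (coedge e)) L R"
    proof (rule root_rows[OF tc, of "g + 1" "\<lambda>i. 2 * of_bool (i = 0)"])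
      show "sqnorm (\<phi> (coedge e)) (g + 1) = 2" if "e \<in> E" for e using \<phi>(3)[OF that nb] .
      show "\<phi> x = (\<lambda>i. 0)" if "x \<in> C1 E" "\<And>a. a < g + 1 \<Longrightarrow> \<phi> x a = 0" for x
        using lat[OF that(1)] that(2) by (metis Suc_eq_plus1 ext not_less_eq)
      show "\<exists>x\<in>C1 E. \<forall>i<g + 1. \<phi> x i = 2 * of_bool (i = a) - 2 * of_bool (i = 0)" if "a < g + 1" for a
        using surj[OF that, of 0 2] by (simp add: algebra_simps)
      show "(\<Sum>a<g + 1. \<phi> (coedge e) a) * (2 * of_bool (i = 0)) = 0" if "e \<in> E" for e i
        using lat[OF coedge_C1[OF that]] by simp
      show "\<exists>x\<in>C1 E. \<forall>i<g + 1. \<phi> x i = of_bool (i = a) - of_bool (i = b)" if "a < g + 1" "b < g + 1" "a \<noteq> b" for a b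
        using surj[OF that(1,2), of 1] by simp
    qed blast
    interpret rows V E s t "g + 1" "\<lambda>e. \<phi> (coedge e)" L R by (rule rows)
    have coh: "\<phi> (coedge e) (L e) + \<phi> (coedge e) (R e) = 0" if "e \<in> E" for e
      using lat[OF coedge_C1[OF that]] M_sum[OF that, of "\<lambda>_. 1"] by simp
    obtain Ts where Ts: "Ts \<subseteq> E" "\<And>a b. a < g + 1 \<Longrightarrow> b < g + 1 \<Longrightarrow> reach Ts R L a b" "\<And>e. e \<in> Ts \<Longrightarrow> bridge Ts R L e"
      using dual_tree by blast
    obtain nx where nx: "inj_on nx darts" "\<forall>d\<in>darts. nx d \<in> darts \<and> snd (nx d) = snd d \<and> tl (nx d) = hd d"
      using next_exists by blast
    obtain e where e: "e \<in> E" using False by blast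
    interpret tour V E s t "g + 1" "\<lambda>e. \<phi> (coedge e)" L R Ts nx "(e, L e)"
    proof
      show "indecomposable a" if "a < g + 1" for a using indecomposable_coherent[OF that coh] .
      show "(e, L e) \<in> darts" using e by (simp add: darts_def)
    qed (use Ts nx coh in auto)
    show ?thesis by (rule coherent_planar[OF coh])
  qed
qed

text \<open>The inverse of \<open>fold_AD\<close>: the last coordinate is recovered from the
  coordinate sum, which is even on the lattice of type D.\<close>

definition unfold_DA :: "nat \<Rightarrow> nat \<Rightarrow> (nat \<Rightarrow> int) \<Rightarrow> nat \<Rightarrow> int" where
  "unfold_DA g a z i = (if i < g then z i - of_bool (i = a) * ((\<Sum>i<g. z i) div 2) else if i = g then - ((\<Sum>i<g. z i) div 2) else 0)"

lemma unfold_fold: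
  assumes "a < g" "y \<in> A_lattice g" shows "unfold_DA g a (fold_AD g a y) = y"
proof -
  have "(\<Sum>i<g. fold_AD g a y i) div 2 = - y g" using sum_fold_AD[OF assms(1), of y] assms(2) by (simp add: A_lattice_def)
  then show ?thesis using assms(2) by (auto simp: unfold_DA_def fold_AD_def A_lattice_def fun_eq_iff)
qed

lemma fold_unfold: "z \<in> D_lattice g \<Longrightarrow> fold_AD g a (unfold_DA g a z) = z"
  by (auto simp: unfold_DA_def fold_AD_def D_lattice_def fun_eq_iff)

lemma unfold_lattice: assumes "a < g" "z \<in> D_lattice g" shows "unfold_DA g a z \<in> A_lattice g"
  using fold_AD_image[OF assms(1)] assms unfold_fold[OF assms(1)] by (metis imageE)

lemma unfold_DA_add:
  assumes "z \<in> D_lattice g" "w \<in> D_lattice g"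
  shows "unfold_DA g a (\<lambda>i. z i + w i) = (\<lambda>i. unfold_DA g a z i + unfold_DA g a w i)"
proof -
  have "(\<Sum>i<g. z i + w i) div 2 = (\<Sum>i<g. z i) div 2 + (\<Sum>i<g. w i) div 2"
    using assms by (auto simp: D_lattice_def sum.distrib)
  then show ?thesis by (auto simp: unfold_DA_def fun_eq_iff algebra_simps)
qed

context H1_map begin

text \<open>After switching, a root avoiding \<open>a\<close> has coordinate sum 0 and is unchanged
  by unfolding. For a root at \<open>a\<close>, half the coordinate sum is 0 or its entry at
  \<open>a\<close>, so the unfolded vector is not supported at both \<open>a\<close> and
  \<open>g\<close> and keeps its norm.\<close>

lemma balanced_has_emm_A:
  assumes im: "\<phi> ` C1 E = D_lattice g" and a: "a < g" and \<eta>: "\<And>b. \<eta> b = 1 \<or> \<eta> b = (-1::int)"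
    and root: "\<And>e. e \<in> E \<Longrightarrow> sqnorm (\<phi> (coedge e)) g = 2"
    and bal: "\<And>e. e \<in> E \<Longrightarrow> \<phi> (coedge e) a = 0 \<Longrightarrow> (\<Sum>b<g. \<eta> b * \<phi> (coedge e) b) = 0"
  shows "has_emm_A V E s t g"
proof -
  define T where "T y = (\<lambda>i. \<eta> i * y i)" for y :: "nat \<Rightarrow> int"
  have TT: "T (T y) = y" for y using \<eta> by (auto simp: T_def fun_eq_iff) (metis mult_1 mult_minus1 minus_minus)
  have \<eta>y: "even (\<Sum>i<g. \<eta> i * y i) = even (\<Sum>i<g. y i)" for y
  proof -
    have "even (\<eta> i * y i - y i)" for i using \<eta>[of i] by auto
    then have "even (\<Sum>i<g. \<eta> i * y i - y i)" by (intro dvd_sum) auto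
    then show ?thesis by (simp add: sum_subtractf)
  qed
  have TD: "T y \<in> D_lattice g" if "y \<in> D_lattice g" for y
    using that unfolding D_lattice_def T_def by (simp add: \<eta>y)
  define \<psi> where "\<psi> x = unfold_DA g a (T (\<phi> x))" for x
  have T\<phi>D: "T (\<phi> x) \<in> D_lattice g" if "x \<in> C1 E" for x using TD im that by blast
  have u0: "unfold_DA g a (\<lambda>i. 0) = (\<lambda>i. 0)" by (auto simp: unfold_DA_def)
  interpret P: H1_map V E s t \<psi>
  proof
    fix x y assume xy: "x \<in> C1 E" "y \<in> C1 E"
    have "T (\<phi> (\<lambda>e. x e + y e)) = (\<lambda>i. T (\<phi> x) i + T (\<phi> y) i)" by (simp add: \<phi>_add[OF xy] T_def distrib_left)
    then show "\<psi> (\<lambda>e. x e + y e) = (\<lambda>i. \<psi> x i + \<psi> y i)" unfolding \<psi>_def using unfold_DA_add[OF T\<phi>D[OF xy(1)] T\<phi>D[OF xy(2)]] by simp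
  next
    fix x assume x: "x \<in> C1 E"
    have "\<psi> x = (\<lambda>i. 0) \<longleftrightarrow> T (\<phi> x) = (\<lambda>i. 0)"
    proof
      assume "\<psi> x = (\<lambda>i. 0)"
      then have "T (\<phi> x) = fold_AD g a (\<lambda>i. 0)" using fold_unfold[OF T\<phi>D[OF x], of a] by (simp add: \<psi>_def)
      then show "T (\<phi> x) = (\<lambda>i. 0)" by (simp add: fold_AD_def fun_eq_iff)
    qed (simp add: \<psi>_def u0)
    also have "\<dots> \<longleftrightarrow> \<phi> x = (\<lambda>i. 0)"
    proof
      assume "T (\<phi> x) = (\<lambda>i. 0)"
      then have "\<phi> x = T (\<lambda>i. 0)" using TT[of "\<phi> x"] by simp
      then show "\<phi> x = (\<lambda>i. 0)" by (simp add: T_def)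
    qed (simp add: T_def)
    finally show "\<psi> x = (\<lambda>i. 0) \<longleftrightarrow> x \<in> coboundaries V E s t" using \<phi>_kernel[OF x] by simp
  qed
  show ?thesis
  proof (rule P.has_emm_AI)
    show "\<psi> ` C1 E = A_lattice g"
    proof (intro equalityI subsetI)
      fix y assume y: "y \<in> A_lattice g"
      have "T (fold_AD g a y) \<in> \<phi> ` C1 E" unfolding im using fold_AD_image[OF a] y TD by blast
      then obtain x where x: "x \<in> C1 E" "T (fold_AD g a y) = \<phi> x" by blast
      then have "\<psi> x = y" using TT[of "fold_AD g a y"] unfold_fold[OF a y] by (simp add: \<psi>_def)
      then show "y \<in> \<psi> ` C1 E" using x(1) by blast
    qed (use T\<phi>D unfold_lattice[OF a] in \<open>auto simp: \<psi>_def\<close>)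
    fix e assume e: "e \<in> E"
    define Y where "Y = T (\<phi> (coedge e))"
    have YD: "Y \<in> D_lattice g" using T\<phi>D[OF coedge_C1[OF e]] by (simp add: Y_def)
    have Yn: "sqnorm Y g = 2"
    proof -
      have "(\<eta> i * y)^2 = y^2" for i y using \<eta>[of i] by (auto simp: power_mult_distrib)
      then show ?thesis using root[OF e] by (simp add: Y_def T_def sqnorm_def)
    qed
    define k where "k = (\<Sum>i<g. Y i) div 2"
    have "(Y a - k) * k = 0"
    proof (cases "\<phi> (coedge e) a = 0")
      case True
      then show ?thesis using bal[OF e] by (simp add: k_def Y_def T_def)
    next
      case False
      then have Ya: "Y a \<noteq> 0" using \<eta>[of a] by (auto simp: Y_def T_def)
      obtain b c where bc: "b < g" "c < g" "b \<noteq> c" "(Y b)^2 = 1" "(Y c)^2 = 1" "\<And>i. i < g \<Longrightarrow> i \<noteq> b \<Longrightarrow> i \<noteq> c \<Longrightarrow> Y i = 0"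
        using sqnorm_eq_2[OF Yn] by blast
      have "(\<Sum>i<g. Y i) = (\<Sum>i\<in>{b, c}. Y i)" using bc by (intro sum.mono_neutral_right) auto
      then have k: "k = (Y b + Y c) div 2" using bc(3) by (simp add: k_def)
      have "Y b = 1 \<or> Y b = -1" "Y c = 1 \<or> Y c = -1" using bc(4,5) by (auto simp: power2_eq_1_iff)
      moreover have "a = b \<or> a = c" using bc(6)[OF a] Ya by blast
      ultimately show ?thesis unfolding k by auto
    qed
    moreover have "unfold_DA g a Y a = Y a - k" "unfold_DA g a Y g = - k" using a by (auto simp: unfold_DA_def k_def)
    ultimately have "unfold_DA g a Y a * unfold_DA g a Y g = 0" by simp
    then have "sqnorm (unfold_DA g a Y) (g + 1) = 2"
      using sqnorm_fold_AD[OF a, of "unfold_DA g a Y"] fold_unfold[OF YD, of a] Yn by (simp del: mult_eq_0_iff)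
    then show "sqnorm (\<psi> (coedge e)) (g + 1) = 2" by (simp add: \<psi>_def Y_def)
  qed
qed

end

theorem has_emm_D_imp_projective_planar:
  assumes G: "fgraph V E s t" and tc: "two_connected V E s t" "loopless E s t" and emm: "has_emm_D V E s t g" and g: "g \<ge> 4"
  shows "projective_planar V E s t"
proof -
  interpret fgraph V E s t by fact
  obtain q where q: "Z_emm V E s t q" "H1_isometric V E s t q (D_lattice g) g" using emm by (auto simp: has_emm_D_def)
  obtain \<phi> where \<phi>: "H1_map V E s t \<phi>" "\<phi> ` C1 E = D_lattice g"
    "\<And>e. e \<in> E \<Longrightarrow> \<not> bridge E s t e \<Longrightarrow> sqnorm (\<phi> (coedge e)) g = 2"
    by (rule emm_map[OF G q]) (rule that, assumption+)
  interpret H1_map V E s t \<phi> by fact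
  have surj: "\<exists>x\<in>C1 E. \<phi> x = y" if "y \<in> D_lattice g" for y using that unfolding \<phi>(2)[symmetric] by blast
  have diff: "\<exists>x\<in>C1 E. \<forall>i<g. \<phi> x i = of_bool (i = a) - of_bool (i = b)" if "a < g" "b < g" for a b
  proof -
    have "(\<Sum>i<g. of_bool (i = a) * 1 - of_bool (i = b) * 1 :: int) = 0"
      using that unfolding sum_subtractf by (simp add: sum_of_bool_single del: mult_1_right)
    then have "(\<lambda>i. of_bool (i = a) - of_bool (i = b)) \<in> D_lattice g" using that by (auto simp: D_lattice_def)
    from surj[OF this] show ?thesis by metis
  qed
  have nb: "\<not> bridge E s t e" for e
  proof
    assume b: "bridge E s t e"
    then have "\<phi> (coedge e') = (\<lambda>i. 0)" if "e' \<in> E" for e' using two_connected_bridge[OF tc b] bridge_zero[OF b] that by simp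
    then have "\<phi> x = (\<lambda>i. 0)" if "x \<in> C1 E" for x using \<phi>_expand[OF that] by simp
    then show False using diff[of 0 1] g by fastforce
  qed
  have root: "sqnorm (\<phi> (coedge e)) g = 2" if "e \<in> E" for e using \<phi>(3)[OF that nb] .
  obtain L R where rows: "rows V E s t g (\<lambda>e. \<phi> (coedge e)) L R"
  proof (rule root_rows[OF tc root, of "\<lambda>i. 0"])
    show "\<phi> x = (\<lambda>i. 0)" if "x \<in> C1 E" "\<And>a. a < g \<Longrightarrow> \<phi> x a = 0" for x
    proof -
      have "\<phi> x \<in> D_lattice g" using \<phi>(2) that(1) by blast
      then show ?thesis using that(2) by (auto simp: D_lattice_def fun_eq_iff) (metis not_le)
    qed
    show "\<exists>x\<in>C1 E. \<forall>i<g. \<phi> x i = 2 * of_bool (i = a) - 0" if "a < g" for a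
    proof -
      have "(\<lambda>i. 2 * of_bool (i = a)) \<in> D_lattice g" using that by (auto simp: D_lattice_def intro!: dvd_sum)
      from surj[OF this] show ?thesis by (metis diff_zero)
    qed
  qed (use diff in auto)
  interpret R0: rows V E s t g "\<lambda>e. \<phi> (coedge e)" L R by (rule rows)
  obtain Ts where Ts: "Ts \<subseteq> E" "\<And>a b. a < g \<Longrightarrow> b < g \<Longrightarrow> reach Ts R L a b" "\<And>e. e \<in> Ts \<Longrightarrow> bridge Ts R L e"
    using R0.dual_tree by blast
  interpret T: fgraph "{..<g}" Ts R L
    using finite_E Ts(1) R0.LR by unfold_locales (auto intro: finite_subset)
  obtain h :: "nat \<Rightarrow> int" where h: "\<And>e. e \<in> Ts \<Longrightarrow> h (L e) - h (R e) = of_bool (\<phi> (coedge e) (L e) = \<phi> (coedge e) (R e))"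
    using T.forest_potential[OF order_refl Ts(3), of "\<lambda>e. of_bool (\<phi> (coedge e) (L e) = \<phi> (coedge e) (R e))"] by blast
  \<comment> \<open>\<open>h\<close> changes by one exactly along the incoherent tree edges, so
    switching by its parity makes all tree edges coherent.\<close>
  define \<eta> :: "nat \<Rightarrow> int" where "\<eta> b = (if even (h b) then 1 else -1)" for b
  have \<eta>: "\<eta> b = 1 \<or> \<eta> b = -1" for b by (simp add: \<eta>_def)
  interpret rows V E s t g "\<lambda>e a. \<eta> a * \<phi> (coedge e) a" L R by (rule R0.rows_switch[OF \<eta>])
  have Ts_coh: "\<eta> (L e) * \<phi> (coedge e) (L e) + \<eta> (R e) * \<phi> (coedge e) (R e) = 0" if e: "e \<in> Ts" for e
  proof -
    have u: "\<phi> (coedge e) (L e) = 1 \<or> \<phi> (coedge e) (L e) = -1" "\<phi> (coedge e) (R e) = 1 \<or> \<phi> (coedge e) (R e) = -1"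
      using R0.M_unit[of e] e Ts(1) by auto
    show ?thesis
    proof (cases "\<phi> (coedge e) (L e) = \<phi> (coedge e) (R e)")
      case True
      then have "h (L e) = h (R e) + 1" using h[OF e] by simp
      then show ?thesis using True by (simp add: \<eta>_def)
    next
      case False
      then have "h (L e) = h (R e)" "\<phi> (coedge e) (L e) = - \<phi> (coedge e) (R e)" using h[OF e] u by auto
      then show ?thesis by (simp add: \<eta>_def)
    qed
  qed
  show ?thesis
  proof (cases "\<exists>a<g. balancing a")
    case True
    then obtain a \<eta>' where a: "a < g" "\<forall>b. \<eta>' b = 1 \<or> \<eta>' b = (-1::int)"
      "\<forall>e\<in>E. L e \<noteq> a \<longrightarrow> R e \<noteq> a \<longrightarrow> \<eta>' (L e) * (\<eta> (L e) * \<phi> (coedge e) (L e)) + \<eta>' (R e) * (\<eta> (R e) * \<phi> (coedge e) (R e)) = 0"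
      unfolding balancing_def by blast
    have "has_emm_A V E s t g"
    proof (rule balanced_has_emm_A[OF \<phi>(2) a(1) _ root])
      show "\<eta>' b * \<eta> b = 1 \<or> \<eta>' b * \<eta> b = -1" for b using a(2) \<eta>[of b] by (metis mult_1 mult_minus1 minus_minus)
      fix e assume e: "e \<in> E" "\<phi> (coedge e) a = 0"
      then have "L e \<noteq> a" "R e \<noteq> a" using R0.M_unit[OF e(1)] by auto
      then show "(\<Sum>b<g. \<eta>' b * \<eta> b * \<phi> (coedge e) b) = 0"
        using a(3) e(1) M_sum[OF e(1), of \<eta>'] by (simp add: mult.assoc)
    qed
    then show ?thesis using has_emm_A_imp_planar[OF G tc] planar_imp_projective_planar by blast
  next
    case False
    \<comment> \<open>If every edge were coherent, constant signs would be balancing at any row,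
      against the case assumption.\<close>
    have "\<exists>f\<in>E. \<eta> (L f) * \<phi> (coedge f) (L f) = \<eta> (R f) * \<phi> (coedge f) (R f)"
    proof (rule ccontr)
      assume "\<not> ?thesis"
      then have "\<eta> (L e) * \<phi> (coedge e) (L e) + \<eta> (R e) * \<phi> (coedge e) (R e) = 0" if "e \<in> E" for e
        using M_unit[OF that] that by auto
      then have "balancing 0" unfolding balancing_def by (intro exI[of _ "\<lambda>_. 1"]) auto
      then show False using False g by auto
    qed
    then obtain f0 where f0: "f0 \<in> E" "\<eta> (L f0) * \<phi> (coedge f0) (L f0) = \<eta> (R f0) * \<phi> (coedge f0) (R f0)" by blast
    obtain nx where nx: "inj_on nx darts" "\<forall>d\<in>darts. nx d \<in> darts \<and> snd (nx d) = snd d \<and> tl (nx d) = hd d"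
      using next_exists by blast
    interpret twisted_tour V E s t g "\<lambda>e a. \<eta> a * \<phi> (coedge e) a" L R Ts nx f0
    proof
      show "indecomposable a" if "a < g" for a using indecomposable_unless_balancing[OF that] False that by blast
      show "(f0, L f0) \<in> darts" using f0 by (simp add: darts_def)
    qed (use Ts nx Ts_coh f0 in auto)
    show ?thesis by (rule twisted_projective)
  qed
qed

theorem theorem4p2:
  fixes V :: "'v set" and E :: "'e set" and s t :: "'e \<Rightarrow> 'v" and g :: nat
  assumes "finite V" and "finite E"
    and "\<forall>e\<in>E. s e \<in> V \<and> t e \<in> V"
    and "g = genus V E s t"
  shows "(two_connected V E s t \<and> loopless E s t \<longrightarrow>
            (has_emm_A V E s t g \<longleftrightarrow> planar V E s t))
       \<and> (two_connected V E s t \<and> loopless E s t \<and> g \<ge> 4 \<longrightarrow>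
            (has_emm_D V E s t g \<longleftrightarrow> projective_planar V E s t))
       \<and> (planar V E s t \<longrightarrow> has_emm_A V E s t g)
       \<and> (g \<ge> 4 \<and> projective_planar V E s t \<longrightarrow> has_emm_D V E s t g)"
proof -
  have G: "fgraph V E s t" using assms by unfold_locales auto
  have A: "planar V E s t \<Longrightarrow> has_emm_A V E s t g" using planar_imp_has_emm_A[OF G] assms(4) by simp
  have D: "projective_planar V E s t \<Longrightarrow> g \<ge> 4 \<Longrightarrow> has_emm_D V E s t g"
    using projective_planar_cases[OF G] has_emm_A_imp_has_emm_D[OF G A] assms(4) by blast
  show ?thesis
    using A D has_emm_A_imp_planar[OF G, of g] has_emm_D_imp_projective_planar[OF G, of g] by blast
qed

end
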